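(* Let $\Bbbk\subset\mathbb R$ be a subfield. The functor $\Pi^W_{\mathbb C}:\mathrm{MHS}_{\Bbbk}\to\mathcal F\mathrm{Vect}_{\mathbb C}$ admits a factorization $\Pi^W_{\mathbb C}=U^{fil}\circ G$, with $G:\mathrm{MHS}_{\Bbbk}\to gr\mathrm{Vect}_{\mathbb C}$ and $U^{fil}:gr\mathrm{Vect}_{\mathbb C}\to\mathcal F\mathrm{Vect}_{\mathbb C}$, into strong symmetric monoidal functors. In particular, there is an isomorphism of functors $U^{fil}\circ gr\circ\Pi^W_{\mathbb C}\cong\Pi^W_{\mathbb C}$, where $gr:\mathcal F\mathrm{Vect}_{\mathbb C}\to gr\mathrm{Vect}_{\mathbb C}$ is the graded functor given by $gr(V_{\mathbb C},W)^p=Gr^W_pV_{\mathbb C}$.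
   Context: $\mathrm{MHS}_{\Bbbk}$ is the category of mixed Hodge structures on finite-dimensional $\Bbbk$-vector spaces: triples $(V,W,F)$ with $W$ an increasing filtration of $V$ and $F$ a decreasing filtration of $V_{\mathbb C}=V\otimes\mathbb C$ such that $F$ induces on each $Gr_m^WV=W_mV/W_{m-1}V$ ($m\in\mathbb Z$) a pure Hodge structure of weight $m$; morphisms are linear maps preserving $W$ and $F$; tensor product is given by the filtered tensor product. Filtrations are exhaustive and of finite length. $\mathcal F\mathrm{Vect}_{\mathbb C}$ is the symmetric monoidal category of $\mathbb C$-vector spaces with increasing filtration, $W_p(A\otimes B)=\sum_{i+j=p}\mathrm{Im}(W_iA\otimes W_jB\to A\otimes B)$. $gr\mathrm{Vect}_{\mathbb C}$ is the symmetric monoidal category of $\mathbb Z$-graded $\mathbb C$-vector spaces (no signs in the symmetry; here only objects with finitely many non-zero pieces occur). $U^{fil}$ sends $\bigoplus_nV^n$ to $(V,W)$ with $W_mV=\bigoplus_{n\le m}V^n$. $\Pi^W_{\mathbb C}$ sends $(V,W,F)$ to $(V\otimes_{\Bbbk}\mathbb C,W)$; it is strong symmetric monoidal. *)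

theory Defs
  imports Complex_Main "HOL-Algebra.Subrings" "HOL-Algebra.AbelCoset"
    "Jordan_Normal_Form.Missing_VectorSpace"
begin

section \<open>Symmetric monoidal categories and functors\<close>

record ('o, 'a) category_data =
  Ob :: "'o set"
  Ar :: "'a set"
  Src :: "'a \<Rightarrow> 'o"
  Tgt :: "'a \<Rightarrow> 'o"
  Idn :: "'o \<Rightarrow> 'a"
  Cmp :: "'a \<Rightarrow> 'a \<Rightarrow> 'a"  (infixr \<open>\<cdot>\<index>\<close> 75)

definition arrow_in :: "('o, 'a, 'x) category_data_scheme \<Rightarrow> 'a \<Rightarrow> 'o \<Rightarrow> 'o \<Rightarrow> bool" where
  "arrow_in C f A B \<longleftrightarrow> f \<in> Ar C \<and> Src C f = A \<and> Tgt C f = B"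

locale category_laws =
  fixes C :: "('o, 'a, 'x) category_data_scheme" (structure)
  assumes Src_Ob: "f \<in> Ar C \<Longrightarrow> Src C f \<in> Ob C"
    and Tgt_Ob: "f \<in> Ar C \<Longrightarrow> Tgt C f \<in> Ob C"
    and Idn_arrow: "A \<in> Ob C \<Longrightarrow> arrow_in C (Idn C A) A A"
    and Cmp_arrow: "\<lbrakk>arrow_in C f X Y; arrow_in C g Y Z\<rbrakk> \<Longrightarrow> arrow_in C (g \<cdot> f) X Z"
    and Cmp_assoc: "\<lbrakk>arrow_in C f X Y; arrow_in C g Y Z; arrow_in C h Z T\<rbrakk>
                      \<Longrightarrow> (h \<cdot> g) \<cdot> f = h \<cdot> (g \<cdot> f)"
    and Cmp_Idn_right: "arrow_in C f X Y \<Longrightarrow> f \<cdot> Idn C X = f"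
    and Cmp_Idn_left: "arrow_in C f X Y \<Longrightarrow> Idn C Y \<cdot> f = f"

definition iso_in :: "('o, 'a, 'x) category_data_scheme \<Rightarrow> 'a \<Rightarrow> 'o \<Rightarrow> 'o \<Rightarrow> bool" where
  "iso_in C f A B \<longleftrightarrow> arrow_in C f A B \<and>
     (\<exists>g. arrow_in C g B A \<and> Cmp C g f = Idn C A \<and> Cmp C f g = Idn C B)"

record ('o, 'a) monoidal_data = "('o, 'a) category_data" +
  Ten :: "'o \<Rightarrow> 'o \<Rightarrow> 'o"  (infixr \<open>\<otimes>o\<index>\<close> 80)
  TenA :: "'a \<Rightarrow> 'a \<Rightarrow> 'a"  (infixr \<open>\<otimes>a\<index>\<close> 80)
  Unt :: "'o"
  Asc :: "'o \<Rightarrow> 'o \<Rightarrow> 'o \<Rightarrow> 'a"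
  LUn :: "'o \<Rightarrow> 'a"
  RUn :: "'o \<Rightarrow> 'a"
  Brd :: "'o \<Rightarrow> 'o \<Rightarrow> 'a"

locale symmetric_monoidal_category = category_laws C
  for C :: "('o, 'a, 'x) monoidal_data_scheme" (structure) +
  assumes Ten_Ob: "\<lbrakk>A \<in> Ob C; B \<in> Ob C\<rbrakk> \<Longrightarrow> A \<otimes>o B \<in> Ob C"
    and Unt_Ob: "Unt C \<in> Ob C"
    and TenA_arrow: "\<lbrakk>arrow_in C f A B; arrow_in C g A' B'\<rbrakk>
          \<Longrightarrow> arrow_in C (f \<otimes>a g) (A \<otimes>o A') (B \<otimes>o B')"
    and TenA_Idn: "\<lbrakk>A \<in> Ob C; B \<in> Ob C\<rbrakk> \<Longrightarrow> Idn C A \<otimes>a Idn C B = Idn C (A \<otimes>o B)"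
    and TenA_Cmp: "\<lbrakk>arrow_in C f X Y; arrow_in C g Y Z; arrow_in C f' X' Y'; arrow_in C g' Y' Z'\<rbrakk>
          \<Longrightarrow> (g \<cdot> f) \<otimes>a (g' \<cdot> f') = (g \<otimes>a g') \<cdot> (f \<otimes>a f')"
    and Asc_iso: "\<lbrakk>X \<in> Ob C; Y \<in> Ob C; Z \<in> Ob C\<rbrakk>
          \<Longrightarrow> iso_in C (Asc C X Y Z) ((X \<otimes>o Y) \<otimes>o Z) (X \<otimes>o (Y \<otimes>o Z))"
    and LUn_iso: "X \<in> Ob C \<Longrightarrow> iso_in C (LUn C X) (Unt C \<otimes>o X) X"
    and RUn_iso: "X \<in> Ob C \<Longrightarrow> iso_in C (RUn C X) (X \<otimes>o Unt C) X"
    and Brd_iso: "\<lbrakk>X \<in> Ob C; Y \<in> Ob C\<rbrakk> \<Longrightarrow> iso_in C (Brd C X Y) (X \<otimes>o Y) (Y \<otimes>o X)"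
    and Asc_natural: "\<lbrakk>arrow_in C f X X'; arrow_in C g Y Y'; arrow_in C h Z Z'\<rbrakk>
          \<Longrightarrow> Asc C X' Y' Z' \<cdot> ((f \<otimes>a g) \<otimes>a h) = (f \<otimes>a (g \<otimes>a h)) \<cdot> Asc C X Y Z"
    and LUn_natural: "arrow_in C f X Y \<Longrightarrow> LUn C Y \<cdot> (Idn C (Unt C) \<otimes>a f) = f \<cdot> LUn C X"
    and RUn_natural: "arrow_in C f X Y \<Longrightarrow> RUn C Y \<cdot> (f \<otimes>a Idn C (Unt C)) = f \<cdot> RUn C X"
    and Brd_natural: "\<lbrakk>arrow_in C f X X'; arrow_in C g Y Y'\<rbrakk>
          \<Longrightarrow> Brd C X' Y' \<cdot> (f \<otimes>a g) = (g \<otimes>a f) \<cdot> Brd C X Y"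
    and pentagon: "\<lbrakk>X \<in> Ob C; Y \<in> Ob C; Z \<in> Ob C; T \<in> Ob C\<rbrakk>
          \<Longrightarrow> (Idn C X \<otimes>a Asc C Y Z T) \<cdot> Asc C X (Y \<otimes>o Z) T \<cdot> (Asc C X Y Z \<otimes>a Idn C T)
              = Asc C X Y (Z \<otimes>o T) \<cdot> Asc C (X \<otimes>o Y) Z T"
    and triangle: "\<lbrakk>X \<in> Ob C; Y \<in> Ob C\<rbrakk>
          \<Longrightarrow> (Idn C X \<otimes>a LUn C Y) \<cdot> Asc C X (Unt C) Y = RUn C X \<otimes>a Idn C Y"
    and hexagon: "\<lbrakk>X \<in> Ob C; Y \<in> Ob C; Z \<in> Ob C\<rbrakk>
          \<Longrightarrow> Asc C Y Z X \<cdot> Brd C X (Y \<otimes>o Z) \<cdot> Asc C X Y Z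
              = (Idn C Y \<otimes>a Brd C X Z) \<cdot> Asc C Y X Z \<cdot> (Brd C X Y \<otimes>a Idn C Z)"
    and symmetry: "\<lbrakk>X \<in> Ob C; Y \<in> Ob C\<rbrakk> \<Longrightarrow> Brd C Y X \<cdot> Brd C X Y = Idn C (X \<otimes>o Y)"

record ('o, 'a, 'p, 'b) functor_data =
  FOb :: "'o \<Rightarrow> 'p"
  FAr :: "'a \<Rightarrow> 'b"

locale functor_laws = C: category_laws C + D: category_laws D
  for C :: "('o, 'a, 'x) category_data_scheme"
    and D :: "('p, 'b, 'y) category_data_scheme"
    and F :: "('o, 'a, 'p, 'b, 'z) functor_data_scheme" +
  assumes FOb_Ob: "A \<in> Ob C \<Longrightarrow> FOb F A \<in> Ob D"
    and FAr_arrow: "arrow_in C f A B \<Longrightarrow> arrow_in D (FAr F f) (FOb F A) (FOb F B)"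
    and FAr_Idn: "A \<in> Ob C \<Longrightarrow> FAr F (Idn C A) = Idn D (FOb F A)"
    and FAr_Cmp: "\<lbrakk>arrow_in C f X Y; arrow_in C g Y Z\<rbrakk>
          \<Longrightarrow> FAr F (Cmp C g f) = Cmp D (FAr F g) (FAr F f)"

definition comp_functor ::
  "('p, 'b, 'q, 'c, 'y) functor_data_scheme \<Rightarrow> ('o, 'a, 'p, 'b, 'x) functor_data_scheme
     \<Rightarrow> ('o, 'a, 'q, 'c) functor_data" where
  "comp_functor G F = \<lparr>FOb = FOb G \<circ> FOb F, FAr = FAr G \<circ> FAr F\<rparr>"

definition naturally_isomorphic ::
  "('o, 'a, 'x) category_data_scheme \<Rightarrow> ('p, 'b, 'y) category_data_scheme
     \<Rightarrow> ('o, 'a, 'p, 'b, 'z) functor_data_scheme \<Rightarrow> ('o, 'a, 'p, 'b, 'w) functor_data_scheme \<Rightarrow> bool"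
  where
  "naturally_isomorphic C D F G \<longleftrightarrow> functor_laws C D F \<and> functor_laws C D G \<and>
     (\<exists>\<eta>. (\<forall>A\<in>Ob C. iso_in D (\<eta> A) (FOb F A) (FOb G A)) \<and>
          (\<forall>A B f. arrow_in C f A B \<longrightarrow> Cmp D (\<eta> B) (FAr F f) = Cmp D (FAr G f) (\<eta> A)))"

text \<open>\<open>FTen F A B\<close> is the structure map \<open>F A \<otimes> F B \<rightarrow> F (A \<otimes> B)\<close> and \<open>FUnt F\<close> is the structure
  map from the unit object to the image of the unit object.\<close>

record ('o, 'a, 'p, 'b) monoidal_functor_data = "('o, 'a, 'p, 'b) functor_data" +
  FTen :: "'o \<Rightarrow> 'o \<Rightarrow> 'b"
  FUnt :: "'b"

locale strong_symmetric_monoidal_functor =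
  functor_laws C D F + C: symmetric_monoidal_category C + D: symmetric_monoidal_category D
  for C :: "('o, 'a, 'x) monoidal_data_scheme"
    and D :: "('p, 'b, 'y) monoidal_data_scheme"
    and F :: "('o, 'a, 'p, 'b, 'z) monoidal_functor_data_scheme" +
  assumes FTen_iso: "\<lbrakk>A \<in> Ob C; B \<in> Ob C\<rbrakk>
          \<Longrightarrow> iso_in D (FTen F A B) (FOb F A \<otimes>o\<^bsub>D\<^esub> FOb F B) (FOb F (A \<otimes>o\<^bsub>C\<^esub> B))"
    and FUnt_iso: "iso_in D (FUnt F) (Unt D) (FOb F (Unt C))"
    and FTen_natural: "\<lbrakk>arrow_in C f A B; arrow_in C g A' B'\<rbrakk>
          \<Longrightarrow> FTen F B B' \<cdot>\<^bsub>D\<^esub> (FAr F f \<otimes>a\<^bsub>D\<^esub> FAr F g) = FAr F (f \<otimes>a\<^bsub>C\<^esub> g) \<cdot>\<^bsub>D\<^esub> FTen F A A'"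
    and FTen_Asc: "\<lbrakk>X \<in> Ob C; Y \<in> Ob C; Z \<in> Ob C\<rbrakk>
          \<Longrightarrow> FAr F (Asc C X Y Z) \<cdot>\<^bsub>D\<^esub> FTen F (X \<otimes>o\<^bsub>C\<^esub> Y) Z \<cdot>\<^bsub>D\<^esub> (FTen F X Y \<otimes>a\<^bsub>D\<^esub> Idn D (FOb F Z))
              = FTen F X (Y \<otimes>o\<^bsub>C\<^esub> Z) \<cdot>\<^bsub>D\<^esub> (Idn D (FOb F X) \<otimes>a\<^bsub>D\<^esub> FTen F Y Z)
                  \<cdot>\<^bsub>D\<^esub> Asc D (FOb F X) (FOb F Y) (FOb F Z)"
    and FUnt_LUn: "X \<in> Ob C
          \<Longrightarrow> FAr F (LUn C X) \<cdot>\<^bsub>D\<^esub> FTen F (Unt C) X \<cdot>\<^bsub>D\<^esub> (FUnt F \<otimes>a\<^bsub>D\<^esub> Idn D (FOb F X))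
              = LUn D (FOb F X)"
    and FUnt_RUn: "X \<in> Ob C
          \<Longrightarrow> FAr F (RUn C X) \<cdot>\<^bsub>D\<^esub> FTen F X (Unt C) \<cdot>\<^bsub>D\<^esub> (Idn D (FOb F X) \<otimes>a\<^bsub>D\<^esub> FUnt F)
              = RUn D (FOb F X)"
    and FTen_Brd: "\<lbrakk>X \<in> Ob C; Y \<in> Ob C\<rbrakk>
          \<Longrightarrow> FAr F (Brd C X Y) \<cdot>\<^bsub>D\<^esub> FTen F X Y = FTen F Y X \<cdot>\<^bsub>D\<^esub> Brd D (FOb F X) (FOb F Y)"

definition comp_monoidal_functor ::
  "('q, 'c, 'w) category_data_scheme \<Rightarrow> ('p, 'b, 'q, 'c, 'y) monoidal_functor_data_scheme
     \<Rightarrow> ('o, 'a, 'p, 'b, 'x) monoidal_functor_data_scheme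
     \<Rightarrow> ('o, 'a, 'q, 'c) monoidal_functor_data" where
  "comp_monoidal_functor E G F =
     \<lparr>FOb = FOb G \<circ> FOb F, FAr = FAr G \<circ> FAr F,
      FTen = (\<lambda>A B. FAr G (FTen F A B) \<cdot>\<^bsub>E\<^esub> FTen G (FOb F A) (FOb F B)),
      FUnt = FAr G (FUnt F) \<cdot>\<^bsub>E\<^esub> FUnt G\<rparr>"

text \<open>The components of a functor are total functions, so that equality of functors out of \<open>C\<close> is
  equality on the objects and arrows of \<open>C\<close>.\<close>

definition monoidal_functor_eq ::
  "('o, 'a, 'w) category_data_scheme \<Rightarrow> ('o, 'a, 'p, 'b, 'x) monoidal_functor_data_scheme
     \<Rightarrow> ('o, 'a, 'p, 'b, 'y) monoidal_functor_data_scheme \<Rightarrow> bool" where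
  "monoidal_functor_eq C F G \<longleftrightarrow>
     (\<forall>A\<in>Ob C. FOb F A = FOb G A) \<and> (\<forall>f\<in>Ar C. FAr F f = FAr G f) \<and>
     (\<forall>A\<in>Ob C. \<forall>B\<in>Ob C. FTen F A B = FTen G A B) \<and> FUnt F = FUnt G"


section \<open>Vector spaces in a universe closed under the constructions used\<close>

text \<open>The vectors of all vector spaces below are elements of the type \<open>'a pt\<close>, where \<open>'a\<close> is
  arbitrary, so that every vector space with underlying set in \<open>'a\<close> has a copy with underlying set
  in \<open>range Atom\<close>. The other constructors provide the elements of the constructed spaces: scalars,
  formal sums of pairs (for tensor products), and families indexed by the integers (for
  direct sums).\<close>

datatype 'a pt =
    Atom 'a
  | Scal (scal: complex)
  | Formal (summands: "('a pt \<times> 'a pt) list")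
  | Fam (comps: "int \<Rightarrow> 'a pt")

type_synonym 'a vs = "(complex, 'a pt) module"

definition complex_ring :: "complex ring" where
  "complex_ring = \<lparr>carrier = UNIV, mult = (*), one = 1, zero = 0, add = (+)\<rparr>"

abbreviation fld :: "complex set \<Rightarrow> complex ring" where
  "fld S \<equiv> complex_ring\<lparr>carrier := S\<rparr>"

text \<open>Linear maps are extensional, i.e. undefined outside of their domain, so that equality of
  linear maps is equality on their domain.\<close>

definition linear_maps :: "complex set \<Rightarrow> 'a vs \<Rightarrow> 'a vs \<Rightarrow> ('a pt \<Rightarrow> 'a pt) set" where
  "linear_maps S V V' =
     LinearCombinations.module_hom (fld S) V V' \<inter> extensional (carrier V)"

definition subsp :: "'a vs \<Rightarrow> 'a pt set \<Rightarrow> 'a vs" where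
  "subsp V N = V\<lparr>carrier := N\<rparr>"

text \<open>\<open>scalars S\<close> is the set of complex numbers \<open>S\<close> as a vector space over any subfield of \<open>\<complex>\<close>
  acting on it by multiplication.\<close>

definition scalars :: "complex set \<Rightarrow> 'a vs" where
  "scalars S = \<lparr>carrier = Scal ` S, mult = undefined, one = undefined, zero = Scal 0,
     add = (\<lambda>x y. Scal (scal x + scal y)), smult = (\<lambda>r x. Scal (r * scal x))\<rparr>"

subsection \<open>Quotients and direct sums\<close>

text \<open>A coset is encoded by a chosen representative.\<close>

definition qcls :: "'a vs \<Rightarrow> 'a pt set \<Rightarrow> 'a pt \<Rightarrow> 'a pt" where
  "qcls V N v = (SOME w. w \<in> N +>\<^bsub>V\<^esub> v)"

definition quot :: "'a vs \<Rightarrow> 'a pt set \<Rightarrow> 'a vs" where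
  "quot V N = \<lparr>carrier = qcls V N ` carrier V, mult = undefined, one = undefined,
     zero = qcls V N \<zero>\<^bsub>V\<^esub>,
     add = (\<lambda>x y. qcls V N (x \<oplus>\<^bsub>V\<^esub> y)), smult = (\<lambda>r x. qcls V N (r \<odot>\<^bsub>V\<^esub> x))\<rparr>"

definition dsum :: "(int \<Rightarrow> 'a vs) \<Rightarrow> 'a vs" where
  "dsum M = \<lparr>carrier = {Fam f |f. (\<forall>p. f p \<in> carrier (M p)) \<and> finite {p. f p \<noteq> \<zero>\<^bsub>M p\<^esub>}},
     mult = undefined, one = undefined,
     zero = Fam (\<lambda>p. \<zero>\<^bsub>M p\<^esub>),
     add = (\<lambda>x y. Fam (\<lambda>p. comps x p \<oplus>\<^bsub>M p\<^esub> comps y p)),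
     smult = (\<lambda>r x. Fam (\<lambda>p. r \<odot>\<^bsub>M p\<^esub> comps x p))\<rparr>"

subsection \<open>Tensor products\<close>

text \<open>The tensor product \<open>V \<otimes>\<^sub>S W\<close> over a field \<open>S\<close> is the set of formal sums
  \<open>v\<^sub>1 \<otimes> w\<^sub>1 + \<dots> + v\<^sub>n \<otimes> w\<^sub>n\<close>, represented by the list of the pairs \<open>(v\<^sub>i, w\<^sub>i)\<close>,
  modulo the congruence generated by commutativity and the bilinearity relations. The additive
  inverse of the class of \<open>(v, w)\<close> is the class of \<open>(-v, w)\<close>.\<close>

inductive ten_rel ::
  "complex set \<Rightarrow> 'a vs \<Rightarrow> 'a vs \<Rightarrow> ('a pt \<times> 'a pt) list \<Rightarrow> ('a pt \<times> 'a pt) list \<Rightarrow> bool"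
  for S V W where
  refl: "ten_rel S V W xs xs"
| sym: "ten_rel S V W xs ys \<Longrightarrow> ten_rel S V W ys xs"
| trans: "ten_rel S V W xs ys \<Longrightarrow> ten_rel S V W ys zs \<Longrightarrow> ten_rel S V W xs zs"
| append: "ten_rel S V W xs xs' \<Longrightarrow> ten_rel S V W ys ys' \<Longrightarrow> ten_rel S V W (xs @ ys) (xs' @ ys')"
| commute: "ten_rel S V W (xs @ ys) (ys @ xs)"
| add_left: "\<lbrakk>v \<in> carrier V; v' \<in> carrier V; w \<in> carrier W\<rbrakk>
    \<Longrightarrow> ten_rel S V W [(v \<oplus>\<^bsub>V\<^esub> v', w)] [(v, w), (v', w)]"
| add_right: "\<lbrakk>v \<in> carrier V; w \<in> carrier W; w' \<in> carrier W\<rbrakk>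
    \<Longrightarrow> ten_rel S V W [(v, w \<oplus>\<^bsub>W\<^esub> w')] [(v, w), (v, w')]"
| zero_left: "w \<in> carrier W \<Longrightarrow> ten_rel S V W [(\<zero>\<^bsub>V\<^esub>, w)] []"
| balanced: "\<lbrakk>r \<in> S; v \<in> carrier V; w \<in> carrier W\<rbrakk>
    \<Longrightarrow> ten_rel S V W [(r \<odot>\<^bsub>V\<^esub> v, w)] [(v, r \<odot>\<^bsub>W\<^esub> w)]"

definition tcls :: "complex set \<Rightarrow> 'a vs \<Rightarrow> 'a vs \<Rightarrow> ('a pt \<times> 'a pt) list \<Rightarrow> 'a pt" where
  "tcls S V W xs = Formal (SOME ys. ten_rel S V W xs ys)"

definition tensor :: "complex set \<Rightarrow> 'a vs \<Rightarrow> 'a vs \<Rightarrow> 'a vs" where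
  "tensor S V W = \<lparr>carrier = tcls S V W ` lists (carrier V \<times> carrier W),
     mult = undefined, one = undefined,
     zero = tcls S V W [],
     add = (\<lambda>s t. tcls S V W (summands s @ summands t)),
     smult = (\<lambda>r t. tcls S V W (map (\<lambda>(v, w). (r \<odot>\<^bsub>V\<^esub> v, w)) (summands t)))\<rparr>"

abbreviation pure_tensor :: "complex set \<Rightarrow> 'a vs \<Rightarrow> 'a vs \<Rightarrow> 'a pt \<Rightarrow> 'a pt \<Rightarrow> 'a pt" where
  "pure_tensor S V W v w \<equiv> tcls S V W [(v, w)]"

text \<open>\<open>tlift X \<beta>\<close> is the additive map from a tensor product to \<open>X\<close> that sends \<open>v \<otimes> w\<close> to \<open>\<beta> v w\<close>,
  for \<open>\<beta>\<close> biadditive and balanced.\<close>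

definition tlift :: "'a vs \<Rightarrow> ('a pt \<Rightarrow> 'a pt \<Rightarrow> 'a pt) \<Rightarrow> 'a pt \<Rightarrow> 'a pt" where
  "tlift X \<beta> t = foldr (\<lambda>(v, w) s. \<beta> v w \<oplus>\<^bsub>X\<^esub> s) (summands t) \<zero>\<^bsub>X\<^esub>"

definition tensor_map ::
  "complex set \<Rightarrow> 'a vs \<Rightarrow> 'a vs \<Rightarrow> 'a vs \<Rightarrow> 'a vs
     \<Rightarrow> ('a pt \<Rightarrow> 'a pt) \<Rightarrow> ('a pt \<Rightarrow> 'a pt) \<Rightarrow> 'a pt \<Rightarrow> 'a pt" where
  "tensor_map S V W V' W' f g =
     (\<lambda>t\<in>carrier (tensor S V W). tlift (tensor S V' W') (\<lambda>v w. pure_tensor S V' W' (f v) (g w)) t)"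

definition tensor_assoc :: "complex set \<Rightarrow> 'a vs \<Rightarrow> 'a vs \<Rightarrow> 'a vs \<Rightarrow> 'a pt \<Rightarrow> 'a pt" where
  "tensor_assoc S U V W =
     (let X = tensor S U (tensor S V W)
      in (\<lambda>t\<in>carrier (tensor S (tensor S U V) W).
           tlift X (\<lambda>s w. tlift X (\<lambda>u v. pure_tensor S U (tensor S V W) u (pure_tensor S V W v w)) s) t))"

definition tensor_lunit :: "complex set \<Rightarrow> 'a vs \<Rightarrow> 'a pt \<Rightarrow> 'a pt" where
  "tensor_lunit S V =
     (\<lambda>t\<in>carrier (tensor S (scalars S) V). tlift V (\<lambda>c v. scal c \<odot>\<^bsub>V\<^esub> v) t)"

definition tensor_runit :: "complex set \<Rightarrow> 'a vs \<Rightarrow> 'a pt \<Rightarrow> 'a pt" where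
  "tensor_runit S V =
     (\<lambda>t\<in>carrier (tensor S V (scalars S)). tlift V (\<lambda>v c. scal c \<odot>\<^bsub>V\<^esub> v) t)"

definition tensor_swap :: "complex set \<Rightarrow> 'a vs \<Rightarrow> 'a vs \<Rightarrow> 'a pt \<Rightarrow> 'a pt" where
  "tensor_swap S V W =
     (\<lambda>t\<in>carrier (tensor S V W). tlift (tensor S W V) (\<lambda>v w. pure_tensor S W V w v) t)"

subsection \<open>Extension of scalars to the complex numbers\<close>

abbreviation CC :: "'a vs" where
  "CC \<equiv> scalars UNIV"

definition cext :: "complex set \<Rightarrow> 'a vs \<Rightarrow> 'a vs" where
  "cext K V = (tensor K V CC)
     \<lparr>smult := (\<lambda>c t. tcls K V CC (map (\<lambda>(v, z). (v, Scal (c * scal z))) (summands t)))\<rparr>"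

definition cext_map :: "complex set \<Rightarrow> 'a vs \<Rightarrow> 'a vs \<Rightarrow> ('a pt \<Rightarrow> 'a pt) \<Rightarrow> 'a pt \<Rightarrow> 'a pt" where
  "cext_map K V V' f = tensor_map K V CC V' CC f (\<lambda>z. z)"

definition cext_conj :: "complex set \<Rightarrow> 'a vs \<Rightarrow> 'a pt \<Rightarrow> 'a pt" where
  "cext_conj K V = tlift (cext K V) (\<lambda>v z. pure_tensor K V CC v (Scal (cnj (scal z))))"

text \<open>The canonical isomorphism \<open>(V \<otimes>\<^sub>K \<complex>) \<otimes> (V' \<otimes>\<^sub>K \<complex>) \<rightarrow> (V \<otimes>\<^sub>K V') \<otimes>\<^sub>K \<complex>\<close>, which sends
  \<open>(v \<otimes> z) \<otimes> (v' \<otimes> z')\<close> to \<open>(v \<otimes> v') \<otimes> z z'\<close>.\<close>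

definition cext_tensor :: "complex set \<Rightarrow> 'a vs \<Rightarrow> 'a vs \<Rightarrow> 'a pt \<Rightarrow> 'a pt" where
  "cext_tensor K V V' =
     (let X = cext K (tensor K V V')
      in (\<lambda>t\<in>carrier (tensor UNIV (cext K V) (cext K V')).
           tlift X (\<lambda>s s'. tlift X (\<lambda>v z. tlift X (\<lambda>v' z'.
             pure_tensor K (tensor K V V') CC (pure_tensor K V V' v v') (Scal (scal z * scal z'))) s') s) t))"


section \<open>Filtrations\<close>

definition increasing_filtration :: "complex set \<Rightarrow> 'a vs \<Rightarrow> (int \<Rightarrow> 'a pt set) \<Rightarrow> bool" where
  "increasing_filtration S V W \<longleftrightarrow> (\<forall>m. VectorSpace.subspace (fld S) (W m) V) \<and> mono W \<and>
     (\<exists>m. W m = {\<zero>\<^bsub>V\<^esub>}) \<and> (\<exists>m. W m = carrier V)"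

definition decreasing_filtration :: "complex set \<Rightarrow> 'a vs \<Rightarrow> (int \<Rightarrow> 'a pt set) \<Rightarrow> bool" where
  "decreasing_filtration S V F \<longleftrightarrow> (\<forall>p. VectorSpace.subspace (fld S) (F p) V) \<and> antimono F \<and>
     (\<exists>p. F p = {\<zero>\<^bsub>V\<^esub>}) \<and> (\<exists>p. F p = carrier V)"

text \<open>\<open>tensor_image S V V' N N'\<close> is the image of \<open>N \<otimes> N' \<rightarrow> V \<otimes> V'\<close>. The family
  \<open>tensor_family S V V' N N'\<close> is the sum of these images over all pairs of indices with sum \<open>p\<close>, in
  degree \<open>p\<close>; it is used for filtrations and for gradings.\<close>

definition tensor_image ::
  "complex set \<Rightarrow> 'a vs \<Rightarrow> 'a vs \<Rightarrow> 'a pt set \<Rightarrow> 'a pt set \<Rightarrow> 'a pt set" where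
  "tensor_image S V V' N N' = tcls S V V' ` lists (N \<times> N')"

definition tensor_family ::
  "complex set \<Rightarrow> 'a vs \<Rightarrow> 'a vs \<Rightarrow> (int \<Rightarrow> 'a pt set) \<Rightarrow> (int \<Rightarrow> 'a pt set) \<Rightarrow> int \<Rightarrow> 'a pt set" where
  "tensor_family S V V' N N' p =
     LinearCombinations.module.span (fld S) (tensor S V V')
       (\<Union>(i, j)\<in>{(i, j). i + j = p}. tensor_image S V V' (N i) (N' j))"

definition Gr :: "'a vs \<Rightarrow> (int \<Rightarrow> 'a pt set) \<Rightarrow> int \<Rightarrow> 'a vs" where
  "Gr V W m = quot (subsp V (W m)) (W (m - 1))"

definition Gr_proj :: "'a vs \<Rightarrow> (int \<Rightarrow> 'a pt set) \<Rightarrow> int \<Rightarrow> 'a pt \<Rightarrow> 'a pt" where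
  "Gr_proj V W m = qcls (subsp V (W m)) (W (m - 1))"


section \<open>Categories of vector spaces with extra structure\<close>

record ('o, 'm) arrow =
  source :: 'o
  mapping :: 'm
  target :: 'o

text \<open>The symmetric monoidal category with objects \<open>obs\<close>, each with an underlying \<open>S\<close>-vector space
  given by \<open>sp\<close>, and morphisms the given sets \<open>homs\<close> of linear maps. The structure maps are those of
  \<open>S\<close>-vector spaces; \<open>ten\<close> and \<open>unt\<close> are the given lifts of the tensor product and of the unit.\<close>

definition vs_category ::
  "complex set \<Rightarrow> 'o set \<Rightarrow> ('o \<Rightarrow> 'a vs) \<Rightarrow> ('o \<Rightarrow> 'o \<Rightarrow> ('a pt \<Rightarrow> 'a pt) set)
     \<Rightarrow> ('o \<Rightarrow> 'o \<Rightarrow> 'o) \<Rightarrow> 'o \<Rightarrow> ('o, ('o, 'a pt \<Rightarrow> 'a pt) arrow) monoidal_data" where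
  "vs_category S obs sp homs ten unt =
     \<lparr>Ob = obs,
      Ar = {f. source f \<in> obs \<and> target f \<in> obs \<and> mapping f \<in> homs (source f) (target f)},
      Src = source,
      Tgt = target,
      Idn = (\<lambda>A. \<lparr>source = A, mapping = (\<lambda>v\<in>carrier (sp A). v), target = A\<rparr>),
      Cmp = (\<lambda>g f. \<lparr>source = source f,
                    mapping = compose (carrier (sp (source f))) (mapping g) (mapping f),
                    target = target g\<rparr>),
      Ten = ten,
      TenA = (\<lambda>f g. \<lparr>source = ten (source f) (source g),
                     mapping = tensor_map S (sp (source f)) (sp (source g))
                                 (sp (target f)) (sp (target g)) (mapping f) (mapping g),
                     target = ten (target f) (target g)\<rparr>),
      Unt = unt,
      Asc = (\<lambda>A B C. \<lparr>source = ten (ten A B) C,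
                      mapping = tensor_assoc S (sp A) (sp B) (sp C),
                      target = ten A (ten B C)\<rparr>),
      LUn = (\<lambda>A. \<lparr>source = ten unt A, mapping = tensor_lunit S (sp A), target = A\<rparr>),
      RUn = (\<lambda>A. \<lparr>source = ten A unt, mapping = tensor_runit S (sp A), target = A\<rparr>),
      Brd = (\<lambda>A B. \<lparr>source = ten A B, mapping = tensor_swap S (sp A) (sp B), target = ten B A\<rparr>)\<rparr>"

subsection \<open>Filtered complex vector spaces\<close>

record 'a fil_vs =
  fspace :: "'a vs"
  fil :: "int \<Rightarrow> 'a pt set"

definition is_fil_vs :: "'a fil_vs \<Rightarrow> bool" where
  "is_fil_vs A \<longleftrightarrow> VectorSpace.vectorspace (fld UNIV) (fspace A) \<and>
     increasing_filtration UNIV (fspace A) (fil A)"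

definition fil_homs :: "'a fil_vs \<Rightarrow> 'a fil_vs \<Rightarrow> ('a pt \<Rightarrow> 'a pt) set" where
  "fil_homs A B = {f \<in> linear_maps UNIV (fspace A) (fspace B). \<forall>m. f ` fil A m \<subseteq> fil B m}"

definition fil_tensor :: "'a fil_vs \<Rightarrow> 'a fil_vs \<Rightarrow> 'a fil_vs" where
  "fil_tensor A B = \<lparr>fspace = tensor UNIV (fspace A) (fspace B),
     fil = tensor_family UNIV (fspace A) (fspace B) (fil A) (fil B)\<rparr>"

definition fil_unit :: "'a fil_vs" where
  "fil_unit = \<lparr>fspace = CC, fil = (\<lambda>m. if 0 \<le> m then carrier CC else {\<zero>\<^bsub>CC\<^esub>})\<rparr>"

definition FVect :: "('a fil_vs, ('a fil_vs, 'a pt \<Rightarrow> 'a pt) arrow) monoidal_data" where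
  "FVect = vs_category UNIV {A. is_fil_vs A} fspace fil_homs fil_tensor fil_unit"

subsection \<open>Graded complex vector spaces\<close>

text \<open>A graded vector space is a vector space with an internal direct sum decomposition into its
  pieces, finitely many of which are nonzero.\<close>

record 'a gr_vs =
  gspace :: "'a vs"
  piece :: "int \<Rightarrow> 'a pt set"

definition is_gr_vs :: "'a gr_vs \<Rightarrow> bool" where
  "is_gr_vs A \<longleftrightarrow> VectorSpace.vectorspace (fld UNIV) (gspace A) \<and>
     (\<forall>n. VectorSpace.subspace (fld UNIV) (piece A n) (gspace A)) \<and>
     finite {n. piece A n \<noteq> {\<zero>\<^bsub>gspace A\<^esub>}} \<and>
     (\<forall>v\<in>carrier (gspace A). \<exists>!f. (\<forall>n. f n \<in> piece A n) \<and>
        v = (\<Oplus>\<^bsub>gspace A\<^esub>n\<in>{n. piece A n \<noteq> {\<zero>\<^bsub>gspace A\<^esub>}}. f n))"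

definition gr_homs :: "'a gr_vs \<Rightarrow> 'a gr_vs \<Rightarrow> ('a pt \<Rightarrow> 'a pt) set" where
  "gr_homs A B = {f \<in> linear_maps UNIV (gspace A) (gspace B). \<forall>n. f ` piece A n \<subseteq> piece B n}"

definition gr_tensor :: "'a gr_vs \<Rightarrow> 'a gr_vs \<Rightarrow> 'a gr_vs" where
  "gr_tensor A B = \<lparr>gspace = tensor UNIV (gspace A) (gspace B),
     piece = tensor_family UNIV (gspace A) (gspace B) (piece A) (piece B)\<rparr>"

definition gr_unit :: "'a gr_vs" where
  "gr_unit = \<lparr>gspace = CC, piece = (\<lambda>n. if n = 0 then carrier CC else {\<zero>\<^bsub>CC\<^esub>})\<rparr>"

definition grVect :: "('a gr_vs, ('a gr_vs, 'a pt \<Rightarrow> 'a pt) arrow) monoidal_data" where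
  "grVect = vs_category UNIV {A. is_gr_vs A} gspace gr_homs gr_tensor gr_unit"

subsection \<open>Mixed Hodge structures\<close>

text \<open>A pure Hodge structure of weight \<open>n\<close> on a finite-dimensional \<open>K\<close>-vector space \<open>H\<close> is given by
  its Hodge filtration \<open>F\<close>, which is \<open>n\<close>-opposed to its complex conjugate.\<close>

definition pure_hodge_structure :: "complex set \<Rightarrow> int \<Rightarrow> 'a vs \<Rightarrow> (int \<Rightarrow> 'a pt set) \<Rightarrow> bool" where
  "pure_hodge_structure K n H F \<longleftrightarrow>
     VectorSpace.vectorspace (fld K) H \<and> vectorspace.fin_dim (fld K) H \<and>
     decreasing_filtration UNIV (cext K H) F \<and>
     (\<forall>p q. p + q = n + 1 \<longrightarrow>
        F p \<inter> cext_conj K H ` F q = {\<zero>\<^bsub>cext K H\<^esub>} \<and>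
        F p <+>\<^bsub>cext K H\<^esub> cext_conj K H ` F q = carrier (cext K H))"

text \<open>The filtration induced by \<open>F\<close> on \<open>Gr\<^sub>m V \<otimes> \<complex>\<close> along the complexifications of
  \<open>Gr\<^sub>m V \<leftarrow> W\<^sub>m V \<rightarrow> V\<close>.\<close>

definition induced_filtration ::
  "complex set \<Rightarrow> 'a vs \<Rightarrow> (int \<Rightarrow> 'a pt set) \<Rightarrow> (int \<Rightarrow> 'a pt set) \<Rightarrow> int \<Rightarrow> int \<Rightarrow> 'a pt set" where
  "induced_filtration K V W F m p =
     cext_map K (subsp V (W m)) (Gr V W m) (Gr_proj V W m) `
       {x \<in> carrier (cext K (subsp V (W m))). cext_map K (subsp V (W m)) V (\<lambda>v. v) x \<in> F p}"

record 'a mhs =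
  hspace :: "'a vs"
  wfil :: "int \<Rightarrow> 'a pt set"
  hfil :: "int \<Rightarrow> 'a pt set"

definition is_mhs :: "complex set \<Rightarrow> 'a mhs \<Rightarrow> bool" where
  "is_mhs K A \<longleftrightarrow>
     VectorSpace.vectorspace (fld K) (hspace A) \<and> vectorspace.fin_dim (fld K) (hspace A) \<and>
     increasing_filtration K (hspace A) (wfil A) \<and>
     decreasing_filtration UNIV (cext K (hspace A)) (hfil A) \<and>
     (\<forall>m. pure_hodge_structure K m (Gr (hspace A) (wfil A) m)
            (induced_filtration K (hspace A) (wfil A) (hfil A) m))"

definition mhs_homs :: "complex set \<Rightarrow> 'a mhs \<Rightarrow> 'a mhs \<Rightarrow> ('a pt \<Rightarrow> 'a pt) set" where
  "mhs_homs K A B = {f \<in> linear_maps K (hspace A) (hspace B).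
     (\<forall>m. f ` wfil A m \<subseteq> wfil B m) \<and>
     (\<forall>p. cext_map K (hspace A) (hspace B) f ` hfil A p \<subseteq> hfil B p)}"

definition mhs_tensor :: "complex set \<Rightarrow> 'a mhs \<Rightarrow> 'a mhs \<Rightarrow> 'a mhs" where
  "mhs_tensor K A B = \<lparr>hspace = tensor K (hspace A) (hspace B),
     wfil = tensor_family K (hspace A) (hspace B) (wfil A) (wfil B),
     hfil = (\<lambda>p. cext_tensor K (hspace A) (hspace B) `
               tensor_family UNIV (cext K (hspace A)) (cext K (hspace B)) (hfil A) (hfil B) p)\<rparr>"

definition mhs_unit :: "complex set \<Rightarrow> 'a mhs" where
  "mhs_unit K = \<lparr>hspace = scalars K,
     wfil = (\<lambda>m. if 0 \<le> m then carrier (scalars K) else {\<zero>\<^bsub>scalars K\<^esub>}),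
     hfil = (\<lambda>p. if p \<le> 0 then carrier (cext K (scalars K)) else {\<zero>\<^bsub>cext K (scalars K)\<^esub>})\<rparr>"

definition MHS :: "complex set \<Rightarrow> ('a mhs, ('a mhs, 'a pt \<Rightarrow> 'a pt) arrow) monoidal_data" where
  "MHS K = vs_category K {A. is_mhs K A} hspace (mhs_homs K) (mhs_tensor K) (mhs_unit K)"


section \<open>The functors\<close>

subsection \<open>From mixed Hodge structures to filtered vector spaces\<close>

definition PiW_Ob :: "complex set \<Rightarrow> 'a mhs \<Rightarrow> 'a fil_vs" where
  "PiW_Ob K A = \<lparr>fspace = cext K (hspace A),
     fil = (\<lambda>m. tensor_image K (hspace A) CC (wfil A m) (carrier CC))\<rparr>"

definition PiW :: "complex set \<Rightarrow>
  ('a mhs, ('a mhs, 'a pt \<Rightarrow> 'a pt) arrow, 'a fil_vs, ('a fil_vs, 'a pt \<Rightarrow> 'a pt) arrow)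
    monoidal_functor_data" where
  "PiW K =
     \<lparr>FOb = PiW_Ob K,
      FAr = (\<lambda>f. \<lparr>source = PiW_Ob K (source f),
                  mapping = cext_map K (hspace (source f)) (hspace (target f)) (mapping f),
                  target = PiW_Ob K (target f)\<rparr>),
      FTen = (\<lambda>A B. \<lparr>source = fil_tensor (PiW_Ob K A) (PiW_Ob K B),
                     mapping = cext_tensor K (hspace A) (hspace B),
                     target = PiW_Ob K (mhs_tensor K A B)\<rparr>),
      FUnt = \<lparr>source = fil_unit,
              mapping = (\<lambda>z\<in>carrier CC. pure_tensor K (scalars K) CC (Scal 1) z),
              target = PiW_Ob K (mhs_unit K)\<rparr>\<rparr>"

subsection \<open>From graded to filtered vector spaces\<close>

definition Ufil_Ob :: "'a gr_vs \<Rightarrow> 'a fil_vs" where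
  "Ufil_Ob A = \<lparr>fspace = gspace A,
     fil = (\<lambda>m. LinearCombinations.module.span (fld UNIV) (gspace A) (\<Union>n\<in>{..m}. piece A n))\<rparr>"

definition Ufil ::
  "('a gr_vs, ('a gr_vs, 'a pt \<Rightarrow> 'a pt) arrow, 'a fil_vs, ('a fil_vs, 'a pt \<Rightarrow> 'a pt) arrow)
    monoidal_functor_data" where
  "Ufil =
     \<lparr>FOb = Ufil_Ob,
      FAr = (\<lambda>f. \<lparr>source = Ufil_Ob (source f), mapping = mapping f, target = Ufil_Ob (target f)\<rparr>),
      FTen = (\<lambda>A B. \<lparr>source = fil_tensor (Ufil_Ob A) (Ufil_Ob B),
                     mapping = (\<lambda>t\<in>carrier (tensor UNIV (gspace A) (gspace B)). t),
                     target = Ufil_Ob (gr_tensor A B)\<rparr>),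
      FUnt = \<lparr>source = fil_unit, mapping = (\<lambda>z\<in>carrier CC. z), target = Ufil_Ob gr_unit\<rparr>\<rparr>"

subsection \<open>From filtered to graded vector spaces\<close>

definition gr_Ob :: "'a fil_vs \<Rightarrow> 'a gr_vs" where
  "gr_Ob A = \<lparr>gspace = dsum (Gr (fspace A) (fil A)),
     piece = (\<lambda>p. {x \<in> carrier (dsum (Gr (fspace A) (fil A))).
                     \<forall>q. q \<noteq> p \<longrightarrow> comps x q = \<zero>\<^bsub>Gr (fspace A) (fil A) q\<^esub>})\<rparr>"

definition gr_functor ::
  "('a fil_vs, ('a fil_vs, 'a pt \<Rightarrow> 'a pt) arrow, 'a gr_vs, ('a gr_vs, 'a pt \<Rightarrow> 'a pt) arrow)
    functor_data" where
  "gr_functor =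
     \<lparr>FOb = gr_Ob,
      FAr = (\<lambda>f. \<lparr>source = gr_Ob (source f),
                  mapping = (\<lambda>x\<in>carrier (gspace (gr_Ob (source f))).
                    Fam (\<lambda>p. Gr_proj (fspace (target f)) (fil (target f)) p (mapping f (comps x p)))),
                  target = gr_Ob (target f)\<rparr>)\<rparr>"

end

theory Submission imports Defs begin

text \<open>
  Write \<open>V\<^sub>\<complex>\<close> for the complexification of a mixed Hodge structure, and \<open>H\<close> for the conjugate of its
  Hodge filtration \<open>F\<close>. Deligne's subspaces \<open>I p q\<close> split \<open>V\<^sub>\<complex>\<close> in such a way that \<open>W m\<close> is the sum of
  the \<open>I p q\<close> with \<open>p + q \<le> m\<close>, and \<open>G\<close> grades \<open>V\<^sub>\<complex>\<close> by \<open>p + q\<close>. The formula for \<open>I p q\<close> only uses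
  intersections and sums of \<open>W\<close>, \<open>F\<close> and \<open>H\<close>, hence it is respected by every map that preserves the three
  filtrations; it is also compatible with tensors. So the structure maps of \<open>\<Pi>\<close> are graded bijections
  for the gradings given by \<open>G\<close>, and a graded bijection is invertible in the graded category.

  That the induced filtrations on the graded pieces of \<open>W\<close> are opposed is restated as a condition on the
  three filtrations of \<open>V\<^sub>\<complex>\<close> alone, which is how tensor products of mixed Hodge structures are handled.
  Finally, taking components and then classes identifies a graded vector space with the graded space of
  its filtration, naturally; applied to \<open>G\<close> this gives the isomorphism of functors.\<close>

section \<open>Vector spaces over a subfield of the complex numbers\<close>

text \<open>Splitting \<open>W\<close> is easy; the difficulty is a splitting that every morphism
  respects. In weight p + q the classes of type (p, q) are those common to \<open>F p\<close> and
  \<open>H q\<close>, but they need not have representatives in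
  \<open>F p \<inter> H q \<inter> W (p + q)\<close>, since a representative in \<open>F p\<close>
  and one in \<open>H q\<close> agree only modulo lower weights. Deligne's formula enlarges
  \<open>H q\<close> by terms of lower weight, just enough for each class to have exactly one
  representative.

  The price is asymmetry: exchanging \<open>F\<close> and \<open>H\<close> gives in general other
  subspaces, congruent to the first ones modulo lower weights. The tensor argument uses this pair of
  splittings: opposedness is a statement on sums and intersections modulo lower weights, which a
  tensor product does not visibly inherit, whereas projections can be tensored. Hence decompositions
  are recorded as systems of projections, and filtrations and gradings alike as the subspaces on
  which prescribed projections vanish.

  Exactness of extension of scalars is read off from linear retractions, which survive any
  functor.\<close>

lemma complex_ring_simps [simp]:
  "carrier complex_ring = UNIV" "\<zero>\<^bsub>complex_ring\<^esub> = 0" "\<one>\<^bsub>complex_ring\<^esub> = 1"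
  "x \<oplus>\<^bsub>complex_ring\<^esub> y = x + y" "x \<otimes>\<^bsub>complex_ring\<^esub> y = x * y"
  by (simp_all add: complex_ring_def)

lemma field_complex_ring: "field complex_ring"
proof -
  have "cring complex_ring"
    by (unfold_locales)
       (auto simp: complex_ring_def Units_def algebra_simps intro: exI[of _ "- x" for x])
  thus ?thesis
    by (rule cring.cring_fieldI2)
       (auto simp: complex_ring_def intro: exI[of _ "inverse a" for a] dest: right_inverse)
qed

lemma subfield_UNIV: "subfield UNIV complex_ring"
  using field.carrier_is_subfield[OF field_complex_ring] by (simp add: complex_ring_def)

text \<open>Linear algebra is needed over \<open>K\<close> and over the complex numbers. Both are
  instances of this locale; the complex one carries the prefix \<open>C\<close>.\<close>

locale base_field =
  fixes S :: "complex set"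
  assumes subfield: "subfield S complex_ring"
begin

lemma field_fld: "field (fld S)"
  using cring.axioms(1)[OF fieldE(1)[OF field_complex_ring]] subfield
  by (rule ring.subfield_iff(2))

lemma S_closed [simp]:
  "0 \<in> S" "1 \<in> S" "a \<in> S \<Longrightarrow> b \<in> S \<Longrightarrow> a + b \<in> S" "a \<in> S \<Longrightarrow> b \<in> S \<Longrightarrow> a * b \<in> S"
  "a \<in> S \<Longrightarrow> - a \<in> S" "a \<in> S \<Longrightarrow> inverse a \<in> S"
proof -
  interpret field "fld S" by (rule field_fld)
  show "0 \<in> S" "1 \<in> S" using zero_closed one_closed by simp_all
  show "a \<in> S \<Longrightarrow> b \<in> S \<Longrightarrow> a + b \<in> S" "a \<in> S \<Longrightarrow> b \<in> S \<Longrightarrow> a * b \<in> S"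
    using a_closed[of a b] m_closed[of a b] by simp_all
  show "- a \<in> S" if "a \<in> S"
    using a_inv_closed[of a] r_neg[of a] that by (simp add: add_eq_0_iff)
  \<comment> \<open>The case a = 0 is included because \<open>inverse 0 = 0\<close>.\<close>
  show "inverse a \<in> S" if a: "a \<in> S"
  proof (cases "a = 0")
    case False
    hence "a \<in> Units (fld S)" using a by (simp add: field_Units)
    then obtain b where "b \<in> S" "a * b = 1" by (auto simp: Units_def)
    thus ?thesis using False by (metis inverse_unique)
  qed (use \<open>0 \<in> S\<close> in simp)
qed

abbreviation vs :: "'a vs \<Rightarrow> bool" where "vs V \<equiv> vectorspace (fld S) V"
abbreviation sub :: "'a vs \<Rightarrow> 'a pt set \<Rightarrow> bool" where "sub V N \<equiv> subspace (fld S) N V"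
text \<open>In contrast to \<open>linear_maps\<close>, values outside of the carrier are arbitrary,
  so that identities and composites are plain lambda terms. Extensionality enters only when maps are
  compared as arrows.\<close>

abbreviation lin :: "'a vs \<Rightarrow> 'a vs \<Rightarrow> ('a pt \<Rightarrow> 'a pt) set" where "lin V V' \<equiv> module_hom (fld S) V V'"
abbreviation span :: "'a vs \<Rightarrow> 'a pt set \<Rightarrow> 'a pt set" where "span V A \<equiv> module.span (fld S) V A"

text \<open>The negatives demanded of a module come from the scalar -1: distributivity together with
  1 v = v and 0 v = 0 makes v + (-1) v vanish.\<close>

lemma vsI:
  fixes V (structure)
  assumes zero: "\<zero> \<in> carrier V"
    and add: "\<And>v w. \<lbrakk>v \<in> carrier V; w \<in> carrier V\<rbrakk> \<Longrightarrow> v \<oplus> w \<in> carrier V"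
    and smult: "\<And>r v. \<lbrakk>r \<in> S; v \<in> carrier V\<rbrakk> \<Longrightarrow> r \<odot> v \<in> carrier V"
    and comm: "\<And>v w. \<lbrakk>v \<in> carrier V; w \<in> carrier V\<rbrakk> \<Longrightarrow> v \<oplus> w = w \<oplus> v"
    and assoc: "\<And>u v w. \<lbrakk>u \<in> carrier V; v \<in> carrier V; w \<in> carrier V\<rbrakk>
      \<Longrightarrow> (u \<oplus> v) \<oplus> w = u \<oplus> (v \<oplus> w)"
    and add_zero: "\<And>v. v \<in> carrier V \<Longrightarrow> v \<oplus> \<zero> = v"
    and smult_zero: "\<And>v. v \<in> carrier V \<Longrightarrow> 0 \<odot> v = \<zero>"
    and smult_one: "\<And>v. v \<in> carrier V \<Longrightarrow> 1 \<odot> v = v"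
    and smult_smult: "\<And>r s v. \<lbrakk>r \<in> S; s \<in> S; v \<in> carrier V\<rbrakk> \<Longrightarrow> (r * s) \<odot> v = r \<odot> (s \<odot> v)"
    and distl: "\<And>r s v. \<lbrakk>r \<in> S; s \<in> S; v \<in> carrier V\<rbrakk> \<Longrightarrow> (r + s) \<odot> v = r \<odot> v \<oplus> s \<odot> v"
    and distr: "\<And>r v w. \<lbrakk>r \<in> S; v \<in> carrier V; w \<in> carrier V\<rbrakk>
      \<Longrightarrow> r \<odot> (v \<oplus> w) = r \<odot> v \<oplus> r \<odot> w"
  shows "vs V"
proof -
  have neg: "\<exists>w\<in>carrier V. v \<oplus> w = \<zero>" if "v \<in> carrier V" for v
    using distl[of 1 "- 1" v] smult[of "- 1" v] that
    by (intro bexI[of _ "(- 1) \<odot> v"]) (simp_all add: smult_one smult_zero)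
  interpret field "fld S" by (rule field_fld)
  have "module (fld S) V"
    by (rule module_criteria; (rule is_cring)?)
       (simp_all add: zero add smult assoc add_zero smult_one smult_smult distl distr neg,
        auto intro: comm)
  thus ?thesis by (simp add: vectorspace_def field_fld)
qed

lemma vs_module: "vs V \<Longrightarrow> module (fld S) V"
  by (simp add: vectorspace_def)

lemma vs_group: "vs V \<Longrightarrow> abelian_group V"
  by (drule vs_module) (rule module.axioms(2))

text \<open>The module laws in terms of complex addition and multiplication and of
  \<open>r \<in> S\<close>, in place of the operations and the carrier of \<open>fld S\<close>, so
  that they rewrite concrete terms.\<close>

lemma
  fixes V (structure)
  assumes V: "vs V"
  shows vs_zero [simp]: "\<zero> \<in> carrier V"
  and vs_add [simp]: "\<lbrakk>v \<in> carrier V; w \<in> carrier V\<rbrakk> \<Longrightarrow> v \<oplus> w \<in> carrier V"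
  and vs_minus [simp]: "\<lbrakk>v \<in> carrier V; w \<in> carrier V\<rbrakk> \<Longrightarrow> v \<ominus> w \<in> carrier V"
  and vs_smult [simp]: "\<lbrakk>r \<in> S; v \<in> carrier V\<rbrakk> \<Longrightarrow> r \<odot> v \<in> carrier V"
  and vs_l_zero [simp]: "v \<in> carrier V \<Longrightarrow> \<zero> \<oplus> v = v"
  and vs_r_zero [simp]: "v \<in> carrier V \<Longrightarrow> v \<oplus> \<zero> = v"
  and vs_minus_self [simp]: "v \<in> carrier V \<Longrightarrow> v \<ominus> v = \<zero>"
  and vs_minus_zero [simp]: "v \<in> carrier V \<Longrightarrow> v \<ominus> \<zero> = v"
  and vs_smult_one [simp]: "v \<in> carrier V \<Longrightarrow> 1 \<odot> v = v"
  and vs_zero_smult [simp]: "v \<in> carrier V \<Longrightarrow> 0 \<odot> v = \<zero>"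
  and vs_smult_zero [simp]: "r \<in> S \<Longrightarrow> r \<odot> \<zero> = \<zero>"
  and vs_assoc: "\<lbrakk>u \<in> carrier V; v \<in> carrier V; w \<in> carrier V\<rbrakk>
      \<Longrightarrow> (u \<oplus> v) \<oplus> w = u \<oplus> (v \<oplus> w)"
  and vs_comm: "\<lbrakk>v \<in> carrier V; w \<in> carrier V\<rbrakk> \<Longrightarrow> v \<oplus> w = w \<oplus> v"
  and vs_lcomm: "\<lbrakk>u \<in> carrier V; v \<in> carrier V; w \<in> carrier V\<rbrakk>
      \<Longrightarrow> u \<oplus> (v \<oplus> w) = v \<oplus> (u \<oplus> w)"
  and vs_smult_smult: "\<lbrakk>r \<in> S; s \<in> S; v \<in> carrier V\<rbrakk> \<Longrightarrow> r \<odot> (s \<odot> v) = (r * s) \<odot> v"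
  and vs_distl: "\<lbrakk>r \<in> S; s \<in> S; v \<in> carrier V\<rbrakk> \<Longrightarrow> (r + s) \<odot> v = r \<odot> v \<oplus> s \<odot> v"
  and vs_distr: "\<lbrakk>r \<in> S; v \<in> carrier V; w \<in> carrier V\<rbrakk>
      \<Longrightarrow> r \<odot> (v \<oplus> w) = r \<odot> v \<oplus> r \<odot> w"
  and vs_minus_add: "\<lbrakk>v \<in> carrier V; w \<in> carrier V\<rbrakk> \<Longrightarrow> (v \<ominus> w) \<oplus> w = v"
  and vs_add_minus: "\<lbrakk>v \<in> carrier V; w \<in> carrier V\<rbrakk> \<Longrightarrow> (v \<oplus> w) \<ominus> w = v"
  and vs_minus_smult: "\<lbrakk>v \<in> carrier V; w \<in> carrier V\<rbrakk> \<Longrightarrow> v \<ominus> w = v \<oplus> (- 1) \<odot> w"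
proof -
  interpret V: module "fld S" V using vs_module[OF V] .
  show "\<zero> \<in> carrier V" by simp
  show "1 \<odot> v = v" "0 \<odot> v = \<zero>" if "v \<in> carrier V"
    using V.smult_one[of v] V.smult_l_null[of v] that by simp_all
  show "r \<odot> \<zero> = \<zero>" if "r \<in> S" using V.smult_r_null[of r] that by simp
  show sm: "r \<odot> v \<in> carrier V" if "r \<in> S" "v \<in> carrier V" for r v
    using V.smult_closed[of r v] that by simp
  show "r \<odot> (s \<odot> v) = (r * s) \<odot> v" if "r \<in> S" "s \<in> S" "v \<in> carrier V"
    using V.smult_assoc1[of r s v] that by simp
  show dl: "(r + s) \<odot> v = r \<odot> v \<oplus> s \<odot> v" if "r \<in> S" "s \<in> S" "v \<in> carrier V" for r s v
    using V.smult_l_distr[of r s v] that by simp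
  show "r \<odot> (v \<oplus> w) = r \<odot> v \<oplus> r \<odot> w" if "r \<in> S" "v \<in> carrier V" "w \<in> carrier V"
    using V.smult_r_distr[of r v w] that by simp
  show "v \<ominus> w = v \<oplus> (- 1) \<odot> w" if "v \<in> carrier V" "w \<in> carrier V"
  proof -
    have w: "w \<oplus> (- 1) \<odot> w = \<zero>"
      using dl[of 1 "- 1" w] V.smult_one[of w] V.smult_l_null[of w] that by simp
    have "\<ominus> w = (- 1) \<odot> w"
    proof (rule V.minus_equality)
      show "(- 1) \<odot> w \<oplus> w = \<zero>"
        using w V.a_comm[of w "(- 1) \<odot> w"] sm[of "- 1" w] that by simp
    qed (use that sm[of "- 1" w] in simp_all)
    thus ?thesis by (simp add: a_minus_def)
  qed
  show "v \<ominus> v = \<zero>" "v \<ominus> \<zero> = v" if "v \<in> carrier V"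
    using that by (simp_all add: a_minus_def V.r_neg)
  show "(v \<ominus> w) \<oplus> w = v" "(v \<oplus> w) \<ominus> w = v" if "v \<in> carrier V" "w \<in> carrier V"
    using that by (simp_all add: a_minus_def V.a_assoc V.l_neg V.r_neg)
  show "(u \<oplus> v) \<oplus> w = u \<oplus> (v \<oplus> w)" "u \<oplus> (v \<oplus> w) = v \<oplus> (u \<oplus> w)"
    if "u \<in> carrier V" "v \<in> carrier V" "w \<in> carrier V"
    using that by (simp_all add: V.a_assoc V.a_lcomm)
  show "v \<oplus> w = w \<oplus> v" if "v \<in> carrier V" "w \<in> carrier V"
    using that by (rule V.a_comm)
  show "v \<oplus> w \<in> carrier V" "v \<ominus> w \<in> carrier V" if "v \<in> carrier V" "w \<in> carrier V"
    using that by simp_all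
  show "\<zero> \<oplus> v = v" "v \<oplus> \<zero> = v" if "v \<in> carrier V"
    using that by simp_all
qed

lemmas vs_ac = vs_assoc vs_comm vs_lcomm

lemma vs_add_diff: "\<lbrakk>vs V; u \<in> carrier V; v \<in> carrier V; w \<in> carrier V\<rbrakk>
    \<Longrightarrow> u \<oplus>\<^bsub>V\<^esub> v = w \<longleftrightarrow> u = w \<ominus>\<^bsub>V\<^esub> v"
  using vs_minus_add[of V w v] vs_add_minus[of V u v] by auto

lemma vs_diff_eq_zero: "\<lbrakk>vs V; v \<in> carrier V; w \<in> carrier V\<rbrakk> \<Longrightarrow> v \<ominus>\<^bsub>V\<^esub> w = \<zero>\<^bsub>V\<^esub> \<longleftrightarrow> v = w"
  using vs_minus_add[of V v w] by auto

subsection \<open>Subspaces and spans\<close>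

lemma subI:
  assumes "vs V" "N \<subseteq> carrier V" "\<zero>\<^bsub>V\<^esub> \<in> N"
    and "\<And>v w. \<lbrakk>v \<in> N; w \<in> N\<rbrakk> \<Longrightarrow> v \<oplus>\<^bsub>V\<^esub> w \<in> N"
    and "\<And>r v. \<lbrakk>r \<in> S; v \<in> N\<rbrakk> \<Longrightarrow> r \<odot>\<^bsub>V\<^esub> v \<in> N"
  shows "sub V N"
  using assms by (simp add: subspace_def submodule_def vs_module)

lemma
  fixes V (structure)
  shows sub_subset: "sub V N \<Longrightarrow> N \<subseteq> carrier V"
  and sub_carrier: "\<lbrakk>sub V N; v \<in> N\<rbrakk> \<Longrightarrow> v \<in> carrier V"
  and sub_vs: "sub V N \<Longrightarrow> vs V"
  and sub_zero: "sub V N \<Longrightarrow> \<zero> \<in> N"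
  and sub_add: "\<lbrakk>sub V N; v \<in> N; w \<in> N\<rbrakk> \<Longrightarrow> v \<oplus> w \<in> N"
  and sub_smult: "\<lbrakk>sub V N; r \<in> S; v \<in> N\<rbrakk> \<Longrightarrow> r \<odot> v \<in> N"
proof -
  assume N: "sub V N"
  interpret N: submodule "fld S" N V by (rule subspace.submod[OF N])
  show "vs V" by (rule subspace.vs[OF N])
  show "N \<subseteq> carrier V" by (rule N.subset)
  thus "v \<in> carrier V" if "v \<in> N" using that ..
  show "v \<oplus> w \<in> N" if "v \<in> N" "w \<in> N" using that by simp
  show "\<zero> \<in> N" by simp
  show "r \<odot> v \<in> N" if "r \<in> S" "v \<in> N" using N.smult_closed[of r v] that by simp
qed

lemma sub_minus: "\<lbrakk>sub V N; v \<in> N; w \<in> N\<rbrakk> \<Longrightarrow> v \<ominus>\<^bsub>V\<^esub> w \<in> N"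
  by (simp add: vs_minus_smult sub_vs sub_carrier sub_add sub_smult)

lemma sub_add_cancel: "\<lbrakk>sub V N; v \<oplus>\<^bsub>V\<^esub> w \<in> N; w \<in> N; v \<in> carrier V\<rbrakk> \<Longrightarrow> v \<in> N"
  using sub_minus[of N V "v \<oplus>\<^bsub>V\<^esub> w" w] by (simp add: vs_add_minus sub_vs sub_carrier)

lemma sub_self: "vs V \<Longrightarrow> sub V (carrier V)"
  by (rule subI) simp_all

lemma sub_zero_space: "vs V \<Longrightarrow> sub V {\<zero>\<^bsub>V\<^esub>}"
  by (rule subI) simp_all

lemma sub_Int: "\<lbrakk>sub V N; sub V N'\<rbrakk> \<Longrightarrow> sub V (N \<inter> N')"
  by (rule subI) (auto simp: sub_vs sub_carrier sub_zero sub_add sub_smult)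

lemma set_add_iff: "x \<in> A <+>\<^bsub>V\<^esub> B \<longleftrightarrow> (\<exists>a\<in>A. \<exists>b\<in>B. x = a \<oplus>\<^bsub>V\<^esub> b)"
  by (auto simp: set_add_def')

lemma sub_set_add:
  fixes V (structure)
  assumes N: "sub V N" and N': "sub V N'"
  shows "sub V (N <+>\<^bsub>V\<^esub> N')"
proof (rule subI)
  have V: "vs V" using N by (rule sub_vs)
  note c = sub_carrier[OF N] sub_carrier[OF N']
  show "N <+>\<^bsub>V\<^esub> N' \<subseteq> carrier V" using c V by (auto simp: set_add_iff)
  show "\<zero> \<in> N <+>\<^bsub>V\<^esub> N'"
    using V sub_zero[OF N] sub_zero[OF N'] by (auto simp: set_add_iff intro!: bexI[of _ "\<zero>"])
  show "v \<oplus> w \<in> N <+>\<^bsub>V\<^esub> N'" if vw: "v \<in> N <+>\<^bsub>V\<^esub> N'" "w \<in> N <+>\<^bsub>V\<^esub> N'" for v w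
  proof -
    obtain a b a' b' where ab: "a \<in> N" "b \<in> N'" "a' \<in> N" "b' \<in> N'"
      and eq: "v = a \<oplus> b" "w = a' \<oplus> b'" using vw by (auto simp: set_add_iff)
    have "v \<oplus> w = (a \<oplus> a') \<oplus> (b \<oplus> b')"
      unfolding eq using V c ab by (simp add: vs_ac)
    thus ?thesis using ab N N' by (auto simp: set_add_iff intro!: bexI sub_add)
  qed
  show "r \<odot> v \<in> N <+>\<^bsub>V\<^esub> N'" if "r \<in> S" "v \<in> N <+>\<^bsub>V\<^esub> N'" for r v
    using that N N' c by (auto simp: set_add_iff vs_distr sub_smult V intro!: bexI)
qed (rule sub_vs[OF N])

lemma set_add_left: "\<lbrakk>sub V N; sub V N'\<rbrakk> \<Longrightarrow> N \<subseteq> N <+>\<^bsub>V\<^esub> N'"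
  using sub_zero[of N' V] by (force simp: set_add_iff sub_carrier sub_vs)

lemma set_add_right: "\<lbrakk>sub V N; sub V N'\<rbrakk> \<Longrightarrow> N' \<subseteq> N <+>\<^bsub>V\<^esub> N'"
  using sub_zero[of N V] by (force simp: set_add_iff sub_carrier sub_vs)

lemma span_sub: "\<lbrakk>vs V; A \<subseteq> carrier V\<rbrakk> \<Longrightarrow> sub V (span V A)"
  by (simp add: vectorspace.span_is_subspace)

lemma span_superset: "\<lbrakk>vs V; A \<subseteq> carrier V\<rbrakk> \<Longrightarrow> A \<subseteq> span V A"
  by (simp add: module.in_own_span vs_module)

lemma span_least: "\<lbrakk>sub V N; A \<subseteq> N\<rbrakk> \<Longrightarrow> span V A \<subseteq> N"
  by (rule module.span_is_subset) (auto simp: subspace_def vs_module)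

subsection \<open>Linear maps\<close>

lemma linI:
  assumes "\<And>v. v \<in> carrier V \<Longrightarrow> f v \<in> carrier W"
    and "\<And>v w. \<lbrakk>v \<in> carrier V; w \<in> carrier V\<rbrakk> \<Longrightarrow> f (v \<oplus>\<^bsub>V\<^esub> w) = f v \<oplus>\<^bsub>W\<^esub> f w"
    and "\<And>r v. \<lbrakk>r \<in> S; v \<in> carrier V\<rbrakk> \<Longrightarrow> f (r \<odot>\<^bsub>V\<^esub> v) = r \<odot>\<^bsub>W\<^esub> f v"
  shows "f \<in> lin V W"
  using assms by (auto simp: module_hom_def)

lemma lin_closed: "\<lbrakk>f \<in> lin V W; v \<in> carrier V\<rbrakk> \<Longrightarrow> f v \<in> carrier W"
  and lin_add: "\<lbrakk>f \<in> lin V W; v \<in> carrier V; w \<in> carrier V\<rbrakk> \<Longrightarrow> f (v \<oplus>\<^bsub>V\<^esub> w) = f v \<oplus>\<^bsub>W\<^esub> f w"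
  and lin_smult: "\<lbrakk>f \<in> lin V W; r \<in> S; v \<in> carrier V\<rbrakk> \<Longrightarrow> f (r \<odot>\<^bsub>V\<^esub> v) = r \<odot>\<^bsub>W\<^esub> f v"
  by (auto simp: module_hom_def)

lemma lin_zero: "\<lbrakk>f \<in> lin V W; vs V; vs W\<rbrakk> \<Longrightarrow> f \<zero>\<^bsub>V\<^esub> = \<zero>\<^bsub>W\<^esub>"
  by (metis lin_closed lin_smult vs_zero vs_zero_smult S_closed(1))

lemma lin_minus: "\<lbrakk>f \<in> lin V W; vs V; vs W; v \<in> carrier V; w \<in> carrier V\<rbrakk>
    \<Longrightarrow> f (v \<ominus>\<^bsub>V\<^esub> w) = f v \<ominus>\<^bsub>W\<^esub> f w"
  by (simp add: vs_minus_smult lin_add lin_smult lin_closed)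

lemma lin_id: "(\<lambda>v. v) \<in> lin V V"
  by (rule linI) simp_all

lemma lin_comp: "\<lbrakk>f \<in> lin U V; g \<in> lin V W\<rbrakk> \<Longrightarrow> (\<lambda>v. g (f v)) \<in> lin U W"
  by (rule linI) (simp_all add: lin_closed lin_add lin_smult)

lemma lin_cong: "\<lbrakk>f \<in> lin V W; vs V; \<And>v. v \<in> carrier V \<Longrightarrow> g v = f v\<rbrakk> \<Longrightarrow> g \<in> lin V W"
  by (rule linI) (simp_all add: lin_closed lin_add lin_smult)

lemma lin_restrict: "\<lbrakk>f \<in> lin V W; vs V\<rbrakk> \<Longrightarrow> restrict f (carrier V) \<in> lin V W"
  by (rule lin_cong) simp_all

lemma lin_image_sub:
  fixes W (structure)
  assumes f: "f \<in> lin V W" "vs V" "vs W" and N: "sub V N"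
  shows "sub W (f ` N)"
proof (rule subI)
  note c = sub_carrier[OF N]
  show "f ` N \<subseteq> carrier W" using f c by (auto intro: lin_closed)
  show "\<zero> \<in> f ` N" using lin_zero[OF f] sub_zero[OF N] by force
  show "v \<oplus> w \<in> f ` N" if vw: "v \<in> f ` N" "w \<in> f ` N" for v w
  proof -
    obtain a b where "a \<in> N" "b \<in> N" "v = f a" "w = f b" using vw by auto
    hence "v \<oplus> w = f (a \<oplus>\<^bsub>V\<^esub> b)" "a \<oplus>\<^bsub>V\<^esub> b \<in> N" using f c N by (simp_all add: lin_add sub_add)
    thus ?thesis by simp
  qed
  show "r \<odot> v \<in> f ` N" if rv: "r \<in> S" "v \<in> f ` N" for r v
  proof -
    obtain a where "a \<in> N" "v = f a" using rv by auto
    hence "r \<odot> v = f (r \<odot>\<^bsub>V\<^esub> a)" "r \<odot>\<^bsub>V\<^esub> a \<in> N" using rv f c N by (simp_all add: lin_smult sub_smult)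
    thus ?thesis by simp
  qed
qed (rule f)

lemma lin_vimage_sub:
  assumes f: "f \<in> lin V W" "vs V" "vs W" and N: "sub W N"
  shows "sub V {v \<in> carrier V. f v \<in> N}"
  using f N by (intro subI) (auto simp: lin_zero lin_add lin_smult sub_zero sub_add sub_smult)

lemma lin_inj_on:
  fixes V (structure)
  assumes f: "f \<in> lin V W" "vs V" "vs W" and "\<And>v. \<lbrakk>v \<in> carrier V; f v = \<zero>\<^bsub>W\<^esub>\<rbrakk> \<Longrightarrow> v = \<zero>"
  shows "inj_on f (carrier V)"
proof (rule inj_onI)
  fix v w assume vw: "v \<in> carrier V" "w \<in> carrier V" "f v = f w"
  have "f w \<in> carrier W" using f vw by (simp add: lin_closed)
  hence "f (v \<ominus> w) = \<zero>\<^bsub>W\<^esub>" using f vw by (simp add: lin_minus)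
  hence "v \<ominus> w = \<zero>" using assms vw by simp
  thus "v = w" using vw f by (simp add: vs_diff_eq_zero)
qed

lemma lin_inv_into:
  assumes f: "f \<in> lin V W" "vs V" "vs W" and b: "bij_betw f (carrier V) (carrier W)"
  shows "inv_into (carrier V) f \<in> lin W V"
proof (rule linI)
  let ?g = "inv_into (carrier V) f"
  have inj: "inj_on f (carrier V)" and im: "f ` carrier V = carrier W" using b by (auto simp: bij_betw_def)
  have g: "?g w \<in> carrier V" "f (?g w) = w" if "w \<in> carrier W" for w
    using that im by (auto intro: inv_into_into f_inv_into_f)
  show "?g w \<in> carrier V" if "w \<in> carrier W" for w using g that by simp
  show "?g (v \<oplus>\<^bsub>W\<^esub> w) = ?g v \<oplus>\<^bsub>V\<^esub> ?g w" if "v \<in> carrier W" "w \<in> carrier W" for v w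
    using that f g by (intro inv_into_f_eq[OF inj]) (simp_all add: lin_add)
  show "?g (r \<odot>\<^bsub>W\<^esub> v) = r \<odot>\<^bsub>V\<^esub> ?g v" if "r \<in> S" "v \<in> carrier W" for r v
    using that f g by (intro inv_into_f_eq[OF inj]) (simp_all add: lin_smult)
qed

lemma linear_maps_iff: "f \<in> linear_maps S V W \<longleftrightarrow> f \<in> lin V W \<and> f \<in> extensional (carrier V)"
  by (simp add: linear_maps_def)

subsection \<open>Scalars\<close>

lemma scalars_simps [simp]:
  "carrier (scalars X) = Scal ` X" "\<zero>\<^bsub>scalars X\<^esub> = Scal 0"
  "x \<oplus>\<^bsub>scalars X\<^esub> y = Scal (scal x + scal y)" "r \<odot>\<^bsub>scalars X\<^esub> x = Scal (r * scal x)"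
  by (simp_all add: scalars_def)

lemma vs_scalars [simp]: "vs (scalars S)"
  by (rule vsI) (auto simp: algebra_simps)

lemma vs_CC [simp]: "vs CC"
  by (rule vsI) (auto simp: algebra_simps)

end

interpretation C: base_field UNIV
  by (rule base_field.intro) (rule subfield_UNIV)

section \<open>Tensor products\<close>

text \<open>The sum inside \<open>tlift\<close>, taken on a list in place of an encoded class, which
  makes induction on the list available.\<close>

definition fsum :: "'a vs \<Rightarrow> ('a pt \<Rightarrow> 'a pt \<Rightarrow> 'a pt) \<Rightarrow> ('a pt \<times> 'a pt) list \<Rightarrow> 'a pt" where
  "fsum X \<beta> xs = foldr (\<lambda>(v, w) s. \<beta> v w \<oplus>\<^bsub>X\<^esub> s) xs \<zero>\<^bsub>X\<^esub>"

lemma fsum_simps [simp]: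
  "fsum X \<beta> [] = \<zero>\<^bsub>X\<^esub>" "fsum X \<beta> ((v, w) # xs) = \<beta> v w \<oplus>\<^bsub>X\<^esub> fsum X \<beta> xs"
  by (simp_all add: fsum_def)

lemma tlift_fsum: "tlift X \<beta> t = fsum X \<beta> (summands t)"
  by (simp add: tlift_def fsum_def)

context base_field
begin

lemma lin_zero_fun: "vs X \<Longrightarrow> (\<lambda>w. \<zero>\<^bsub>X\<^esub>) \<in> lin W X"
  by (rule linI) simp_all

lemma lin_add_fun: "\<lbrakk>vs X; f \<in> lin W X; g \<in> lin W X\<rbrakk> \<Longrightarrow> (\<lambda>w. f w \<oplus>\<^bsub>X\<^esub> g w) \<in> lin W X"
  by (rule linI) (simp_all add: lin_closed lin_add lin_smult vs_ac vs_distr)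

definition bilin :: "'a vs \<Rightarrow> 'a vs \<Rightarrow> 'a vs \<Rightarrow> ('a pt \<Rightarrow> 'a pt \<Rightarrow> 'a pt) \<Rightarrow> bool" where
  "bilin V W X \<beta> \<longleftrightarrow> (\<forall>w\<in>carrier W. (\<lambda>v. \<beta> v w) \<in> lin V X) \<and> (\<forall>v\<in>carrier V. \<beta> v \<in> lin W X)"

lemma bilinI:
  assumes "\<And>w. w \<in> carrier W \<Longrightarrow> (\<lambda>v. \<beta> v w) \<in> lin V X" "\<And>v. v \<in> carrier V \<Longrightarrow> \<beta> v \<in> lin W X"
  shows "bilin V W X \<beta>"
  using assms by (simp add: bilin_def)

lemma bilin_left: "\<lbrakk>bilin V W X \<beta>; w \<in> carrier W\<rbrakk> \<Longrightarrow> (\<lambda>v. \<beta> v w) \<in> lin V X"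
  and bilin_right: "\<lbrakk>bilin V W X \<beta>; v \<in> carrier V\<rbrakk> \<Longrightarrow> \<beta> v \<in> lin W X"
  by (simp_all add: bilin_def)

lemma bilin_closed: "\<lbrakk>bilin V W X \<beta>; v \<in> carrier V; w \<in> carrier W\<rbrakk> \<Longrightarrow> \<beta> v w \<in> carrier X"
  by (metis bilin_right lin_closed)

lemma fsum_closed: "\<lbrakk>bilin V W X \<beta>; vs X; xs \<in> lists (carrier V \<times> carrier W)\<rbrakk> \<Longrightarrow> fsum X \<beta> xs \<in> carrier X"
  by (induction xs) (auto simp: bilin_closed)

lemma fsum_append:
  assumes "bilin V W X \<beta>" "vs X"
    and "xs \<in> lists (carrier V \<times> carrier W)" "ys \<in> lists (carrier V \<times> carrier W)"
  shows "fsum X \<beta> (xs @ ys) = fsum X \<beta> xs \<oplus>\<^bsub>X\<^esub> fsum X \<beta> ys"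
  using assms(3)
proof (induction xs)
  case (Cons x xs)
  obtain v w where x: "x = (v, w)" by (cases x)
  have "\<beta> v w \<in> carrier X" using Cons.hyps x assms(1) by (auto simp: bilin_closed)
  thus ?case using Cons assms x by (simp add: vs_assoc fsum_closed)
qed (use assms in \<open>simp add: fsum_closed\<close>)

text \<open>\<open>refl\<close> and \<open>commute\<close> hold for arbitrary lists, so membership
  of the entries is no part of the relation and has to be carried along it.\<close>

lemma ten_rel_lists:
  assumes "ten_rel S V W xs ys" "vs V" "vs W"
  shows "xs \<in> lists (carrier V \<times> carrier W) \<longleftrightarrow> ys \<in> lists (carrier V \<times> carrier W)"
  using assms(1) by induction (use assms(2,3) in auto)

text \<open>This is the existence half of the universal property: each generating relation of the
  tensor product is an equation satisfied by a bilinear map.\<close>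

lemma ten_rel_fsum:
  assumes rel: "ten_rel S V W xs ys" and V: "vs V" and W: "vs W" and X: "vs X" and \<beta>: "bilin V W X \<beta>"
    and xs: "xs \<in> lists (carrier V \<times> carrier W)"
  shows "fsum X \<beta> xs = fsum X \<beta> ys"
  using rel xs
proof induction
  case (sym xs ys)
  thus ?case using ten_rel_lists[OF sym(1) V W] by simp
next
  case (trans xs ys zs)
  thus ?case using ten_rel_lists[OF trans(1) V W] by simp
next
  case (append xs xs' ys ys')
  thus ?case
    using ten_rel_lists[OF append(1) V W] ten_rel_lists[OF append(2) V W] fsum_append[OF \<beta> X] by auto
next
  case (commute xs ys)
  thus ?case using fsum_append[OF \<beta> X] fsum_closed[OF \<beta> X] vs_comm[OF X] by auto
next
  case (add_left v v' w)
  thus ?case using lin_add[OF bilin_left[OF \<beta>]] X V W by (simp add: bilin_closed[OF \<beta>])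
next
  case (add_right v w w')
  thus ?case using lin_add[OF bilin_right[OF \<beta>]] X V W by (simp add: bilin_closed[OF \<beta>])
next
  case (zero_left w)
  thus ?case using lin_zero[OF bilin_left[OF \<beta>]] X V W by simp
next
  case (balanced r v w)
  thus ?case
    using lin_smult[OF bilin_left[OF \<beta>], of w r v] lin_smult[OF bilin_right[OF \<beta>], of v r w] by simp
qed simp

end

text \<open>The representative is chosen from the predicate \<open>ten_rel S V W xs\<close>. Related
  lists define the same predicate, hence lead to the same choice.\<close>

lemma tcls_cong: "ten_rel S V W xs ys \<Longrightarrow> tcls S V W xs = tcls S V W ys"
proof -
  assume xy: "ten_rel S V W xs ys"
  have "ten_rel S V W xs = ten_rel S V W ys"
    by (intro ext iffI) (rule ten_rel.trans[OF ten_rel.sym[OF xy]] ten_rel.trans[OF xy], assumption)+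
  thus ?thesis by (simp add: tcls_def)
qed

lemma ten_rel_summands: "ten_rel S V W (summands (tcls S V W xs)) xs"
  unfolding tcls_def pt.sel
  by (rule ten_rel.sym) (rule someI[where P = "ten_rel S V W xs"], rule ten_rel.refl)

lemma tensor_simps:
  "carrier (tensor S V W) = tcls S V W ` lists (carrier V \<times> carrier W)"
  "\<zero>\<^bsub>tensor S V W\<^esub> = tcls S V W []"
  "s \<oplus>\<^bsub>tensor S V W\<^esub> t = tcls S V W (summands s @ summands t)"
  "r \<odot>\<^bsub>tensor S V W\<^esub> t = tcls S V W (map (\<lambda>(v, w). (r \<odot>\<^bsub>V\<^esub> v, w)) (summands t))"
  by (simp_all add: tensor_def)

lemma tcls_append: "tcls S V W (xs @ ys) = tcls S V W xs \<oplus>\<^bsub>tensor S V W\<^esub> tcls S V W ys"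
  unfolding tensor_simps
  by (rule tcls_cong[OF ten_rel.sym]) (intro ten_rel.append ten_rel_summands)

section \<open>The vector space structure of the tensor product\<close>

context base_field
begin

text \<open>Scalars act on the left entries of the chosen representative. Compatibility with every
  generating relation makes the result independent of the choice; the \<open>balanced\<close> case
  rests on commutativity of complex multiplication.\<close>

lemma ten_rel_smult:
  fixes V (structure)
  assumes rel: "ten_rel S V W xs ys" and V: "vs V" and W: "vs W" and r: "r \<in> S"
  defines "m \<equiv> map (\<lambda>(v, w). (r \<odot> v, w))"
  shows "ten_rel S V W (m xs) (m ys)"
  using rel
proof induction
  case (add_left v v' w)
  thus ?case using V r ten_rel.add_left[of "r \<odot> v" V "r \<odot> v'" w W S]
    by (simp add: m_def vs_distr)
next
  case (add_right v w w')
  thus ?case using V r by (simp add: m_def ten_rel.add_right)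
next
  case (zero_left w)
  thus ?case using V r by (simp add: m_def ten_rel.zero_left)
next
  case (balanced s v w)
  thus ?case using V r ten_rel.balanced[of s S "r \<odot> v" V w W]
    by (simp add: m_def vs_smult_smult mult.commute)
next
  case (trans xs ys zs)
  thus ?case by (blast intro: ten_rel.trans)
qed (simp_all add: m_def ten_rel.refl ten_rel.sym ten_rel.append ten_rel.commute)

lemma tcls_smult:
  assumes "vs V" "vs W" "r \<in> S"
  shows "r \<odot>\<^bsub>tensor S V W\<^esub> tcls S V W xs = tcls S V W (map (\<lambda>(v, w). (r \<odot>\<^bsub>V\<^esub> v, w)) xs)"
  unfolding tensor_simps using assms by (intro tcls_cong ten_rel_smult ten_rel_summands)

lemma map_smult_lists:
  assumes "vs V" "r \<in> S" "xs \<in> lists (carrier V \<times> carrier W)"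
  shows "map (\<lambda>(v, w). (r \<odot>\<^bsub>V\<^esub> v, w)) xs \<in> lists (carrier V \<times> carrier W)"
  using assms by (auto simp: in_lists_conv_set)

lemma vs_tensor [simp]:
  fixes V (structure)
  assumes V: "vs V" and W: "vs W"
  shows "vs (tensor S V W)"
proof (rule vsI, unfold tensor_simps(1,2))
  let ?L = "lists (carrier V \<times> carrier W)" and ?c = "tcls S V W" and ?T = "tensor S V W"
  let ?m = "\<lambda>r. map (\<lambda>(v, w). (r \<odot> v, w))"
  note app = tcls_append[symmetric, of S V W]
  note sm = tcls_smult[OF V W]
  note ms = map_smult_lists[OF V]
  have Cons: "?c (a # xs) = ?c [a] \<oplus>\<^bsub>?T\<^esub> ?c xs" for a xs
    using tcls_append[of S V W "[a]" xs] by simp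
  have comm: "?c xs \<oplus>\<^bsub>?T\<^esub> ?c ys = ?c ys \<oplus>\<^bsub>?T\<^esub> ?c xs" for xs ys
    unfolding app by (intro tcls_cong ten_rel.commute)
  have assoc: "(?c xs \<oplus>\<^bsub>?T\<^esub> ?c ys) \<oplus>\<^bsub>?T\<^esub> ?c zs = ?c xs \<oplus>\<^bsub>?T\<^esub> (?c ys \<oplus>\<^bsub>?T\<^esub> ?c zs)" for xs ys zs
    by (simp add: app)
  show "?c [] \<in> ?c ` ?L" by auto
  show "s \<oplus>\<^bsub>?T\<^esub> t \<in> ?c ` ?L" if "s \<in> ?c ` ?L" "t \<in> ?c ` ?L" for s t
    using that by (elim imageE) (simp add: app imageI del: in_lists_conv_set)
  show "r \<odot>\<^bsub>?T\<^esub> t \<in> ?c ` ?L" if "r \<in> S" "t \<in> ?c ` ?L" for r t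
    using that by (elim imageE) (simp add: sm imageI ms del: in_lists_conv_set)
  show "s \<oplus>\<^bsub>?T\<^esub> t = t \<oplus>\<^bsub>?T\<^esub> s" if "s \<in> ?c ` ?L" "t \<in> ?c ` ?L" for s t
    using that comm by auto
  show "(s \<oplus>\<^bsub>?T\<^esub> t) \<oplus>\<^bsub>?T\<^esub> u = s \<oplus>\<^bsub>?T\<^esub> (t \<oplus>\<^bsub>?T\<^esub> u)"
    if "s \<in> ?c ` ?L" "t \<in> ?c ` ?L" "u \<in> ?c ` ?L" for s t u
    using that assoc by auto
  show "t \<oplus>\<^bsub>?T\<^esub> ?c [] = t" if "t \<in> ?c ` ?L" for t
    using that by (auto simp: app)
  show "0 \<odot>\<^bsub>?T\<^esub> t = ?c []" if "t \<in> ?c ` ?L" for t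
  proof -
    obtain xs where t: "t = ?c xs" "xs \<in> ?L" using \<open>t \<in> _\<close> by auto
    have "ten_rel S V W (?m 0 xs) []" using t(2)
    proof (induction xs)
      case (Cons a xs)
      obtain v w where a: "a = (v, w)" by (cases a)
      have "ten_rel S V W ([(\<zero>, w)] @ ?m 0 xs) ([] @ [])"
        using Cons a by (intro ten_rel.append ten_rel.zero_left) auto
      thus ?case using Cons.hyps a V by simp
    qed (simp add: ten_rel.refl)
    thus ?thesis using t by (simp add: sm tcls_cong)
  qed
  show "1 \<odot>\<^bsub>?T\<^esub> t = t" if t: "t \<in> ?c ` ?L" for t
  proof -
    have "?m 1 xs = xs" if "xs \<in> ?L" for xs using that V by (induction xs) auto
    thus ?thesis using t by (elim imageE) (simp add: sm del: in_lists_conv_set)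
  qed
  show "(r * s) \<odot>\<^bsub>?T\<^esub> t = r \<odot>\<^bsub>?T\<^esub> (s \<odot>\<^bsub>?T\<^esub> t)" if rs: "r \<in> S" "s \<in> S" and t: "t \<in> ?c ` ?L" for r s t
  proof -
    have "?m (r * s) xs = ?m r (?m s xs)" if "xs \<in> ?L" for xs
      using that V rs by (induction xs) (auto simp: vs_smult_smult)
    thus ?thesis using t rs by (elim imageE) (simp add: sm del: in_lists_conv_set map_map)
  qed
  show "r \<odot>\<^bsub>?T\<^esub> (s \<oplus>\<^bsub>?T\<^esub> t) = r \<odot>\<^bsub>?T\<^esub> s \<oplus>\<^bsub>?T\<^esub> r \<odot>\<^bsub>?T\<^esub> t"
    if "r \<in> S" "s \<in> ?c ` ?L" "t \<in> ?c ` ?L" for r s t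
    using that by (auto simp: sm app simp del: in_lists_conv_set)
  show "(r + s) \<odot>\<^bsub>?T\<^esub> t = r \<odot>\<^bsub>?T\<^esub> t \<oplus>\<^bsub>?T\<^esub> s \<odot>\<^bsub>?T\<^esub> t" if rs: "r \<in> S" "s \<in> S" and t: "t \<in> ?c ` ?L" for r s t
  proof -
    obtain xs where t: "t = ?c xs" "xs \<in> ?L" using t by auto
    have "ten_rel S V W (?m (r + s) xs) (?m r xs @ ?m s xs)" using t(2)
    proof (induction xs)
      case (Cons a xs)
      obtain v w where a: "a = (v, w)" by (cases a)
      have vw: "v \<in> carrier V" "w \<in> carrier W" using Cons.hyps a by auto
      let ?r = "(r \<odot> v, w)" and ?s = "(s \<odot> v, w)"
      have "ten_rel S V W ([((r + s) \<odot> v, w)] @ ?m (r + s) xs) ([?r, ?s] @ (?m r xs @ ?m s xs))"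
        using Cons V vw rs by (intro ten_rel.append) (simp_all add: vs_distl ten_rel.add_left)
      \<comment> \<open>\<open>add_left\<close> produces the two new pairs side by side. The second
        one has to pass \<open>?m r xs\<close> to reach the summands scaled by s.\<close>
      moreover have "ten_rel S V W ([?r] @ (([?s] @ ?m r xs) @ ?m s xs)) ([?r] @ ((?m r xs @ [?s]) @ ?m s xs))"
        by (intro ten_rel.append ten_rel.refl ten_rel.commute)
      ultimately show ?case unfolding a by (auto intro: ten_rel.trans)
    qed (simp add: ten_rel.refl)
    thus ?thesis using t rs by (simp add: sm app tcls_cong)
  qed
qed

lemma pure_closed [simp]:
  "\<lbrakk>v \<in> carrier V; w \<in> carrier W\<rbrakk> \<Longrightarrow> pure_tensor S V W v w \<in> carrier (tensor S V W)"
  by (auto simp: tensor_simps)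

lemma bilin_pure: "\<lbrakk>vs V; vs W\<rbrakk> \<Longrightarrow> bilin V W (tensor S V W) (pure_tensor S V W)"
proof (intro bilinI linI)
  assume V: "vs V" and W: "vs W"
  let ?p = "pure_tensor S V W" and ?T = "tensor S V W"
  have app: "?p v w \<oplus>\<^bsub>?T\<^esub> ?p v' w' = tcls S V W [(v, w), (v', w')]" for v w v' w'
    by (simp add: tcls_append[symmetric])
  show "?p (v \<oplus>\<^bsub>V\<^esub> v') w = ?p v w \<oplus>\<^bsub>?T\<^esub> ?p v' w"
    if "v \<in> carrier V" "v' \<in> carrier V" "w \<in> carrier W" for v v' w
    unfolding app using that by (intro tcls_cong ten_rel.add_left)
  show "?p v (w \<oplus>\<^bsub>W\<^esub> w') = ?p v w \<oplus>\<^bsub>?T\<^esub> ?p v w'"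
    if "v \<in> carrier V" "w \<in> carrier W" "w' \<in> carrier W" for v w w'
    unfolding app using that by (intro tcls_cong ten_rel.add_right)
  show l: "?p (r \<odot>\<^bsub>V\<^esub> v) w = r \<odot>\<^bsub>?T\<^esub> ?p v w" if "r \<in> S" for r v w
    using that V W by (simp add: tcls_smult)
  show "?p v (r \<odot>\<^bsub>W\<^esub> w) = r \<odot>\<^bsub>?T\<^esub> ?p v w" if "r \<in> S" "v \<in> carrier V" "w \<in> carrier W" for r v w
    unfolding l[symmetric, OF that(1)] using that
    by (intro tcls_cong ten_rel.sym[OF ten_rel.balanced])
qed simp_all

lemmas pure_lin_left = bilin_left[OF bilin_pure] and pure_lin_right = bilin_right[OF bilin_pure]

lemma pure_zero_left: "\<lbrakk>vs V; vs W; w \<in> carrier W\<rbrakk> \<Longrightarrow> pure_tensor S V W \<zero>\<^bsub>V\<^esub> w = \<zero>\<^bsub>tensor S V W\<^esub>"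
  and pure_zero_right: "\<lbrakk>vs V; vs W; v \<in> carrier V\<rbrakk> \<Longrightarrow> pure_tensor S V W v \<zero>\<^bsub>W\<^esub> = \<zero>\<^bsub>tensor S V W\<^esub>"
  using lin_zero[OF pure_lin_left, of V W w] lin_zero[OF pure_lin_right, of V W v] by simp_all

lemma pure_add_left: "\<lbrakk>vs V; vs W; v \<in> carrier V; v' \<in> carrier V; w \<in> carrier W\<rbrakk>
    \<Longrightarrow> pure_tensor S V W (v \<oplus>\<^bsub>V\<^esub> v') w = pure_tensor S V W v w \<oplus>\<^bsub>tensor S V W\<^esub> pure_tensor S V W v' w"
  and pure_add_right: "\<lbrakk>vs V; vs W; v \<in> carrier V; w \<in> carrier W; w' \<in> carrier W\<rbrakk>
    \<Longrightarrow> pure_tensor S V W v (w \<oplus>\<^bsub>W\<^esub> w') = pure_tensor S V W v w \<oplus>\<^bsub>tensor S V W\<^esub> pure_tensor S V W v w'"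
  and pure_smult_left: "\<lbrakk>vs V; vs W; r \<in> S; v \<in> carrier V; w \<in> carrier W\<rbrakk>
    \<Longrightarrow> pure_tensor S V W (r \<odot>\<^bsub>V\<^esub> v) w = r \<odot>\<^bsub>tensor S V W\<^esub> pure_tensor S V W v w"
  and pure_smult_right: "\<lbrakk>vs V; vs W; r \<in> S; v \<in> carrier V; w \<in> carrier W\<rbrakk>
    \<Longrightarrow> pure_tensor S V W v (r \<odot>\<^bsub>W\<^esub> w) = r \<odot>\<^bsub>tensor S V W\<^esub> pure_tensor S V W v w"
  using lin_add[OF pure_lin_left, of V W w v v'] lin_add[OF pure_lin_right, of V W v w w']
    lin_smult[OF pure_lin_left, of V W w r v] lin_smult[OF pure_lin_right, of V W v r w]
  by simp_all

text \<open>No case for scalar multiples is required: a formal sum has no coefficients, since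
  scalars are absorbed by the left entries.\<close>

lemma tensor_induct [consumes 1, case_names zero pure add]:
  assumes t: "t \<in> carrier (tensor S V W)" and zero: "P \<zero>\<^bsub>tensor S V W\<^esub>"
    and pure: "\<And>v w. \<lbrakk>v \<in> carrier V; w \<in> carrier W\<rbrakk> \<Longrightarrow> P (pure_tensor S V W v w)"
    and add: "\<And>s t. \<lbrakk>s \<in> carrier (tensor S V W); t \<in> carrier (tensor S V W); P s; P t\<rbrakk>
      \<Longrightarrow> P (s \<oplus>\<^bsub>tensor S V W\<^esub> t)"
  shows "P t"
proof -
  obtain xs where xs: "xs \<in> lists (carrier V \<times> carrier W)" and t: "t = tcls S V W xs"
    using t by (auto simp: tensor_simps)
  have "P (tcls S V W xs)" using xs
  proof (induction xs)
    case Nil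
    thus ?case using zero by (simp add: tensor_simps)
  next
    case (Cons a xs)
    hence "P (tcls S V W [a] \<oplus>\<^bsub>tensor S V W\<^esub> tcls S V W xs)"
      by (intro add) (auto simp: tensor_simps(1) pure)
    thus ?case by (simp add: tcls_append[symmetric])
  qed
  thus ?thesis using t by simp
qed

section \<open>The universal property of the tensor product\<close>

lemma tensor_lin_eqI:
  assumes "f \<in> lin (tensor S V W) X" "g \<in> lin (tensor S V W) X" "vs V" "vs W" "vs X"
    and "\<And>v w. \<lbrakk>v \<in> carrier V; w \<in> carrier W\<rbrakk> \<Longrightarrow> f (pure_tensor S V W v w) = g (pure_tensor S V W v w)"
    and "t \<in> carrier (tensor S V W)"
  shows "f t = g t"
  using assms(7) by (induction rule: tensor_induct) (use assms in \<open>simp_all add: lin_zero lin_add\<close>)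

text \<open>\<open>tlift\<close> evaluates the representative chosen by \<open>tcls\<close>; by
  \<open>ten_rel_fsum\<close> any other list in the class gives the same value.\<close>

lemma tlift_tcls:
  assumes "vs V" "vs W" "vs X" "bilin V W X \<beta>" "xs \<in> lists (carrier V \<times> carrier W)"
  shows "tlift X \<beta> (tcls S V W xs) = fsum X \<beta> xs"
  unfolding tlift_fsum
  using assms ten_rel_lists[OF ten_rel_summands assms(1,2)]
  by (intro ten_rel_fsum[OF ten_rel_summands]) simp_all

lemma tlift_pure [simp]:
  assumes "vs V" "vs W" "vs X" "bilin V W X \<beta>" "v \<in> carrier V" "w \<in> carrier W"
  shows "tlift X \<beta> (pure_tensor S V W v w) = \<beta> v w"
  using assms by (simp add: tlift_tcls bilin_closed)

lemma tlift_lin: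
  fixes X (structure)
  assumes V: "vs V" and W: "vs W" and X: "vs X" and \<beta>: "bilin V W X \<beta>"
  shows "tlift X \<beta> \<in> lin (tensor S V W) X"
proof (rule linI)
  let ?L = "lists (carrier V \<times> carrier W)" and ?c = "tcls S V W" and ?T = "tensor S V W"
  note tl = tlift_tcls[OF V W X \<beta>]
  note cl = fsum_closed[OF \<beta> X]
  show "tlift X \<beta> t \<in> carrier X" if "t \<in> carrier ?T" for t
    using that unfolding tensor_simps(1) by (elim imageE) (simp add: tl cl del: in_lists_conv_set)
  show add: "tlift X \<beta> (s \<oplus>\<^bsub>?T\<^esub> t) = tlift X \<beta> s \<oplus> tlift X \<beta> t"
    if st: "s \<in> carrier ?T" "t \<in> carrier ?T" for s t
  proof -
    obtain xs ys where xy: "xs \<in> ?L" "ys \<in> ?L" and "s = ?c xs" "t = ?c ys"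
      using st by (auto simp: tensor_simps(1) simp del: in_lists_conv_set)
    moreover have "xs @ ys \<in> ?L" using xy by auto
    ultimately show ?thesis by (simp add: tcls_append[symmetric] tl fsum_append[OF \<beta> X] del: in_lists_conv_set)
  qed
  show "tlift X \<beta> (r \<odot>\<^bsub>?T\<^esub> t) = r \<odot> tlift X \<beta> t" if r: "r \<in> S" and t: "t \<in> carrier ?T" for r t
  proof -
    obtain xs where xs: "xs \<in> ?L" and t: "t = ?c xs"
      using t by (auto simp: tensor_simps(1) simp del: in_lists_conv_set)
    let ?m = "map (\<lambda>(v, w). (r \<odot>\<^bsub>V\<^esub> v, w))"
    have "fsum X \<beta> (?m xs) = r \<odot> fsum X \<beta> xs" using xs
    proof (induction xs)
      case (Cons a xs)
      obtain v w where a: "a = (v, w)" by (cases a)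
      have "v \<in> carrier V" "w \<in> carrier W" using Cons.hyps a by auto
      moreover have "\<beta> (r \<odot>\<^bsub>V\<^esub> v) w = r \<odot> \<beta> v w"
        using lin_smult[OF bilin_left[OF \<beta>]] calculation r by simp
      ultimately show ?case using Cons a X r cl by (simp add: vs_distr bilin_closed[OF \<beta>])
    qed (use X r in simp)
    thus ?thesis using xs r V W
      by (simp add: t tcls_smult tl map_smult_lists del: in_lists_conv_set)
  qed
qed

lemma bilin_comp:
  assumes "bilin V' W' X \<beta>" "f \<in> lin V V'" "g \<in> lin W W'"
  shows "bilin V W X (\<lambda>v w. \<beta> (f v) (g w))"
  using assms by (intro bilinI)
    (auto intro!: lin_comp[OF assms(2) bilin_left[OF assms(1)]] lin_comp[OF assms(3) bilin_right[OF assms(1)]]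
      intro: lin_closed)

text \<open>Maps out of a threefold product are nested lifts, so the inner lift must be linear in
  the remaining argument w. As s is an encoded class, this is proved by induction on s: the maps of
  w that are linear contain zero and are closed under sums.\<close>

lemma bilin_tlift:
  assumes U: "vs U" and V: "vs V" and W: "vs W" and X: "vs X"
    and uv: "\<And>w. w \<in> carrier W \<Longrightarrow> bilin U V X (\<beta> w)"
    and w: "\<And>u v. \<lbrakk>u \<in> carrier U; v \<in> carrier V\<rbrakk> \<Longrightarrow> (\<lambda>w. \<beta> w u v) \<in> lin W X"
  shows "bilin (tensor S U V) W X (\<lambda>s w. tlift X (\<beta> w) s)"
proof (rule bilinI)
  let ?T = "tensor S U V"
  show lin: "(\<lambda>s. tlift X (\<beta> w) s) \<in> lin ?T X" if "w \<in> carrier W" for w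
    using tlift_lin[OF U V X uv[OF that]] .
  show "(\<lambda>w. tlift X (\<beta> w) s) \<in> lin W X" if "s \<in> carrier ?T" for s
    using that
  proof (induction rule: tensor_induct)
    case zero
    show ?case
      using lin_zero_fun[OF X] by (rule lin_cong) (simp_all add: lin_zero[OF lin] U V W X)
  next
    case (pure u v)
    show ?case by (rule lin_cong[OF w[OF pure] W]) (simp add: U V X uv pure)
  next
    case (add s t)
    show ?case
      using lin_add_fun[OF X add.IH] by (rule lin_cong) (simp_all add: W lin_add[OF lin add.hyps])
  qed
qed

lemma linear_maps_lin: "f \<in> linear_maps S V W \<Longrightarrow> f \<in> lin V W"
  by (simp add: linear_maps_iff)

text \<open>Extensionality turns agreement on the carrier into equality of functions, as needed for
  equality of arrows. All coherence laws reduce in this way to an evaluation on pure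
  tensors.\<close>

lemma linear_maps_eqI:
  assumes "f \<in> linear_maps S (tensor S V W) X" "g \<in> linear_maps S (tensor S V W) X" "vs V" "vs W" "vs X"
    and "\<And>v w. \<lbrakk>v \<in> carrier V; w \<in> carrier W\<rbrakk> \<Longrightarrow> f (pure_tensor S V W v w) = g (pure_tensor S V W v w)"
  shows "f = g"
proof (rule extensionalityI)
  show "f \<in> extensional (carrier (tensor S V W))" "g \<in> extensional (carrier (tensor S V W))"
    using assms(1,2) by (simp_all add: linear_maps_iff)
  show "f t = g t" if "t \<in> carrier (tensor S V W)" for t
    using assms(3-6) that by (rule tensor_lin_eqI[OF assms(1,2)[THEN linear_maps_lin]])
qed

text \<open>The associativity, triangle and hexagon laws start at a product bracketed to the left,
  so it suffices to evaluate them at (u \<otimes> v) \<otimes> w.\<close>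

lemma linear_maps_eqI_left:
  assumes f: "f \<in> linear_maps S (tensor S (tensor S U V) W) X" "g \<in> linear_maps S (tensor S (tensor S U V) W) X"
    and vs: "vs U" "vs V" "vs W" "vs X"
    and eq: "\<And>u v w. \<lbrakk>u \<in> carrier U; v \<in> carrier V; w \<in> carrier W\<rbrakk>
      \<Longrightarrow> f (pure_tensor S (tensor S U V) W (pure_tensor S U V u v) w)
        = g (pure_tensor S (tensor S U V) W (pure_tensor S U V u v) w)"
  shows "f = g"
proof (rule linear_maps_eqI[OF f])
  fix s w assume s: "s \<in> carrier (tensor S U V)" and w: "w \<in> carrier W"
  let ?p = "\<lambda>s. pure_tensor S (tensor S U V) W s w"
  have l: "(\<lambda>s. h (?p s)) \<in> lin (tensor S U V) X"
    if "h \<in> linear_maps S (tensor S (tensor S U V) W) X" for h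
    using that vs w by (intro lin_comp[OF pure_lin_left[OF _ _ w]] linear_maps_lin) simp_all
  show "f (?p s) = g (?p s)"
    by (rule tensor_lin_eqI[of "\<lambda>s. f (?p s)" U V X "\<lambda>s. g (?p s)"]) (fact l[OF f(1)] l[OF f(2)] vs s eq[OF _ _ w])+
qed (use vs in simp_all)

lemma linear_maps_eqI_left2:
  assumes f: "f \<in> linear_maps S (tensor S (tensor S (tensor S U V) W) T) X"
      "g \<in> linear_maps S (tensor S (tensor S (tensor S U V) W) T) X"
    and vs: "vs U" "vs V" "vs W" "vs T" "vs X"
    and eq: "\<And>u v w t. \<lbrakk>u \<in> carrier U; v \<in> carrier V; w \<in> carrier W; t \<in> carrier T\<rbrakk>
      \<Longrightarrow> f (pure_tensor S (tensor S (tensor S U V) W) T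
              (pure_tensor S (tensor S U V) W (pure_tensor S U V u v) w) t)
        = g (pure_tensor S (tensor S (tensor S U V) W) T
              (pure_tensor S (tensor S U V) W (pure_tensor S U V u v) w) t)"
  shows "f = g"
proof (rule linear_maps_eqI_left[OF f])
  let ?UV = "tensor S U V"
  fix s w t assume s: "s \<in> carrier ?UV" and w: "w \<in> carrier W" and t: "t \<in> carrier T"
  let ?p = "\<lambda>s. pure_tensor S (tensor S ?UV W) T (pure_tensor S ?UV W s w) t"
  have l: "(\<lambda>s. h (?p s)) \<in> lin ?UV X" if "h \<in> linear_maps S (tensor S (tensor S ?UV W) T) X" for h
    using that vs w t
    by (intro lin_comp[OF lin_comp[OF pure_lin_left[OF _ _ w] pure_lin_left[OF _ _ t]]] linear_maps_lin) simp_all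
  show "f (?p s) = g (?p s)"
    by (rule tensor_lin_eqI[of "\<lambda>s. f (?p s)" U V X "\<lambda>s. g (?p s)"]) (fact l[OF f(1)] l[OF f(2)] vs s eq[OF _ _ w t])+
qed (use vs in simp_all)

lemma linear_maps_restrict: "\<lbrakk>f \<in> lin V W; vs V\<rbrakk> \<Longrightarrow> (\<lambda>v\<in>carrier V. f v) \<in> linear_maps S V W"
  by (simp add: linear_maps_iff lin_restrict)

lemma linear_maps_id [simp]: "vs V \<Longrightarrow> (\<lambda>v\<in>carrier V. v) \<in> linear_maps S V V"
  by (simp add: linear_maps_restrict lin_id)

lemma linear_maps_compose [simp]:
  "\<lbrakk>f \<in> linear_maps S U V; g \<in> linear_maps S V W; vs U\<rbrakk> \<Longrightarrow> compose (carrier U) g f \<in> linear_maps S U W"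
  unfolding compose_def by (rule linear_maps_restrict, rule lin_comp[OF linear_maps_lin linear_maps_lin])

lemma linear_maps_closed: "\<lbrakk>f \<in> linear_maps S V W; v \<in> carrier V\<rbrakk> \<Longrightarrow> f v \<in> carrier W"
  by (rule lin_closed[OF linear_maps_lin])

section \<open>Functoriality, associativity, symmetry and units for tensor products of vector
  spaces\<close>

lemma bilin_tensor_map:
  assumes "vs V'" "vs W'" "f \<in> lin V V'" "g \<in> lin W W'"
  shows "bilin V W (tensor S V' W') (\<lambda>v w. pure_tensor S V' W' (f v) (g w))"
  using assms by (intro bilin_comp[OF bilin_pure])

lemma tensor_map_linear:
  assumes "vs V" "vs W" "vs V'" "vs W'" "f \<in> lin V V'" "g \<in> lin W W'"
  shows "tensor_map S V W V' W' f g \<in> linear_maps S (tensor S V W) (tensor S V' W')"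
  unfolding tensor_map_def using assms by (intro linear_maps_restrict tlift_lin bilin_tensor_map) simp_all

lemma tensor_map_pure:
  assumes "vs V" "vs W" "vs V'" "vs W'" "f \<in> lin V V'" "g \<in> lin W W'" "v \<in> carrier V" "w \<in> carrier W"
  shows "tensor_map S V W V' W' f g (pure_tensor S V W v w) = pure_tensor S V' W' (f v) (g w)"
  unfolding tensor_map_def using assms by (simp add: bilin_tensor_map)

lemma bilin_assoc:
  assumes "vs U" "vs V" "vs W"
  shows "w \<in> carrier W \<Longrightarrow> bilin U V (tensor S U (tensor S V W))
      (\<lambda>u v. pure_tensor S U (tensor S V W) u (pure_tensor S V W v w))" (is "_ \<Longrightarrow> ?inner w")
    and "bilin (tensor S U V) W (tensor S U (tensor S V W))
      (\<lambda>s w. tlift (tensor S U (tensor S V W))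
        (\<lambda>u v. pure_tensor S U (tensor S V W) u (pure_tensor S V W v w)) s)"
proof -
  show inner: "?inner w" if "w \<in> carrier W" for w
    using that assms by (intro bilin_comp[OF bilin_pure] lin_id pure_lin_left) simp_all
  show "bilin (tensor S U V) W (tensor S U (tensor S V W))
      (\<lambda>s w. tlift (tensor S U (tensor S V W))
        (\<lambda>u v. pure_tensor S U (tensor S V W) u (pure_tensor S V W v w)) s)"
    using assms by (intro bilin_tlift inner lin_comp[OF pure_lin_right pure_lin_right]) simp_all
qed

lemma tensor_assoc_linear:
  assumes "vs U" "vs V" "vs W"
  shows "tensor_assoc S U V W \<in> linear_maps S (tensor S (tensor S U V) W) (tensor S U (tensor S V W))"
  unfolding tensor_assoc_def Let_def
  using assms by (intro linear_maps_restrict tlift_lin bilin_assoc) simp_all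

lemma tensor_assoc_pure:
  assumes "vs U" "vs V" "vs W" "u \<in> carrier U" "v \<in> carrier V" "w \<in> carrier W"
  shows "tensor_assoc S U V W (pure_tensor S (tensor S U V) W (pure_tensor S U V u v) w)
    = pure_tensor S U (tensor S V W) u (pure_tensor S V W v w)"
  unfolding tensor_assoc_def Let_def using assms by (simp add: bilin_assoc)

lemma bilin_swap: "\<lbrakk>vs V; vs W\<rbrakk> \<Longrightarrow> bilin V W (tensor S W V) (\<lambda>v w. pure_tensor S W V w v)"
  by (intro bilinI pure_lin_left pure_lin_right)

lemma tensor_swap_linear:
  "\<lbrakk>vs V; vs W\<rbrakk> \<Longrightarrow> tensor_swap S V W \<in> linear_maps S (tensor S V W) (tensor S W V)"
  unfolding tensor_swap_def by (intro linear_maps_restrict tlift_lin bilin_swap) simp_all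

lemma tensor_swap_pure:
  "\<lbrakk>vs V; vs W; v \<in> carrier V; w \<in> carrier W\<rbrakk>
    \<Longrightarrow> tensor_swap S V W (pure_tensor S V W v w) = pure_tensor S W V w v"
  unfolding tensor_swap_def by (simp add: bilin_swap)

lemma bilin_lunit: "vs V \<Longrightarrow> bilin (scalars S) V V (\<lambda>c v. scal c \<odot>\<^bsub>V\<^esub> v)"
  by (intro bilinI linI) (auto simp: vs_distl vs_distr vs_smult_smult mult.commute)

lemma tensor_lunit_linear: "vs V \<Longrightarrow> tensor_lunit S V \<in> linear_maps S (tensor S (scalars S) V) V"
  unfolding tensor_lunit_def by (intro linear_maps_restrict tlift_lin bilin_lunit) simp_all

lemma tensor_lunit_pure:
  "\<lbrakk>vs V; c \<in> S; v \<in> carrier V\<rbrakk> \<Longrightarrow> tensor_lunit S V (pure_tensor S (scalars S) V (Scal c) v) = c \<odot>\<^bsub>V\<^esub> v"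
  unfolding tensor_lunit_def by (simp add: bilin_lunit)

lemma bilin_runit: "vs V \<Longrightarrow> bilin V (scalars S) V (\<lambda>v c. scal c \<odot>\<^bsub>V\<^esub> v)"
  by (intro bilinI linI) (auto simp: vs_distl vs_distr vs_smult_smult mult.commute)

lemma tensor_runit_linear: "vs V \<Longrightarrow> tensor_runit S V \<in> linear_maps S (tensor S V (scalars S)) V"
  unfolding tensor_runit_def by (intro linear_maps_restrict tlift_lin bilin_runit) simp_all

lemma tensor_runit_pure:
  "\<lbrakk>vs V; c \<in> S; v \<in> carrier V\<rbrakk> \<Longrightarrow> tensor_runit S V (pure_tensor S V (scalars S) v (Scal c)) = c \<odot>\<^bsub>V\<^esub> v"
  unfolding tensor_runit_def by (simp add: bilin_runit)

definition tensor_lunit_inv :: "'a vs \<Rightarrow> 'a pt \<Rightarrow> 'a pt" where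
  "tensor_lunit_inv V = (\<lambda>v\<in>carrier V. pure_tensor S (scalars S) V (Scal 1) v)"

lemma tensor_lunit_inv_linear: "vs V \<Longrightarrow> tensor_lunit_inv V \<in> linear_maps S V (tensor S (scalars S) V)"
  unfolding tensor_lunit_inv_def by (intro linear_maps_restrict pure_lin_right) simp_all

end

section \<open>Symmetric monoidal categories of vector spaces with extra structure\<close>

abbreviation arr :: "'o \<Rightarrow> 'm \<Rightarrow> 'o \<Rightarrow> ('o, 'm) arrow" where
  "arr A f B \<equiv> \<lparr>source = A, mapping = f, target = B\<rparr>"

lemma compose_eq_idD: "\<lbrakk>compose A g f = (\<lambda>v\<in>A. v); v \<in> A\<rbrakk> \<Longrightarrow> g (f v) = v"
  by (drule fun_cong[of _ _ v]) (simp add: compose_def)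

text \<open>A category of vector spaces with extra structure inherits all coherence equations from
  vector spaces; what remains is that the structure maps are among its morphisms. The list is kept
  short: the inverse associator and both right unit maps are composed from the maps listed here by
  means of the swap.\<close>

locale vs_monoidal = base_field S for S :: "complex set" +
  fixes obs :: "'o set" and sp :: "'o \<Rightarrow> 'a vs" and homs :: "'o \<Rightarrow> 'o \<Rightarrow> ('a pt \<Rightarrow> 'a pt) set"
    and ten :: "'o \<Rightarrow> 'o \<Rightarrow> 'o" and unt :: 'o
  assumes sp_vs [simp]: "A \<in> obs \<Longrightarrow> vs (sp A)"
    and homs_linear: "\<lbrakk>A \<in> obs; B \<in> obs; f \<in> homs A B\<rbrakk> \<Longrightarrow> f \<in> linear_maps S (sp A) (sp B)"
    and homs_id: "A \<in> obs \<Longrightarrow> (\<lambda>v\<in>carrier (sp A). v) \<in> homs A A"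
    and homs_compose: "\<lbrakk>A \<in> obs; B \<in> obs; D \<in> obs; f \<in> homs A B; g \<in> homs B D\<rbrakk>
          \<Longrightarrow> compose (carrier (sp A)) g f \<in> homs A D"
    and ten_obs [simp]: "\<lbrakk>A \<in> obs; B \<in> obs\<rbrakk> \<Longrightarrow> ten A B \<in> obs"
    and sp_ten [simp]: "\<lbrakk>A \<in> obs; B \<in> obs\<rbrakk> \<Longrightarrow> sp (ten A B) = tensor S (sp A) (sp B)"
    and unt_obs [simp]: "unt \<in> obs"
    and sp_unt [simp]: "sp unt = scalars S"
    and homs_map: "\<lbrakk>A \<in> obs; B \<in> obs; A' \<in> obs; B' \<in> obs; f \<in> homs A A'; g \<in> homs B B'\<rbrakk>
          \<Longrightarrow> tensor_map S (sp A) (sp B) (sp A') (sp B') f g \<in> homs (ten A B) (ten A' B')"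
    and homs_assoc: "\<lbrakk>A \<in> obs; B \<in> obs; D \<in> obs\<rbrakk>
          \<Longrightarrow> tensor_assoc S (sp A) (sp B) (sp D) \<in> homs (ten (ten A B) D) (ten A (ten B D))"
    and homs_swap: "\<lbrakk>A \<in> obs; B \<in> obs\<rbrakk> \<Longrightarrow> tensor_swap S (sp A) (sp B) \<in> homs (ten A B) (ten B A)"
    and homs_lunit: "A \<in> obs \<Longrightarrow> tensor_lunit S (sp A) \<in> homs (ten unt A) A"
    and homs_lunit_inv: "A \<in> obs \<Longrightarrow> tensor_lunit_inv (sp A) \<in> homs A (ten unt A)"
begin

abbreviation cat where "cat \<equiv> vs_category S obs sp homs ten unt"

lemma vs_category_simps [simp]:
  "Ob cat = obs" "Src cat = source" "Tgt cat = target"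
  "Ten cat = ten" "Unt cat = unt"
  "Idn cat A = arr A (\<lambda>v\<in>carrier (sp A). v) A"
  "Cmp cat (arr B' g D) (arr A f B) = arr A (compose (carrier (sp A)) g f) D"
  "TenA cat (arr A f B) (arr A' g B')
    = arr (ten A A') (tensor_map S (sp A) (sp A') (sp B) (sp B') f g) (ten B B')"
  "Asc cat X Y Z = arr (ten (ten X Y) Z) (tensor_assoc S (sp X) (sp Y) (sp Z)) (ten X (ten Y Z))"
  "LUn cat X = arr (ten unt X) (tensor_lunit S (sp X)) X"
  "RUn cat X = arr (ten X unt) (tensor_runit S (sp X)) X"
  "Brd cat X Y = arr (ten X Y) (tensor_swap S (sp X) (sp Y)) (ten Y X)"
  by (simp_all add: vs_category_def)

lemma arrow_in_arr [simp]:
  "arrow_in cat (arr A f B) A' B' \<longleftrightarrow> A' = A \<and> B' = B \<and> A \<in> obs \<and> B \<in> obs \<and> f \<in> homs A B"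
  by (auto simp: arrow_in_def vs_category_def)

lemma arrow_inE:
  assumes "arrow_in cat F A B"
  obtains f where "F = arr A f B" "A \<in> obs" "B \<in> obs" "f \<in> homs A B"
  using assms by (cases F) (auto simp: arrow_in_def vs_category_def)

lemmas homs_lin = homs_linear[THEN linear_maps_lin]

lemma iso_inI:
  assumes "arrow_in cat (arr A f B) A B" "arrow_in cat (arr B g A) B A"
    and "\<And>v. v \<in> carrier (sp A) \<Longrightarrow> g (f v) = v" "\<And>v. v \<in> carrier (sp B) \<Longrightarrow> f (g v) = v"
  shows "iso_in cat (arr A f B) A B"
proof -
  have "compose (carrier (sp A)) g f = (\<lambda>v\<in>carrier (sp A). v)"
    "compose (carrier (sp B)) f g = (\<lambda>v\<in>carrier (sp B). v)"
    using assms(3,4) by (auto simp: compose_def restrict_def)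
  thus ?thesis using assms(1,2) unfolding iso_in_def by (intro conjI exI[of _ "arr B g A"]) simp_all
qed

lemma category: "category_laws cat"
proof
  fix F assume "F \<in> Ar cat"
  thus "Src cat F \<in> Ob cat" "Tgt cat F \<in> Ob cat" by (auto simp: vs_category_def)
next
  fix A assume "A \<in> Ob cat"
  thus "arrow_in cat (Idn cat A) A A" by (simp add: homs_id)
next
  fix F G X Y Z assume "arrow_in cat F X Y" "arrow_in cat G Y Z"
  thus "arrow_in cat (Cmp cat G F) X Z" by (auto elim!: arrow_inE intro: homs_compose)
next
  fix F G H X Y Z T assume "arrow_in cat F X Y" "arrow_in cat G Y Z" "arrow_in cat H Z T"
  thus "Cmp cat (Cmp cat H G) F = Cmp cat H (Cmp cat G F)"
    by (auto elim!: arrow_inE intro!: compose_assoc[symmetric] funcsetI intro: linear_maps_closed[OF homs_linear])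
next
  fix F X Y assume "arrow_in cat F X Y"
  then obtain f where "F = arr X f Y" "X \<in> obs" "Y \<in> obs" "f \<in> linear_maps S (sp X) (sp Y)"
    by (rule arrow_inE) (blast intro: homs_linear)
  thus "Cmp cat F (Idn cat X) = F" "Cmp cat (Idn cat Y) F = F"
    using linear_maps_closed[of f "sp X" "sp Y"]
    by (auto simp: linear_maps_iff intro!: Id_compose compose_Id)
qed

text \<open>The inverse associator is the composite a (b d), (b d) a, (d b) a, d (b a), (b a) d, (a
  b) d of four swaps and one associator, so it is a morphism because these are.\<close>

lemma homs_assoc_inv:
  assumes [simp]: "A \<in> obs" "B \<in> obs" "D \<in> obs"
  obtains h where "h \<in> homs (ten A (ten B D)) (ten (ten A B) D)"
    and "\<And>a b d. \<lbrakk>a \<in> carrier (sp A); b \<in> carrier (sp B); d \<in> carrier (sp D)\<rbrakk>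
      \<Longrightarrow> h (pure_tensor S (sp A) (sp (ten B D)) a (pure_tensor S (sp B) (sp D) b d))
        = pure_tensor S (sp (ten A B)) (sp D) (pure_tensor S (sp A) (sp B) a b) d"
proof -
  let ?swap = "\<lambda>X Y. tensor_swap S (sp X) (sp Y)" and ?T = "\<lambda>X Y. carrier (sp (ten X Y))"
  let ?id = "\<lambda>X. \<lambda>v\<in>carrier (sp X). v"
  let ?m = "\<lambda>X Y Z. tensor_map S (sp (ten X Y)) (sp Z) (sp (ten Y X)) (sp Z) (?swap X Y) (?id Z)"
  let ?BD = "ten B D" and ?DB = "ten D B" and ?BA = "ten B A" and ?AB = "ten A B"
  let ?f1 = "?swap A ?BD" and ?f2 = "?m B D A" and ?f3 = "tensor_assoc S (sp D) (sp B) (sp A)"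
    and ?f4 = "?swap D ?BA" and ?f5 = "?m B A D"
  let ?c = "compose (?T A ?BD)"
  have f: "?f1 \<in> homs (ten A ?BD) (ten ?BD A)" "?f2 \<in> homs (ten ?BD A) (ten ?DB A)"
    "?f3 \<in> homs (ten ?DB A) (ten D ?BA)" "?f4 \<in> homs (ten D ?BA) (ten ?BA D)"
    "?f5 \<in> homs (ten ?BA D) (ten ?AB D)"
    by (intro homs_swap homs_map homs_assoc homs_id; simp)+
  have "?c ?f5 (?c ?f4 (?c ?f3 (?c ?f2 ?f1))) \<in> homs (ten A ?BD) (ten ?AB D)"
    by (rule homs_compose[OF _ _ _ homs_compose[OF _ _ _ homs_compose[OF _ _ _ homs_compose[OF _ _ _ f(1) f(2)] f(3)] f(4)] f(5)]; simp)
  moreover have "?c ?f5 (?c ?f4 (?c ?f3 (?c ?f2 ?f1)))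
       (pure_tensor S (sp A) (sp ?BD) a (pure_tensor S (sp B) (sp D) b d))
      = pure_tensor S (sp ?AB) (sp D) (pure_tensor S (sp A) (sp B) a b) d"
    if "a \<in> carrier (sp A)" "b \<in> carrier (sp B)" "d \<in> carrier (sp D)" for a b d
    using that
    by (simp add: compose_eq tensor_swap_pure tensor_assoc_pure tensor_map_pure lin_restrict lin_id
        tensor_swap_linear[THEN linear_maps_lin])
  ultimately show ?thesis by (rule that)
qed

lemma homs_runit: "A \<in> obs \<Longrightarrow> tensor_runit S (sp A) \<in> homs (ten A unt) A"
proof -
  assume A: "A \<in> obs"
  have "tensor_runit S (sp A) = compose (carrier (sp (ten A unt))) (tensor_lunit S (sp A)) (tensor_swap S (sp A) (sp unt))"
    (is "_ = ?c") using A
    by (intro linear_maps_eqI[of _ "sp A" "scalars S" "sp A"])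
       (auto simp: tensor_runit_linear tensor_runit_pure compose_eq tensor_swap_pure tensor_lunit_pure
         intro!: linear_maps_compose[OF tensor_swap_linear tensor_lunit_linear])
  moreover have "?c \<in> homs (ten A unt) A"
    by (rule homs_compose[OF _ _ _ homs_swap homs_lunit]) (simp_all add: A)
  ultimately show ?thesis by simp
qed

lemma symmetric_monoidal: "symmetric_monoidal_category cat"
proof -
  have "(\<lambda>v\<in>Scal ` S. v) \<in> lin (scalars S) (scalars S)"
    using lin_restrict[OF lin_id vs_scalars] by simp
  note lins = this tensor_map_linear[THEN linear_maps_lin] tensor_assoc_linear[THEN linear_maps_lin]
    tensor_swap_linear[THEN linear_maps_lin] tensor_lunit_linear[THEN linear_maps_lin]
    tensor_runit_linear[THEN linear_maps_lin] lin_restrict lin_id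
  note linears = tensor_map_linear tensor_assoc_linear tensor_swap_linear tensor_lunit_linear tensor_runit_linear
    linear_maps_compose linear_maps_id
  note pures = tensor_map_pure tensor_assoc_pure tensor_swap_pure tensor_lunit_pure tensor_runit_pure compose_eq
  have swap_swap: "tensor_swap S (sp Y) (sp X) (tensor_swap S (sp X) (sp Y) v) = v"
    if "X \<in> obs" "Y \<in> obs" "v \<in> carrier (tensor S (sp X) (sp Y))" for X Y v
  proof -
    have "compose (carrier (sp (ten X Y))) (tensor_swap S (sp Y) (sp X)) (tensor_swap S (sp X) (sp Y))
        = (\<lambda>v\<in>carrier (sp (ten X Y)). v)"
      using that linear_maps_compose[OF tensor_swap_linear[of "sp X" "sp Y"] tensor_swap_linear[of "sp Y" "sp X"]]
      by (intro linear_maps_eqI[of _ "sp X" "sp Y" "sp (ten X Y)"]) (auto simp: pures)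
    thus ?thesis using that by (auto dest: compose_eq_idD)
  qed
  show ?thesis
  proof (intro symmetric_monoidal_category.intro category symmetric_monoidal_category_axioms.intro,
      goal_cases Ten Unt map map_id map_comp
      assoc lunit runit swap assoc_nat lunit_nat runit_nat swap_nat pentagon triangle hexagon symmetry)
    case (Ten A B)
    thus ?case by simp
  next
    case Unt
    show ?case by simp
  next
    case (map F A B G A' B')
    thus ?case by (auto elim!: arrow_inE intro: homs_map)
  next
    case (map_id A B)
    thus ?case
      by (auto intro!: linear_maps_eqI[of _ "sp A" "sp B" "tensor S (sp A) (sp B)"] simp: lins linears pures)
  next
    case (map_comp F X Y G Z F' X' Y' G' Z')
    obtain f g f' g' where eq: "F = arr X f Y" "G = arr Y g Z" "F' = arr X' f' Y'" "G' = arr Y' g' Z'"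
      and obs [simp]: "X \<in> obs" "Y \<in> obs" "Z \<in> obs" "X' \<in> obs" "Y' \<in> obs" "Z' \<in> obs"
      and homs: "f \<in> homs X Y" "g \<in> homs Y Z" "f' \<in> homs X' Y'" "g' \<in> homs Y' Z'"
      using map_comp by (auto elim!: arrow_inE)
    have f: "f \<in> linear_maps S (sp X) (sp Y)" "g \<in> linear_maps S (sp Y) (sp Z)"
      "f' \<in> linear_maps S (sp X') (sp Y')" "g' \<in> linear_maps S (sp Y') (sp Z')"
      using homs by (simp_all add: homs_linear)
    note l = f[THEN linear_maps_lin] linear_maps_compose[OF f(1,2), THEN linear_maps_lin]
      linear_maps_compose[OF f(3,4), THEN linear_maps_lin]
    show ?case unfolding eq using l
      by (auto intro!: linear_maps_eqI[of _ "sp X" "sp X'" "tensor S (sp Z) (sp Z')"] tensor_map_linear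
          linear_maps_compose[of _ _ "tensor S (sp Y) (sp Y')"] simp: pures lin_closed)
  next
    case (assoc X Y Z)
    have obs [simp]: "X \<in> obs" "Y \<in> obs" "Z \<in> obs" using assoc by simp_all
    from obs obtain h where h: "h \<in> homs (ten X (ten Y Z)) (ten (ten X Y) Z)"
      and hp: "\<And>a b d. \<lbrakk>a \<in> carrier (sp X); b \<in> carrier (sp Y); d \<in> carrier (sp Z)\<rbrakk>
        \<Longrightarrow> h (pure_tensor S (sp X) (sp (ten Y Z)) a (pure_tensor S (sp Y) (sp Z) b d))
          = pure_tensor S (sp (ten X Y)) (sp Z) (pure_tensor S (sp X) (sp Y) a b) d"
      by (rule homs_assoc_inv) (rule that)
    let ?a = "tensor_assoc S (sp X) (sp Y) (sp Z)"
    let ?l = "sp (ten (ten X Y) Z)" and ?r = "sp (ten X (ten Y Z))"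
    have hl: "h \<in> linear_maps S ?r ?l" by (rule homs_linear[OF _ _ h]) simp_all
    have al: "?a \<in> linear_maps S ?l ?r" by (simp add: tensor_assoc_linear)
    have "compose (carrier ?l) h ?a = (\<lambda>v\<in>carrier ?l. v)"
      using linear_maps_compose[OF al hl] hp
      by (intro linear_maps_eqI_left[of _ "sp X" "sp Y" "sp Z" ?l]) (simp_all add: pures)
    hence 1: "h (?a v) = v" if "v \<in> carrier ?l" for v using that by (rule compose_eq_idD)
    \<comment> \<open>Here the domain is bracketed to the right, so
      \<open>linear_maps_eqI_left\<close> does not fit. The equation is reduced to x \<otimes> t and
      then, by linearity in t, to t = y \<otimes> z.\<close>
    have 2: "?a (h v) = v" if v: "v \<in> carrier ?r" for v
    proof -
      let ?yz = "tensor S (sp Y) (sp Z)"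
      have id: "(\<lambda>v. v) \<in> lin ?r ?r" by (rule lin_id)
      have ah: "(\<lambda>v. ?a (h v)) \<in> lin ?r ?r" using al hl by (rule_tac lin_comp[OF linear_maps_lin linear_maps_lin])
      have "?a (h (pure_tensor S (sp X) ?yz x t)) = pure_tensor S (sp X) ?yz x t"
        if x: "x \<in> carrier (sp X)" and t: "t \<in> carrier ?yz" for x t
      proof (rule tensor_lin_eqI[of "\<lambda>t. ?a (h (pure_tensor S (sp X) ?yz x t))" "sp Y" "sp Z" ?r
              "\<lambda>t. pure_tensor S (sp X) ?yz x t"])
        have p: "pure_tensor S (sp X) ?yz x \<in> lin ?yz ?r" using x by (simp add: pure_lin_right)
        show "(\<lambda>t. ?a (h (pure_tensor S (sp X) ?yz x t))) \<in> lin ?yz ?r" using lin_comp[OF p ah] .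
        show "(\<lambda>t. pure_tensor S (sp X) ?yz x t) \<in> lin ?yz ?r" by (rule p)
        show "?a (h (pure_tensor S (sp X) ?yz x (pure_tensor S (sp Y) (sp Z) y z)))
            = pure_tensor S (sp X) ?yz x (pure_tensor S (sp Y) (sp Z) y z)"
          if "y \<in> carrier (sp Y)" "z \<in> carrier (sp Z)" for y z
          using hp[OF x that] x that by (simp add: pures)
      qed (use t in simp_all)
      from tensor_lin_eqI[of "\<lambda>v. ?a (h v)" "sp X" ?yz ?r "\<lambda>v. v" v] this ah id v show ?thesis by simp
    qed
    have "iso_in cat (arr (ten (ten X Y) Z) ?a (ten X (ten Y Z))) (ten (ten X Y) Z) (ten X (ten Y Z))"
      using 1 2 h homs_assoc[OF obs] by (intro iso_inI[of _ _ _ h]) simp_all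
    thus ?case by simp
  next
    case (lunit X)
    have X [simp]: "X \<in> obs" using lunit by simp
    \<comment> \<open>On pure tensors this is c \<otimes> v = 1 \<otimes> c v: the scalar crosses
      the tensor sign.\<close>
    have "compose (carrier (sp (ten unt X))) (tensor_lunit_inv (sp X)) (tensor_lunit S (sp X)) = (\<lambda>v\<in>carrier (sp (ten unt X)). v)"
      using linear_maps_compose[OF tensor_lunit_linear[of "sp X"] tensor_lunit_inv_linear[of "sp X"]]
      by (intro linear_maps_eqI[of _ "scalars S" "sp X" "sp (ten unt X)"])
         (auto simp: pures tensor_lunit_inv_def pure_smult_right pure_smult_left[symmetric])
    hence "tensor_lunit_inv (sp X) (tensor_lunit S (sp X) v) = v" if "v \<in> carrier (sp (ten unt X))" for v
      using that by (rule compose_eq_idD)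
    moreover have "tensor_lunit S (sp X) (tensor_lunit_inv (sp X) v) = v" if "v \<in> carrier (sp X)" for v
      using that by (simp add: tensor_lunit_inv_def pures)
    ultimately have "iso_in cat (arr (ten unt X) (tensor_lunit S (sp X)) X) (ten unt X) X"
      using homs_lunit homs_lunit_inv by (intro iso_inI[of _ _ _ "tensor_lunit_inv (sp X)"]) simp_all
    thus ?case by simp
  next
    case (swap X Y)
    have "iso_in cat (arr (ten X Y) (tensor_swap S (sp X) (sp Y)) (ten Y X)) (ten X Y) (ten Y X)"
      using homs_swap swap_swap swap by (intro iso_inI[of _ _ _ "tensor_swap S (sp Y) (sp X)"]) simp_all
    thus ?case by simp
  next
    case (runit X)
    have X [simp]: "X \<in> obs" using runit by simp
    let ?i = "compose (carrier (sp X)) (tensor_swap S (scalars S) (sp X)) (tensor_lunit_inv (sp X))"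
    have i: "?i \<in> homs X (ten X unt)"
      using homs_compose[OF _ _ _ homs_lunit_inv[of X] homs_swap[of unt X]] by simp
    have iv: "?i v = pure_tensor S (sp X) (scalars S) v (Scal 1)" if "v \<in> carrier (sp X)" for v
      using that by (simp add: pures tensor_lunit_inv_def)
    have "compose (carrier (sp (ten X unt))) ?i (tensor_runit S (sp X)) = (\<lambda>v\<in>carrier (sp (ten X unt)). v)"
      using linear_maps_compose[OF tensor_runit_linear[of "sp X"] homs_linear[OF _ _ i]]
      by (intro linear_maps_eqI[of _ "sp X" "scalars S" "sp (ten X unt)"])
         (auto simp: pures tensor_lunit_inv_def pure_smult_left pure_smult_right[symmetric])
    hence "?i (tensor_runit S (sp X) v) = v" if "v \<in> carrier (sp (ten X unt))" for v
      using that by (rule compose_eq_idD)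
    moreover have "tensor_runit S (sp X) (?i v) = v" if "v \<in> carrier (sp X)" for v
      using that by (simp add: tensor_lunit_inv_def pures)
    ultimately have "iso_in cat (arr (ten X unt) (tensor_runit S (sp X)) X) (ten X unt) X"
      using homs_runit i by (intro iso_inI[of _ _ _ ?i]) simp_all
    thus ?case by simp
  next
    case (assoc_nat F X X' G Y Y' H Z Z')
    obtain f g h where eq: "F = arr X f X'" "G = arr Y g Y'" "H = arr Z h Z'"
      and obs [simp]: "X \<in> obs" "Y \<in> obs" "Z \<in> obs" "X' \<in> obs" "Y' \<in> obs" "Z' \<in> obs"
      and homs: "f \<in> homs X X'" "g \<in> homs Y Y'" "h \<in> homs Z Z'"
      using assoc_nat by (auto elim!: arrow_inE)
    note l = homs_lin[OF _ _ homs(1)] homs_lin[OF _ _ homs(2)] homs_lin[OF _ _ homs(3)]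
    show ?case unfolding eq using l
      by (auto intro!: linear_maps_eqI_left[of _ "sp X" "sp Y" "sp Z" "sp (ten X' (ten Y' Z'))"]
          linear_maps_compose[OF tensor_map_linear tensor_assoc_linear]
          linear_maps_compose[OF tensor_assoc_linear tensor_map_linear] simp: pures lins lin_closed)
  next
    case (lunit_nat F X Y)
    obtain f where eq: "F = arr X f Y" and obs [simp]: "X \<in> obs" "Y \<in> obs" and homs: "f \<in> homs X Y"
      using lunit_nat by (auto elim!: arrow_inE)
    note l = homs_lin[OF _ _ homs(1)] homs_linear[OF _ _ homs(1)]
    show ?case unfolding eq using l
      by (auto intro!: linear_maps_eqI[of _ "scalars S" "sp X" "sp Y"]
          linear_maps_compose[OF tensor_map_linear tensor_lunit_linear]
          linear_maps_compose[OF tensor_lunit_linear] simp: pures lins lin_closed lin_smult)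
  next
    case (runit_nat F X Y)
    obtain f where eq: "F = arr X f Y" and obs [simp]: "X \<in> obs" "Y \<in> obs" and homs: "f \<in> homs X Y"
      using runit_nat by (auto elim!: arrow_inE)
    note l = homs_lin[OF _ _ homs(1)] homs_linear[OF _ _ homs(1)]
    show ?case unfolding eq using l
      by (auto intro!: linear_maps_eqI[of _ "sp X" "scalars S" "sp Y"]
          linear_maps_compose[OF tensor_map_linear tensor_runit_linear]
          linear_maps_compose[OF tensor_runit_linear] simp: pures lins lin_closed lin_smult)
  next
    case (swap_nat F X X' G Y Y')
    obtain f g where eq: "F = arr X f X'" "G = arr Y g Y'"
      and obs [simp]: "X \<in> obs" "Y \<in> obs" "X' \<in> obs" "Y' \<in> obs" and homs: "f \<in> homs X X'" "g \<in> homs Y Y'"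
      using swap_nat by (auto elim!: arrow_inE)
    note l = homs_lin[OF _ _ homs(1)] homs_lin[OF _ _ homs(2)]
    show ?case unfolding eq using l
      by (auto intro!: linear_maps_eqI[of _ "sp X" "sp Y" "sp (ten Y' X')"]
          linear_maps_compose[OF tensor_map_linear tensor_swap_linear]
          linear_maps_compose[OF tensor_swap_linear tensor_map_linear] simp: pures lins lin_closed)
  next
    case (pentagon X Y Z T)
    thus ?case
    by (auto intro!: linear_maps_eqI_left2[of _ "sp X" "sp Y" "sp Z" "sp T" "sp (ten X (ten Y (ten Z T)))"]
        linear_maps_compose[OF tensor_assoc_linear tensor_assoc_linear]
        linear_maps_compose[OF linear_maps_compose[OF tensor_map_linear tensor_assoc_linear] tensor_map_linear]
        simp: pures lins)
  next
    case (triangle X Y)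
    thus ?case
    by (auto intro!: linear_maps_eqI_left[of _ "sp X" "scalars S" "sp Y" "sp (ten X Y)"]
        tensor_map_linear linear_maps_compose[OF tensor_assoc_linear tensor_map_linear]
        simp: pures lins pure_smult_left pure_smult_right)
  next
    case (hexagon X Y Z)
    thus ?case
    by (auto intro!: linear_maps_eqI_left[of _ "sp X" "sp Y" "sp Z" "sp (ten Y (ten Z X))"]
        linear_maps_compose[OF linear_maps_compose[OF tensor_assoc_linear tensor_swap_linear] tensor_assoc_linear]
        linear_maps_compose[OF linear_maps_compose[OF tensor_map_linear tensor_assoc_linear] tensor_map_linear]
        simp: pures lins)
  next
    case (symmetry X Y)
    thus ?case using swap_swap by (auto simp: compose_def restrict_def)
  qed
qed

end

section \<open>Families of subspaces of tensor products\<close>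

context base_field
begin

abbreviation family :: "'a vs \<Rightarrow> (int \<Rightarrow> 'a pt set) \<Rightarrow> bool" where
  "family V N \<equiv> (\<forall>i. sub V (N i))"

lemma family_carrier: "\<lbrakk>family V N; v \<in> N i\<rbrakk> \<Longrightarrow> v \<in> carrier V"
  by (blast intro: sub_carrier)

lemma tensor_image_sub:
  assumes N: "sub V N" and N': "sub V' N'"
  shows "tensor_image S V V' N N' \<subseteq> span (tensor S V V') {pure_tensor S V V' v v' |v v'. v \<in> N \<and> v' \<in> N'}"
    (is "_ \<subseteq> ?M")
proof -
  let ?A = "{pure_tensor S V V' v v' |v v'. v \<in> N \<and> v' \<in> N'}"
  have V: "vs V" "vs V'" "vs (tensor S V V')" using sub_vs[OF N] sub_vs[OF N'] by auto
  have A: "?A \<subseteq> carrier (tensor S V V')" using sub_carrier[OF N] sub_carrier[OF N'] by auto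
  have M: "sub (tensor S V V') ?M" using V(3) A by (rule span_sub)
  have "tcls S V V' xs \<in> ?M" if "xs \<in> lists (N \<times> N')" for xs
    using that
  proof (induction xs)
    case Nil
    thus ?case using sub_zero[OF M] by (simp add: tensor_simps)
  next
    case (Cons a xs)
    obtain v w where "a = (v, w)" by (cases a)
    hence "tcls S V V' [a] \<in> ?M" using Cons.hyps span_superset[OF V(3) A] by auto
    thus ?case using sub_add[OF M] Cons.IH tcls_append[of S V V' "[a]" xs] by simp
  qed
  thus ?thesis by (auto simp: tensor_image_def)
qed

lemma pure_in_tensor_image: "\<lbrakk>v \<in> N; w \<in> N'\<rbrakk> \<Longrightarrow> pure_tensor S V V' v w \<in> tensor_image S V V' N N'"
  by (auto simp: tensor_image_def)

context
  fixes V V' :: "'a vs" and N N' :: "int \<Rightarrow> 'a pt set"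
  assumes V: "vs V" and V': "vs V'" and N: "family V N" and N': "family V' N'"
begin

lemma tensor_family_generators:
  "(\<Union>(i, j)\<in>{(i, j). i + j = p}. tensor_image S V V' (N i) (N' j)) \<subseteq> carrier (tensor S V V')"
proof -
  have "lists (N i \<times> N' j) \<subseteq> lists (carrier V \<times> carrier V')" for i j
    using family_carrier[OF N] family_carrier[OF N'] by auto
  thus ?thesis unfolding tensor_image_def tensor_simps(1) by blast
qed

lemma tensor_family_sub: "sub (tensor S V V') (tensor_family S V V' N N' p)"
  unfolding tensor_family_def by (intro span_sub tensor_family_generators vs_tensor V V')

lemma pure_in_tensor_family:
  "\<lbrakk>v \<in> N i; w \<in> N' j; i + j = p\<rbrakk> \<Longrightarrow> pure_tensor S V V' v w \<in> tensor_family S V V' N N' p"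
  unfolding tensor_family_def
  by (rule subsetD[OF span_superset[OF vs_tensor[OF V V'] tensor_family_generators]])
     (auto intro!: pure_in_tensor_image)

lemma tensor_family_least:
  assumes M: "sub (tensor S V V') M"
    and pure: "\<And>i j v w. \<lbrakk>i + j = p; v \<in> N i; w \<in> N' j\<rbrakk> \<Longrightarrow> pure_tensor S V V' v w \<in> M"
  shows "tensor_family S V V' N N' p \<subseteq> M"
  unfolding tensor_family_def
proof (rule span_least[OF M], clarify)
  fix x i j assume "x \<in> tensor_image S V V' (N i) (N' j)" "p = i + j"
  moreover have "span (tensor S V V') {pure_tensor S V V' v v' |v v'. v \<in> N i \<and> v' \<in> N' j} \<subseteq> M"
    using calculation pure by (intro span_least[OF M]) auto
  ultimately show "x \<in> M" using tensor_image_sub N N' by blast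
qed

text \<open>\<open>P\<close> is not assumed to be stable under scalars, so the elements satisfying
  it need not form a subspace. Those whose multiples all satisfy \<open>P\<close> do, and they
  contain the generators, because r v stays in \<open>N i\<close>.\<close>

lemma tensor_family_induct [consumes 1, case_names zero pure add]:
  assumes t: "t \<in> tensor_family S V V' N N' p" and zero: "P \<zero>\<^bsub>tensor S V V'\<^esub>"
    and pure: "\<And>i j v w. \<lbrakk>i + j = p; v \<in> N i; w \<in> N' j\<rbrakk> \<Longrightarrow> P (pure_tensor S V V' v w)"
    and add: "\<And>s t. \<lbrakk>s \<in> carrier (tensor S V V'); t \<in> carrier (tensor S V V'); P s; P t\<rbrakk>
      \<Longrightarrow> P (s \<oplus>\<^bsub>tensor S V V'\<^esub> t)"
  shows "P t"
proof -
  let ?T = "tensor S V V'"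
  let ?M = "{t \<in> carrier ?T. \<forall>r\<in>S. P (r \<odot>\<^bsub>?T\<^esub> t)}"
  have T: "vs ?T" using V V' by simp
  have M: "sub ?T ?M"
    by (rule subI) (use T in \<open>auto simp: zero vs_distr vs_smult_smult intro!: add\<close>)
  have "pure_tensor S V V' v w \<in> ?M" if "i + j = p" "v \<in> N i" "w \<in> N' j" for i j v w
  proof -
    have c: "v \<in> carrier V" "w \<in> carrier V'" using that family_carrier N N' by auto
    have "P (r \<odot>\<^bsub>?T\<^esub> pure_tensor S V V' v w)" if "r \<in> S" for r
      using pure[OF \<open>i + j = p\<close> sub_smult[OF N[rule_format] \<open>r \<in> S\<close> \<open>v \<in> N i\<close>] \<open>w \<in> N' j\<close>] V V' c that
      by (simp add: pure_smult_left)
    thus ?thesis using c by simp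
  qed
  hence "t \<in> ?M" using tensor_family_least[OF M] t by blast
  hence "P (1 \<odot>\<^bsub>?T\<^esub> t)" "t \<in> carrier ?T" by auto
  thus ?thesis using T by simp
qed

lemma tensor_family_image:
  assumes f: "f \<in> lin (tensor S V V') X" and X: "vs X" and M: "sub X M"
    and pure: "\<And>i j v w. \<lbrakk>i + j = p; v \<in> N i; w \<in> N' j\<rbrakk> \<Longrightarrow> f (pure_tensor S V V' v w) \<in> M"
  shows "f ` tensor_family S V V' N N' p \<subseteq> M"
proof -
  have "tensor_family S V V' N N' p \<subseteq> {t \<in> carrier (tensor S V V'). f t \<in> M}"
    using pure family_carrier[OF N] family_carrier[OF N']
    by (intro tensor_family_least lin_vimage_sub[OF f _ X M]) (use V V' in auto)
  thus ?thesis by auto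
qed

end

lemma tensor_family_map:
  assumes vs: "vs V" "vs V'" "vs U" "vs U'"
    and fam: "family V N" "family V' N'" "family U M" "family U' M'"
    and f: "f \<in> lin V U" "\<And>i. f ` N i \<subseteq> M i" and g: "g \<in> lin V' U'" "\<And>i. g ` N' i \<subseteq> M' i"
  shows "tensor_map S V V' U U' f g ` tensor_family S V V' N N' p \<subseteq> tensor_family S U U' M M' p"
proof (rule tensor_family_image[OF vs(1,2) fam(1,2)])
  show "tensor_map S V V' U U' f g \<in> lin (tensor S V V') (tensor S U U')"
    using vs f(1) g(1) by (rule linear_maps_lin[OF tensor_map_linear])
  show "sub (tensor S U U') (tensor_family S U U' M M' p)" by (rule tensor_family_sub[OF vs(3,4) fam(3,4)])
  show "tensor_map S V V' U U' f g (pure_tensor S V V' v w) \<in> tensor_family S U U' M M' p"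
    if ij: "i + j = p" "v \<in> N i" "w \<in> N' j" for i j v w
  proof -
    have "v \<in> carrier V" "w \<in> carrier V'" using ij family_carrier fam by auto
    moreover have "pure_tensor S U U' (f v) (g w) \<in> tensor_family S U U' M M' p"
      using ij f(2)[of i] g(2)[of j] pure_in_tensor_family[OF vs(3,4) fam(3,4), of "f v" i "g w" j p] by auto
    ultimately show ?thesis using vs f(1) g(1) by (simp add: tensor_map_pure)
  qed
qed (use vs in simp_all)

text \<open>A generator f v \<otimes> w is the image of v \<otimes> w. This is for iterated tensor
  products of mixed Hodge structures, where the Hodge filtration of one factor is itself an
  image.\<close>

lemma tensor_family_image_left:
  assumes vs: "vs V" "vs V'" "vs U" and fam: "family V N" "family V' N'" and f: "f \<in> lin V U"
  shows "tensor_family S U V' (\<lambda>i. f ` N i) N' p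
    \<subseteq> tensor_map S V V' U V' f (\<lambda>x\<in>carrier V'. x) ` tensor_family S V V' N N' p"
proof -
  let ?m = "tensor_map S V V' U V' f (\<lambda>x\<in>carrier V'. x)"
  note id = lin_restrict[OF lin_id vs(2)]
  show ?thesis
  proof (rule tensor_family_least[OF vs(3,2)])
    show "family U (\<lambda>i. f ` N i)" using lin_image_sub[OF f vs(1,3)] fam(1) by blast
    show "sub (tensor S U V') (?m ` tensor_family S V V' N N' p)"
      using tensor_map_linear[OF vs(1,2,3,2) f id] vs
      by (intro lin_image_sub[OF _ _ _ tensor_family_sub[OF vs(1,2) fam]] linear_maps_lin) simp_all
    fix i j u w assume ij: "i + j = p" and u: "u \<in> f ` N i" and w: "w \<in> N' j"
    then obtain v where v: "v \<in> N i" "u = f v" by blast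
    have "?m (pure_tensor S V V' v w) = pure_tensor S U V' u w"
      using family_carrier[OF fam(1) v(1)] family_carrier[OF fam(2) w] v(2) vs f id by (simp add: tensor_map_pure)
    thus "pure_tensor S U V' u w \<in> ?m ` tensor_family S V V' N N' p"
      using pure_in_tensor_family[OF vs(1,2) fam v(1) w ij] by (intro image_eqI[OF HOL.sym])
  qed (rule fam(2))
qed

lemma tensor_family_triple_image:
  assumes vs: "vs U" "vs V" "vs W" "vs X" and fam: "family U L" "family V M" "family W N"
    and f: "f \<in> lin (tensor S (tensor S U V) W) X" and Q: "sub X Q"
    and pure: "\<And>i j k u v w. \<lbrakk>i + j + k = p; u \<in> L i; v \<in> M j; w \<in> N k\<rbrakk>
      \<Longrightarrow> f (pure_tensor S (tensor S U V) W (pure_tensor S U V u v) w) \<in> Q"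
  shows "f ` tensor_family S (tensor S U V) W (tensor_family S U V L M) N p \<subseteq> Q"
proof (rule tensor_family_image[OF _ vs(3) _ fam(3) f vs(4) Q])
  show "f (pure_tensor S (tensor S U V) W s w) \<in> Q"
    if ij: "i + j = p" "s \<in> tensor_family S U V L M i" "w \<in> N j" for i j s w
  proof -
    have w: "w \<in> carrier W" using ij family_carrier fam by auto
    have "(\<lambda>s. f (pure_tensor S (tensor S U V) W s w)) ` tensor_family S U V L M i \<subseteq> Q"
      using ij pure vs w
      by (intro tensor_family_image[OF vs(1,2) fam(1,2) _ vs(4) Q] lin_comp[OF pure_lin_left f]) auto
    thus ?thesis using ij by auto
  qed
qed (use vs fam tensor_family_sub in auto)

lemma tensor_family_assoc:
  assumes vs: "vs U" "vs V" "vs W" and fam: "family U L" "family V M" "family W N"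
  shows "tensor_assoc S U V W ` tensor_family S (tensor S U V) W (tensor_family S U V L M) N p
    \<subseteq> tensor_family S U (tensor S V W) L (tensor_family S V W M N) p"
proof (rule tensor_family_triple_image[OF vs _ fam])
  have VW: "family (tensor S V W) (tensor_family S V W M N)" using tensor_family_sub[OF vs(2,3) fam(2,3)] ..
  show "sub (tensor S U (tensor S V W)) (tensor_family S U (tensor S V W) L (tensor_family S V W M N) p)"
    using vs fam VW by (intro tensor_family_sub) auto
  show "tensor_assoc S U V W (pure_tensor S (tensor S U V) W (pure_tensor S U V u v) w)
      \<in> tensor_family S U (tensor S V W) L (tensor_family S V W M N) p"
    if ijk: "i + j + k = p" "u \<in> L i" "v \<in> M j" "w \<in> N k" for i j k u v w
  proof -
    have "pure_tensor S V W v w \<in> tensor_family S V W M N (j + k)"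
      using ijk by (intro pure_in_tensor_family[OF vs(2,3) fam(2,3)]) auto
    hence "pure_tensor S U (tensor S V W) u (pure_tensor S V W v w)
        \<in> tensor_family S U (tensor S V W) L (tensor_family S V W M N) p"
      using ijk(1) vs pure_in_tensor_family[OF vs(1) _ fam(1) VW ijk(2)] by simp
    moreover have "u \<in> carrier U" "v \<in> carrier V" "w \<in> carrier W" using ijk family_carrier fam by auto
    ultimately show ?thesis using vs by (simp add: tensor_assoc_pure)
  qed
qed (use vs in \<open>simp_all add: tensor_assoc_linear[THEN linear_maps_lin]\<close>)

lemma tensor_family_swap:
  assumes vs: "vs V" "vs W" and fam: "family V M" "family W N"
  shows "tensor_swap S V W ` tensor_family S V W M N p \<subseteq> tensor_family S W V N M p"
proof (rule tensor_family_image[OF vs fam _ _ tensor_family_sub[OF vs(2,1) fam(2,1)]])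
  show "tensor_swap S V W (pure_tensor S V W v w) \<in> tensor_family S W V N M p"
    if ij: "i + j = p" "v \<in> M i" "w \<in> N j" for i j v w
  proof -
    have "v \<in> carrier V" "w \<in> carrier W" using ij family_carrier fam by auto
    moreover have "pure_tensor S W V w v \<in> tensor_family S W V N M p"
      using pure_in_tensor_family[OF vs(2,1) fam(2,1) ij(3,2)] ij(1) by (simp add: add.commute)
    ultimately show ?thesis using vs by (simp add: tensor_swap_pure)
  qed
qed (use vs in \<open>simp_all add: tensor_swap_linear[THEN linear_maps_lin]\<close>)

text \<open>The assumption \<open>E\<close> covers several units at once: for an increasing
  filtration it follows from monotonicity, for a grading from the unit being concentrated in degree
  0.\<close>

lemma tensor_family_lunit:
  assumes V: "vs V" and fam: "family (scalars S) E" "family V N"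
    and E: "\<And>i j c v. \<lbrakk>Scal c \<in> E i; v \<in> N j\<rbrakk> \<Longrightarrow> c \<odot>\<^bsub>V\<^esub> v \<in> N (i + j)"
  shows "tensor_lunit S V ` tensor_family S (scalars S) V E N p \<subseteq> N p"
proof (rule tensor_family_image[OF vs_scalars V fam _ V fam(2)[rule_format]])
  show "tensor_lunit S V (pure_tensor S (scalars S) V c v) \<in> N p"
    if ij: "i + j = p" "c \<in> E i" "v \<in> N j" for i j c v
  proof -
    have "c \<in> Scal ` S" using ij family_carrier[OF fam(1)] by fastforce
    moreover have "v \<in> carrier V" using ij family_carrier fam by auto
    ultimately show ?thesis using ij V E[of "scal c" i v j] by (auto simp: tensor_lunit_pure)
  qed
qed (use V in \<open>simp add: tensor_lunit_linear[THEN linear_maps_lin]\<close>)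

lemma tensor_family_lunit_inv:
  assumes V: "vs V" and fam: "family (scalars S) E" "family V N" and E: "Scal 1 \<in> E 0"
  shows "tensor_lunit_inv V ` N p \<subseteq> tensor_family S (scalars S) V E N p"
proof clarify
  fix v assume v: "v \<in> N p"
  hence "v \<in> carrier V" using family_carrier fam by auto
  thus "tensor_lunit_inv V v \<in> tensor_family S (scalars S) V E N p"
    using E v pure_in_tensor_family[OF vs_scalars V fam E v] by (simp add: tensor_lunit_inv_def)
qed

text \<open>Transports the results on weight filtrations to Hodge filtrations.\<close>

lemma decreasing_filtration_uminus:
  "decreasing_filtration S V F \<longleftrightarrow> increasing_filtration S V (\<lambda>p. F (- p))"
proof -
  have "(\<forall>p. sub V (F p)) \<longleftrightarrow> (\<forall>p. sub V (F (- p)))" "(\<exists>p. F p = X) \<longleftrightarrow> (\<exists>p. F (- p) = X)" for X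
    by (metis minus_minus)+
  moreover have "antimono F \<longleftrightarrow> mono (\<lambda>p. F (- p))"
    unfolding monotone_def by (metis minus_minus neg_le_iff_le)
  ultimately show ?thesis unfolding decreasing_filtration_def increasing_filtration_def by simp
qed

lemma tensor_family_uminus:
  "tensor_family S V V' (\<lambda>i. N (- i)) (\<lambda>i. N' (- i)) (- p) = tensor_family S V V' N N' p"
proof -
  \<comment> \<open>Written as a union over i alone, the antidiagonal can be reindexed by
    negation.\<close>
  have 1: "(\<Union>(i, j)\<in>{(i, j). i + j = q}. X i j) = (\<Union>i. X i (q - i))" for q :: int and X :: "int \<Rightarrow> int \<Rightarrow> 'b set"
  proof (intro equalityI subsetI)
    fix x assume "x \<in> (\<Union>(i, j)\<in>{(i, j). i + j = q}. X i j)"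
    then obtain i j where "i + j = q" "x \<in> X i j" by auto
    hence "x \<in> X i (q - i)" by auto
    thus "x \<in> (\<Union>i. X i (q - i))" by (rule UN_I[OF UNIV_I])
  next
    fix x assume "x \<in> (\<Union>i. X i (q - i))"
    then obtain i where "x \<in> X i (q - i)" by (rule UN_E)
    thus "x \<in> (\<Union>(i, j)\<in>{(i, j). i + j = q}. X i j)" by (intro UN_I[of "(i, q - i)"]) auto
  qed
  have 2: "(\<Union>i. X (- i)) = (\<Union>i. X i)" for X :: "int \<Rightarrow> 'b set"
    using image_image[of X uminus UNIV] by simp
  have "(\<Union>i. tensor_image S V V' (N (- i)) (N' (- (- p - i)))) = (\<Union>i. tensor_image S V V' (N i) (N' (p - i)))"
    using 2[of "\<lambda>i. tensor_image S V V' (N i) (N' (p - i))"] by (simp add: algebra_simps)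
  thus ?thesis unfolding tensor_family_def 1 by simp
qed

lemma increasing_filtration_tensor:
  assumes V: "vs V" "vs V'" and W: "increasing_filtration S V W" and W': "increasing_filtration S V' W'"
  shows "increasing_filtration S (tensor S V V') (tensor_family S V V' W W')"
proof -
  let ?W = "tensor_family S V V' W W'" and ?T = "tensor S V V'"
  have fam: "family V W" "family V' W'" using W W' by (simp_all add: increasing_filtration_def)
  have mono: "W i \<subseteq> W j" "W' i \<subseteq> W' j" if "i \<le> j" for i j
    using W W' that by (auto simp: increasing_filtration_def mono_def)
  obtain a b c d where a: "W a = {\<zero>\<^bsub>V\<^esub>}" "W' b = {\<zero>\<^bsub>V'\<^esub>}" and c: "W c = carrier V" "W' d = carrier V'"
    using W W' by (auto simp: increasing_filtration_def)
  note sub = tensor_family_sub[OF V fam]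
  have "?W p \<subseteq> ?W q" if "p \<le> q" for p q
  proof (rule tensor_family_least[OF V fam sub])
    fix i j v w assume ij: "i + j = p" "v \<in> W i" "w \<in> W' j"
    \<comment> \<open>The surplus q - p of the index is given to the second factor.\<close>
    hence "w \<in> W' (q - i)" using mono(2)[of j "q - i"] that by auto
    thus "pure_tensor S V V' v w \<in> ?W q" using ij by (intro pure_in_tensor_family[OF V fam]) auto
  qed
  hence "mono ?W" by (rule monoI)
  moreover have "?W (a + b) \<subseteq> {\<zero>\<^bsub>?T\<^esub>}"
  proof (rule tensor_family_least[OF V fam sub_zero_space])
    fix i j v w assume ij: "i + j = a + b" "v \<in> W i" "w \<in> W' j"
    have c: "v \<in> carrier V" "w \<in> carrier V'" using ij family_carrier fam by auto
    \<comment> \<open>One factor of every generator of degree a + b lies at or below the index where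
      its filtration vanishes.\<close>
    have "i \<le> a \<or> j \<le> b" using ij by auto
    hence "v = \<zero>\<^bsub>V\<^esub> \<or> w = \<zero>\<^bsub>V'\<^esub>" using mono(1)[of i a] mono(2)[of j b] a ij by auto
    thus "pure_tensor S V V' v w \<in> {\<zero>\<^bsub>?T\<^esub>}" using c V by (auto simp: pure_zero_left pure_zero_right)
  qed (use V in simp)
  hence "?W (a + b) = {\<zero>\<^bsub>?T\<^esub>}" using sub_zero[OF sub] by blast
  moreover have "t \<in> ?W (c + d)" if "t \<in> carrier ?T" for t
    using that
  proof (induction rule: tensor_induct)
    case (pure v w)
    thus ?case using c by (intro pure_in_tensor_family[OF V fam]) auto
  qed (use sub_zero[OF sub] sub_add[OF sub] in auto)
  hence "?W (c + d) = carrier ?T" using sub_subset[OF sub] by blast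
  ultimately show ?thesis unfolding increasing_filtration_def using sub by blast
qed

lemma decreasing_filtration_tensor:
  assumes "vs V" "vs V'" "decreasing_filtration S V F" "decreasing_filtration S V' F'"
  shows "decreasing_filtration S (tensor S V V') (tensor_family S V V' F F')"
proof -
  have "(\<lambda>p. tensor_family S V V' F F' (- p)) = tensor_family S V V' (\<lambda>p. F (- p)) (\<lambda>p. F' (- p))"
    using tensor_family_uminus[of V V' F F' "- p" for p] by (intro ext) simp
  thus ?thesis
    using assms increasing_filtration_tensor[of V V' "\<lambda>p. F (- p)" "\<lambda>p. F' (- p)"]
    by (simp add: decreasing_filtration_uminus)
qed

end

text \<open>Filtered and graded spaces are both spaces with one family of subspaces indexed by the
  integers, and the same rule for tensor products; only the unit differs. Mixed Hodge structures do
  not fit, as their second family lives on another space, the complexification.\<close>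

locale family_monoidal = base_field S for S :: "complex set" +
  fixes obs :: "'o set" and sp :: "'o \<Rightarrow> 'a vs" and fm :: "'o \<Rightarrow> int \<Rightarrow> 'a pt set"
    and ten :: "'o \<Rightarrow> 'o \<Rightarrow> 'o" and unt :: 'o
  assumes sp_vs [simp]: "A \<in> obs \<Longrightarrow> vs (sp A)"
    and fm_sub: "A \<in> obs \<Longrightarrow> sub (sp A) (fm A m)"
    and ten_obs [simp]: "\<lbrakk>A \<in> obs; B \<in> obs\<rbrakk> \<Longrightarrow> ten A B \<in> obs"
    and sp_ten [simp]: "\<lbrakk>A \<in> obs; B \<in> obs\<rbrakk> \<Longrightarrow> sp (ten A B) = tensor S (sp A) (sp B)"
    and fm_ten [simp]: "\<lbrakk>A \<in> obs; B \<in> obs\<rbrakk> \<Longrightarrow> fm (ten A B) = tensor_family S (sp A) (sp B) (fm A) (fm B)"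
    and unt_obs [simp]: "unt \<in> obs"
    and sp_unt [simp]: "sp unt = scalars S"
    and unt_smult: "\<lbrakk>A \<in> obs; Scal c \<in> fm unt i; v \<in> fm A j\<rbrakk> \<Longrightarrow> c \<odot>\<^bsub>sp A\<^esub> v \<in> fm A (i + j)"
    and unt_one: "Scal 1 \<in> fm unt 0"
begin

definition fhoms :: "'o \<Rightarrow> 'o \<Rightarrow> ('a pt \<Rightarrow> 'a pt) set" where
  "fhoms A B = {f \<in> linear_maps S (sp A) (sp B). \<forall>m. f ` fm A m \<subseteq> fm B m}"

lemma fm_family: "A \<in> obs \<Longrightarrow> family (sp A) (fm A)"
  by (simp add: fm_sub)

lemma vs_monoidal: "vs_monoidal S obs sp fhoms ten unt"
proof (intro vs_monoidal.intro base_field_axioms vs_monoidal_axioms.intro)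
  fix A assume A: "A \<in> obs"
  show "(\<lambda>v\<in>carrier (sp A). v) \<in> fhoms A A"
    using A sub_carrier[OF fm_sub[OF A]] by (auto simp: fhoms_def)
  show "tensor_lunit S (sp A) \<in> fhoms (ten unt A) A"
    using A tensor_family_lunit[OF _ fm_family[OF unt_obs, simplified] fm_family[OF A] unt_smult[OF A]]
    by (simp add: fhoms_def tensor_lunit_linear)
  show "tensor_lunit_inv (sp A) \<in> fhoms A (ten unt A)"
    using A tensor_family_lunit_inv[OF _ fm_family[OF unt_obs, simplified] fm_family[OF A] unt_one]
    by (simp add: fhoms_def tensor_lunit_inv_linear)
next
  fix A B D f g assume "A \<in> obs" "B \<in> obs" "D \<in> obs" "f \<in> fhoms A B" "g \<in> fhoms B D"
  moreover have "compose (carrier (sp A)) g f ` fm A m = g ` f ` fm A m" for m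
    using sub_carrier[OF fm_sub] \<open>A \<in> obs\<close> by (force simp: compose_def)
  ultimately show "compose (carrier (sp A)) g f \<in> fhoms A D"
    by (auto simp: fhoms_def intro!: linear_maps_compose) blast
next
  fix A B A' B' f g assume "A \<in> obs" "B \<in> obs" "A' \<in> obs" "B' \<in> obs" "f \<in> fhoms A A'" "g \<in> fhoms B B'"
  thus "tensor_map S (sp A) (sp B) (sp A') (sp B') f g \<in> fhoms (ten A B) (ten A' B')"
    using tensor_family_map[OF _ _ _ _ fm_family fm_family fm_family fm_family, of A B A' B' f g]
    by (simp add: fhoms_def tensor_map_linear linear_maps_lin)
next
  fix A B D assume "A \<in> obs" "B \<in> obs" "D \<in> obs"
  thus "tensor_assoc S (sp A) (sp B) (sp D) \<in> fhoms (ten (ten A B) D) (ten A (ten B D))"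
    using tensor_family_assoc[OF _ _ _ fm_family fm_family fm_family, of A B D]
    by (simp add: fhoms_def tensor_assoc_linear)
next
  fix A B assume "A \<in> obs" "B \<in> obs"
  thus "tensor_swap S (sp A) (sp B) \<in> fhoms (ten A B) (ten B A)"
    using tensor_family_swap[OF _ _ fm_family fm_family, of A B]
    by (simp add: fhoms_def tensor_swap_linear)
qed (simp_all add: fhoms_def)

end

subsection \<open>Filtered vector spaces\<close>

lemma is_fil_vs_tensor: "\<lbrakk>is_fil_vs A; is_fil_vs B\<rbrakk> \<Longrightarrow> is_fil_vs (fil_tensor A B)"
  by (simp add: is_fil_vs_def fil_tensor_def C.increasing_filtration_tensor)

interpretation Fil: family_monoidal UNIV "{A :: 'a fil_vs. is_fil_vs A}" fspace fil fil_tensor fil_unit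
proof (intro family_monoidal.intro C.base_field_axioms family_monoidal_axioms.intro)
  fix A B :: "'a fil_vs" and m i j c v
  show "C.vs (fspace A)" "C.sub (fspace A) (fil A m)" if "A \<in> {A. is_fil_vs A}"
    using that by (auto simp: is_fil_vs_def increasing_filtration_def)
  show "fil_tensor A B \<in> {A. is_fil_vs A}" if "A \<in> {A. is_fil_vs A}" "B \<in> {A. is_fil_vs A}"
    using that by (simp add: is_fil_vs_tensor)
  have "increasing_filtration UNIV CC (fil fil_unit)"
    unfolding increasing_filtration_def fil_unit_def
    using C.sub_self[of CC] C.sub_zero_space[of CC]
    by (intro conjI exI[of _ 0] exI[of _ "- 1"]) (auto simp: mono_def)
  thus "fil_unit \<in> {A :: 'a fil_vs. is_fil_vs A}" by (simp add: is_fil_vs_def fil_unit_def)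
  show "c \<odot>\<^bsub>fspace A\<^esub> v \<in> fil A (i + j)" if "A \<in> {A. is_fil_vs A}" "Scal c \<in> fil fil_unit i" "v \<in> fil A j"
  proof -
    have A: "C.vs (fspace A)" "\<And>j. C.sub (fspace A) (fil A j)" "mono (fil A)"
      using that by (auto simp: is_fil_vs_def increasing_filtration_def)
    show ?thesis
    proof (cases "0 \<le> i")
      case True
      hence "v \<in> fil A (i + j)" using that(3) monoD[OF A(3), of j "i + j"] by auto
      thus ?thesis using A(2) by (simp add: C.sub_smult)
    next
      case False
      hence "c = 0" using that(2) by (simp add: fil_unit_def)
      thus ?thesis using A that(3) by (simp add: C.sub_carrier[OF A(2)] C.sub_zero)
    qed
  qed
qed (simp_all add: fil_tensor_def fil_unit_def)

lemma fil_homs_eq: "fil_homs = Fil.fhoms"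
  by (intro ext) (simp add: fil_homs_def Fil.fhoms_def)

interpretation FVect: vs_monoidal UNIV "{A :: 'a fil_vs. is_fil_vs A}" fspace fil_homs fil_tensor fil_unit
  unfolding fil_homs_eq by (rule Fil.vs_monoidal)

lemma FVect_symmetric_monoidal: "symmetric_monoidal_category FVect"
  unfolding FVect_def by (rule FVect.symmetric_monoidal)

section \<open>Systems of projections\<close>

context base_field
begin

section \<open>Finite sums in a vector space\<close>

lemma vs_monoid: "vs V \<Longrightarrow> abelian_monoid V"
  by (rule abelian_group.axioms(1)[OF vs_group])

lemma finsum_vs_closed: "\<lbrakk>vs V; \<And>i. i \<in> J \<Longrightarrow> f i \<in> carrier V\<rbrakk> \<Longrightarrow> finsum V f J \<in> carrier V"
  by (intro abelian_monoid.finsum_closed[OF vs_monoid]) auto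

lemma finsum_vs_empty [simp]: "vs V \<Longrightarrow> finsum V f {} = \<zero>\<^bsub>V\<^esub>"
  by (rule abelian_monoid.finsum_empty[OF vs_monoid])

lemma finsum_vs_insert: "\<lbrakk>vs V; finite J; i \<notin> J; \<And>j. j \<in> insert i J \<Longrightarrow> f j \<in> carrier V\<rbrakk>
    \<Longrightarrow> finsum V f (insert i J) = f i \<oplus>\<^bsub>V\<^esub> finsum V f J"
  by (intro abelian_monoid.finsum_insert[OF vs_monoid]) auto

lemma finsum_vs_cong: "\<lbrakk>vs V; \<And>i. i \<in> J \<Longrightarrow> g i \<in> carrier V; \<And>i. i \<in> J \<Longrightarrow> f i = g i\<rbrakk>
    \<Longrightarrow> finsum V f J = finsum V g J"
  by (intro abelian_monoid.finsum_cong'[OF vs_monoid]) auto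

lemma finsum_vs_add: "\<lbrakk>vs V; \<And>i. i \<in> J \<Longrightarrow> f i \<in> carrier V; \<And>i. i \<in> J \<Longrightarrow> g i \<in> carrier V\<rbrakk>
    \<Longrightarrow> finsum V (\<lambda>i. f i \<oplus>\<^bsub>V\<^esub> g i) J = finsum V f J \<oplus>\<^bsub>V\<^esub> finsum V g J"
  by (intro abelian_monoid.finsum_addf[OF vs_monoid]) auto

lemma lin_finsum:
  assumes f: "f \<in> lin V W" and V: "vs V" and W: "vs W" and J: "finite J"
    and g: "\<And>i. i \<in> J \<Longrightarrow> g i \<in> carrier V"
  shows "f (finsum V g J) = finsum W (\<lambda>i. f (g i)) J"
  using J g
proof (induction J)
  case (insert i J)
  have "f (finsum V g (insert i J)) = f (g i \<oplus>\<^bsub>V\<^esub> finsum V g J)"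
    using insert by (subst finsum_vs_insert[OF V]) auto
  also have "\<dots> = f (g i) \<oplus>\<^bsub>W\<^esub> finsum W (\<lambda>i. f (g i)) J"
    using insert V by (simp add: lin_add[OF f] finsum_vs_closed)
  also have "\<dots> = finsum W (\<lambda>i. f (g i)) (insert i J)"
    using insert by (subst finsum_vs_insert[OF W]) (auto intro: lin_closed[OF f])
  finally show ?case .
qed (simp add: V W lin_zero[OF f])

lemma finsum_in_sub:
  assumes N: "sub V N" and J: "finite J" and f: "\<And>i. i \<in> J \<Longrightarrow> f i \<in> N"
  shows "finsum V f J \<in> N"
  using J f
proof (induction J)
  case (insert i J)
  thus ?case using N
    by (subst finsum_vs_insert) (auto simp: sub_vs sub_carrier sub_add)
qed (use N in \<open>simp add: sub_vs sub_zero\<close>)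

lemma finsum_delta:
  assumes V: "vs V" and J: "finite J" and f: "f k \<in> carrier V"
  shows "finsum V (\<lambda>i. if i = k then f i else \<zero>\<^bsub>V\<^esub>) J = (if k \<in> J then f k else \<zero>\<^bsub>V\<^esub>)"
  using J by (induction J) (use V f in \<open>auto simp: finsum_vs_insert\<close>)

lemma finsum_Times:
  assumes V: "vs V" and fin: "finite A" "finite B"
    and f: "\<And>a b. \<lbrakk>a \<in> A; b \<in> B\<rbrakk> \<Longrightarrow> f a b \<in> carrier V"
  shows "finsum V (\<lambda>(a, b). f a b) (A \<times> B) = finsum V (\<lambda>a. finsum V (f a) B) A"
proof -
  interpret V: abelian_monoid V by (rule vs_monoid[OF V])
  have inner: "finsum V (\<lambda>(a, b). f a b) ({a} \<times> B) = finsum V (f a) B" if "a \<in> A" for a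
  proof -
    have "finsum V (\<lambda>(a, b). f a b) (Pair a ` B) = finsum V (\<lambda>b. case (a, b) of (a, b) \<Rightarrow> f a b) B"
      using f that by (intro V.finsum_reindex) (auto intro!: inj_onI)
    moreover have "Pair a ` B = {a} \<times> B" by auto
    ultimately show ?thesis by simp
  qed
  have "A \<times> B = (\<Union>a\<in>A. {a} \<times> B)" by auto
  hence "finsum V (\<lambda>(a, b). f a b) (A \<times> B) = finsum V (\<lambda>a. finsum V (\<lambda>(a, b). f a b) ({a} \<times> B)) A"
    using V.add.finprod_UN_disjoint[of A "\<lambda>a. {a} \<times> B" "\<lambda>(a, b). f a b"] fin f
    by (auto simp: pairwise_def disjnt_def)
  also have "\<dots> = finsum V (\<lambda>a. finsum V (f a) B) A"
    using f V by (intro finsum_vs_cong) (auto simp: inner intro!: finsum_vs_closed)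
  finally show ?thesis .
qed

text \<open>A finite direct sum decomposition, encoded by its orthogonal projections in place of its
  summands: projections pass to a tensor product simply by tensoring the maps.\<close>

definition proj_system :: "'a vs \<Rightarrow> 'i set \<Rightarrow> ('i \<Rightarrow> 'a pt \<Rightarrow> 'a pt) \<Rightarrow> bool" where
  "proj_system V J \<pi> \<longleftrightarrow> vs V \<and> finite J \<and> (\<forall>i\<in>J. \<pi> i \<in> lin V V) \<and>
     (\<forall>i\<in>J. \<forall>j\<in>J. \<forall>v\<in>carrier V. \<pi> i (\<pi> j v) = (if i = j then \<pi> i v else \<zero>\<^bsub>V\<^esub>)) \<and>
     (\<forall>v\<in>carrier V. finsum V (\<lambda>i. \<pi> i v) J = v)"

text \<open>The sum of the summands whose index satisfies \<open>Q\<close>, described through the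
  components that vanish. Pieces of a grading and steps of an adapted filtration both have this
  form.\<close>

definition supported :: "'a vs \<Rightarrow> 'i set \<Rightarrow> ('i \<Rightarrow> 'a pt \<Rightarrow> 'a pt) \<Rightarrow> ('i \<Rightarrow> bool) \<Rightarrow> 'a pt set" where
  "supported V J \<pi> Q = {v \<in> carrier V. \<forall>i\<in>J. \<not> Q i \<longrightarrow> \<pi> i v = \<zero>\<^bsub>V\<^esub>}"

lemma proj_systemD:
  assumes "proj_system V J \<pi>"
  shows "vs V" "finite J" "\<And>i. i \<in> J \<Longrightarrow> \<pi> i \<in> lin V V"
    "\<And>i j v. \<lbrakk>i \<in> J; j \<in> J; v \<in> carrier V\<rbrakk> \<Longrightarrow> \<pi> i (\<pi> j v) = (if i = j then \<pi> i v else \<zero>\<^bsub>V\<^esub>)"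
    "\<And>v. v \<in> carrier V \<Longrightarrow> finsum V (\<lambda>i. \<pi> i v) J = v"
    "\<And>i v. \<lbrakk>i \<in> J; v \<in> carrier V\<rbrakk> \<Longrightarrow> \<pi> i v \<in> carrier V"
  using assms unfolding proj_system_def by (auto intro: lin_closed)

context
  fixes V :: "'a vs" (structure) and J :: "'i set" and \<pi> :: "'i \<Rightarrow> 'a pt \<Rightarrow> 'a pt"
  assumes \<pi>: "proj_system V J \<pi>"
begin

lemmas projD = proj_systemD[OF \<pi>]

lemma supported_sub: "sub V (supported V J \<pi> Q)"
  using projD(1) unfolding supported_def
  by (intro subI) (auto simp: lin_zero[OF projD(3)] lin_add[OF projD(3)] lin_smult[OF projD(3)])

lemma proj_supported: "\<lbrakk>i \<in> J; Q i; v \<in> carrier V\<rbrakk> \<Longrightarrow> \<pi> i v \<in> supported V J \<pi> Q"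
  unfolding supported_def using projD(4,6) by auto

text \<open>v is the sum of its components, and the components outside of \<open>Q\<close> are
  zero.\<close>

lemma supported_subset:
  assumes N: "sub V N" and v: "v \<in> supported V J \<pi> Q" and i: "\<And>i. \<lbrakk>i \<in> J; Q i\<rbrakk> \<Longrightarrow> \<pi> i v \<in> N"
  shows "v \<in> N"
proof -
  have "\<pi> i v \<in> N" if "i \<in> J" for i
    using that i v sub_zero[OF N] by (cases "Q i") (auto simp: supported_def)
  hence "finsum V (\<lambda>i. \<pi> i v) J \<in> N" using projD(2) by (intro finsum_in_sub[OF N])
  thus ?thesis using v projD(5) by (simp add: supported_def)
qed

lemma supported_False: "(\<And>i. i \<in> J \<Longrightarrow> \<not> Q i) \<Longrightarrow> supported V J \<pi> Q = {\<zero>}"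
  using supported_subset[OF sub_zero_space[OF projD(1)]] sub_zero[OF supported_sub] by blast

lemma span_supported:
  assumes A: "A \<subseteq> supported V J \<pi> Q" and J: "\<And>i v. \<lbrakk>i \<in> J; Q i; v \<in> carrier V\<rbrakk> \<Longrightarrow> \<pi> i v \<in> A"
  shows "span V A = supported V J \<pi> Q"
proof
  have AV: "A \<subseteq> carrier V" using A by (auto simp: supported_def)
  show "span V A \<subseteq> supported V J \<pi> Q" by (rule span_least[OF supported_sub A])
  show "supported V J \<pi> Q \<subseteq> span V A"
  proof
    fix v assume v: "v \<in> supported V J \<pi> Q"
    hence "v \<in> carrier V" by (simp add: supported_def)
    thus "v \<in> span V A"
      using J span_superset[OF projD(1) AV] by (intro supported_subset[OF span_sub[OF projD(1) AV] v]) auto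
  qed
qed

lemma proj_eqI:
  assumes v: "v \<in> carrier V" "w \<in> carrier V" and eq: "\<And>i. i \<in> J \<Longrightarrow> \<pi> i v = \<pi> i w"
  shows "v = w"
proof -
  have "finsum V (\<lambda>i. \<pi> i v) J = finsum V (\<lambda>i. \<pi> i w) J"
    using v eq projD(6) by (intro finsum_vs_cong[OF projD(1)]) auto
  thus ?thesis using projD(5) v by simp
qed

end

text \<open>Orthogonality can be tested on pure tensors. For the sum, both factors of v \<otimes> w
  are expanded into their components, which turns the sum over pairs into an iterated sum.\<close>

lemma proj_system_tensor:
  assumes \<pi>: "proj_system V J \<pi>" and \<pi>': "proj_system V' J' \<pi>'"
  shows "proj_system (tensor S V V') (J \<times> J') (\<lambda>(i, j). tensor_map S V V' V V' (\<pi> i) (\<pi>' j))"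
proof -
  let ?T = "tensor S V V'" and ?m = "\<lambda>i j. tensor_map S V V' V V' (\<pi> i) (\<pi>' j)"
  note D = proj_systemD[OF \<pi>] and D' = proj_systemD[OF \<pi>']
  have T: "vs ?T" using D(1) D'(1) by simp
  have lin: "?m i j \<in> lin ?T ?T" if "i \<in> J" "j \<in> J'" for i j
    using that D D' by (intro tensor_map_linear[THEN linear_maps_lin]) auto
  have map_pure: "?m i j (pure_tensor S V V' v w) = pure_tensor S V V' (\<pi> i v) (\<pi>' j w)"
    if "i \<in> J" "j \<in> J'" "v \<in> carrier V" "w \<in> carrier V'" for i j v w
    using that D D' by (intro tensor_map_pure) auto
  have orth: "?m i j (?m k l t) = (if i = k \<and> j = l then ?m i j t else \<zero>\<^bsub>?T\<^esub>)"
    if ij: "i \<in> J" "k \<in> J" "j \<in> J'" "l \<in> J'" and t: "t \<in> carrier ?T" for i j k l t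
  proof (rule tensor_lin_eqI[OF lin_comp[OF lin[OF ij(2,4)] lin[OF ij(1,3)]] _ D(1) D'(1) T _ t])
    show "(\<lambda>t. if i = k \<and> j = l then ?m i j t else \<zero>\<^bsub>?T\<^esub>) \<in> lin ?T ?T"
      using lin[OF ij(1,3)] lin_zero_fun[OF T, of ?T] by (cases "i = k \<and> j = l") auto
    show "?m i j (?m k l (pure_tensor S V V' v w))
        = (if i = k \<and> j = l then ?m i j (pure_tensor S V V' v w) else \<zero>\<^bsub>?T\<^esub>)"
      if "v \<in> carrier V" "w \<in> carrier V'" for v w
      using that ij D D' by (auto simp: map_pure pure_zero_left pure_zero_right)
  qed
  have sum: "finsum ?T (\<lambda>(i, j). ?m i j t) (J \<times> J') = t" if "t \<in> carrier ?T" for t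
    using that
  proof (induction rule: tensor_induct)
    case zero
    have "finsum ?T (\<lambda>(i, j). ?m i j \<zero>\<^bsub>?T\<^esub>) (J \<times> J') \<in> {\<zero>\<^bsub>?T\<^esub>}"
      using T D(2) D'(2) by (intro finsum_in_sub sub_zero_space) (auto simp: lin_zero[OF lin])
    thus ?case by simp
  next
    case (pure v w)
    have "finsum ?T (\<lambda>(i, j). ?m i j (pure_tensor S V V' v w)) (J \<times> J')
        = finsum ?T (\<lambda>(i, j). pure_tensor S V V' (\<pi> i v) (\<pi>' j w)) (J \<times> J')"
      using pure D(6) D'(6) by (intro finsum_vs_cong[OF T]) (auto simp: map_pure)
    also have "\<dots> = finsum ?T (\<lambda>i. finsum ?T (\<lambda>j. pure_tensor S V V' (\<pi> i v) (\<pi>' j w)) J') J"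
      using pure D(2,6) D'(2,6) by (intro finsum_Times[OF T]) auto
    also have "\<dots> = finsum ?T (\<lambda>i. pure_tensor S V V' (\<pi> i v) w) J"
    proof (rule finsum_vs_cong[OF T])
      fix i assume i: "i \<in> J"
      hence p: "\<pi> i v \<in> carrier V" using pure D(6) by simp
      thus "pure_tensor S V V' (\<pi> i v) w \<in> carrier ?T" using pure by simp
      show "finsum ?T (\<lambda>j. pure_tensor S V V' (\<pi> i v) (\<pi>' j w)) J' = pure_tensor S V V' (\<pi> i v) w"
        using lin_finsum[OF pure_lin_right[OF D(1) D'(1) p] D'(1) T D'(2), of "\<lambda>j. \<pi>' j w"] D'(5,6) pure
        by simp
    qed
    also have "\<dots> = pure_tensor S V V' v w"
      using lin_finsum[OF pure_lin_left[OF D(1) D'(1)] D(1) T D(2), of w "\<lambda>i. \<pi> i v"] D(5,6) pure by simp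
    finally show ?case .
  next
    case (add s t)
    have "finsum ?T (\<lambda>(i, j). ?m i j (s \<oplus>\<^bsub>?T\<^esub> t)) (J \<times> J')
        = finsum ?T (\<lambda>x. (case x of (i, j) \<Rightarrow> ?m i j s) \<oplus>\<^bsub>?T\<^esub> (case x of (i, j) \<Rightarrow> ?m i j t)) (J \<times> J')"
      using add.hyps T by (intro finsum_vs_cong[OF T]) (auto simp: lin_add[OF lin] lin_closed[OF lin])
    also have "\<dots> = s \<oplus>\<^bsub>?T\<^esub> t"
      using add by (subst finsum_vs_add[OF T]) (auto simp: lin_closed[OF lin])
    finally show ?case .
  qed
  show ?thesis unfolding proj_system_def using T D(2) D'(2) lin orth sum by (auto simp: case_prod_beta')
qed

text \<open>The component (i, j) of v \<otimes> w, with v in \<open>N a\<close> and w in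
  \<open>N' b\<close>, vanishes unless \<open>R i a\<close> and \<open>R' j b\<close>. Conversely
  the projection (i, j) sends every pure tensor into \<open>N a \<otimes> N' b\<close> for any such
  a and b. Taking equality or an order relation for \<open>R\<close> and \<open>R'\<close> covers
  gradings and filtrations in both directions.\<close>

lemma tensor_family_supported:
  assumes \<pi>: "proj_system V J \<pi>" and \<pi>': "proj_system V' J' \<pi>'"
    and N: "\<And>a. N a = supported V J \<pi> (\<lambda>i. R i a)" and N': "\<And>a. N' a = supported V' J' \<pi>' (\<lambda>j. R' j a)"
  shows "tensor_family S V V' N N' p = supported (tensor S V V') (J \<times> J')
    (\<lambda>(i, j). tensor_map S V V' V V' (\<pi> i) (\<pi>' j)) (\<lambda>(i, j). \<exists>a b. a + b = p \<and> R i a \<and> R' j b)"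
    (is "_ = supported ?T _ ?m ?Q")
proof
  note D = proj_systemD[OF \<pi>] and D' = proj_systemD[OF \<pi>']
  note T = proj_system_tensor[OF \<pi> \<pi>']
  have fam: "family V N" "family V' N'" unfolding N N' by (simp_all add: supported_sub[OF \<pi>] supported_sub[OF \<pi>'])
  have map_pure: "tensor_map S V V' V V' (\<pi> i) (\<pi>' j) (pure_tensor S V V' v w) = pure_tensor S V V' (\<pi> i v) (\<pi>' j w)"
    if "i \<in> J" "j \<in> J'" "v \<in> carrier V" "w \<in> carrier V'" for i j v w
    using that D D' by (intro tensor_map_pure) auto
  show "tensor_family S V V' N N' p \<subseteq> supported ?T (J \<times> J') ?m ?Q"
  proof (rule tensor_family_least[OF D(1) D'(1) fam supported_sub[OF T]])
    fix a b v w assume ab: "a + b = p" "v \<in> N a" "w \<in> N' b"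
    have c: "v \<in> carrier V" "w \<in> carrier V'" using ab by (auto simp: N N' supported_def)
    have "pure_tensor S V V' (\<pi> i v) (\<pi>' j w) = \<zero>\<^bsub>?T\<^esub>" if ij: "i \<in> J" "j \<in> J'" "\<not> ?Q (i, j)" for i j
    proof -
      have "\<not> R i a \<or> \<not> R' j b" using ij ab(1) by auto
      hence "\<pi> i v = \<zero>\<^bsub>V\<^esub> \<or> \<pi>' j w = \<zero>\<^bsub>V'\<^esub>" using ab ij by (auto simp: N N' supported_def)
      thus ?thesis using c ij D D' by (auto simp: pure_zero_left pure_zero_right)
    qed
    thus "pure_tensor S V V' v w \<in> supported ?T (J \<times> J') ?m ?Q"
      using c by (auto simp: supported_def map_pure)
  qed
  show "supported ?T (J \<times> J') ?m ?Q \<subseteq> tensor_family S V V' N N' p"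
  proof
    fix t assume t: "t \<in> supported ?T (J \<times> J') ?m ?Q"
    show "t \<in> tensor_family S V V' N N' p"
    proof (rule supported_subset[OF T tensor_family_sub[OF D(1) D'(1) fam] t])
      fix x assume x: "x \<in> J \<times> J'" "?Q x"
      obtain i j where ij: "x = (i, j)" by (cases x)
      obtain a b where ab: "a + b = p" "R i a" "R' j b" using x ij by auto
      have m: "?m x \<in> lin ?T ?T" using proj_systemD(3)[OF T x(1)] .
      have "?m x s \<in> tensor_family S V V' N N' p" if "s \<in> carrier ?T" for s
        using that
      proof (induction rule: tensor_induct)
        case zero
        thus ?case using lin_zero[OF m] D(1) D'(1) sub_zero[OF tensor_family_sub[OF D(1) D'(1) fam]] by simp
      next
        case (pure v w)
        have "\<pi> i v \<in> N a" "\<pi>' j w \<in> N' b"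
          using x ij ab pure unfolding N N' by (auto intro!: proj_supported[OF \<pi>] proj_supported[OF \<pi>'])
        hence "pure_tensor S V V' (\<pi> i v) (\<pi>' j w) \<in> tensor_family S V V' N N' p"
          using ab(1) by (intro pure_in_tensor_family[OF D(1) D'(1) fam])
        thus ?case using x ij pure map_pure by simp
      next
        case (add s t)
        thus ?case using sub_add[OF tensor_family_sub[OF D(1) D'(1) fam]] by (simp add: lin_add[OF m])
      qed
      thus "?m x t \<in> tensor_family S V V' N N' p" using t by (simp add: supported_def)
    qed
  qed
qed

text \<open>Uniqueness is assumed only for decompositions of zero; subtraction extends it to all
  vectors. Uniqueness then forces the chosen coordinates \<open>F v i\<close> to be linear in v,
  because the sum of two decompositions is a decomposition of the sum.\<close>

lemma decomposition_proj_system: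
  fixes V (structure)
  assumes V: "vs V" and J: "finite J" and P: "\<And>i. i \<in> J \<Longrightarrow> sub V (P i)"
    and ex: "\<And>v. v \<in> carrier V \<Longrightarrow> \<exists>f. (\<forall>i\<in>J. f i \<in> P i) \<and> v = finsum V f J"
    and unique: "\<And>f i. \<lbrakk>\<forall>i\<in>J. f i \<in> P i; finsum V f J = \<zero>; i \<in> J\<rbrakk> \<Longrightarrow> f i = \<zero>"
  obtains \<pi> where "proj_system V J \<pi>" "\<And>i. i \<in> J \<Longrightarrow> P i = supported V J \<pi> (\<lambda>j. j = i)"
proof -
  have c: "v \<in> carrier V" if "i \<in> J" "v \<in> P i" for i v using sub_carrier[OF P[OF that(1)] that(2)] .
  obtain F where F: "\<And>v i. v \<in> carrier V \<Longrightarrow> i \<in> J \<Longrightarrow> F v i \<in> P i"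
    and F_sum: "\<And>v. v \<in> carrier V \<Longrightarrow> v = finsum V (F v) J"
    using ex by metis
  have eq: "f i = g i" if f: "\<forall>i\<in>J. f i \<in> P i" and g: "\<forall>i\<in>J. g i \<in> P i" and "finsum V f J = finsum V g J" "i \<in> J"
    for f g i
  proof -
    have fc: "f i \<in> carrier V" "g i \<in> carrier V" if "i \<in> J" for i using f g c that by auto
    have "finsum V (\<lambda>i. f i \<ominus> g i) J \<oplus> finsum V g J = finsum V (\<lambda>i. (f i \<ominus> g i) \<oplus> g i) J"
      using fc V by (intro finsum_vs_add[symmetric]) auto
    also have "\<dots> = finsum V f J"
      using fc V by (intro finsum_vs_cong) (auto simp: vs_minus_add)
    also have "\<dots> = \<zero> \<oplus> finsum V g J" using that V fc by (simp add: finsum_vs_closed)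
    finally have "finsum V (\<lambda>i. f i \<ominus> g i) J = \<zero>"
      using V fc by (subst (asm) vs_add_diff) (auto simp: finsum_vs_closed vs_add_minus)
    hence "f i \<ominus> g i = \<zero>" using unique[of "\<lambda>i. f i \<ominus> g i" i] f g P \<open>i \<in> J\<close> by (auto intro: sub_minus)
    thus ?thesis using V fc \<open>i \<in> J\<close> by (simp add: vs_diff_eq_zero)
  qed
  have FI: "F v i = f i" if "\<forall>i\<in>J. f i \<in> P i" "v = finsum V f J" "v \<in> carrier V" "i \<in> J" for v f i
    using that F F_sum by (intro eq[of "F v" f i]) auto
  have delta: "F v i = (if i = k then v else \<zero>)" if "k \<in> J" "v \<in> P k" "i \<in> J" for v k i
    using that c[OF that(1,2)] P sub_zero finsum_delta[OF V J, of "\<lambda>_. v" k]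
    by (intro FI[of "\<lambda>i. if i = k then v else \<zero>"]) auto
  let ?\<pi> = "\<lambda>i v. F v i"
  have "?\<pi> i \<in> lin V V" if i: "i \<in> J" for i
  proof (rule linI)
    show "F v i \<in> carrier V" if "v \<in> carrier V" for v using c i that F by auto
    show "F (v \<oplus> w) i = F v i \<oplus> F w i" if vw: "v \<in> carrier V" "w \<in> carrier V" for v w
    proof (rule FI[OF _ _ _ i])
      show "\<forall>i\<in>J. F v i \<oplus> F w i \<in> P i" using F vw P by (auto intro: sub_add)
      show "v \<oplus> w = finsum V (\<lambda>i. F v i \<oplus> F w i) J"
        using F c vw V F_sum[of v] F_sum[of w] by (subst finsum_vs_add) auto
    qed (use V vw in simp)
    show "F (r \<odot> v) i = r \<odot> F v i" if rv: "r \<in> S" "v \<in> carrier V" for r v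
    proof (rule FI[OF _ _ _ i])
      have sm: "(\<lambda>v. r \<odot> v) \<in> lin V V" using V rv by (intro linI) (auto simp: vs_distr vs_smult_smult mult.commute)
      show "\<forall>i\<in>J. r \<odot> F v i \<in> P i" using F rv P by (auto intro: sub_smult)
      show "r \<odot> v = finsum V (\<lambda>i. r \<odot> F v i) J"
        using lin_finsum[OF sm V V J, of "F v"] F c rv F_sum[of v] by auto
    qed (use V rv in simp)
  qed
  moreover have "?\<pi> i (?\<pi> j v) = (if i = j then ?\<pi> i v else \<zero>)" if "i \<in> J" "j \<in> J" "v \<in> carrier V" for i j v
    using delta[of j "F v j" i] F that by auto
  ultimately have ps: "proj_system V J ?\<pi>"
    unfolding proj_system_def using V J F_sum by auto
  have "P i = supported V J ?\<pi> (\<lambda>j. j = i)" if i: "i \<in> J" for i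
  proof
    show "P i \<subseteq> supported V J ?\<pi> (\<lambda>j. j = i)" using delta i c by (auto simp: supported_def)
    show "supported V J ?\<pi> (\<lambda>j. j = i) \<subseteq> P i"
    proof
      fix v assume v: "v \<in> supported V J ?\<pi> (\<lambda>j. j = i)"
      hence "v \<in> carrier V" by (simp add: supported_def)
      thus "v \<in> P i" using F by (intro supported_subset[OF ps P[OF i] v]) auto
    qed
  qed
  thus ?thesis using ps that by blast
qed

lemma finsum_family_sub:
  fixes V (structure)
  assumes V: "vs V" and J: "finite J" and P: "\<And>i. i \<in> J \<Longrightarrow> sub V (P i)"
  shows "sub V {finsum V f J |f. \<forall>i\<in>J. f i \<in> P i}" (is "sub V ?M")
proof (rule subI)
  have c: "v \<in> carrier V" if "i \<in> J" "v \<in> P i" for i v using sub_carrier[OF P[OF that(1)] that(2)] .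
  show "?M \<subseteq> carrier V" using c V by (auto intro: finsum_vs_closed)
  have "finsum V (\<lambda>_. \<zero>) J \<in> {\<zero>}" using V J by (intro finsum_in_sub sub_zero_space) auto
  thus "\<zero> \<in> ?M" using P sub_zero by (auto intro!: exI[of _ "\<lambda>_. \<zero>"])
  show "v \<oplus> w \<in> ?M" if vw: "v \<in> ?M" "w \<in> ?M" for v w
  proof -
    obtain f g where fg: "\<forall>i\<in>J. f i \<in> P i" "\<forall>i\<in>J. g i \<in> P i" "v = finsum V f J" "w = finsum V g J"
      using vw by auto
    have "v \<oplus> w = finsum V (\<lambda>i. f i \<oplus> g i) J" using fg c V by (subst finsum_vs_add) auto
    thus ?thesis using fg P by (intro CollectI exI[of _ "\<lambda>i. f i \<oplus> g i"]) (auto intro: sub_add)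
  qed
  show "r \<odot> v \<in> ?M" if rv: "r \<in> S" "v \<in> ?M" for r v
  proof -
    obtain f where f: "\<forall>i\<in>J. f i \<in> P i" "v = finsum V f J" using rv by auto
    have sm: "(\<lambda>v. r \<odot> v) \<in> lin V V" using V rv by (intro linI) (auto simp: vs_distr vs_smult_smult mult.commute)
    have "r \<odot> v = finsum V (\<lambda>i. r \<odot> f i) J" using lin_finsum[OF sm V V J, of f] f c by auto
    thus ?thesis using rv f P by (intro CollectI exI[of _ "\<lambda>i. r \<odot> f i"]) (auto intro: sub_smult)
  qed
qed (rule V)

lemma finsum_family_member:
  assumes V: "vs V" and J: "finite J" and P: "\<And>i. i \<in> J \<Longrightarrow> sub V (P i)" and k: "k \<in> J"
  shows "P k \<subseteq> {finsum V f J |f. \<forall>i\<in>J. f i \<in> P i}"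
proof
  fix v assume v: "v \<in> P k"
  hence "v = finsum V (\<lambda>i. if i = k then v else \<zero>\<^bsub>V\<^esub>) J"
    using finsum_delta[OF V J, of "\<lambda>_. v" k] sub_carrier[OF P[OF k]] k by auto
  moreover have "\<forall>i\<in>J. (if i = k then v else \<zero>\<^bsub>V\<^esub>) \<in> P i" using v P sub_zero by auto
  ultimately show "v \<in> {finsum V f J |f. \<forall>i\<in>J. f i \<in> P i}" by blast
qed

end

subsection \<open>Graded vector spaces\<close>

abbreviation degrees :: "'a gr_vs \<Rightarrow> int set" where "degrees A \<equiv> {n. piece A n \<noteq> {\<zero>\<^bsub>gspace A\<^esub>}}"

lemma is_gr_vs_proj_system:
  assumes A: "is_gr_vs A"
  obtains \<pi> where "C.proj_system (gspace A) (degrees A) \<pi>"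
    "\<And>n. piece A n = C.supported (gspace A) (degrees A) \<pi> (\<lambda>i. i = n)"
proof -
  let ?V = "gspace A" and ?J = "(degrees A)"
  have V: "C.vs ?V" and P: "\<And>n. C.sub ?V (piece A n)" and J: "finite ?J"
    and ex: "\<And>v. v \<in> carrier ?V \<Longrightarrow> \<exists>!f. (\<forall>n. f n \<in> piece A n) \<and> v = finsum ?V f ?J"
    using A by (auto simp: is_gr_vs_def)
  have unique: "f n = \<zero>\<^bsub>?V\<^esub>" if f: "\<forall>n\<in>?J. f n \<in> piece A n" "finsum ?V f ?J = \<zero>\<^bsub>?V\<^esub>" "n \<in> ?J" for f n
  proof -
    \<comment> \<open>The uniqueness in \<open>is_gr_vs\<close> concerns functions on all integers,
      so a family given on the nonzero degrees is extended by zero before it is compared with the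
      zero family.\<close>
    let ?f = "\<lambda>n. if n \<in> ?J then f n else \<zero>\<^bsub>?V\<^esub>"
    have fc: "f n \<in> carrier ?V" if "n \<in> ?J" for n using f(1) C.sub_carrier[OF P] that by blast
    have 1: "finsum ?V ?f ?J = \<zero>\<^bsub>?V\<^esub>" using f(2) C.finsum_vs_cong[OF V, of ?J f ?f] fc by auto
    have 2: "finsum ?V (\<lambda>_. \<zero>\<^bsub>?V\<^esub>) ?J \<in> {\<zero>\<^bsub>?V\<^esub>}" using V J by (intro C.finsum_in_sub C.sub_zero_space) auto
    obtain g where g: "\<And>h. (\<forall>n. h n \<in> piece A n) \<and> \<zero>\<^bsub>?V\<^esub> = finsum ?V h ?J \<Longrightarrow> h = g"
      using ex[OF C.vs_zero[OF V]] by (elim ex1E) blast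
    have "?f = g" using f(1) C.sub_zero[OF P] 1 by (intro g[of ?f]) auto
    moreover have "(\<lambda>_. \<zero>\<^bsub>?V\<^esub>) = g" using C.sub_zero[OF P] 2 by (intro g[of "\<lambda>_. \<zero>\<^bsub>?V\<^esub>"]) auto
    ultimately have "?f n = \<zero>\<^bsub>?V\<^esub>" using fun_cong[of ?f "\<lambda>_. \<zero>\<^bsub>?V\<^esub>" n] by argo
    thus ?thesis using f(3) by simp
  qed
  obtain \<pi> where \<pi>: "C.proj_system ?V ?J \<pi>" and p: "\<And>n. n \<in> ?J \<Longrightarrow> piece A n = C.supported ?V ?J \<pi> (\<lambda>i. i = n)"
  proof (rule C.decomposition_proj_system[OF V J, of "piece A"])
    show "\<exists>f. (\<forall>i\<in>?J. f i \<in> piece A i) \<and> v = finsum ?V f ?J" if "v \<in> carrier ?V" for v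
      using ex[OF that] by (elim ex1E) blast
    show "f i = \<zero>\<^bsub>?V\<^esub>" if "\<forall>n\<in>?J. f n \<in> piece A n" "finsum ?V f ?J = \<zero>\<^bsub>?V\<^esub>" "i \<in> ?J" for f i
      using that by (rule unique)
  qed (rule P, rule that)
  have "piece A n = C.supported ?V ?J \<pi> (\<lambda>i. i = n)" for n
  proof (cases "n \<in> ?J")
    case False
    thus ?thesis using C.supported_False[OF \<pi>, of "\<lambda>i. i = n"] by auto
  qed (rule p)
  thus ?thesis using \<pi> that by blast
qed

text \<open>Several indices may share a degree; the component of degree n adds up the projections
  with \<open>d i = n\<close>. This generality is for pairs (i, j) of degree i + j in a tensor
  product and for bidegrees (p, q) of degree p + q.\<close>

lemma proj_system_is_gr_vs:
  fixes V (structure)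
  assumes \<pi>: "C.proj_system V J \<pi>" and P: "\<And>n. P n = C.supported V J \<pi> (\<lambda>i. d i = n)"
  shows "is_gr_vs \<lparr>gspace = V, piece = P\<rparr>"
proof -
  note D = C.proj_systemD[OF \<pi>]
  let ?X = "{n. P n \<noteq> {\<zero>}}"
  have "P n = {\<zero>}" if "n \<notin> d ` J" for n
    unfolding P using that by (intro C.supported_False[OF \<pi>]) auto
  hence "?X \<subseteq> d ` J" by blast
  hence X: "finite ?X" using D(2) finite_subset by blast
  have Ps: "C.sub V (P n)" for n unfolding P by (rule C.supported_sub[OF \<pi>])
  have \<pi>P: "\<pi> i v \<in> P (d i)" if "i \<in> J" "v \<in> carrier V" for i v
    unfolding P using that by (intro C.proj_supported[OF \<pi>]) auto
  have component: "\<pi> i (finsum V f ?X) = \<pi> i (f (d i))" if f: "\<And>n. f n \<in> P n" and i: "i \<in> J" for f i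
  proof -
    have fc: "f n \<in> carrier V" for n using f C.sub_carrier[OF Ps] by blast
    have "\<pi> i (finsum V f ?X) = finsum V (\<lambda>n. \<pi> i (f n)) ?X"
      using fc by (intro C.lin_finsum[OF D(3)[OF i] D(1) D(1) X])
    also have "\<dots> = finsum V (\<lambda>n. if n = d i then \<pi> i (f n) else \<zero>) ?X"
      using f i D(1) D(6)[OF i] fc by (intro C.finsum_vs_cong[OF D(1)]) (auto simp: P C.supported_def)
    also have "\<dots> = (if d i \<in> ?X then \<pi> i (f (d i)) else \<zero>)"
      using C.finsum_delta[OF D(1) X, of "\<lambda>n. \<pi> i (f n)" "d i"] D(6)[OF i] fc by simp
    also have "\<dots> = \<pi> i (f (d i))"
      using f[of "d i"] C.lin_zero[OF D(3)[OF i] D(1) D(1)] by auto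
    finally show ?thesis .
  qed
  have "\<exists>!f. (\<forall>n. f n \<in> P n) \<and> v = finsum V f ?X" if v: "v \<in> carrier V" for v
  proof
    let ?f = "\<lambda>n. finsum V (\<lambda>i. \<pi> i v) {i \<in> J. d i = n}"
    have f: "?f n \<in> P n" for n
      using D(2) \<pi>P v by (intro C.finsum_in_sub[OF Ps]) auto
    have "v = finsum V ?f ?X"
    proof (rule C.proj_eqI[OF \<pi> v])
      show "finsum V ?f ?X \<in> carrier V" by (rule C.finsum_vs_closed[OF D(1) C.sub_carrier[OF Ps f]])
      show "\<pi> i v = \<pi> i (finsum V ?f ?X)" if i: "i \<in> J" for i
      proof -
        have "\<pi> i (?f (d i)) = finsum V (\<lambda>j. \<pi> i (\<pi> j v)) {j \<in> J. d j = d i}"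
          using D v by (intro C.lin_finsum[OF D(3)[OF i]]) auto
        also have "\<dots> = finsum V (\<lambda>j. if j = i then \<pi> j v else \<zero>) {j \<in> J. d j = d i}"
          using D v i by (intro C.finsum_vs_cong) auto
        also have "\<dots> = \<pi> i v" using C.finsum_delta[OF D(1), of "{j \<in> J. d j = d i}" "\<lambda>j. \<pi> j v" i] D v i by auto
        finally show ?thesis using component[OF f i] by simp
      qed
    qed
    thus "(\<forall>n. ?f n \<in> P n) \<and> v = finsum V ?f ?X" using f by blast
    hence v_eq: "v = finsum V ?f ?X" ..
    fix g assume g: "(\<forall>n. g n \<in> P n) \<and> v = finsum V g ?X"
    have "g n = ?f n" for n
    proof (rule C.proj_eqI[OF \<pi>])
      show "g n \<in> carrier V" "?f n \<in> carrier V" using g f C.sub_carrier[OF Ps] by blast+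
      show "\<pi> i (g n) = \<pi> i (?f n)" if i: "i \<in> J" for i
      proof (cases "d i = n")
        case True
        thus ?thesis using component[of g i] component[of ?f i] f g i v_eq by metis
      next
        case False
        hence "\<pi> i x = \<zero>" if "x \<in> P n" for x using that i by (auto simp: P C.supported_def)
        thus ?thesis using f g by metis
      qed
    qed
    thus "g = ?f" by (rule ext)
  qed
  thus ?thesis unfolding is_gr_vs_def using D(1) Ps X by auto
qed

lemma is_gr_vs_tensor:
  assumes A: "is_gr_vs A" and B: "is_gr_vs B"
  shows "is_gr_vs (gr_tensor A B)"
proof -
  obtain \<pi> where \<pi>: "C.proj_system (gspace A) (degrees A) \<pi>"
    "\<And>n. piece A n = C.supported (gspace A) (degrees A) \<pi> (\<lambda>i. i = n)"
    by (rule is_gr_vs_proj_system[OF A]) (rule that)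
  obtain \<pi>' where \<pi>': "C.proj_system (gspace B) (degrees B) \<pi>'"
    "\<And>n. piece B n = C.supported (gspace B) (degrees B) \<pi>' (\<lambda>i. i = n)"
    by (rule is_gr_vs_proj_system[OF B]) (rule that)
  have "(\<lambda>(i, j). \<exists>a b. a + b = p \<and> i = a \<and> j = b) = (\<lambda>x. (case x of (i, j) \<Rightarrow> i + j) = p)" for p :: int
    by auto
  thus ?thesis
    unfolding gr_tensor_def using C.tensor_family_supported[OF \<pi>(1) \<pi>'(1) \<pi>(2) \<pi>'(2)]
    by (intro proj_system_is_gr_vs[OF C.proj_system_tensor[OF \<pi>(1) \<pi>'(1)]]) simp
qed

interpretation Grd: family_monoidal UNIV "{A :: 'a gr_vs. is_gr_vs A}" gspace piece gr_tensor gr_unit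
proof (intro family_monoidal.intro C.base_field_axioms family_monoidal_axioms.intro)
  fix A B :: "'a gr_vs" and m i j c v
  show "C.vs (gspace A)" "C.sub (gspace A) (piece A m)" if "A \<in> {A. is_gr_vs A}"
    using that by (auto simp: is_gr_vs_def)
  show "gr_tensor A B \<in> {A. is_gr_vs A}" if "A \<in> {A. is_gr_vs A}" "B \<in> {A. is_gr_vs A}"
    using that by (simp add: is_gr_vs_tensor)
  \<comment> \<open>The unit is a decomposition with the single index 0, its projection being the
    identity.\<close>
  have "C.proj_system (CC :: 'a vs) {0 :: int} (\<lambda>_ v. v)"
    unfolding C.proj_system_def by (auto simp: C.lin_id C.finsum_vs_insert[of CC "{}", simplified])
  hence "is_gr_vs (gr_unit :: 'a gr_vs)" unfolding gr_unit_def
  proof (rule proj_system_is_gr_vs[where d = "\<lambda>i. i"])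
    show "(if n = 0 then carrier CC else {\<zero>\<^bsub>CC\<^esub>})
        = C.supported (CC :: 'a vs) {0 :: int} (\<lambda>_ v. v) (\<lambda>i. i = n)" for n
      by (auto simp: C.supported_def)
  qed
  thus "gr_unit \<in> {A :: 'a gr_vs. is_gr_vs A}" by simp
  show "c \<odot>\<^bsub>gspace A\<^esub> v \<in> piece A (i + j)" if "A \<in> {A. is_gr_vs A}" "Scal c \<in> piece gr_unit i" "v \<in> piece A j"
  proof -
    have A: "C.vs (gspace A)" "\<And>j. C.sub (gspace A) (piece A j)" using that by (auto simp: is_gr_vs_def)
    show ?thesis
    proof (cases "i = 0")
      case True
      thus ?thesis using A(2) that(3) by (simp add: C.sub_smult)
    next
      case False
      hence "c = 0" using that(2) by (simp add: gr_unit_def)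
      thus ?thesis using A that(3) by (simp add: C.sub_carrier[OF A(2)] C.sub_zero)
    qed
  qed
qed (simp_all add: gr_tensor_def gr_unit_def)

lemma gr_homs_eq: "gr_homs = Grd.fhoms"
  by (intro ext) (simp add: gr_homs_def Grd.fhoms_def)

interpretation grVect: vs_monoidal UNIV "{A :: 'a gr_vs. is_gr_vs A}" gspace gr_homs gr_tensor gr_unit
  unfolding gr_homs_eq by (rule Grd.vs_monoidal)

lemma grVect_symmetric_monoidal: "symmetric_monoidal_category grVect"
  unfolding grVect_def by (rule grVect.symmetric_monoidal)

section \<open>Opposed filtrations and the Deligne splitting\<close>

context base_field
begin

text \<open>\<open>F\<close> and \<open>H\<close> induce m-opposed filtrations on the quotient of
  \<open>W m\<close> by \<open>W (m - 1)\<close>: for p + q = m + 1 their steps span it and meet in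
  zero. Both conditions are written with representatives, so no quotient space occurs. In the second
  one, f and h represent the same class, which lies in the intersection.\<close>

definition opposed :: "'a vs \<Rightarrow> (int \<Rightarrow> 'a pt set) \<Rightarrow> (int \<Rightarrow> 'a pt set) \<Rightarrow> (int \<Rightarrow> 'a pt set) \<Rightarrow> bool" where
  "opposed V W F H \<longleftrightarrow> (\<forall>m p q. p + q = m + 1 \<longrightarrow>
     (\<forall>x\<in>W m. \<exists>f\<in>F p \<inter> W m. \<exists>h\<in>H q \<inter> W m. \<exists>w\<in>W (m - 1). x = (f \<oplus>\<^bsub>V\<^esub> h) \<oplus>\<^bsub>V\<^esub> w) \<and>
     (\<forall>f\<in>F p \<inter> W m. \<forall>h\<in>H q \<inter> W m. f \<ominus>\<^bsub>V\<^esub> h \<in> W (m - 1) \<longrightarrow> f \<in> W (m - 1)))"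

text \<open>The last factor of Deligne's formula. For m = p + q the index in the j-th term satisfies
  p + (q - j + 1) = (m - j) + 1, so \<open>F p\<close> and \<open>H (q - j + 1)\<close> are
  complementary in weight m - j: errors in that weight can be corrected, and in one way only. In
  weight m - 1 the complementary step is \<open>H q\<close>, and its part there already lies in
  \<open>H q \<inter> W m\<close>; hence the terms start at j = 2.\<close>

definition deligne_tail :: "'a vs \<Rightarrow> (int \<Rightarrow> 'a pt set) \<Rightarrow> (int \<Rightarrow> 'a pt set) \<Rightarrow> int \<Rightarrow> int \<Rightarrow> 'a pt set" where
  "deligne_tail V W H q m = span V (H q \<inter> W m \<union> (\<Union>j\<in>{2..}. H (q - j + 1) \<inter> W (m - j)))"

text \<open>Deligne's subspaces \<open>I\<^sup>p\<^sup>q\<close> for \<open>H\<close> the conjugate of \<open>F\<close>.\<close>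

definition deligne ::
  "'a vs \<Rightarrow> (int \<Rightarrow> 'a pt set) \<Rightarrow> (int \<Rightarrow> 'a pt set) \<Rightarrow> (int \<Rightarrow> 'a pt set) \<Rightarrow> int \<Rightarrow> int \<Rightarrow> 'a pt set" where
  "deligne V W F H p q = F p \<inter> W (p + q) \<inter> deligne_tail V W H q (p + q)"

text \<open>These rules gather all subtractions into one; combined with \<open>vs_ac\<close> they
  prove the rearrangements of sums and differences below.\<close>

lemma vs_diff_simps:
  fixes V (structure)
  assumes V: "vs V"
  shows "\<lbrakk>a \<in> carrier V; b \<in> carrier V; c \<in> carrier V\<rbrakk> \<Longrightarrow> (a \<ominus> b) \<oplus> c = (a \<oplus> c) \<ominus> b"
    and "\<lbrakk>a \<in> carrier V; b \<in> carrier V; c \<in> carrier V\<rbrakk> \<Longrightarrow> c \<oplus> (a \<ominus> b) = (c \<oplus> a) \<ominus> b"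
    and "\<lbrakk>a \<in> carrier V; b \<in> carrier V; c \<in> carrier V\<rbrakk> \<Longrightarrow> (a \<ominus> b) \<ominus> c = a \<ominus> (b \<oplus> c)"
    and "\<lbrakk>a \<in> carrier V; b \<in> carrier V; c \<in> carrier V\<rbrakk> \<Longrightarrow> a \<ominus> (b \<ominus> c) = (a \<oplus> c) \<ominus> b"
    and "\<lbrakk>a \<in> carrier V; b \<in> carrier V; c \<in> carrier V\<rbrakk> \<Longrightarrow> a \<ominus> b = c \<longleftrightarrow> a = c \<oplus> b"
    and "\<lbrakk>a \<in> carrier V; b \<in> carrier V; c \<in> carrier V\<rbrakk> \<Longrightarrow> c = a \<ominus> b \<longleftrightarrow> c \<oplus> b = a"
proof -
  interpret A: abelian_group V by (rule vs_group[OF V])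
  assume c: "a \<in> carrier V" "b \<in> carrier V" "c \<in> carrier V"
  show "(a \<ominus> b) \<oplus> c = (a \<oplus> c) \<ominus> b" "c \<oplus> (a \<ominus> b) = (c \<oplus> a) \<ominus> b"
    "(a \<ominus> b) \<ominus> c = a \<ominus> (b \<oplus> c)" "a \<ominus> (b \<ominus> c) = (a \<oplus> c) \<ominus> b"
    using c by (simp_all add: a_minus_def A.minus_add A.a_ac)
  show "a \<ominus> b = c \<longleftrightarrow> a = c \<oplus> b" "c = a \<ominus> b \<longleftrightarrow> c \<oplus> b = a"
    using vs_add_diff[OF V c(3,2,1)] by auto
qed

lemma sub_diff_trans:
  fixes V (structure)
  assumes N: "sub V N" and c: "x \<in> carrier V" "y \<in> carrier V" "z \<in> carrier V"
    and d: "x \<ominus> y \<in> N" "y \<ominus> z \<in> N"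
  shows "x \<ominus> z \<in> N"
proof -
  note V = sub_vs[OF N]
  have "x \<ominus> z = (x \<ominus> y) \<oplus> (y \<ominus> z)" using c by (simp add: V vs_diff_simps[OF V] vs_ac[OF V])
  thus ?thesis using sub_add[OF N d] by simp
qed

lemma sub_diff_sym:
  fixes V (structure)
  assumes N: "sub V N" and c: "x \<in> carrier V" "y \<in> carrier V" and d: "x \<ominus> y \<in> N"
  shows "y \<ominus> x \<in> N"
proof -
  note V = sub_vs[OF N]
  have "y \<ominus> x = \<zero> \<ominus> (x \<ominus> y)" using c by (simp add: V vs_diff_simps[OF V] vs_ac[OF V])
  thus ?thesis using sub_minus[OF N sub_zero[OF N] d] by simp
qed

lemma sub_diff_mem:
  assumes N: "sub V N" and c: "x \<in> carrier V" and d: "y \<in> N" "x \<ominus>\<^bsub>V\<^esub> y \<in> N"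
  shows "x \<in> N"
  using sub_add[OF N d(2,1)] sub_carrier[OF N d(1)] c by (simp add: vs_minus_add sub_vs[OF N])

end

text \<open>\<open>H\<close> is any filtration and not tied to \<open>F\<close> by conjugation. This
  allows exchanging the two, and treating tensor products with no reference to a real
  structure.\<close>

locale opposed_filtrations = base_field S for S :: "complex set" +
  fixes V :: "'a vs" (structure) and W F H :: "int \<Rightarrow> 'a pt set"
  assumes V: "vs V" and W_fil: "increasing_filtration S V W"
    and F_fil: "decreasing_filtration S V F" and H_fil: "decreasing_filtration S V H"
    and opposed: "opposed V W F H"
begin

lemma W: "sub V (W m)" and F: "sub V (F p)" and H: "sub V (H p)"
  using W_fil F_fil H_fil by (auto simp: increasing_filtration_def decreasing_filtration_def)

lemma W_mono: "i \<le> j \<Longrightarrow> x \<in> W i \<Longrightarrow> x \<in> W j"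
  using W_fil by (auto simp: increasing_filtration_def mono_def)

lemma F_mono: "i \<le> j \<Longrightarrow> x \<in> F j \<Longrightarrow> x \<in> F i"
  using F_fil antimonoD[of F i j] by (auto simp: decreasing_filtration_def)

lemma H_mono: "i \<le> j \<Longrightarrow> x \<in> H j \<Longrightarrow> x \<in> H i"
  using H_fil antimonoD[of H i j] by (auto simp: decreasing_filtration_def)

lemmas W_c = sub_carrier[OF W] and F_c = sub_carrier[OF F] and H_c = sub_carrier[OF H]

lemma W_bot: "\<exists>m. W m = {\<zero>}" and W_top: "\<exists>m. W m = carrier V"
  and F_bot: "\<exists>p. F p = {\<zero>}" and F_top: "\<exists>p. F p = carrier V" and H_bot: "\<exists>p. H p = {\<zero>}"
  using W_fil F_fil H_fil by (auto simp: increasing_filtration_def decreasing_filtration_def)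

lemma W_zero: "x \<in> W n \<Longrightarrow> W m = {\<zero>} \<Longrightarrow> n \<le> m \<Longrightarrow> x = \<zero>"
  using W_mono[of n m x] by simp

lemma opposed_split:
  assumes "p + q = m + 1" "x \<in> W m"
  obtains f h w where "f \<in> F p" "f \<in> W m" "h \<in> H q" "h \<in> W m" "w \<in> W (m - 1)" "x = (f \<oplus> h) \<oplus> w"
  using opposed assms unfolding opposed_def by blast

lemma opposed_inter:
  "\<lbrakk>p + q = m + 1; f \<in> F p; f \<in> W m; h \<in> H q; h \<in> W m; f \<ominus> h \<in> W (m - 1)\<rbrakk> \<Longrightarrow> f \<in> W (m - 1)"
  using opposed unfolding opposed_def by blast

text \<open>The splitting condition is symmetric up to the order of f and h. For the other one, f
  and h differ by an element of \<open>W (m - 1)\<close>, so one lies in it as soon as the other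
  does.\<close>

lemma swap: "opposed_filtrations S V W H F"
proof (intro opposed_filtrations.intro base_field_axioms opposed_filtrations_axioms.intro V W_fil F_fil H_fil)
  show "opposed V W H F"
    unfolding opposed_def
  proof (intro allI impI conjI ballI)
    fix m p q x assume pq: "p + q = m + 1" and x: "x \<in> W m"
    have "q + p = m + 1" using pq by simp
    from this x obtain f h w where fhw: "f \<in> F q" "f \<in> W m" "h \<in> H p" "h \<in> W m" "w \<in> W (m - 1)"
        "x = (f \<oplus> h) \<oplus> w"
      by (rule opposed_split)
    moreover have "f \<oplus> h = h \<oplus> f" using fhw F_c H_c by (intro vs_comm[OF V])
    ultimately show "\<exists>f\<in>H p \<inter> W m. \<exists>h\<in>F q \<inter> W m. \<exists>w\<in>W (m - 1). x = (f \<oplus> h) \<oplus> w"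
      by (intro bexI[of _ h] bexI[of _ f] bexI[of _ w]) auto
  next
    fix m p q f h assume pq: "p + q = m + 1" and fh: "f \<in> H p \<inter> W m" "h \<in> F q \<inter> W m"
      and d: "f \<ominus> h \<in> W (m - 1)"
    have "h \<in> W (m - 1)"
      using fh W_c pq sub_diff_sym[OF W _ _ d] by (intro opposed_inter[of q p m h f]) auto
    thus "f \<in> W (m - 1)" using sub_diff_mem[OF W _ _ d] fh W_c by blast
  qed
qed

section \<open>Deligne's subspaces of a space with opposed filtrations\<close>

abbreviation "tail \<equiv> deligne_tail V W H"
abbreviation "I \<equiv> deligne V W F H"

lemma tail_generators: "H q \<inter> W m \<union> (\<Union>j\<in>{2..}. H (q - j + 1) \<inter> W (m - j)) \<subseteq> carrier V"
  using W_c by auto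

lemma tail_sub: "sub V (tail q m)"
  unfolding deligne_tail_def by (rule span_sub[OF V tail_generators])

lemma tail_base: "x \<in> H q \<Longrightarrow> x \<in> W m \<Longrightarrow> x \<in> tail q m"
  and tail_step: "2 \<le> j \<Longrightarrow> x \<in> H (q - j + 1) \<Longrightarrow> x \<in> W (m - j) \<Longrightarrow> x \<in> tail q m"
  unfolding deligne_tail_def using span_superset[OF V tail_generators, of q m] by auto

text \<open>The terms with j > k lie in \<open>W (m - k - 1)\<close>, and all others lie in
  \<open>H (q - k + 1)\<close>, the largest of the steps that occur in them.\<close>

lemma tail_approx:
  assumes x: "x \<in> tail q m" and k: "1 \<le> k"
  obtains h where "h \<in> H (q - k + 1)" "h \<in> W m" "x \<ominus> h \<in> W (m - k - 1)"
proof -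
  let ?M = "(H (q - k + 1) \<inter> W m) <+>\<^bsub>V\<^esub> W (m - k - 1)"
  have M: "sub V ?M" by (intro sub_set_add sub_Int H W)
  have "tail q m \<subseteq> ?M"
    unfolding deligne_tail_def
  proof (rule span_least[OF M], intro Un_least UN_least)
    have "H q \<inter> W m \<subseteq> H (q - k + 1) \<inter> W m" using H_mono[of "q - k + 1" q] k by auto
    also have "\<dots> \<subseteq> ?M" by (intro set_add_left sub_Int H W)
    finally show "H q \<inter> W m \<subseteq> ?M" .
    fix j :: int assume j: "j \<in> {2..}"
    show "H (q - j + 1) \<inter> W (m - j) \<subseteq> ?M"
    proof (cases "j \<le> k")
      case True
      hence "H (q - j + 1) \<inter> W (m - j) \<subseteq> H (q - k + 1) \<inter> W m"
        using H_mono[of "q - k + 1" "q - j + 1"] W_mono[of "m - j" m] j by auto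
      also have "\<dots> \<subseteq> ?M" by (intro set_add_left sub_Int H W)
      finally show ?thesis .
    next
      case False
      hence "H (q - j + 1) \<inter> W (m - j) \<subseteq> W (m - k - 1)"
        using W_mono[of "m - j" "m - k - 1"] by auto
      also have "\<dots> \<subseteq> ?M" by (intro set_add_right sub_Int H W)
      finally show ?thesis .
    qed
  qed
  hence "x \<in> ?M" using x by (rule subsetD)
  then obtain h w where hw: "h \<in> H (q - k + 1)" "h \<in> W m" "w \<in> W (m - k - 1)" "x = h \<oplus> w"
    by (auto simp: set_add_iff)
  have "x \<ominus> h = w" using hw W_c by (simp add: vs_add_minus[OF V] vs_comm[OF V, of h w])
  thus ?thesis using hw that by simp
qed

lemma I_sub: "sub V (I p q)"
  unfolding deligne_def by (intro sub_Int F W tail_sub)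

lemma I_D: "x \<in> I p q \<Longrightarrow> x \<in> F p" "x \<in> I p q \<Longrightarrow> x \<in> W (p + q)" "x \<in> I p q \<Longrightarrow> x \<in> tail q (p + q)"
  by (simp_all add: deligne_def)

text \<open>The case k = 1 of \<open>tail_approx\<close>, with the bound p + q - 2 relaxed to p + q
  - 1: modulo lower weights, x is a class of type (p, q).\<close>

lemma I_approx:
  assumes "x \<in> I p q"
  obtains h where "h \<in> H q" "h \<in> W (p + q)" "x \<ominus> h \<in> W (p + q - 1)"
proof (rule tail_approx[OF I_D(3)[OF assms], of 1])
  fix h assume "h \<in> H (q - 1 + 1)" "h \<in> W (p + q)" "x \<ominus> h \<in> W (p + q - 1 - 1)"
  thus ?thesis using W_mono[of "p + q - 1 - 1" "p + q - 1"] by (intro that[of h]) auto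
qed simp

text \<open>Descent on the weight. If x lies in \<open>W n\<close> with n = p + q - 1 - k, then
  \<open>tail_approx\<close> makes it congruent modulo \<open>W (n - 1)\<close> to an element of
  \<open>H (q - k)\<close>. Since p + (q - k) = n + 1, opposedness moves x into
  \<open>W (n - 1)\<close>, and \<open>W\<close> is eventually zero. Hence \<open>I p q\<close>
  embeds into the graded piece of weight p + q.\<close>

lemma I_inj:
  assumes x: "x \<in> I p q" "x \<in> W (p + q - 1)"
  shows "x = \<zero>"
proof -
  have step: "x \<in> W (p + q - 1 - int k)" for k
  proof (induction k)
    case (Suc k)
    let ?n = "p + q - 1 - int k"
    obtain h where h: "h \<in> H (q - (1 + int k) + 1)" "h \<in> W (p + q)" "x \<ominus> h \<in> W (p + q - (1 + int k) - 1)"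
      by (rule tail_approx[OF I_D(3)[OF x(1)], of "1 + int k"]) auto
    have d: "x \<ominus> h \<in> W (?n - 1)" using h(3) by (simp add: algebra_simps)
    hence "h \<ominus> x \<in> W ?n" using sub_diff_sym[OF W, of x h] W_c[OF h(2)] W_c[OF x(2)] W_mono[of "?n - 1" ?n] by auto
    hence "h \<in> W ?n" using sub_diff_mem[OF W W_c[OF h(2)] Suc] by simp
    hence "x \<in> W (?n - 1)"
      using opposed_inter[of p "q - (1 + int k) + 1" ?n x h] I_D(1)[OF x(1)] Suc h(1) d by simp
    thus ?case by (simp add: algebra_simps)
  qed (use x in simp)
  obtain m where m: "W m = {\<zero>}" using W_bot by blast
  show ?thesis using W_zero[OF step[of "nat (p + q - 1 - m)"] m] by simp
qed

text \<open>Successive approximation: y in \<open>F p\<close> and h in the tail are kept with a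
  difference of weight at most n = p + q - 1 - k. Opposedness splits this difference into a part
  from \<open>F p\<close>, removed from y, a part from \<open>H (q - k)\<close>, added to h, and a
  remainder of weight at most n - 1. When \<open>W\<close> has reached zero, y = h lies in
  both.\<close>

lemma I_surj:
  assumes x: "x \<in> F p" "x \<in> W (p + q)" and h: "h \<in> H q" "h \<in> W (p + q)" and d: "x \<ominus> h \<in> W (p + q - 1)"
  obtains y where "y \<in> I p q" "x \<ominus> y \<in> W (p + q - 1)"
proof -
  let ?m = "p + q"
  have step: "\<exists>y h. y \<in> F p \<and> y \<in> W ?m \<and> h \<in> tail q ?m \<and> x \<ominus> y \<in> W (?m - 1) \<and> y \<ominus> h \<in> W (?m - 1 - int k)" for k
  proof (induction k)
    case 0
    have "x \<ominus> x \<in> W (?m - 1)" using V W_c[OF x(2)] sub_zero[OF W] by simp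
    thus ?case using x d tail_base[OF h] by auto
  next
    case (Suc k)
    let ?n = "?m - 1 - int k"
    obtain y h where y: "y \<in> F p" "y \<in> W ?m" "h \<in> tail q ?m" "x \<ominus> y \<in> W (?m - 1)" "y \<ominus> h \<in> W ?n"
      using Suc by blast
    have "p + (q - int k) = ?n + 1" by simp
    from this y(5) obtain f h1 w where f: "f \<in> F p" "f \<in> W ?n" "h1 \<in> H (q - int k)" "h1 \<in> W ?n" "w \<in> W (?n - 1)"
      and eq: "y \<ominus> h = (f \<oplus> h1) \<oplus> w"
      by (rule opposed_split)
    note c = W_c[OF x(2)] W_c[OF y(2)] sub_carrier[OF tail_sub y(3)] W_c[OF f(2)] W_c[OF f(4)] W_c[OF f(5)]
    \<comment> \<open>For k = 0 the correction lies in \<open>H q\<close> and belongs to the first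
      term of the tail; otherwise it belongs to the term j = k + 1.\<close>
    have h1: "h1 \<in> tail q ?m"
    proof (cases k)
      case 0
      thus ?thesis using f W_mono[of ?n ?m] by (intro tail_base) auto
    next
      case (Suc l)
      thus ?thesis using f by (intro tail_step[of "1 + int k"]) (auto simp: algebra_simps)
    qed
    have "(y \<ominus> f) \<ominus> (h \<oplus> h1) = (y \<ominus> h) \<ominus> (f \<oplus> h1)" using c by (simp add: V vs_diff_simps[OF V] vs_ac[OF V])
    also have "\<dots> = w" unfolding eq using c by (simp add: V vs_diff_simps[OF V] vs_ac[OF V])
    finally have 1: "(y \<ominus> f) \<ominus> (h \<oplus> h1) \<in> W (?m - 1 - int (Suc k))" using f(5) by (simp add: algebra_simps)
    have "x \<ominus> (y \<ominus> f) = (x \<ominus> y) \<oplus> f" using c by (simp add: V vs_diff_simps[OF V] vs_ac[OF V])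
    hence 2: "x \<ominus> (y \<ominus> f) \<in> W (?m - 1)" using sub_add[OF W y(4) W_mono[OF _ f(2)]] by simp
    have "y \<ominus> f \<in> F p" "y \<ominus> f \<in> W ?m"
      using sub_minus[OF F y(1) f(1)] sub_minus[OF W y(2) W_mono[OF _ f(2)]] by auto
    moreover have "h \<oplus> h1 \<in> tail q ?m" by (rule sub_add[OF tail_sub y(3) h1])
    ultimately show ?case using 1 2 by blast
  qed
  obtain m where m: "W m = {\<zero>}" using W_bot by blast
  obtain y h where y: "y \<in> F p" "y \<in> W ?m" "h \<in> tail q ?m" "x \<ominus> y \<in> W (?m - 1)"
    "y \<ominus> h \<in> W (?m - 1 - int (nat (?m - 1 - m)))"
    using step by blast
  hence "y \<ominus> h = \<zero>" by (intro W_zero[OF _ m]) auto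
  hence "y = h" using vs_diff_eq_zero[OF V W_c[OF y(2)] sub_carrier[OF tail_sub y(3)]] by simp
  thus ?thesis using y that[of y] by (simp add: deligne_def)
qed

text \<open>Opposedness for the pair (p + 1, m - p) splits off a part in \<open>F (p + 1)\<close>.
  The rest of x is congruent to an element of \<open>H (m - p)\<close>, so its class has type (p, m
  - p) and \<open>I_surj\<close> lifts it.\<close>

lemma I_step:
  assumes x: "x \<in> F p" "x \<in> W m"
  obtains y f g where "y \<in> I p (m - p)" "f \<in> F (p + 1)" "f \<in> W m" "g \<in> F p" "g \<in> W (m - 1)"
    "x = (y \<oplus> f) \<oplus> g"
proof -
  have "(p + 1) + (m - p) = m + 1" by simp
  from this x(2) obtain f h w where f: "f \<in> F (p + 1)" "f \<in> W m" and h: "h \<in> H (m - p)" "h \<in> W m"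
    and w: "w \<in> W (m - 1)" and eq: "x = (f \<oplus> h) \<oplus> w"
    by (rule opposed_split)
  note c = W_c[OF x(2)] W_c[OF f(2)] W_c[OF h(2)] W_c[OF w]
  have xf: "x \<ominus> f \<in> F p" "x \<ominus> f \<in> W m"
    using sub_minus[OF F x(1) F_mono[OF _ f(1)]] sub_minus[OF W x(2) f(2)] by auto
  have "(x \<ominus> f) \<ominus> h = w" unfolding eq using c by (simp add: V vs_diff_simps[OF V] vs_ac[OF V])
  hence "(x \<ominus> f) \<ominus> h \<in> W (p + (m - p) - 1)" using w by simp
  then obtain y where y: "y \<in> I p (m - p)" "(x \<ominus> f) \<ominus> y \<in> W (p + (m - p) - 1)"
    using xf h by (elim I_surj[of "x \<ominus> f" p "m - p" h, rotated -1]) auto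
  let ?g = "(x \<ominus> f) \<ominus> y"
  have yc: "y \<in> carrier V" using sub_carrier[OF I_sub y(1)] .
  have "x = (y \<oplus> f) \<oplus> ?g" using c yc by (simp add: V vs_diff_simps[OF V] vs_ac[OF V])
  moreover have "?g \<in> F p" by (rule sub_minus[OF F xf(1) I_D(1)[OF y(1)]])
  moreover have "?g \<in> W (m - 1)" using y(2) by simp
  ultimately show ?thesis using that y(1) f by blast
qed

text \<open>Both remainders of \<open>I_step\<close> are handled by induction: one has a larger p,
  the other a smaller m. The measure counts the distances to the indices a and b at which
  \<open>F\<close> and \<open>W\<close> vanish.\<close>

lemma I_generate:
  assumes N: "sub V N" and I: "\<And>r s. \<lbrakk>p \<le> r; r + s \<le> m\<rbrakk> \<Longrightarrow> I r s \<subseteq> N"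
  shows "F p \<inter> W m \<subseteq> N"
proof -
  obtain a where a: "F a = {\<zero>}" using F_bot by blast
  obtain b where b: "W b = {\<zero>}" using W_bot by blast
  show ?thesis using I
  proof (induction "nat (a - p) + nat (m - b)" arbitrary: p m rule: less_induct)
    case less
    show ?case
    proof (cases "a \<le> p \<or> m \<le> b")
      case True
      hence "F p \<inter> W m \<subseteq> {\<zero>}" using a b F_mono[of a p] W_mono[of m b] by auto
      thus ?thesis using sub_zero[OF N] by auto
    next
      case False
      have F': "F (p + 1) \<inter> W m \<subseteq> N" using False by (intro less.hyps less.prems) auto
      have W': "F p \<inter> W (m - 1) \<subseteq> N" using False by (intro less.hyps less.prems) auto
      have I': "I p (m - p) \<subseteq> N" by (intro less.prems) auto
      show ?thesis
      proof
        fix x assume "x \<in> F p \<inter> W m"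
        hence "x \<in> F p" "x \<in> W m" by auto
        then obtain y f g where "y \<in> I p (m - p)" "f \<in> F (p + 1)" "f \<in> W m" "g \<in> F p" "g \<in> W (m - 1)"
          "x = (y \<oplus> f) \<oplus> g" by (rule I_step)
        thus "x \<in> N" using F' W' I' by (auto intro!: sub_add[OF N])
      qed
    qed
  qed
qed

text \<open>Leaves finitely many bidegrees. If \<open>H s\<close> is zero, the approximation in
  \<open>H s\<close> is zero too, so x has lower weight and vanishes by
  \<open>I_inj\<close>.\<close>

lemma I_outside:
  assumes F0: "F a = {\<zero>}" and H0: "H b = {\<zero>}" and W0: "W c = {\<zero>}"
    and rs: "\<not> (r < a \<and> s < b \<and> c < r + s)"
  shows "I r s = {\<zero>}"
proof -
  have "x = \<zero>" if x: "x \<in> I r s" for x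
  proof -
    consider "a \<le> r" | "b \<le> s" | "r + s \<le> c" using rs by linarith
    thus ?thesis
    proof cases
      case 1
      thus ?thesis using F_mono[OF 1 I_D(1)[OF x]] F0 by simp
    next
      case 2
      obtain h where h: "h \<in> H s" "h \<in> W (r + s)" "x \<ominus> h \<in> W (r + s - 1)" using I_approx[OF x] .
      hence "h = \<zero>" using H_mono[OF 2] H0 by auto
      hence "x \<in> W (r + s - 1)" using h(3) V W_c[OF I_D(2)[OF x]] by simp
      thus ?thesis by (rule I_inj[OF x])
    next
      case 3
      thus ?thesis using W_zero[OF I_D(2)[OF x] W0] by simp
    qed
  qed
  thus ?thesis using sub_zero[OF I_sub] by blast
qed

text \<open>A leading term argument. Among the nonzero terms take one, k, of maximal weight m = r k
  + s k and then of minimal r. Every other term lies in \<open>F (r k + 1) \<inter> W m\<close> or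
  in \<open>W (m - 1)\<close>, so \<open>f k\<close> is congruent to an element of
  \<open>F (r k + 1)\<close>. It is also congruent to one of \<open>H (s k)\<close>, and (r k + 1) +
  s k = m + 1, so opposedness lowers its weight and \<open>I_inj\<close> makes it zero.\<close>

lemma I_independent:
  assumes J: "finite J" and inj: "inj_on (\<lambda>i. (r i, s i)) J"
    and f: "\<forall>i\<in>J. f i \<in> I (r i) (s i)" and sum: "finsum V f J = \<zero>" and i: "i \<in> J"
  shows "f i = \<zero>"
proof (rule ccontr)
  assume "f i \<noteq> \<zero>"
  let ?Z = "{i \<in> J. f i \<noteq> \<zero>}"
  let ?m = "Max ((\<lambda>i. r i + s i) ` ?Z)"
  let ?Y = "{i \<in> ?Z. r i + s i = ?m}"
  have Z: "finite ?Z" "?Z \<noteq> {}" using J i \<open>f i \<noteq> \<zero>\<close> by auto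
  have m: "r j + s j \<le> ?m" if "j \<in> ?Z" for j using Z that by (intro Max_ge) auto
  have "?m \<in> (\<lambda>i. r i + s i) ` ?Z" using Z by (intro Max_in) auto
  hence "?Y \<noteq> {}" by auto
  moreover have "finite ?Y" using Z(1) by (rule rev_finite_subset) auto
  ultimately have Y: "finite ?Y" "?Y \<noteq> {}" by simp_all
  from Y have "Min (r ` ?Y) \<in> r ` ?Y" by (intro Min_in) auto
  then obtain k where k: "k \<in> ?Y" "r k = Min (r ` ?Y)" by auto
  have rk: "r k < r j" if "j \<in> ?Y" "j \<noteq> k" for j
  proof -
    have "r k \<le> r j" unfolding k(2) using Y(1) that(1) by (intro Min_le) auto
    moreover have "r k \<noteq> r j" using inj k(1) that by (auto dest!: inj_onD)
    ultimately show ?thesis by simp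
  qed
  have kJ: "k \<in> J" "f k \<noteq> \<zero>" and mk: "?m = r k + s k" using k(1) by auto
  have fI: "f j \<in> I (r j) (s j)" if "j \<in> J" for j using f that by blast
  have fc: "f j \<in> carrier V" if "j \<in> J" for j using sub_carrier[OF I_sub fI[OF that]] .
  let ?M = "(F (r k + 1) \<inter> W ?m) <+>\<^bsub>V\<^esub> W (?m - 1)"
  have M: "sub V ?M" by (intro sub_set_add sub_Int F W)
  have "f j \<in> ?M" if j: "j \<in> J - {k}" for j
  proof -
    consider "f j = \<zero>" | "j \<in> ?Z" "r j + s j < ?m" | "j \<in> ?Y" using m[of j] j by fastforce
    thus ?thesis
    proof cases
      case 1
      thus ?thesis using sub_zero[OF M] by simp
    next
      case 2
      hence "f j \<in> W (?m - 1)" using I_D(2)[OF fI, of j] W_mono[of "r j + s j" "?m - 1"] j by auto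
      thus ?thesis using set_add_right[OF sub_Int[OF F W] W] by blast
    next
      case 3
      hence "f j \<in> F (r k + 1) \<inter> W ?m"
        using rk[of j] j I_D(1,2)[OF fI, of j] F_mono[of "r k + 1" "r j" "f j"] by auto
      thus ?thesis using set_add_left[OF sub_Int[OF F W] W] by blast
    qed
  qed
  hence rest: "finsum V f (J - {k}) \<in> ?M" using J by (intro finsum_in_sub[OF M]) auto
  have "finsum V f (insert k (J - {k})) = f k \<oplus> finsum V f (J - {k})"
    using J fc kJ by (intro finsum_vs_insert[OF V]) auto
  hence "f k \<oplus> finsum V f (J - {k}) = \<zero>" using sum kJ(1) by (simp add: insert_absorb)
  hence "f k \<oplus> finsum V f (J - {k}) \<in> ?M" using sub_zero[OF M] by simp
  hence "f k \<in> ?M" using sub_add_cancel[OF M _ rest fc[OF kJ(1)]] by simp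
  then obtain a w where aw: "a \<in> F (r k + 1)" "a \<in> W ?m" "w \<in> W (?m - 1)" "f k = a \<oplus> w"
    by (auto simp: set_add_iff)
  obtain h where h: "h \<in> H (s k)" "h \<in> W ?m" "f k \<ominus> h \<in> W (?m - 1)"
    unfolding mk using I_approx[OF fI[OF kJ(1)]] .
  have "a \<ominus> h = ((a \<oplus> w) \<ominus> h) \<ominus> w" using W_c[OF aw(2)] W_c[OF aw(3)] W_c[OF h(2)] by (simp add: V vs_diff_simps[OF V] vs_ac[OF V])
  hence "a \<ominus> h \<in> W (?m - 1)" using sub_minus[OF W h(3) aw(3)] aw(4) by simp
  hence "a \<in> W (?m - 1)" using aw h mk by (intro opposed_inter[of "r k + 1" "s k" ?m a h]) auto
  hence "f k \<in> W (?m - 1)" using aw sub_add[OF W] by simp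
  thus False using I_inj[OF fI[OF kJ(1)]] kJ(2) mk by simp
qed

text \<open>The index set is abstract and only put in bijection with the bidegrees that
  \<open>I_outside\<close> leaves over. One \<open>J\<close> can therefore index this splitting and
  also the one with \<open>F\<close> and \<open>H\<close> exchanged, whose bidegrees are the
  reversed pairs.\<close>

lemma splitting:
  assumes F0: "F a = {\<zero>}" and H0: "H b = {\<zero>}" and W0: "W c = {\<zero>}" and J: "finite J"
    and bij: "bij_betw (\<lambda>i. (r i, s i)) J {(x, y). x < a \<and> y < b \<and> c < x + y}"
  obtains \<pi> where "proj_system V J \<pi>"
    "\<And>i. i \<in> J \<Longrightarrow> I (r i) (s i) = supported V J \<pi> (\<lambda>j. j = i)"
    "\<And>n. W n = supported V J \<pi> (\<lambda>i. r i + s i \<le> n)"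
    "\<And>p. F p = supported V J \<pi> (\<lambda>i. p \<le> r i)"
    "\<And>n. span V (\<Union>p. I p (n - p)) = supported V J \<pi> (\<lambda>i. r i + s i = n)"
proof -
  have inj: "inj_on (\<lambda>i. (r i, s i)) J" using bij by (simp add: bij_betw_def)
  have idx: "I x y = {\<zero>} \<or> (\<exists>i\<in>J. x = r i \<and> y = s i)" for x y
  proof (cases "x < a \<and> y < b \<and> c < x + y")
    case True
    hence "(x, y) \<in> (\<lambda>i. (r i, s i)) ` J" using bij by (simp add: bij_betw_def)
    thus ?thesis by auto
  next
    case False
    thus ?thesis using I_outside[OF F0 H0 W0] by simp
  qed
  obtain p0 where p0: "F p0 = carrier V" using F_top by blast
  obtain m0 where m0: "W m0 = carrier V" using W_top by blast
  have ex: "\<exists>f. (\<forall>i\<in>J. f i \<in> I (r i) (s i)) \<and> v = finsum V f J" if "v \<in> carrier V" for v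
  proof -
    let ?M = "{finsum V f J |f. \<forall>i\<in>J. f i \<in> I (r i) (s i)}"
    have M: "sub V ?M" by (rule finsum_family_sub[OF V J I_sub])
    have "F p0 \<inter> W m0 \<subseteq> ?M"
    proof (rule I_generate[OF M])
      fix x y
      show "I x y \<subseteq> ?M"
        using idx[of x y]
      proof
        assume "\<exists>i\<in>J. x = r i \<and> y = s i"
        then obtain i where "i \<in> J" "x = r i" "y = s i" by blast
        thus ?thesis using finsum_family_member[OF V J I_sub, of i r s] by simp
      qed (use sub_zero[OF M] in simp)
    qed
    thus ?thesis using that p0 m0 by auto
  qed
  obtain \<pi> where \<pi>: "proj_system V J \<pi>" and I_supp: "\<And>i. i \<in> J \<Longrightarrow> I (r i) (s i) = supported V J \<pi> (\<lambda>j. j = i)"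
  proof (rule decomposition_proj_system[OF V J, of "\<lambda>i. I (r i) (s i)"])
    show "f i = \<zero>" if "\<forall>i\<in>J. f i \<in> I (r i) (s i)" "finsum V f J = \<zero>" "i \<in> J" for f i
      using that by (rule I_independent[OF J inj])
  qed (rule I_sub, erule ex, rule that)
  have I_sup: "I x y \<subseteq> supported V J \<pi> Q" if "\<And>i. i \<in> J \<Longrightarrow> x = r i \<Longrightarrow> y = s i \<Longrightarrow> Q i" for x y Q
    using idx[of x y]
  proof
    assume "I x y = {\<zero>}"
    thus ?thesis using sub_zero[OF supported_sub[OF \<pi>]] by simp
  next
    assume "\<exists>i\<in>J. x = r i \<and> y = s i"
    then obtain i where "i \<in> J" "x = r i" "y = s i" by blast
    thus ?thesis using I_supp[of i] that[of i] by (auto simp: supported_def)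
  qed
  have \<pi>I: "\<pi> i v \<in> I (r i) (s i)" if "i \<in> J" "v \<in> carrier V" for i v
    unfolding I_supp[OF that(1)] using that by (intro proj_supported[OF \<pi>]) auto
  have 1: "W n = supported V J \<pi> (\<lambda>i. r i + s i \<le> n)" for n
  proof
    have "F p0 \<inter> W n \<subseteq> supported V J \<pi> (\<lambda>i. r i + s i \<le> n)"
      by (rule I_generate[OF supported_sub[OF \<pi>]]) (auto intro!: I_sup)
    thus "W n \<subseteq> supported V J \<pi> (\<lambda>i. r i + s i \<le> n)" using p0 sub_subset[OF W, of n] by blast
    show "supported V J \<pi> (\<lambda>i. r i + s i \<le> n) \<subseteq> W n"
    proof
      fix v assume v: "v \<in> supported V J \<pi> (\<lambda>i. r i + s i \<le> n)"
      hence "v \<in> carrier V" by (simp add: supported_def)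
      thus "v \<in> W n" using \<pi>I I_D(2) W_mono by (intro supported_subset[OF \<pi> W v]) blast
    qed
  qed
  have 2: "F p = supported V J \<pi> (\<lambda>i. p \<le> r i)" for p
  proof
    have "F p \<inter> W m0 \<subseteq> supported V J \<pi> (\<lambda>i. p \<le> r i)"
      by (rule I_generate[OF supported_sub[OF \<pi>]]) (auto intro!: I_sup)
    thus "F p \<subseteq> supported V J \<pi> (\<lambda>i. p \<le> r i)" using m0 sub_subset[OF F, of p] by blast
    show "supported V J \<pi> (\<lambda>i. p \<le> r i) \<subseteq> F p"
    proof
      fix v assume v: "v \<in> supported V J \<pi> (\<lambda>i. p \<le> r i)"
      hence "v \<in> carrier V" by (simp add: supported_def)
      thus "v \<in> F p" using \<pi>I I_D(1) F_mono by (intro supported_subset[OF \<pi> F v]) blast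
    qed
  qed
  have 3: "span V (\<Union>p. I p (n - p)) = supported V J \<pi> (\<lambda>i. r i + s i = n)" for n
  proof (rule span_supported[OF \<pi>])
    show "(\<Union>p. I p (n - p)) \<subseteq> supported V J \<pi> (\<lambda>i. r i + s i = n)"
      by (intro UN_least I_sup) auto
    show "\<pi> i v \<in> (\<Union>p. I p (n - p))" if "i \<in> J" "r i + s i = n" "v \<in> carrier V" for i v
    proof -
      have "s i = n - r i" using that by simp
      thus ?thesis using \<pi>I[OF that(1,3)] by (intro UN_I[of "r i"]) auto
    qed
  qed
  show ?thesis using that[OF \<pi> I_supp 1 2 3] .
qed

text \<open>Both splittings represent the same classes of type (r, s): y lies in \<open>H s\<close>
  and is congruent to some f in \<open>F r\<close>, from which \<open>I_surj\<close> produces a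
  congruent x in \<open>I r s\<close>.\<close>

lemma splitting_compare:
  assumes y: "y \<in> deligne V W H F s r"
  shows "y \<in> I r s <+>\<^bsub>V\<^esub> W (r + s - 1)"
proof -
  interpret X: opposed_filtrations S V W H F by (rule swap)
  obtain f where f: "f \<in> F r" "f \<in> W (s + r)" "y \<ominus> f \<in> W (s + r - 1)" using X.I_approx[OF y] .
  have y': "y \<in> H s" "y \<in> W (s + r)" using X.I_D[OF y] by auto
  have c: "y \<in> carrier V" "f \<in> carrier V" using W_c y'(2) f(2) by auto
  obtain x where x: "x \<in> I r s" "f \<ominus> x \<in> W (r + s - 1)"
    by (rule I_surj[of f r s y]) (use f y' sub_diff_sym[OF W c f(3)] in \<open>auto simp: add.commute\<close>)
  have xc: "x \<in> carrier V" using sub_carrier[OF I_sub x(1)] .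
  have "y \<ominus> x \<in> W (r + s - 1)" using sub_diff_trans[OF W c xc _ x(2)] f(3) by (simp add: add.commute)
  moreover have "y = x \<oplus> (y \<ominus> x)"
    using vs_minus_add[OF V c(1) xc] vs_comm[OF V xc, of "y \<ominus> x"] V c xc by simp
  ultimately show ?thesis using x(1) by (auto simp: set_add_iff)
qed

end

subsection \<open>Tensor products of opposed filtrations\<close>

context base_field
begin

text \<open>Opposedness of three filtrations is equivalent to the existence of two bigradings, both adapted to
  \<open>W\<close> and one adapted to each of \<open>F\<close> and \<open>H\<close>, that agree on the graded pieces of \<open>W\<close>. Unlike
  opposedness itself, this is visibly stable under tensor products.\<close>

definition split_opposed :: "'a vs \<Rightarrow> (int \<Rightarrow> 'a pt set) \<Rightarrow> (int \<Rightarrow> 'a pt set) \<Rightarrow> (int \<Rightarrow> 'a pt set)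
    \<Rightarrow> 'i set \<Rightarrow> ('i \<Rightarrow> int) \<Rightarrow> ('i \<Rightarrow> int) \<Rightarrow> ('i \<Rightarrow> 'a pt \<Rightarrow> 'a pt) \<Rightarrow> ('i \<Rightarrow> 'a pt \<Rightarrow> 'a pt) \<Rightarrow> bool" where
  "split_opposed V W F H J r s \<pi> \<pi>' \<longleftrightarrow> proj_system V J \<pi> \<and> proj_system V J \<pi>' \<and>
     (\<forall>n. W n = supported V J \<pi> (\<lambda>i. r i + s i \<le> n)) \<and> (\<forall>n. W n = supported V J \<pi>' (\<lambda>i. r i + s i \<le> n)) \<and>
     (\<forall>p. F p = supported V J \<pi> (\<lambda>i. p \<le> r i)) \<and> (\<forall>q. H q = supported V J \<pi>' (\<lambda>i. q \<le> s i)) \<and>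
     (\<forall>i\<in>J. \<forall>v\<in>carrier V. \<pi>' i v \<in> supported V J \<pi> (\<lambda>j. j = i) <+>\<^bsub>V\<^esub> W (r i + s i - 1)) \<and>
     (\<forall>i\<in>J. \<forall>v\<in>carrier V. \<pi> i v \<in> supported V J \<pi>' (\<lambda>j. j = i) <+>\<^bsub>V\<^esub> W (r i + s i - 1))"

lemma split_opposedD:
  assumes "split_opposed V W F H J r s \<pi> \<pi>'"
  shows "proj_system V J \<pi>" "proj_system V J \<pi>'"
    "W n = supported V J \<pi> (\<lambda>i. r i + s i \<le> n)" "W n = supported V J \<pi>' (\<lambda>i. r i + s i \<le> n)"
    "F p = supported V J \<pi> (\<lambda>i. p \<le> r i)" "H q = supported V J \<pi>' (\<lambda>i. q \<le> s i)"
    "\<lbrakk>i \<in> J; v \<in> carrier V\<rbrakk> \<Longrightarrow> \<pi>' i v \<in> supported V J \<pi> (\<lambda>j. j = i) <+>\<^bsub>V\<^esub> W (r i + s i - 1)"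
    "\<lbrakk>i \<in> J; v \<in> carrier V\<rbrakk> \<Longrightarrow> \<pi> i v \<in> supported V J \<pi>' (\<lambda>j. j = i) <+>\<^bsub>V\<^esub> W (r i + s i - 1)"
  using assms by (auto simp only: split_opposed_def)

lemma supported_mono: "(\<And>i. i \<in> J \<Longrightarrow> Q i \<Longrightarrow> Q' i) \<Longrightarrow> supported V J \<pi> Q \<subseteq> supported V J \<pi> Q'"
  by (auto simp: supported_def)

text \<open>If p + q = m + 1, an index of weight m = r i + s i satisfies exactly one of
  \<open>p \<le> r i\<close> and \<open>q \<le> s i\<close>. At least one gives the decomposition of
  \<open>W m\<close>; at most one gives the vanishing of the intersection.\<close>

lemma split_opposed_imp_opposed:
  fixes V (structure)
  assumes sp: "split_opposed V W F H J r s \<pi> \<pi>'"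
  shows "opposed V W F H"
  unfolding opposed_def
proof (intro allI impI conjI ballI)
  note D = split_opposedD[OF sp]
  note P = proj_systemD[OF D(1)] and P' = proj_systemD[OF D(2)]
  have W: "sub V (W n)" for n unfolding D(3) by (rule supported_sub[OF D(1)])
  have F: "sub V (F p)" for p unfolding D(5) by (rule supported_sub[OF D(1)])
  have H: "sub V (H q)" for q unfolding D(6) by (rule supported_sub[OF D(2)])
  fix m p q :: int assume pq: "p + q = m + 1"
  {
    fix x assume x: "x \<in> W m"
    let ?M = "((F p \<inter> W m) <+>\<^bsub>V\<^esub> (H q \<inter> W m)) <+>\<^bsub>V\<^esub> W (m - 1)"
    have sums: "sub V (F p \<inter> W m)" "sub V (H q \<inter> W m)" "sub V (W (m - 1))"
      "sub V ((F p \<inter> W m) <+>\<^bsub>V\<^esub> (H q \<inter> W m))"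
      by (intro sub_set_add sub_Int F H W)+
    have M: "sub V ?M" by (intro sub_set_add sub_Int F H W)
    have low: "W (m - 1) \<subseteq> ?M" by (rule set_add_right[OF sums(4,3)])
    have FM: "F p \<inter> W m \<subseteq> ?M" using set_add_left[OF sums(1,2)] set_add_left[OF sums(4,3)] by (rule order_trans)
    have HM: "H q \<inter> W m \<subseteq> ?M" using set_add_right[OF sums(1,2)] set_add_left[OF sums(4,3)] by (rule order_trans)
    have c: "x \<in> carrier V" using sub_carrier[OF W x] .
    have "x \<in> supported V J \<pi> (\<lambda>i. r i + s i \<le> m)" using x D(3) by simp
    hence "x \<in> ?M"
    proof (rule supported_subset[OF D(1) M])
      fix i assume i: "i \<in> J" "r i + s i \<le> m"
      consider "r i + s i \<le> m - 1" | "r i + s i = m" "p \<le> r i" | "r i + s i = m" "q \<le> s i"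
        using i(2) pq by linarith
      thus "\<pi> i x \<in> ?M"
      proof cases
        case 1
        hence "\<pi> i x \<in> W (m - 1)" unfolding D(3) using i c by (intro proj_supported[OF D(1)])
        thus ?thesis using low by blast
      next
        case 2
        have "\<pi> i x \<in> F p" unfolding D(5) using i 2 c by (intro proj_supported[OF D(1)])
        moreover have "\<pi> i x \<in> W m" unfolding D(3) using i 2 c by (intro proj_supported[OF D(1)]) auto
        ultimately show ?thesis using FM by blast
      next
        case 3
        \<comment> \<open>\<open>\<pi>\<close> is adapted to \<open>F\<close> only. Up to lower
          weight, its component can be exchanged for one in the summand i of \<open>\<pi>'\<close>,
          which lies in \<open>H q\<close>.\<close>
        have "\<pi> i x \<in> supported V J \<pi>' (\<lambda>j. j = i) <+>\<^bsub>V\<^esub> W (r i + s i - 1)" by (rule D(8)[OF i(1) c])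
        then obtain y w where yw: "y \<in> supported V J \<pi>' (\<lambda>j. j = i)" "w \<in> W (m - 1)" "\<pi> i x = y \<oplus> w"
          using 3 by (auto simp: set_add_iff)
        have "y \<in> H q" unfolding D(6) using yw(1) 3 supported_mono[of J "\<lambda>j. j = i" "\<lambda>i. q \<le> s i"] by blast
        moreover have "y \<in> W m"
          unfolding D(4) using yw(1) 3 supported_mono[of J "\<lambda>j. j = i" "\<lambda>i. r i + s i \<le> m"] by blast
        ultimately have "y \<in> ?M" using HM by blast
        moreover have "w \<in> ?M" using yw(2) low by blast
        ultimately show ?thesis using sub_add[OF M] yw(3) by simp
      qed
    qed
    then obtain y w where "y \<in> (F p \<inter> W m) <+>\<^bsub>V\<^esub> (H q \<inter> W m)" "w \<in> W (m - 1)" "x = y \<oplus> w"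
      unfolding set_add_iff[of x] by blast
    thus "\<exists>f\<in>F p \<inter> W m. \<exists>h\<in>H q \<inter> W m. \<exists>w\<in>W (m - 1). x = (f \<oplus> h) \<oplus> w"
      unfolding set_add_iff[of y] by blast
  next
    fix f h assume f: "f \<in> F p \<inter> W m" and h: "h \<in> H q \<inter> W m" and d: "f \<ominus> h \<in> W (m - 1)"
    have c: "f \<in> carrier V" "h \<in> carrier V" using f h sub_carrier[OF W] by auto
    have "\<pi> i f = \<zero>" if i: "i \<in> J" "\<not> r i + s i \<le> m - 1" for i
    proof -
      consider "m < r i + s i" | "r i + s i = m" "r i < p" | "r i + s i = m" "s i < q"
        using i(2) pq by linarith
      thus ?thesis
      proof cases
        case 1
        thus ?thesis using f i unfolding D(3) by (auto simp: supported_def)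
      next
        case 2
        thus ?thesis using f i unfolding D(5) by (auto simp: supported_def)
      next
        case 3
        \<comment> \<open>\<open>\<pi> i\<close> vanishes on h: the \<open>\<pi>'\<close>-components
          of h have indices j with \<open>q \<le> s j\<close>, hence different from i. Passing from
          \<open>\<pi>' j\<close> to \<open>\<pi> j\<close> costs a term of weight below m, where
          \<open>\<pi> i\<close> is zero as well.\<close>
        let ?N = "{v \<in> carrier V. \<pi> i v \<in> {\<zero>}}"
        have N: "sub V ?N" by (rule lin_vimage_sub[OF P(3)[OF i(1)] P(1) P(1) sub_zero_space[OF P(1)]])
        have "h \<in> supported V J \<pi>' (\<lambda>j. q \<le> s j \<and> r j + s j \<le> m)"
          using h unfolding D(6) D(4) by (auto simp: supported_def)
        hence "h \<in> ?N"
        proof (rule supported_subset[OF D(2) N])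
          fix j assume j: "j \<in> J" "q \<le> s j \<and> r j + s j \<le> m"
          have "\<pi>' j h \<in> supported V J \<pi> (\<lambda>k. k = j) <+>\<^bsub>V\<^esub> W (r j + s j - 1)" by (rule D(7)[OF j(1) c(2)])
          then obtain y w where yw: "y \<in> supported V J \<pi> (\<lambda>k. k = j)" "w \<in> W (r j + s j - 1)" "\<pi>' j h = y \<oplus> w"
            by (auto simp: set_add_iff)
          have "\<pi> i y = \<zero>" using yw(1) i(1) j 3 by (auto simp: supported_def)
          moreover have "\<pi> i w = \<zero>" using yw(2) i(1) j 3 unfolding D(3) by (auto simp: supported_def)
          moreover have "y \<in> carrier V" "w \<in> carrier V" using yw unfolding D(3) by (auto simp: supported_def)
          ultimately show "\<pi>' j h \<in> ?N" using yw(3) P i(1) by (simp add: lin_add[OF P(3)])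
        qed
        hence "\<pi> i h = \<zero>" by simp
        moreover have "\<pi> i (f \<ominus> h) = \<zero>" using d i unfolding D(3) by (simp add: supported_def)
        ultimately show ?thesis using c P(1,6) i(1) by (simp add: lin_minus[OF P(3) P(1) P(1)])
      qed
    qed
    thus "f \<in> W (m - 1)" unfolding D(3) using c by (simp add: supported_def)
  }
qed

lemma split_opposed_swap:
  "split_opposed V W F H J r s \<pi> \<pi>' \<Longrightarrow> split_opposed V W H F J s r \<pi>' \<pi>"
  unfolding split_opposed_def add.commute[of "s i" "r i" for i] by (elim conjE) (intro conjI; assumption)

text \<open>Bidegrees add up, so \<open>tensor_family_supported\<close> yields every condition on
  the filtrations. To compare the two bigradings, write the components as x + a and y + b with a and
  b of lower weight: the product is x \<otimes> y up to x \<otimes> b and a \<otimes> (y + b), which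
  have lower weight.\<close>

lemma split_opposed_tensor:
  fixes V' (structure)
  assumes sp: "split_opposed V W F H J r s \<pi> \<pi>'" and sq: "split_opposed V' W' F' H' J' r' s' \<rho> \<rho>'"
  shows "split_opposed (tensor S V V') (tensor_family S V V' W W') (tensor_family S V V' F F')
    (tensor_family S V V' H H') (J \<times> J') (\<lambda>(i, j). r i + r' j) (\<lambda>(i, j). s i + s' j)
    (\<lambda>(i, j). tensor_map S V V' V V' (\<pi> i) (\<rho> j)) (\<lambda>(i, j). tensor_map S V V' V V' (\<pi>' i) (\<rho>' j))"
proof -
  let ?T = "tensor S V V'" and ?W = "tensor_family S V V' W W'"
  have W_cond: "(\<lambda>(i, j). \<exists>a b. a + b = n \<and> r i + s i \<le> a \<and> r' j + s' j \<le> b)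
      = (\<lambda>i. (case i of (i, j) \<Rightarrow> r i + r' j) + (case i of (i, j) \<Rightarrow> s i + s' j) \<le> n)" for n
  proof (rule ext, clarsimp)
    fix i j
    show "(\<exists>a b. a + b = n \<and> r i + s i \<le> a \<and> r' j + s' j \<le> b) = (r i + r' j + (s i + s' j) \<le> n)"
      by presburger
  qed
  have FH_cond: "(\<lambda>(i, j). \<exists>a b. a + b = n \<and> a \<le> r i \<and> b \<le> r' j) = (\<lambda>i. n \<le> (case i of (i, j) \<Rightarrow> r i + r' j))"
    for n :: int and r :: "'b \<Rightarrow> int" and r' :: "'c \<Rightarrow> int"
  proof (rule ext, clarsimp)
    fix i j
    show "(\<exists>a b. a + b = n \<and> a \<le> r i \<and> b \<le> r' j) = (n \<le> r i + r' j)"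
      by presburger
  qed
  \<comment> \<open>The data other than \<open>W\<close> and \<open>W'\<close> are quantified here,
    since the comparison is used a second time with the two bigradings exchanged.\<close>
  have compare: "tensor_map S V V' V V' (\<pi>' i) (\<rho>' j) t
      \<in> supported ?T (J \<times> J') (\<lambda>(i, j). tensor_map S V V' V V' (\<pi> i) (\<rho> j)) (\<lambda>k. k = (i, j))
        <+>\<^bsub>?T\<^esub> ?W (r i + r' j + (s i + s' j) - 1)"
    if sp: "split_opposed V W F H J r s \<pi> \<pi>'" and sq: "split_opposed V' W' F' H' J' r' s' \<rho> \<rho>'"
      and ij: "i \<in> J" "j \<in> J'" and t: "t \<in> carrier ?T"
    for F H r s \<pi> \<pi>' F' H' r' s' \<rho> \<rho>' i j t
  proof -
    note D = split_opposedD[OF sp] and E = split_opposedD[OF sq]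
    note P = proj_systemD[OF D(1)] and P' = proj_systemD[OF D(2)]
      and R = proj_systemD[OF E(1)] and R' = proj_systemD[OF E(2)]
    let ?m = "tensor_map S V V' V V' (\<pi>' i) (\<rho>' j)"
    let ?X = "supported ?T (J \<times> J') (\<lambda>(i, j). tensor_map S V V' V V' (\<pi> i) (\<rho> j)) (\<lambda>k. k = (i, j))"
    let ?n = "r i + r' j + (s i + s' j)"
    have T: "vs ?T" using P(1) R(1) by simp
    have fam: "family V W" "family V' W'" unfolding D(3) E(3) by (simp_all add: supported_sub[OF D(1)] supported_sub[OF E(1)])
    have X: "sub ?T ?X" by (rule supported_sub[OF proj_system_tensor[OF D(1) E(1)]])
    have Wn: "sub ?T (?W n)" for n by (rule tensor_family_sub[OF P(1) R(1) fam])
    have M: "sub ?T (?X <+>\<^bsub>?T\<^esub> ?W (?n - 1))" by (rule sub_set_add[OF X Wn])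
    have m: "?m \<in> lin ?T ?T" using P(1) R(1) P'(3)[OF ij(1)] R'(3)[OF ij(2)]
      by (intro tensor_map_linear[THEN linear_maps_lin])
    show ?thesis using t
    proof (induction rule: tensor_induct)
      case zero
      thus ?case using sub_zero[OF M] lin_zero[OF m T T] by simp
    next
      case (pure v w)
      obtain x a where x: "x \<in> supported V J \<pi> (\<lambda>j. j = i)" "a \<in> W (r i + s i - 1)" "\<pi>' i v = x \<oplus>\<^bsub>V\<^esub> a"
        using D(7)[OF ij(1) pure(1)] by (auto simp: set_add_iff)
      obtain y b where y: "y \<in> supported V' J' \<rho> (\<lambda>k. k = j)" "b \<in> W' (r' j + s' j - 1)" "\<rho>' j w = y \<oplus> b"
        using E(7)[OF ij(2) pure(2)] by (auto simp: set_add_iff)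
      have c: "x \<in> carrier V" "a \<in> carrier V" "y \<in> carrier V'" "b \<in> carrier V'"
        using x y sub_carrier[OF fam(1)[rule_format]] sub_carrier[OF fam(2)[rule_format]] by (auto simp: supported_def)
      have wx: "x \<in> W (r i + s i)" "\<pi>' i v \<in> W (r i + s i)" "y \<in> W' (r' j + s' j)"
        using x(1) y(1) P'(6) pure ij proj_supported[OF D(2), of i "\<lambda>k. r k + s k \<le> r i + s i" v]
        unfolding D(3)[of "r i + s i"] D(4)[of "r i + s i", symmetric] E(3)[of "r' j + s' j"]
        by (auto simp: supported_def D(4))
      let ?p = "pure_tensor S V V'"
      have "?p x y \<in> ?X"
        unfolding supported_def
      proof (intro CollectI conjI ballI impI)
        show "?p x y \<in> carrier ?T" using c by simp
        fix k assume k: "k \<in> J \<times> J'" "k \<noteq> (i, j)"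
        obtain k1 k2 where kk: "k = (k1, k2)" by (cases k)
        have "\<pi> k1 x = \<zero>\<^bsub>V\<^esub> \<or> \<rho> k2 y = \<zero>" using k kk x(1) y(1) by (auto simp: supported_def)
        thus "(case k of (i, j) \<Rightarrow> tensor_map S V V' V V' (\<pi> i) (\<rho> j)) (?p x y) = \<zero>\<^bsub>?T\<^esub>"
          using c k kk P(1,3,6) R(1,3,6)
          by (auto simp: tensor_map_pure pure_zero_left pure_zero_right)
      qed
      moreover have "?p x b \<in> ?W (?n - 1)" "?p a (\<rho>' j w) \<in> ?W (?n - 1)"
      proof -
        show "?p x b \<in> ?W (?n - 1)"
          using wx(1) y(2) by (intro pure_in_tensor_family[OF P(1) R(1) fam]) auto
        have "\<rho>' j w \<in> W' (r' j + s' j)"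
          unfolding E(4) using ij pure by (intro proj_supported[OF E(2)]) auto
        thus "?p a (\<rho>' j w) \<in> ?W (?n - 1)"
          using x(2) by (intro pure_in_tensor_family[OF P(1) R(1) fam]) auto
      qed
      moreover have "?m (?p v w) = ?p x y \<oplus>\<^bsub>?T\<^esub> (?p x b \<oplus>\<^bsub>?T\<^esub> ?p a (\<rho>' j w))"
      proof -
        have "?m (?p v w) = ?p (x \<oplus>\<^bsub>V\<^esub> a) (\<rho>' j w)"
          using x(3) P(1) R(1) P'(3)[OF ij(1)] R'(3)[OF ij(2)] pure by (simp add: tensor_map_pure)
        also have "\<dots> = ?p x (y \<oplus> b) \<oplus>\<^bsub>?T\<^esub> ?p a (\<rho>' j w)"
          using c P(1) R(1) R'(6)[OF ij(2)] pure y(3) by (simp add: pure_add_left)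
        also have "?p x (y \<oplus> b) = ?p x y \<oplus>\<^bsub>?T\<^esub> ?p x b"
          using c P(1) R(1) by (simp add: pure_add_right)
        finally show ?thesis using c P(1) R(1) R'(6)[OF ij(2)] pure by (simp add: vs_assoc[OF T])
      qed
      ultimately show ?case unfolding set_add_iff
        by (intro bexI[of _ "?p x y"] bexI[of _ "?p x b \<oplus>\<^bsub>?T\<^esub> ?p a (\<rho>' j w)"] sub_add[OF Wn])
    next
      case (add s t)
      thus ?case using sub_add[OF M] by (simp add: lin_add[OF m])
    qed
  qed
  note D = split_opposedD[OF sp] and E = split_opposedD[OF sq]
  show ?thesis
    unfolding split_opposed_def
  proof (intro conjI allI)
    show "proj_system ?T (J \<times> J') (\<lambda>(i, j). tensor_map S V V' V V' (\<pi> i) (\<rho> j))"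
      "proj_system ?T (J \<times> J') (\<lambda>(i, j). tensor_map S V V' V V' (\<pi>' i) (\<rho>' j))"
      by (rule proj_system_tensor[OF D(1) E(1)], rule proj_system_tensor[OF D(2) E(2)])
    fix n
    show "?W n = supported ?T (J \<times> J') (\<lambda>(i, j). tensor_map S V V' V V' (\<pi> i) (\<rho> j))
        (\<lambda>i. (case i of (i, j) \<Rightarrow> r i + r' j) + (case i of (i, j) \<Rightarrow> s i + s' j) \<le> n)"
      unfolding W_cond[symmetric] by (rule tensor_family_supported[OF D(1) E(1) D(3) E(3)])
    show "?W n = supported ?T (J \<times> J') (\<lambda>(i, j). tensor_map S V V' V V' (\<pi>' i) (\<rho>' j))
        (\<lambda>i. (case i of (i, j) \<Rightarrow> r i + r' j) + (case i of (i, j) \<Rightarrow> s i + s' j) \<le> n)"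
      unfolding W_cond[symmetric] by (rule tensor_family_supported[OF D(2) E(2) D(4) E(4)])
    show "tensor_family S V V' F F' n = supported ?T (J \<times> J') (\<lambda>(i, j). tensor_map S V V' V V' (\<pi> i) (\<rho> j))
        (\<lambda>i. n \<le> (case i of (i, j) \<Rightarrow> r i + r' j))"
      unfolding FH_cond[symmetric] by (rule tensor_family_supported[OF D(1) E(1) D(5) E(5)])
    show "tensor_family S V V' H H' n = supported ?T (J \<times> J') (\<lambda>(i, j). tensor_map S V V' V V' (\<pi>' i) (\<rho>' j))
        (\<lambda>i. n \<le> (case i of (i, j) \<Rightarrow> s i + s' j))"
      unfolding FH_cond[symmetric] by (rule tensor_family_supported[OF D(2) E(2) D(6) E(6)])
  next
    show "\<forall>i\<in>J \<times> J'. \<forall>v\<in>carrier ?T. (case i of (i, j) \<Rightarrow> tensor_map S V V' V V' (\<pi>' i) (\<rho>' j)) v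
        \<in> supported ?T (J \<times> J') (\<lambda>(i, j). tensor_map S V V' V V' (\<pi> i) (\<rho> j)) (\<lambda>j. j = i)
          <+>\<^bsub>?T\<^esub> ?W ((case i of (i, j) \<Rightarrow> r i + r' j) + (case i of (i, j) \<Rightarrow> s i + s' j) - 1)"
      using compare[OF sp sq] by fastforce
    show "\<forall>i\<in>J \<times> J'. \<forall>v\<in>carrier ?T. (case i of (i, j) \<Rightarrow> tensor_map S V V' V V' (\<pi> i) (\<rho> j)) v
        \<in> supported ?T (J \<times> J') (\<lambda>(i, j). tensor_map S V V' V V' (\<pi>' i) (\<rho>' j)) (\<lambda>j. j = i)
          <+>\<^bsub>?T\<^esub> ?W ((case i of (i, j) \<Rightarrow> r i + r' j) + (case i of (i, j) \<Rightarrow> s i + s' j) - 1)"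
      using compare[OF split_opposed_swap[OF sp] split_opposed_swap[OF sq]] by (fastforce simp: add.commute)
  qed
qed

end

text \<open>The pair consists of the Deligne splitting for (F, H) and the one for (H, F), indexed by
  the same bidegrees; \<open>splitting_compare\<close> is applied in both directions.\<close>

lemma (in opposed_filtrations) ex_split_opposed:
  "\<exists>(J :: (int \<times> int) set) r s \<pi> \<pi>'. split_opposed V W F H J r s \<pi> \<pi>'"
proof -
  interpret X: opposed_filtrations S V W H F by (rule swap)
  obtain a b c where abc: "F a = {\<zero>}" "H b = {\<zero>}" "W c = {\<zero>}"
    using F_bot H_bot W_bot by blast
  let ?J = "{(x, y). x < a \<and> y < b \<and> c < x + y}"
  \<comment> \<open>The bound y < b together with c < x + y bounds x from below, and symmetrically
    for y.\<close>
  have "?J \<subseteq> {c - b..a} \<times> {c - a..b}" by auto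
  hence J: "finite ?J" by (rule finite_subset) simp
  have bij: "bij_betw (\<lambda>i. (fst i, snd i)) ?J {(x, y). x < a \<and> y < b \<and> c < x + y}"
    by (auto simp: bij_betw_def inj_on_def)
  have bij': "bij_betw (\<lambda>i. (snd i, fst i)) ?J {(x, y). x < b \<and> y < a \<and> c < x + y}"
    by (auto simp: bij_betw_def inj_on_def image_iff)
  obtain \<pi> where \<pi>: "proj_system V ?J \<pi>" "\<And>i. i \<in> ?J \<Longrightarrow> I (fst i) (snd i) = supported V ?J \<pi> (\<lambda>j. j = i)"
    "\<And>n. W n = supported V ?J \<pi> (\<lambda>i. fst i + snd i \<le> n)" "\<And>p. F p = supported V ?J \<pi> (\<lambda>i. p \<le> fst i)"
    by (rule splitting[OF abc J bij]) (rule that)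
  obtain \<pi>' where \<pi>': "proj_system V ?J \<pi>'"
    "\<And>i. i \<in> ?J \<Longrightarrow> deligne V W H F (snd i) (fst i) = supported V ?J \<pi>' (\<lambda>j. j = i)"
    "\<And>n. W n = supported V ?J \<pi>' (\<lambda>i. snd i + fst i \<le> n)" "\<And>p. H p = supported V ?J \<pi>' (\<lambda>i. p \<le> snd i)"
    by (rule X.splitting[OF abc(2,1,3) J bij']) (rule that)
  have "split_opposed V W F H ?J fst snd \<pi> \<pi>'"
    unfolding split_opposed_def
  proof (intro conjI allI ballI)
    show "W n = supported V ?J \<pi>' (\<lambda>i. fst i + snd i \<le> n)" for n using \<pi>'(3)[of n] by (simp add: add.commute)
    fix i v assume i: "i \<in> ?J" and v: "v \<in> carrier V"
    have "\<pi>' i v \<in> deligne V W H F (snd i) (fst i)"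
      unfolding \<pi>'(2)[OF i] using i v by (intro proj_supported[OF \<pi>'(1)]) auto
    from splitting_compare[OF this]
    show "\<pi>' i v \<in> supported V ?J \<pi> (\<lambda>j. j = i) <+>\<^bsub>V\<^esub> W (fst i + snd i - 1)" unfolding \<pi>(2)[OF i] .
    have "\<pi> i v \<in> I (fst i) (snd i)"
      unfolding \<pi>(2)[OF i] using i v by (intro proj_supported[OF \<pi>(1)]) auto
    from X.splitting_compare[OF this]
    show "\<pi> i v \<in> supported V ?J \<pi>' (\<lambda>j. j = i) <+>\<^bsub>V\<^esub> W (fst i + snd i - 1)"
      unfolding \<pi>'(2)[OF i] by (simp add: add.commute)
  qed (rule \<pi>(1) \<pi>'(1) \<pi>(3) \<pi>(4) \<pi>'(4))+
  thus ?thesis by blast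
qed

context base_field
begin

lemma opposed_filtrations_tensor:
  assumes A: "opposed_filtrations S V W F H" and B: "opposed_filtrations S V' W' F' H'"
  shows "opposed_filtrations S (tensor S V V') (tensor_family S V V' W W') (tensor_family S V V' F F')
    (tensor_family S V V' H H')"
proof -
  interpret A: opposed_filtrations S V W F H by (rule A)
  interpret B: opposed_filtrations S V' W' F' H' by (rule B)
  obtain J r s \<pi> \<pi>' and J' r' s' \<rho> \<rho>'
    where "split_opposed V W F H (J :: (int \<times> int) set) r s \<pi> \<pi>'"
      "split_opposed V' W' F' H' (J' :: (int \<times> int) set) r' s' \<rho> \<rho>'"
    using A.ex_split_opposed B.ex_split_opposed by blast
  note * = split_opposed_imp_opposed[OF split_opposed_tensor[OF this]]
  show ?thesis
    by (intro opposed_filtrations.intro base_field_axioms opposed_filtrations_axioms.intro * vs_tensor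
        increasing_filtration_tensor decreasing_filtration_tensor
        A.V B.V A.W_fil B.W_fil A.F_fil B.F_fil A.H_fil B.H_fil)
qed

lemma opposed_filtrations_image:
  fixes X (structure)
  assumes A: "opposed_filtrations S V W F H" and f: "f \<in> lin V X" and X: "vs X"
    and b: "bij_betw f (carrier V) (carrier X)"
    and W': "\<And>m. W' m = f ` W m" and F': "\<And>p. F' p = f ` F p" and H': "\<And>p. H' p = f ` H p"
  shows "opposed_filtrations S X W' F' H'"
proof -
  interpret A: opposed_filtrations S V W F H by (rule A)
  have inj: "inj_on f (carrier V)" and im: "f ` carrier V = carrier X" using b by (auto simp: bij_betw_def)
  have im_zero: "f ` {\<zero>\<^bsub>V\<^esub>} = {\<zero>}" using lin_zero[OF f A.V X] by simp
  have incr: "increasing_filtration S X (\<lambda>m. f ` N m)" if N: "increasing_filtration S V N" for N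
  proof -
    have "sub X (f ` N m)" for m using N by (intro lin_image_sub[OF f A.V X]) (simp add: increasing_filtration_def)
    moreover have "mono (\<lambda>m. f ` N m)" using N by (intro monoI image_mono) (simp add: increasing_filtration_def monoD)
    moreover have "(\<exists>m. f ` N m = {\<zero>}) \<and> (\<exists>m. f ` N m = carrier X)"
      using N im im_zero unfolding increasing_filtration_def by metis
    ultimately show ?thesis by (simp add: increasing_filtration_def)
  qed
  have decr: "decreasing_filtration S X (\<lambda>m. f ` N m)" if "decreasing_filtration S V N" for N
    using that incr[of "\<lambda>p. N (- p)"] by (simp add: decreasing_filtration_uminus)
  have "opposed X (\<lambda>m. f ` W m) (\<lambda>p. f ` F p) (\<lambda>p. f ` H p)"
    unfolding opposed_def
  proof (intro allI impI conjI ballI)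
    fix m p q x assume pq: "p + q = m + 1" and x: "x \<in> f ` W m"
    obtain v where v: "v \<in> W m" "x = f v" using x by blast
    obtain a h w where a: "a \<in> F p" "a \<in> W m" "h \<in> H q" "h \<in> W m" "w \<in> W (m - 1)" "v = (a \<oplus>\<^bsub>V\<^esub> h) \<oplus>\<^bsub>V\<^esub> w"
      using A.opposed_split[OF pq v(1)] .
    have "f v = (f a \<oplus> f h) \<oplus> f w"
      using a A.W_c A.V by (simp add: lin_add[OF f])
    thus "\<exists>a\<in>f ` F p \<inter> f ` W m. \<exists>h\<in>f ` H q \<inter> f ` W m. \<exists>w\<in>f ` W (m - 1). x = (a \<oplus> h) \<oplus> w"
      unfolding v(2) using a by (intro bexI[of _ "f a"] bexI[of _ "f h"] bexI[of _ "f w"]) auto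
  next
    fix m p q x y assume pq: "p + q = m + 1" and x: "x \<in> f ` F p \<inter> f ` W m" and y: "y \<in> f ` H q \<inter> f ` W m"
      and d: "x \<ominus> y \<in> f ` W (m - 1)"
    \<comment> \<open>By injectivity the preimages in \<open>F p\<close> and in \<open>W m\<close>
      are the same vector, so the images intersect in the image of the intersection.\<close>
    obtain a h where a: "a \<in> F p" "a \<in> W m" "x = f a" and h: "h \<in> H q" "h \<in> W m" "y = f h"
      using x y A.F_c A.W_c A.H_c inj_onD[OF inj] by (smt (verit) IntE imageE)
    obtain w where w: "w \<in> W (m - 1)" "x \<ominus> y = f w" using d by blast
    have "f (a \<ominus>\<^bsub>V\<^esub> h) = f w" using w(2) a h A.W_c by (simp add: lin_minus[OF f A.V X])
    hence "a \<ominus>\<^bsub>V\<^esub> h = w" using A.W_c[OF a(2)] A.W_c[OF h(2)] A.W_c[OF w(1)] A.V by (auto dest: inj_onD[OF inj])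
    hence "a \<in> W (m - 1)" using w(1) by (intro A.opposed_inter[OF pq a(1,2) h(1,2)]) simp
    thus "x \<in> f ` W (m - 1)" using a(3) by blast
  qed
  hence "opposed_filtrations S X (\<lambda>m. f ` W m) (\<lambda>p. f ` F p) (\<lambda>p. f ` H p)"
    by (intro opposed_filtrations.intro base_field_axioms opposed_filtrations_axioms.intro X
        incr decr A.W_fil A.F_fil A.H_fil)
  moreover have "W' = (\<lambda>m. f ` W m)" "F' = (\<lambda>p. f ` F p)" "H' = (\<lambda>p. f ` H p)" using W' F' H' by auto
  ultimately show ?thesis by simp
qed

subsection \<open>Functoriality of the Deligne splitting\<close>

lemma deligne_map:
  assumes A: "opposed_filtrations S V W F H" and B: "opposed_filtrations S X W' F' H'" and f: "f \<in> lin V X"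
    and W': "\<And>m. f ` W m \<subseteq> W' m" and F': "\<And>p. f ` F p \<subseteq> F' p" and H': "\<And>p. f ` H p \<subseteq> H' p"
  shows "f ` deligne V W F H p q \<subseteq> deligne X W' F' H' p q"
proof -
  interpret A: opposed_filtrations S V W F H by (rule A)
  interpret B: opposed_filtrations S X W' F' H' by (rule B)
  let ?N = "{v \<in> carrier V. f v \<in> B.tail q (p + q)}"
  have "A.tail q (p + q) \<subseteq> ?N"
    unfolding deligne_tail_def[of V]
  proof (rule span_least[OF lin_vimage_sub[OF f A.V B.V B.tail_sub]], intro Un_least UN_least subsetI)
    fix x assume "x \<in> H q \<inter> W (p + q)"
    thus "x \<in> ?N" using W'[of "p + q"] H'[of q] A.W_c by (auto intro!: B.tail_base)
  next
    fix j x assume "j \<in> {2..}" "x \<in> H (q - j + 1) \<inter> W (p + q - j)"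
    thus "x \<in> ?N" using W'[of "p + q - j"] H'[of "q - j + 1"] A.W_c by (auto intro!: B.tail_step[of j])
  qed
  thus ?thesis using W' F' unfolding deligne_def by blast
qed

text \<open>The point is that the tail for (q, p + q) times the tail for (s, r + s) lands in the
  tail for the sums of the indices. It is checked on products of generators and extended by
  linearity, first in the right factor and then in the left one.\<close>

lemma deligne_pure_tensor:
  assumes A: "opposed_filtrations S V W F H" and B: "opposed_filtrations S V' W' F' H'"
    and x: "x \<in> deligne V W F H p q" and y: "y \<in> deligne V' W' F' H' r s"
  shows "pure_tensor S V V' x y \<in> deligne (tensor S V V') (tensor_family S V V' W W')
    (tensor_family S V V' F F') (tensor_family S V V' H H') (p + r) (q + s)"
proof -
  interpret A: opposed_filtrations S V W F H by (rule A)
  interpret B: opposed_filtrations S V' W' F' H' by (rule B)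
  let ?T = "tensor S V V'" and ?p = "pure_tensor S V V'"
  let ?W = "tensor_family S V V' W W'" and ?F = "tensor_family S V V' F F'" and ?H = "tensor_family S V V' H H'"
  interpret T: opposed_filtrations S ?T ?W ?F ?H by (rule opposed_filtrations_tensor[OF A B])
  have fam: "family V W" "family V' W'" "family V F" "family V' F'" "family V H" "family V' H'"
    using A.W B.W A.F B.F A.H B.H by auto
  note pW = pure_in_tensor_family[OF A.V B.V fam(1,2)] and pF = pure_in_tensor_family[OF A.V B.V fam(3,4)]
    and pH = pure_in_tensor_family[OF A.V B.V fam(5,6)]
  let ?m = "p + q" and ?n = "r + s"
  let ?tail = "T.tail (q + s) (?m + ?n)"
  \<comment> \<open>The first term of a tail is encoded by the index 0, the others by their j; the
    weight then drops by i + j in all four combinations.\<close>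
  have step: "?p u v \<in> ?tail"
    if uv: "u \<in> H (q - i + 1) \<inter> W (?m - i) \<and> 2 \<le> i \<or> u \<in> H q \<inter> W ?m \<and> i = 0"
      "v \<in> H' (s - j + 1) \<inter> W' (?n - j) \<and> 2 \<le> j \<or> v \<in> H' s \<inter> W' ?n \<and> j = 0" for u v i j
  proof -
    have w: "?p u v \<in> ?W (?m + ?n - (i + j))" using uv by (intro pW[of u "?m - i" v "?n - j"]) auto
    consider "i = 0" "j = 0" | "2 \<le> i" "2 \<le> j" | "i = 0" "2 \<le> j" | "2 \<le> i" "j = 0" using uv by auto
    thus ?thesis
    proof cases
      case 1
      thus ?thesis using uv w by (intro T.tail_base pH[of u q v s]) auto
    next
      case 2
      \<comment> \<open>Two proper terms contribute + 1 each, whereas the term i + j of the target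
        asks for only one; the surplus is dropped by monotonicity.\<close>
      have "?p u v \<in> ?H ((q + s) - (i + j) + 2)" using uv 2 by (intro pH[of u "q - i + 1" v "s - j + 1"]) auto
      hence "?p u v \<in> ?H ((q + s) - (i + j) + 1)" by (rule T.H_mono[rotated]) simp
      thus ?thesis using w 2 by (intro T.tail_step[of "i + j"]) auto
    next
      case 3
      hence "?p u v \<in> ?H ((q + s) - (i + j) + 1)" using uv by (intro pH[of u q v "s - j + 1"]) auto
      thus ?thesis using w 3 by (intro T.tail_step[of "i + j"]) auto
    next
      case 4
      hence "?p u v \<in> ?H ((q + s) - (i + j) + 1)" using uv by (intro pH[of u "q - i + 1" v s]) auto
      thus ?thesis using w 4 by (intro T.tail_step[of "i + j"]) auto
    qed
  qed
  have right: "?p u v \<in> ?tail"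
    if u: "u \<in> H (q - i + 1) \<inter> W (?m - i) \<and> 2 \<le> i \<or> u \<in> H q \<inter> W ?m \<and> i = 0" and v: "v \<in> B.tail s ?n" for u v i
  proof -
    have uc: "u \<in> carrier V" using u A.W_c by auto
    have "B.tail s ?n \<subseteq> {v \<in> carrier V'. ?p u v \<in> ?tail}"
      unfolding deligne_tail_def[of V']
    proof (rule span_least[OF lin_vimage_sub[OF pure_lin_right[OF A.V B.V uc] B.V T.V T.tail_sub]],
        intro Un_least UN_least subsetI)
      fix v assume "v \<in> H' s \<inter> W' ?n"
      thus "v \<in> {v \<in> carrier V'. ?p u v \<in> ?tail}" using step[OF u, of v 0] B.W_c by auto
    next
      fix j v assume "j \<in> {2..}" "v \<in> H' (s - j + 1) \<inter> W' (?n - j)"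
      thus "v \<in> {v \<in> carrier V'. ?p u v \<in> ?tail}" using step[OF u, of v j] B.W_c by auto
    qed
    thus ?thesis using v by auto
  qed
  have yt: "y \<in> B.tail s ?n" and yc: "y \<in> carrier V'" using B.I_D[OF y] B.W_c by auto
  have "A.tail q ?m \<subseteq> {u \<in> carrier V. ?p u y \<in> ?tail}"
    unfolding deligne_tail_def[of V]
  proof (rule span_least[OF lin_vimage_sub[OF pure_lin_left[OF A.V B.V yc] A.V T.V T.tail_sub]],
      intro Un_least UN_least subsetI)
    fix u assume "u \<in> H q \<inter> W ?m"
    thus "u \<in> {u \<in> carrier V. ?p u y \<in> ?tail}" using right[of u 0, OF _ yt] A.W_c by auto
  next
    fix i u assume "i \<in> {2..}" "u \<in> H (q - i + 1) \<inter> W (?m - i)"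
    thus "u \<in> {u \<in> carrier V. ?p u y \<in> ?tail}" using right[of u i, OF _ yt] A.W_c by auto
  qed
  hence "?p x y \<in> ?tail" using A.I_D(3)[OF x] by auto
  moreover have "?p x y \<in> ?F (p + r)" using A.I_D(1)[OF x] B.I_D(1)[OF y] by (rule pF) simp
  moreover have "?p x y \<in> ?W (?m + ?n)" using A.I_D(2)[OF x] B.I_D(2)[OF y] by (rule pW) simp
  ultimately show ?thesis unfolding deligne_def by (simp add: algebra_simps)
qed

end

section \<open>Complements, quotients and dimension\<close>

context base_field
begin

text \<open>By Zorn's lemma there is a maximal subspace \<open>M\<close> meeting \<open>N\<close> in
  zero. If v were outside of \<open>N\<close> + \<open>M\<close>, the line through v could be added
  to \<open>M\<close>: a nonzero multiple of v in \<open>N\<close> + \<open>M\<close> would bring v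
  itself there.\<close>

lemma complement_exists:
  fixes V (structure)
  assumes N: "sub V N"
  obtains M where "sub V M" "N \<inter> M = {\<zero>}" "N <+>\<^bsub>V\<^esub> M = carrier V"
proof -
  have V: "vs V" using N by (rule sub_vs)
  let ?A = "{M. sub V M \<and> N \<inter> M = {\<zero>}}"
  have "\<Union>C \<in> ?A" if C: "C \<noteq> {}" "subset.chain ?A C" for C
  proof -
    have CA: "sub V M" "N \<inter> M = {\<zero>}" if "M \<in> C" for M
      using C(2) that by (auto simp: subset.chain_def)
    have "sub V (\<Union>C)"
    proof (rule subI[OF V])
      show "\<Union>C \<subseteq> carrier V" using CA(1) sub_subset by blast
      show "\<zero> \<in> \<Union>C" using C(1) CA(1) sub_zero by blast
      show "v \<oplus> w \<in> \<Union>C" if vw: "v \<in> \<Union>C" "w \<in> \<Union>C" for v w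
      proof -
        obtain M M' where M: "M \<in> C" "v \<in> M" "M' \<in> C" "w \<in> M'" using vw by blast
        hence "M \<subseteq> M' \<or> M' \<subseteq> M" using C(2) by (auto simp: subset_chain_def)
        then obtain M'' where M'': "M'' \<in> C" "v \<in> M''" "w \<in> M''" using M by blast
        thus ?thesis using sub_add[OF CA(1)] by blast
      qed
      show "r \<odot> v \<in> \<Union>C" if "r \<in> S" "v \<in> \<Union>C" for r v
        using that CA(1) sub_smult by blast
    qed
    thus ?thesis using C(1) CA(2) by blast
  qed
  moreover have "{\<zero>} \<in> ?A" using sub_zero_space[OF V] sub_zero[OF N] by simp
  ultimately obtain M where M: "M \<in> ?A" "\<And>X. X \<in> ?A \<Longrightarrow> M \<subseteq> X \<Longrightarrow> X = M"
    using subset_Zorn_nonempty[of ?A] by (metis (no_types, lifting) empty_iff)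
  hence Ms: "sub V M" "N \<inter> M = {\<zero>}" by auto
  let ?P = "N <+>\<^bsub>V\<^esub> M"
  have P: "sub V ?P" by (rule sub_set_add[OF N Ms(1)])
  have NP: "N \<subseteq> ?P" by (rule set_add_left[OF N Ms(1)])
  have MP: "M \<subseteq> ?P" by (rule set_add_right[OF N Ms(1)])
  have "v \<in> ?P" if v: "v \<in> carrier V" for v
  proof (rule ccontr)
    assume nv: "v \<notin> ?P"
    let ?L = "(\<lambda>r. r \<odot> v) ` S"
    have L: "sub V ?L"
    proof (rule subI[OF V])
      show "?L \<subseteq> carrier V" using V v by auto
      show "\<zero> \<in> ?L" using V v by (intro image_eqI[of _ _ 0]) auto
      show "x \<oplus> y \<in> ?L" if "x \<in> ?L" "y \<in> ?L" for x y
        using that V v by (auto simp: vs_distl[symmetric])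
      show "r \<odot> x \<in> ?L" if "r \<in> S" "x \<in> ?L" for r x
        using that V v by (auto simp: vs_smult_smult)
    qed
    let ?M = "M <+>\<^bsub>V\<^esub> ?L"
    have "x = \<zero>" if x: "x \<in> N" "x \<in> ?M" for x
    proof -
      obtain m r where m: "m \<in> M" "r \<in> S" "x = m \<oplus> r \<odot> v" using x(2) by (auto simp: set_add_iff)
      have mc: "m \<in> carrier V" using sub_carrier[OF Ms(1) m(1)] .
      show ?thesis
      proof (cases "r = 0")
        case True
        thus ?thesis using m x V v mc Ms(2) by auto
      next
        case False
        have "r \<odot> v = x \<ominus> m" using m V v mc by (simp add: vs_diff_simps[OF V] vs_ac[OF V])
        also have "\<dots> \<in> ?P" using sub_minus[OF P] NP MP x m by blast
        finally have "inverse r \<odot> (r \<odot> v) \<in> ?P" using m(2) by (rule_tac sub_smult[OF P]) simp_all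
        thus ?thesis using nv False V v m(2) by (simp add: vs_smult_smult)
      qed
    qed
    moreover have "sub V ?M" by (rule sub_set_add[OF Ms(1) L])
    moreover have "\<zero> \<in> N" "\<zero> \<in> ?M" using sub_zero[OF N] sub_zero[OF sub_set_add[OF Ms(1) L]] .
    ultimately have "N \<inter> ?M = {\<zero>}" "sub V ?M" by blast+
    hence "?M = M" using set_add_left[OF Ms(1) L] by (intro M(2)) simp_all
    moreover have "v \<in> ?L" using V v by (intro image_eqI[of _ _ 1]) auto
    ultimately have "v \<in> M" using set_add_right[OF Ms(1) L] by blast
    thus False using MP nv by blast
  qed
  hence "?P = carrier V" using sub_subset[OF P] by blast
  thus ?thesis using that Ms by blast
qed

text \<open>Retractions split inclusions and quotients, and a split exact sequence stays exact after
  extension of scalars.\<close>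

lemma retraction_exists:
  fixes V (structure)
  assumes N: "sub V N"
  obtains \<rho> where "\<rho> \<in> lin V V" "\<And>v. v \<in> carrier V \<Longrightarrow> \<rho> v \<in> N" "\<And>v. v \<in> N \<Longrightarrow> \<rho> v = v"
proof -
  have V: "vs V" using N by (rule sub_vs)
  obtain M where M: "sub V M" "N \<inter> M = {\<zero>}" "N <+>\<^bsub>V\<^esub> M = carrier V"
    using complement_exists[OF N] .
  have "\<exists>n\<in>N. v \<ominus> n \<in> M" if v: "v \<in> carrier V" for v
  proof -
    have "v \<in> N <+>\<^bsub>V\<^esub> M" using v M(3) by simp
    then obtain n m where nm: "n \<in> N" "m \<in> M" "v = n \<oplus> m" by (auto simp: set_add_iff)
    hence "v \<ominus> n = m"
      using V sub_carrier[OF N] sub_carrier[OF M(1)] by (simp add: vs_diff_simps[OF V] vs_ac[OF V])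
    thus ?thesis using nm by (intro bexI[of _ n]) simp_all
  qed
  then obtain \<rho> where \<rho>: "\<And>v. v \<in> carrier V \<Longrightarrow> \<rho> v \<in> N \<and> v \<ominus> \<rho> v \<in> M" by metis
  have uniq: "\<rho> v = n" if v: "v \<in> carrier V" and n: "n \<in> N" "v \<ominus> n \<in> M" for v n
  proof -
    have c: "\<rho> v \<in> carrier V" "n \<in> carrier V" using \<rho>[OF v] n sub_carrier[OF N] by auto
    have "\<rho> v \<ominus> n = (v \<ominus> n) \<ominus> (v \<ominus> \<rho> v)"
      using V v c by (simp add: vs_diff_simps[OF V] vs_ac[OF V])
    hence "\<rho> v \<ominus> n \<in> M" using sub_minus[OF M(1)] \<rho>[OF v] n by simp
    moreover have "\<rho> v \<ominus> n \<in> N" using sub_minus[OF N] \<rho>[OF v] n by simp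
    ultimately have "\<rho> v \<ominus> n = \<zero>" using M(2) by blast
    thus ?thesis using V c by (simp add: vs_diff_eq_zero)
  qed
  have c: "\<rho> v \<in> carrier V" if "v \<in> carrier V" for v using \<rho>[OF that] sub_carrier[OF N] by blast
  have "\<rho> \<in> lin V V"
  proof (rule linI[OF c])
    show "\<rho> (v \<oplus> w) = \<rho> v \<oplus> \<rho> w" if vw: "v \<in> carrier V" "w \<in> carrier V" for v w
    proof (rule uniq)
      have "(v \<oplus> w) \<ominus> (\<rho> v \<oplus> \<rho> w) = (v \<ominus> \<rho> v) \<oplus> (w \<ominus> \<rho> w)"
        using V vw c by (simp add: vs_diff_simps[OF V] vs_ac[OF V])
      thus "(v \<oplus> w) \<ominus> (\<rho> v \<oplus> \<rho> w) \<in> M" using sub_add[OF M(1)] \<rho> vw by simp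
    qed (use V vw \<rho> sub_add[OF N] in auto)
    show "\<rho> (r \<odot> v) = r \<odot> \<rho> v" if rv: "r \<in> S" "v \<in> carrier V" for r v
    proof (rule uniq)
      have "(r \<odot> v) \<ominus> (r \<odot> \<rho> v) = r \<odot> (v \<ominus> \<rho> v)"
        using V rv c by (simp add: vs_minus_smult vs_distr vs_smult_smult mult.commute)
      thus "(r \<odot> v) \<ominus> (r \<odot> \<rho> v) \<in> M" using sub_smult[OF M(1)] \<rho> rv by simp
    qed (use V rv \<rho> sub_smult[OF N] in auto)
  qed
  moreover have "\<rho> v = v" if "v \<in> N" for v
    using that sub_carrier[OF N] V sub_zero[OF M(1)] by (intro uniq) auto
  ultimately show ?thesis using that \<rho> by blast
qed

section \<open>Subspaces and quotients as vector spaces\<close>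

lemma subsp_simps [simp]:
  "carrier (subsp V N) = N" "\<zero>\<^bsub>subsp V N\<^esub> = \<zero>\<^bsub>V\<^esub>" "x \<oplus>\<^bsub>subsp V N\<^esub> y = x \<oplus>\<^bsub>V\<^esub> y" "r \<odot>\<^bsub>subsp V N\<^esub> x = r \<odot>\<^bsub>V\<^esub> x"
  by (simp_all add: subsp_def)

lemma vs_subsp: "sub V N \<Longrightarrow> vs (subsp V N)"
  using vectorspace.subspace_is_vs[OF sub_vs] by (simp add: subsp_def)

lemma subsp_minus: "\<lbrakk>sub V N; x \<in> N; y \<in> N\<rbrakk> \<Longrightarrow> x \<ominus>\<^bsub>subsp V N\<^esub> y = x \<ominus>\<^bsub>V\<^esub> y"
  by (simp add: vs_minus_smult vs_subsp sub_vs sub_carrier)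

lemma subsp_incl: "sub V N \<Longrightarrow> (\<lambda>v. v) \<in> lin (subsp V N) V"
  by (rule linI) (simp_all add: sub_carrier)

lemma sub_subsp: "\<lbrakk>sub V N; sub V M; M \<subseteq> N\<rbrakk> \<Longrightarrow> sub (subsp V N) M"
  by (rule subI) (auto simp: vs_subsp sub_zero sub_add sub_smult)

context
  fixes U :: "'a vs" (structure) and N :: "'a pt set"
  assumes U: "vs U" and N: "sub U N"
begin

lemma coset_iff: "v \<in> carrier U \<Longrightarrow> w \<in> N +> v \<longleftrightarrow> w \<in> carrier U \<and> w \<ominus> v \<in> N"
proof -
  assume v: "v \<in> carrier U"
  have "w \<in> N +> v \<longleftrightarrow> (\<exists>n\<in>N. w = n \<oplus> v)" by (simp add: a_r_coset_def')
  also have "\<dots> \<longleftrightarrow> w \<in> carrier U \<and> w \<ominus> v \<in> N"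
    using v U sub_carrier[OF N] by (auto simp: vs_add_minus intro!: bexI[of _ "w \<ominus> v"] simp: vs_minus_add)
  finally show ?thesis .
qed

text \<open>Elements of the quotient are themselves vectors of \<open>U\<close>, namely chosen
  representatives; this congruence is all that is known about the choice.\<close>

lemma qcls_rep: "v \<in> carrier U \<Longrightarrow> qcls U N v \<in> carrier U \<and> qcls U N v \<ominus> v \<in> N"
proof -
  assume v: "v \<in> carrier U"
  have "v \<in> N +> v" using v U sub_zero[OF N] by (simp add: coset_iff)
  hence "qcls U N v \<in> N +> v" unfolding qcls_def by (rule someI)
  thus ?thesis using v by (simp add: coset_iff)
qed

lemma qcls_eq_iff: "\<lbrakk>v \<in> carrier U; w \<in> carrier U\<rbrakk> \<Longrightarrow> qcls U N v = qcls U N w \<longleftrightarrow> v \<ominus> w \<in> N"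
proof
  assume vw: "v \<in> carrier U" "w \<in> carrier U"
  {
    assume "qcls U N v = qcls U N w"
    thus "v \<ominus> w \<in> N"
      using qcls_rep[OF vw(1)] qcls_rep[OF vw(2)] vw sub_diff_trans[OF N, of v "qcls U N v" w]
        sub_diff_sym[OF N, of "qcls U N v" v] by auto
  next
    assume d: "v \<ominus> w \<in> N"
    have "N +> v = N +> w"
      using vw d sub_diff_trans[OF N, of _ v w] sub_diff_trans[OF N, of _ w v] sub_diff_sym[OF N vw d]
      by (auto simp: coset_iff)
    thus "qcls U N v = qcls U N w" by (simp add: qcls_def)
  }
qed

lemma quot_simps:
  "carrier (quot U N) = qcls U N ` carrier U" "\<zero>\<^bsub>quot U N\<^esub> = qcls U N \<zero>"
  by (simp_all add: quot_def)

lemma quot_add: "\<lbrakk>v \<in> carrier U; w \<in> carrier U\<rbrakk> \<Longrightarrow> qcls U N v \<oplus>\<^bsub>quot U N\<^esub> qcls U N w = qcls U N (v \<oplus> w)"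
proof -
  assume vw: "v \<in> carrier U" "w \<in> carrier U"
  have c: "qcls U N v \<in> carrier U" "qcls U N w \<in> carrier U" using qcls_rep vw by auto
  have "(qcls U N v \<oplus> qcls U N w) \<ominus> (v \<oplus> w) = (qcls U N v \<ominus> v) \<oplus> (qcls U N w \<ominus> w)"
    using vw c U by (simp add: vs_diff_simps[OF U] vs_ac[OF U])
  thus ?thesis using sub_add[OF N] qcls_rep vw U c by (simp add: quot_def qcls_eq_iff)
qed

lemma quot_smult: "\<lbrakk>r \<in> S; v \<in> carrier U\<rbrakk> \<Longrightarrow> r \<odot>\<^bsub>quot U N\<^esub> qcls U N v = qcls U N (r \<odot> v)"
proof -
  assume rv: "r \<in> S" "v \<in> carrier U"
  have c: "qcls U N v \<in> carrier U" using qcls_rep rv by auto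
  have "(r \<odot> qcls U N v) \<ominus> (r \<odot> v) = r \<odot> (qcls U N v \<ominus> v)"
    using rv c U by (simp add: vs_minus_smult vs_distr vs_smult_smult mult.commute)
  thus ?thesis using sub_smult[OF N] qcls_rep rv U c by (simp add: quot_def qcls_eq_iff)
qed

lemma vs_quot: "vs (quot U N)"
  by (rule vsI)
     (auto simp: quot_simps quot_add quot_smult U vs_smult_smult vs_distl vs_distr vs_ac)

lemma qcls_lin: "qcls U N \<in> lin U (quot U N)"
  by (rule linI) (simp_all add: quot_simps quot_add quot_smult)

lemma qcls_zero_iff: "v \<in> carrier U \<Longrightarrow> qcls U N v = \<zero>\<^bsub>quot U N\<^esub> \<longleftrightarrow> v \<in> N"
  using U by (simp add: quot_simps qcls_eq_iff)

end

section \<open>Finite dimension\<close>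

abbreviation fin_dim :: "'a vs \<Rightarrow> bool" where "fin_dim V \<equiv> vectorspace.fin_dim (fld S) V"

lemma fin_dim_iff: "vs V \<Longrightarrow> fin_dim V \<longleftrightarrow> (\<exists>A. finite A \<and> A \<subseteq> carrier V \<and> span V A = carrier V)"
  by (simp add: vectorspace.fin_dim_def)

lemma fin_dim_image:
  assumes f: "f \<in> lin V W" and V: "vs V" and W: "vs W" and surj: "f ` carrier V = carrier W" and fin: "fin_dim V"
  shows "fin_dim W"
proof -
  obtain A where A: "finite A" "A \<subseteq> carrier V" "span V A = carrier V" using fin V by (auto simp: fin_dim_iff)
  have fA: "f ` A \<subseteq> carrier W" using A(2) surj by auto
  have "span V A \<subseteq> {v \<in> carrier V. f v \<in> span W (f ` A)}"
    using A(2) span_superset[OF W fA] by (intro span_least lin_vimage_sub[OF f V W] span_sub[OF W fA]) auto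
  hence "carrier W \<subseteq> span W (f ` A)" unfolding A(3) surj[symmetric] by auto
  hence "span W (f ` A) = carrier W" using sub_subset[OF span_sub[OF W fA]] by blast
  thus ?thesis using A(1) fA W by (auto simp: fin_dim_iff)
qed

text \<open>A subspace is the image of a retraction, and images of finite generating sets
  generate.\<close>

lemma fin_dim_subsp:
  assumes N: "sub V N" and fin: "fin_dim V"
  shows "fin_dim (subsp V N)"
proof -
  obtain \<rho> where \<rho>: "\<rho> \<in> lin V V" "\<And>v. v \<in> carrier V \<Longrightarrow> \<rho> v \<in> N" "\<And>v. v \<in> N \<Longrightarrow> \<rho> v = v"
    by (rule retraction_exists[OF N]) (rule that)
  have "\<rho> \<in> lin V (subsp V N)" using \<rho> by (intro linI) (simp_all add: lin_add lin_smult)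
  moreover have "\<rho> ` carrier V = N"
  proof
    show "N \<subseteq> \<rho> ` carrier V" using \<rho>(3) sub_carrier[OF N] by force
  qed (use \<rho>(2) in auto)
  ultimately show ?thesis using fin sub_vs[OF N] vs_subsp[OF N] by (rule_tac fin_dim_image[of \<rho> V]) simp_all
qed

lemma fin_dim_tensor:
  assumes V: "vs V" and W: "vs W" and fin: "fin_dim V" "fin_dim W"
  shows "fin_dim (tensor S V W)"
proof -
  let ?T = "tensor S V W" and ?p = "pure_tensor S V W"
  obtain A B where A: "finite A" "A \<subseteq> carrier V" "span V A = carrier V"
    and B: "finite B" "B \<subseteq> carrier W" "span W B = carrier W" using fin V W by (auto simp: fin_dim_iff)
  let ?G = "(\<lambda>(a, b). ?p a b) ` (A \<times> B)"
  have T: "vs ?T" using V W by simp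
  have G: "?G \<subseteq> carrier ?T" using A(2) B(2) by (auto intro!: pure_closed)
  note GS = span_sub[OF T G]
  have 1: "?p a w \<in> span ?T ?G" if a: "a \<in> A" and w: "w \<in> carrier W" for a w
  proof -
    have "span W B \<subseteq> {w \<in> carrier W. ?p a w \<in> span ?T ?G}"
      using a A(2) B(2) span_superset[OF T G]
      by (intro span_least lin_vimage_sub[OF pure_lin_right[OF V W] W T GS]) auto
    thus ?thesis using w B(3) by auto
  qed
  have 2: "?p v w \<in> span ?T ?G" if v: "v \<in> carrier V" and w: "w \<in> carrier W" for v w
  proof -
    have "span V A \<subseteq> {v \<in> carrier V. ?p v w \<in> span ?T ?G}"
      using w A(2) 1 by (intro span_least lin_vimage_sub[OF pure_lin_left[OF V W] V T GS]) auto
    thus ?thesis using v A(3) by auto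
  qed
  have "t \<in> span ?T ?G" if "t \<in> carrier ?T" for t
    using that by (induction rule: tensor_induct) (rule sub_zero[OF GS] 2 sub_add[OF GS]; assumption?)+
  hence "span ?T ?G = carrier ?T" using sub_subset[OF GS] by blast
  thus ?thesis using T A(1) B(1) G by (subst fin_dim_iff) (auto intro!: exI[of _ ?G])
qed

end

section \<open>Extension of scalars\<close>

text \<open>Reality makes complex conjugation \<open>K\<close>-linear, so that it acts on V
  \<otimes> \<complex> through the second factor.\<close>

locale real_field = base_field K for K :: "complex set" +
  assumes K_real: "K \<subseteq> \<real>"
begin

lemma restrict_vs: "C.vs X \<Longrightarrow> vs X"
  by (rule vsI) (simp_all add: C.vs_ac C.vs_smult_smult C.vs_distl C.vs_distr)

lemma restrict_lin: "f \<in> C.lin X Y \<Longrightarrow> f \<in> lin X Y"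
  by (rule linI) (simp_all add: C.lin_closed C.lin_add C.lin_smult)

text \<open>\<open>cext K V\<close> differs from \<open>tensor K V CC\<close> in its scalar
  multiplication alone. Proofs that regard it as a complex space remove these rules again.\<close>

lemma cext_simps [simp]:
  "carrier (cext K V) = carrier (tensor K V CC)" "\<zero>\<^bsub>cext K V\<^esub> = \<zero>\<^bsub>tensor K V CC\<^esub>"
  "x \<oplus>\<^bsub>cext K V\<^esub> y = x \<oplus>\<^bsub>tensor K V CC\<^esub> y"
  by (simp_all add: cext_def)

abbreviation ctensor :: "'a vs \<Rightarrow> 'a pt \<Rightarrow> complex \<Rightarrow> 'a pt" where
  "ctensor V v z \<equiv> pure_tensor K V CC v (Scal z)"

text \<open>Scalar multiplication by complex numbers is defined by a map on representatives; written
  as a lift, it falls under the universal property.\<close>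

lemma tlift_ctensor: "tlift (tensor K V CC) (\<lambda>v z. ctensor V v (f (scal z))) t
    = tcls K V CC (map (\<lambda>(v, z). (v, Scal (f (scal z)))) (summands t))"
proof -
  have "fsum (tensor K V CC) (\<lambda>v z. ctensor V v (f (scal z))) xs
      = tcls K V CC (map (\<lambda>(v, z). (v, Scal (f (scal z)))) xs)" for xs
  proof (induction xs)
    case Nil
    thus ?case by (simp add: tensor_simps)
  next
    case (Cons a xs)
    obtain v z where "a = (v, z)" by (cases a)
    thus ?case using Cons tcls_append[of K V CC "[(v, Scal (f (scal z)))]"
        "map (\<lambda>(v, z). (v, Scal (f (scal z)))) xs"] by simp
  qed
  thus ?thesis by (simp add: tlift_fsum)
qed

lemma cext_smult: "c \<odot>\<^bsub>cext K V\<^esub> t = tlift (tensor K V CC) (\<lambda>v z. ctensor V v (c * scal z)) t"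
  by (simp add: cext_def tlift_ctensor)

lemma bilin_ctensor:
  assumes V: "vs V" and f: "\<And>x y. f (x + y) = f x + f y" "\<And>r x. r \<in> K \<Longrightarrow> f (r * x) = r * f x"
  shows "bilin V CC (tensor K V CC) (\<lambda>v z. ctensor V v (f (scal z)))"
proof -
  have "(\<lambda>z. Scal (f (scal z))) \<in> lin CC CC" using f by (intro linI) auto
  thus ?thesis using V by (intro bilin_comp[OF bilin_pure lin_id]) auto
qed

lemma cext_smult_lin: "vs V \<Longrightarrow> (\<lambda>t. c \<odot>\<^bsub>cext K V\<^esub> t) \<in> lin (tensor K V CC) (tensor K V CC)"
  unfolding cext_smult by (intro tlift_lin bilin_ctensor) (auto simp: algebra_simps)

lemma cext_smult_pure [simp]:
  "\<lbrakk>vs V; v \<in> carrier V\<rbrakk> \<Longrightarrow> c \<odot>\<^bsub>cext K V\<^esub> ctensor V v z = ctensor V v (c * z)"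
  unfolding cext_smult by (subst tlift_pure[OF _ _ _ bilin_ctensor]) (auto simp: algebra_simps)

text \<open>On pure tensors both sides are v \<otimes> r z, because a scalar of \<open>K\<close>
  crosses the tensor sign.\<close>

lemma cext_smult_real:
  fixes V :: "'a vs"
  assumes V: "vs V" and r: "r \<in> K" and t: "t \<in> carrier (tensor K V CC)"
  shows "r \<odot>\<^bsub>cext K V\<^esub> t = r \<odot>\<^bsub>tensor K V CC\<^esub> t"
proof (rule tensor_lin_eqI[OF cext_smult_lin[OF V] _ V vs_CC _ _ t])
  show "(\<lambda>t. r \<odot>\<^bsub>tensor K V CC\<^esub> t) \<in> lin (tensor K V CC) (tensor K V CC)"
    using V r by (intro linI) (auto simp: vs_distr vs_smult_smult mult.commute)
  fix v z :: "'a pt" assume vz: "v \<in> carrier V" "z \<in> carrier CC"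
  thus "r \<odot>\<^bsub>cext K V\<^esub> pure_tensor K V CC v z = r \<odot>\<^bsub>tensor K V CC\<^esub> pure_tensor K V CC v z"
    using V r pure_smult_right[of V CC r v z] by auto
qed (simp add: V)

lemma cext_induct [consumes 1, case_names zero pure add]:
  assumes "t \<in> carrier (cext K V)" "P \<zero>\<^bsub>cext K V\<^esub>" "\<And>v z. v \<in> carrier V \<Longrightarrow> P (ctensor V v z)"
    "\<And>s t. \<lbrakk>s \<in> carrier (cext K V); t \<in> carrier (cext K V); P s; P t\<rbrakk> \<Longrightarrow> P (s \<oplus>\<^bsub>cext K V\<^esub> t)"
  shows "P t"
  using assms(1)[unfolded cext_simps] by (induction rule: tensor_induct) (use assms in auto)

lemma ctensor_add: "\<lbrakk>vs V; v \<in> carrier V; w \<in> carrier V\<rbrakk>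
    \<Longrightarrow> ctensor V (v \<oplus>\<^bsub>V\<^esub> w) z = ctensor V v z \<oplus>\<^bsub>tensor K V CC\<^esub> ctensor V w z"
  and ctensor_add_right: "\<lbrakk>vs V; v \<in> carrier V\<rbrakk>
    \<Longrightarrow> ctensor V v (x + y) = ctensor V v x \<oplus>\<^bsub>tensor K V CC\<^esub> ctensor V v y"
  and ctensor_zero: "vs V \<Longrightarrow> ctensor V \<zero>\<^bsub>V\<^esub> z = \<zero>\<^bsub>tensor K V CC\<^esub>"
  and ctensor_zero_right: "\<lbrakk>vs V; v \<in> carrier V\<rbrakk> \<Longrightarrow> ctensor V v 0 = \<zero>\<^bsub>tensor K V CC\<^esub>"
  using pure_add_left[of V CC v w "Scal z"] pure_add_right[of V CC v "Scal x" "Scal y"]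
    pure_zero_left[of V CC "Scal z"] pure_zero_right[of V CC v] by auto

lemma vs_cext [simp]:
  fixes V :: "'a vs"
  assumes V: "vs V"
  shows "C.vs (cext K V)"
proof (rule C.vsI, unfold cext_simps)
  let ?T = "tensor K V CC"
  have T: "vs ?T" using V by simp
  note sm = cext_smult_lin[OF V]
  show "\<zero>\<^bsub>?T\<^esub> \<in> carrier ?T" "\<And>v w. v \<in> carrier ?T \<Longrightarrow> w \<in> carrier ?T \<Longrightarrow> v \<oplus>\<^bsub>?T\<^esub> w \<in> carrier ?T"
    using T by simp_all
  show "v \<oplus>\<^bsub>?T\<^esub> w = w \<oplus>\<^bsub>?T\<^esub> v" if "v \<in> carrier ?T" "w \<in> carrier ?T" for v w
    using T that by (rule vs_comm)
  show "u \<oplus>\<^bsub>?T\<^esub> v \<oplus>\<^bsub>?T\<^esub> w = u \<oplus>\<^bsub>?T\<^esub> (v \<oplus>\<^bsub>?T\<^esub> w)"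
    if "u \<in> carrier ?T" "v \<in> carrier ?T" "w \<in> carrier ?T" for u v w
    using T that by (rule vs_assoc)
  show "v \<oplus>\<^bsub>?T\<^esub> \<zero>\<^bsub>?T\<^esub> = v" if "v \<in> carrier ?T" for v
    using T that by simp
  show "c \<odot>\<^bsub>cext K V\<^esub> t \<in> carrier ?T" if "t \<in> carrier ?T" for c t using lin_closed[OF sm that] .
  show "c \<odot>\<^bsub>cext K V\<^esub> (s \<oplus>\<^bsub>?T\<^esub> t) = c \<odot>\<^bsub>cext K V\<^esub> s \<oplus>\<^bsub>?T\<^esub> c \<odot>\<^bsub>cext K V\<^esub> t"
    if "s \<in> carrier ?T" "t \<in> carrier ?T" for c s t using lin_add[OF sm that] .
  show "0 \<odot>\<^bsub>cext K V\<^esub> t = \<zero>\<^bsub>?T\<^esub>" "1 \<odot>\<^bsub>cext K V\<^esub> t = t" if "t \<in> carrier ?T" for t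
    using that T V by (simp_all add: cext_smult_real)
  show "(r * s) \<odot>\<^bsub>cext K V\<^esub> t = r \<odot>\<^bsub>cext K V\<^esub> (s \<odot>\<^bsub>cext K V\<^esub> t)" if t: "t \<in> carrier ?T" for r s t
  proof (rule tensor_lin_eqI[OF sm lin_comp[OF sm sm] V vs_CC T _ t])
    fix v z :: "'a pt" assume "v \<in> carrier V" "z \<in> carrier CC"
    thus "(r * s) \<odot>\<^bsub>cext K V\<^esub> pure_tensor K V CC v z = r \<odot>\<^bsub>cext K V\<^esub> (s \<odot>\<^bsub>cext K V\<^esub> pure_tensor K V CC v z)"
      using V by (auto simp: mult.assoc)
  qed
  show "(r + s) \<odot>\<^bsub>cext K V\<^esub> t = r \<odot>\<^bsub>cext K V\<^esub> t \<oplus>\<^bsub>?T\<^esub> s \<odot>\<^bsub>cext K V\<^esub> t" if t: "t \<in> carrier ?T" for r s t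
  proof (rule tensor_lin_eqI[OF sm lin_add_fun[OF T sm sm] V vs_CC T _ t])
    fix v z :: "'a pt" assume "v \<in> carrier V" "z \<in> carrier CC"
    thus "(r + s) \<odot>\<^bsub>cext K V\<^esub> pure_tensor K V CC v z
        = r \<odot>\<^bsub>cext K V\<^esub> pure_tensor K V CC v z \<oplus>\<^bsub>?T\<^esub> s \<odot>\<^bsub>cext K V\<^esub> pure_tensor K V CC v z"
      using V by (auto simp: distrib_right ctensor_add_right)
  qed
qed

text \<open>v \<otimes> z is z times v \<otimes> 1, so complex linear maps are determined by their
  values on V \<otimes> 1.\<close>

lemma cext_lin_eqI:
  assumes f: "f \<in> C.lin (cext K V) X" and g: "g \<in> C.lin (cext K V) X" and V: "vs V" and X: "C.vs X"
    and eq: "\<And>v. v \<in> carrier V \<Longrightarrow> f (ctensor V v 1) = g (ctensor V v 1)" and t: "t \<in> carrier (cext K V)"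
  shows "f t = g t"
  using t
proof (induction rule: cext_induct)
  case zero
  show ?case using C.lin_zero[OF f vs_cext[OF V] X] C.lin_zero[OF g vs_cext[OF V] X] by simp
next
  case (pure v z)
  hence "f (z \<odot>\<^bsub>cext K V\<^esub> ctensor V v 1) = g (z \<odot>\<^bsub>cext K V\<^esub> ctensor V v 1)"
    using eq C.lin_smult[OF f, of z "ctensor V v 1"] C.lin_smult[OF g, of z "ctensor V v 1"] by simp
  thus ?case using V pure by simp
next
  case (add s t)
  thus ?case using C.lin_add[OF f, of s t] C.lin_add[OF g, of s t] by simp
qed

lemma cext_linI:
  assumes V: "vs V" and X: "C.vs X" and f: "f \<in> lin (tensor K V CC) X"
    and pure: "\<And>c v z. v \<in> carrier V \<Longrightarrow> f (ctensor V v (c * z)) = c \<odot>\<^bsub>X\<^esub> f (ctensor V v z)"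
  shows "f \<in> C.lin (cext K V) X"
proof (rule C.linI)
  show "f v \<in> carrier X" if "v \<in> carrier (cext K V)" for v using that lin_closed[OF f] by simp
  show "f (v \<oplus>\<^bsub>cext K V\<^esub> w) = f v \<oplus>\<^bsub>X\<^esub> f w" if "v \<in> carrier (cext K V)" "w \<in> carrier (cext K V)" for v w
    using that lin_add[OF f] by simp
  show "f (c \<odot>\<^bsub>cext K V\<^esub> t) = c \<odot>\<^bsub>X\<^esub> f t" if t: "t \<in> carrier (cext K V)" for c t
    using t
  proof (induction rule: cext_induct)
    case zero
    thus ?case using lin_zero[OF f _ restrict_vs[OF X]] V X C.vs_smult_zero[OF vs_cext[OF V], of c] by simp
  next
    case (pure v z)
    thus ?case using V assms(4) by simp
  next
    case (add s t)
    thus ?case using C.vs_distr[OF vs_cext[OF V], of c s t] C.vs_smult[OF vs_cext[OF V], of c] X lin_add[OF f] lin_closed[OF f]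
      by (simp add: C.vs_distr)
  qed
qed

lemma cext_map_tensor: "cext_map K V V' f = tensor_map K V CC V' CC f (\<lambda>z. z)"
  by (simp add: cext_map_def)

lemma cext_map_pure [simp]:
  "\<lbrakk>vs V; vs V'; f \<in> lin V V'; v \<in> carrier V\<rbrakk> \<Longrightarrow> cext_map K V V' f (ctensor V v z) = ctensor V' (f v) z"
  unfolding cext_map_tensor by (subst tensor_map_pure) (auto simp: lin_id)

lemma cext_map_linear:
  assumes V: "vs V" "vs V'" and f: "f \<in> lin V V'"
  shows "cext_map K V V' f \<in> linear_maps UNIV (cext K V) (cext K V')"
proof -
  have l: "cext_map K V V' f \<in> linear_maps K (tensor K V CC) (tensor K V' CC)"
    unfolding cext_map_tensor using V f by (intro tensor_map_linear lin_id) auto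
  have l': "cext_map K V V' f \<in> lin (tensor K V CC) (cext K V')"
    using linear_maps_lin[OF l] V by (intro linI) (auto simp: lin_closed lin_add lin_smult cext_smult_real)
  have "cext_map K V V' f \<in> C.lin (cext K V) (cext K V')"
    using V f by (intro cext_linI l') (auto simp: lin_closed)
  thus ?thesis using l by (simp add: C.linear_maps_iff linear_maps_iff)
qed

lemmas cext_map_lin = cext_map_linear[THEN C.linear_maps_lin]

lemma cext_map_comp:
  assumes V: "vs U" "vs V" "vs W" and f: "f \<in> lin U V" and g: "g \<in> lin V W" and t: "t \<in> carrier (cext K U)"
  shows "cext_map K V W g (cext_map K U V f t) = cext_map K U W (\<lambda>v. g (f v)) t"
proof (rule cext_lin_eqI[OF _ _ V(1) vs_cext[OF V(3)] _ t])
  show "(\<lambda>t. cext_map K V W g (cext_map K U V f t)) \<in> C.lin (cext K U) (cext K W)"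
    by (rule C.lin_comp[OF cext_map_lin[OF V(1,2) f] cext_map_lin[OF V(2,3) g]])
  show "cext_map K U W (\<lambda>v. g (f v)) \<in> C.lin (cext K U) (cext K W)"
    by (rule cext_map_lin[OF V(1,3) lin_comp[OF f g]])
  show "cext_map K V W g (cext_map K U V f (ctensor U v 1)) = cext_map K U W (\<lambda>v. g (f v)) (ctensor U v 1)"
    if "v \<in> carrier U" for v
    using that V f g lin_comp[OF f g] lin_closed[OF f] by simp
qed

lemma cext_map_cong:
  assumes V: "vs V" "vs W" and f: "f \<in> lin V W" and eq: "\<And>v. v \<in> carrier V \<Longrightarrow> g v = f v" and t: "t \<in> carrier (cext K V)"
  shows "cext_map K V W g t = cext_map K V W f t"
proof (rule cext_lin_eqI[OF _ _ V(1) vs_cext[OF V(2)] _ t])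
  have g: "g \<in> lin V W" using f V(1) eq by (rule lin_cong)
  show "cext_map K V W g \<in> C.lin (cext K V) (cext K W)" "cext_map K V W f \<in> C.lin (cext K V) (cext K W)"
    by (rule cext_map_lin[OF V g], rule cext_map_lin[OF V f])
  show "cext_map K V W g (ctensor V v 1) = cext_map K V W f (ctensor V v 1)" if "v \<in> carrier V" for v
    using that V f g eq by simp
qed

lemma cext_map_id:
  assumes V: "vs V" and t: "t \<in> carrier (cext K V)"
  shows "cext_map K V V (\<lambda>v. v) t = t"
  by (rule cext_lin_eqI[OF cext_map_lin[OF V V lin_id] C.lin_id V vs_cext[OF V] _ t]) (use V in \<open>simp add: lin_id\<close>)

subsection \<open>Complex conjugation\<close>

lemma cnj_K: "r \<in> K \<Longrightarrow> cnj r = r"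
  using K_real by (auto simp: Reals_cnj_iff)

lemma cext_conj_tlift: "cext_conj K V = tlift (tensor K V CC) (\<lambda>v z. ctensor V v (cnj (scal z)))"
  by (rule ext) (simp add: cext_conj_def tlift_fsum fsum_def)

lemma cext_conj_lin: "vs V \<Longrightarrow> cext_conj K V \<in> lin (tensor K V CC) (tensor K V CC)"
  unfolding cext_conj_tlift by (intro tlift_lin bilin_ctensor) (auto simp: cnj_K)

lemma cext_conj_pure [simp]: "\<lbrakk>vs V; v \<in> carrier V\<rbrakk> \<Longrightarrow> cext_conj K V (ctensor V v z) = ctensor V v (cnj z)"
  unfolding cext_conj_tlift by (subst tlift_pure[OF _ _ _ bilin_ctensor]) (auto simp: cnj_K)

lemma cext_conj_closed: "\<lbrakk>vs V; t \<in> carrier (cext K V)\<rbrakk> \<Longrightarrow> cext_conj K V t \<in> carrier (cext K V)"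
  and cext_conj_add: "\<lbrakk>vs V; s \<in> carrier (cext K V); t \<in> carrier (cext K V)\<rbrakk>
    \<Longrightarrow> cext_conj K V (s \<oplus>\<^bsub>cext K V\<^esub> t) = cext_conj K V s \<oplus>\<^bsub>cext K V\<^esub> cext_conj K V t"
  and cext_conj_zero: "vs V \<Longrightarrow> cext_conj K V \<zero>\<^bsub>cext K V\<^esub> = \<zero>\<^bsub>cext K V\<^esub>"
  by (simp_all add: lin_closed[OF cext_conj_lin] lin_add[OF cext_conj_lin] lin_zero[OF cext_conj_lin])

lemma cext_conj_conj:
  assumes V: "vs V" and t: "t \<in> carrier (cext K V)"
  shows "cext_conj K V (cext_conj K V t) = t"
  using t by (induction rule: cext_induct) (use V in \<open>simp_all add: cext_conj_zero cext_conj_add cext_conj_closed del: cext_simps\<close>)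

lemma cext_conj_smult:
  assumes V: "vs V" and t: "t \<in> carrier (cext K V)"
  shows "cext_conj K V (c \<odot>\<^bsub>cext K V\<^esub> t) = cnj c \<odot>\<^bsub>cext K V\<^esub> cext_conj K V t"
  using t
proof (induction rule: cext_induct)
  case zero
  thus ?case using V C.vs_smult_zero[OF vs_cext[OF V]] by (simp add: cext_conj_zero del: cext_simps)
next
  case (add s t)
  thus ?case using V C.vs_distr[OF vs_cext[OF V]] C.vs_smult[OF vs_cext[OF V]]
    by (simp add: cext_conj_add cext_conj_closed del: cext_simps)
qed (use V in simp)

lemma cext_conj_map:
  assumes V: "vs V" "vs W" and f: "f \<in> lin V W" and t: "t \<in> carrier (cext K V)"
  shows "cext_conj K W (cext_map K V W f t) = cext_map K V W f (cext_conj K V t)"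
  using t
proof (induction rule: cext_induct)
  case zero
  thus ?case using V C.lin_zero[OF cext_map_lin[OF V f]] by (simp add: cext_conj_zero del: cext_simps)
next
  case (pure v z)
  thus ?case using V f lin_closed[OF f] by simp
next
  case (add s t)
  thus ?case using V C.lin_add[OF cext_map_lin[OF V f]] C.lin_closed[OF cext_map_lin[OF V f]]
    by (simp add: cext_conj_add cext_conj_closed del: cext_simps)
qed

lemma cext_conj_image_iff:
  assumes V: "vs V" and N: "N \<subseteq> carrier (cext K V)" and x: "x \<in> carrier (cext K V)"
  shows "x \<in> cext_conj K V ` N \<longleftrightarrow> cext_conj K V x \<in> N"
proof
  assume "x \<in> cext_conj K V ` N"
  then obtain y where "y \<in> N" "x = cext_conj K V y" by blast
  thus "cext_conj K V x \<in> N" using cext_conj_conj[OF V, of y] N by auto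
next
  assume "cext_conj K V x \<in> N"
  thus "x \<in> cext_conj K V ` N" using cext_conj_conj[OF V x] by (intro image_eqI) simp_all
qed

lemma cext_conj_sub:
  assumes V: "vs V" and N: "C.sub (cext K V) N"
  shows "C.sub (cext K V) (cext_conj K V ` N)"
proof (rule C.subI[OF vs_cext[OF V]])
  note c = C.sub_carrier[OF N]
  show "cext_conj K V ` N \<subseteq> carrier (cext K V)" using c cext_conj_closed[OF V] by blast
  show "\<zero>\<^bsub>cext K V\<^esub> \<in> cext_conj K V ` N" using C.sub_zero[OF N] cext_conj_zero[OF V] by (metis imageI)
  show "v \<oplus>\<^bsub>cext K V\<^esub> w \<in> cext_conj K V ` N" if "v \<in> cext_conj K V ` N" "w \<in> cext_conj K V ` N" for v w
    using that cext_conj_add[OF V] c C.sub_add[OF N] by (smt (verit) imageE imageI)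
  \<comment> \<open>Conjugation is conjugate-linear: r times the conjugate of y is the conjugate of
    \<open>cnj r\<close> times y.\<close>
  show "r \<odot>\<^bsub>cext K V\<^esub> v \<in> cext_conj K V ` N" if "v \<in> cext_conj K V ` N" for r v
    using that cext_conj_smult[OF V, of _ "cnj r"] c C.sub_smult[OF N, of "cnj r"]
    by (smt (verit) UNIV_I complex_cnj_cnj imageE imageI)
qed

lemma cext_conj_decreasing:
  assumes V: "vs V" and F: "decreasing_filtration UNIV (cext K V) F"
  shows "decreasing_filtration UNIV (cext K V) (\<lambda>p. cext_conj K V ` F p)"
proof -
  obtain a b where ab: "F a = {\<zero>\<^bsub>cext K V\<^esub>}" "F b = carrier (cext K V)"
    using F unfolding decreasing_filtration_def by blast
  have "cext_conj K V ` F a = {\<zero>\<^bsub>cext K V\<^esub>}" using ab(1) cext_conj_zero[OF V] by simp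
  moreover have "cext_conj K V ` F b = carrier (cext K V)"
    unfolding ab(2)
  proof
    show "cext_conj K V ` carrier (cext K V) \<subseteq> carrier (cext K V)" using cext_conj_closed[OF V] by blast
    show "carrier (cext K V) \<subseteq> cext_conj K V ` carrier (cext K V)"
    proof
      fix x assume x: "x \<in> carrier (cext K V)"
      thus "x \<in> cext_conj K V ` carrier (cext K V)"
        by (intro image_eqI[of _ _ "cext_conj K V x"]) (rule cext_conj_conj[OF V, symmetric] cext_conj_closed[OF V], assumption)+
    qed
  qed
  moreover have "antimono (\<lambda>p. cext_conj K V ` F p)"
    using F by (intro antimonoI image_mono) (simp add: decreasing_filtration_def antimonoD)
  moreover have "C.sub (cext K V) (cext_conj K V ` F p)" for p
    using F by (intro cext_conj_sub[OF V]) (simp add: decreasing_filtration_def)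
  ultimately show ?thesis unfolding decreasing_filtration_def by blast
qed

subsection \<open>Exactness\<close>

abbreviation csub :: "'a vs \<Rightarrow> 'a pt set \<Rightarrow> 'a pt set" where
  "csub V N \<equiv> tensor_image K V CC N (carrier CC)"

abbreviation cincl :: "'a vs \<Rightarrow> 'a pt set \<Rightarrow> 'a pt \<Rightarrow> 'a pt" where
  "cincl V N \<equiv> cext_map K (subsp V N) V (\<lambda>v. v)"

lemma cincl_lin: "sub V N \<Longrightarrow> cincl V N \<in> C.lin (cext K (subsp V N)) (cext K V)"
  by (intro cext_map_lin subsp_incl vs_subsp) (auto dest: sub_vs)

text \<open>The same list represents an element of N \<otimes> \<complex> and its image. This
  replaces a set of classes of lists by the image of a linear map.\<close>

lemma csub_image:
  assumes N: "sub V N"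
  shows "csub V N = cincl V N ` carrier (cext K (subsp V N))"
proof -
  note V = sub_vs[OF N] and U = vs_subsp[OF N]
  have "cincl V N (tcls K (subsp V N) CC xs) = tcls K V CC xs" if xs: "xs \<in> lists (N \<times> carrier CC)" for xs
  proof -
    have "tcls K (subsp V N) CC xs \<in> carrier (tensor K (subsp V N) CC)" using xs by (simp add: tensor_simps(1) del: in_lists_conv_set)
    hence "cincl V N (tcls K (subsp V N) CC xs)
        = tlift (tensor K V CC) (\<lambda>v z. pure_tensor K V CC v z) (tcls K (subsp V N) CC xs)"
      by (simp add: cext_map_def tensor_map_def)
    also have "\<dots> = fsum (tensor K V CC) (pure_tensor K V CC) xs"
      using xs V U bilin_tensor_map[OF V vs_CC subsp_incl[OF N] lin_id] by (intro tlift_tcls) auto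
    also have "\<dots> = tcls K V CC xs"
    proof (induction xs)
      case (Cons a xs)
      obtain v z where "a = (v, z)" by (cases a)
      thus ?case using Cons tcls_append[of K V CC "[(v, z)]" xs] by simp
    qed (simp add: tensor_simps)
    finally show ?thesis .
  qed
  thus ?thesis unfolding tensor_image_def cext_simps tensor_simps(1) subsp_simps image_image
    by (intro image_cong) simp_all
qed

lemma csub_sub: "sub V N \<Longrightarrow> C.sub (cext K V) (csub V N)"
  unfolding csub_image
  by (rule C.lin_image_sub[OF cincl_lin]) (simp_all only: vs_cext vs_subsp sub_vs C.sub_self)

lemma ctensor_csub: "v \<in> N \<Longrightarrow> ctensor V v z \<in> csub V N"
  by (intro pure_in_tensor_image) auto

lemma csub_induct [consumes 2, case_names zero pure add]:
  assumes N: "sub V N" and t: "t \<in> csub V N" and zero: "P \<zero>\<^bsub>cext K V\<^esub>"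
    and pure: "\<And>v z. v \<in> N \<Longrightarrow> P (ctensor V v z)"
    and add: "\<And>s t. \<lbrakk>s \<in> csub V N; t \<in> csub V N; P s; P t\<rbrakk> \<Longrightarrow> P (s \<oplus>\<^bsub>cext K V\<^esub> t)"
  shows "P t"
proof -
  note V = sub_vs[OF N] and U = vs_subsp[OF N]
  obtain x where x: "x \<in> carrier (cext K (subsp V N))" and t: "t = cincl V N x" using t csub_image[OF N] by blast
  have "cincl V N x \<in> csub V N \<and> P (cincl V N x)" using x
  proof (induction rule: cext_induct)
    case zero
    thus ?case using assms(3) C.lin_zero[OF cincl_lin[OF N]] V U C.sub_zero[OF csub_sub[OF N]] by simp
  next
    case (pure v z)
    hence "cincl V N (ctensor (subsp V N) v z) = ctensor V v z"
      using V U subsp_incl[OF N] by (subst cext_map_pure) auto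
    thus ?case using assms(4) pure ctensor_csub by simp
  next
    case (add s t)
    thus ?case using assms(5) C.lin_add[OF cincl_lin[OF N], of s t] C.sub_add[OF csub_sub[OF N]] by simp
  qed
  thus ?thesis using t by simp
qed

lemma csub_mono: "N \<subseteq> N' \<Longrightarrow> csub V N \<subseteq> csub V N'"
  unfolding tensor_image_def by (intro image_mono lists_mono) auto

lemma csub_carrier: "csub V (carrier V) = carrier (cext K V)"
  by (simp add: tensor_image_def tensor_simps)

lemma csub_zero:
  assumes V: "vs V"
  shows "csub V {\<zero>\<^bsub>V\<^esub>} = {\<zero>\<^bsub>cext K V\<^esub>}"
proof -
  have "t = \<zero>\<^bsub>cext K V\<^esub>" if "t \<in> csub V {\<zero>\<^bsub>V\<^esub>}" for t
    using sub_zero_space[OF V] that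
  proof (induction rule: csub_induct)
    case (add s t)
    thus ?case using C.vs_r_zero[OF vs_cext[OF V], of "\<zero>\<^bsub>cext K V\<^esub>"] C.vs_zero[OF vs_cext[OF V]] by simp
  qed (use V in \<open>auto simp: ctensor_zero\<close>)
  thus ?thesis using C.sub_zero[OF csub_sub[OF sub_zero_space[OF V]]] by blast
qed

lemma csub_increasing:
  assumes V: "vs V" and W: "increasing_filtration K V W"
  shows "increasing_filtration UNIV (cext K V) (\<lambda>m. csub V (W m))"
proof -
  obtain a b where "W a = {\<zero>\<^bsub>V\<^esub>}" "W b = carrier V" using W unfolding increasing_filtration_def by blast
  hence "csub V (W a) = {\<zero>\<^bsub>cext K V\<^esub>}" "csub V (W b) = carrier (cext K V)"
    by (simp_all only: csub_zero[OF V] csub_carrier)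
  moreover have "mono (\<lambda>m. csub V (W m))"
    using W by (intro monoI csub_mono) (simp add: increasing_filtration_def monoD)
  moreover have "C.sub (cext K V) (csub V (W m))" for m
    using W by (intro csub_sub) (simp add: increasing_filtration_def)
  ultimately show ?thesis unfolding increasing_filtration_def by blast
qed

text \<open>The extension of a retraction onto \<open>N\<close> is a left inverse.\<close>

lemma cincl_inj:
  assumes N: "sub V N"
  shows "inj_on (cincl V N) (carrier (cext K (subsp V N)))"
proof -
  note V = sub_vs[OF N] and U = vs_subsp[OF N]
  obtain \<rho> where \<rho>: "\<rho> \<in> lin V V" "\<And>v. v \<in> carrier V \<Longrightarrow> \<rho> v \<in> N" "\<And>v. v \<in> N \<Longrightarrow> \<rho> v = v"
    by (rule retraction_exists[OF N]) (rule that)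
  have \<rho>': "\<rho> \<in> lin V (subsp V N)" using \<rho> by (intro linI) (simp_all add: lin_add lin_smult)
  have "cext_map K V (subsp V N) \<rho> (cincl V N t) = t" if t: "t \<in> carrier (cext K (subsp V N))" for t
  proof -
    have "cext_map K V (subsp V N) \<rho> (cincl V N t) = cext_map K (subsp V N) (subsp V N) \<rho> t"
      using cext_map_comp[OF U V U subsp_incl[OF N] \<rho>' t] .
    also have "\<dots> = cext_map K (subsp V N) (subsp V N) (\<lambda>v. v) t"
      using \<rho>(3) by (intro cext_map_cong[OF U U lin_id _ t]) simp
    finally show ?thesis using cext_map_id[OF U t] by simp
  qed
  thus ?thesis by (rule inj_on_inverseI)
qed

lemma cquot_surj:
  assumes U: "vs U" and N: "sub U N"
  shows "cext_map K U (quot U N) (qcls U N) ` carrier (cext K U) = carrier (cext K (quot U N))"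
proof -
  let ?f = "cext_map K U (quot U N) (qcls U N)"
  note Q = vs_quot[OF U N] and q = qcls_lin[OF U N]
  note f = cext_map_lin[OF U Q q]
  have "t \<in> ?f ` carrier (cext K U)" if "t \<in> carrier (cext K (quot U N))" for t
    using that
  proof (induction rule: cext_induct)
    case zero
    thus ?case using C.sub_zero[OF C.lin_image_sub[OF f _ _ C.sub_self]] U Q by simp
  next
    case (pure v z)
    then obtain u where u: "u \<in> carrier U" "v = qcls U N u" using quot_simps[OF U N] by auto
    thus ?case using U Q q by (intro image_eqI[of _ _ "ctensor U u z"]) simp_all
  next
    case (add s t)
    thus ?case using C.sub_add[OF C.lin_image_sub[OF f _ _ C.sub_self]] U Q by simp
  qed
  thus ?thesis using C.lin_closed[OF f] by blast
qed

text \<open>For a retraction \<rho> onto \<open>N\<close>, the map v - \<rho> v factors through the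
  quotient. After extension of scalars every t is the sum of \<rho> t and a term computed from its
  class; if the class is zero, t = \<rho> t comes from \<open>N\<close>.\<close>

lemma cquot_kernel:
  fixes U (structure)
  assumes U: "vs U" and N: "sub U N" and t: "t \<in> carrier (cext K U)"
    and zero: "cext_map K U (quot U N) (qcls U N) t = \<zero>\<^bsub>cext K (quot U N)\<^esub>"
  shows "t \<in> csub U N"
proof -
  note Q = vs_quot[OF U N] and q = qcls_lin[OF U N]
  obtain \<rho> where \<rho>: "\<rho> \<in> lin U U" "\<And>v. v \<in> carrier U \<Longrightarrow> \<rho> v \<in> N" "\<And>v. v \<in> N \<Longrightarrow> \<rho> v = v"
    by (rule retraction_exists[OF N]) (rule that)
  let ?e = "\<lambda>v. v \<ominus> \<rho> v"
  have rep: "qcls U N v \<in> carrier U" "qcls U N v \<ominus> v \<in> N" if "v \<in> carrier U" for v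
    using qcls_rep[OF U N that] by auto
  have eq: "?e (qcls U N v) = ?e v" if v: "v \<in> carrier U" for v
  proof -
    have "\<rho> (qcls U N v \<ominus> v) = qcls U N v \<ominus> v" using \<rho>(3) rep v by blast
    hence "\<rho> (qcls U N v) \<ominus> \<rho> v = qcls U N v \<ominus> v" using rep v U lin_minus[OF \<rho>(1) U U] by simp
    thus ?thesis using rep v U lin_closed[OF \<rho>(1)] by (simp add: vs_diff_simps[OF U] vs_ac[OF U])
  qed
  have el: "?e \<in> lin U U"
    using U lin_closed[OF \<rho>(1)]
    by (intro linI) (auto simp: lin_add[OF \<rho>(1)] lin_smult[OF \<rho>(1)] vs_minus_smult vs_distr vs_smult_smult mult.commute vs_ac)
  \<comment> \<open>As the quotient consists of representatives, the same function is the factored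
    map; \<open>eq\<close> says that its value depends on the coset only.\<close>
  have e: "?e \<in> lin (quot U N) U"
  proof (rule linI)
    show "?e v \<in> carrier U" if "v \<in> carrier (quot U N)" for v
      using that U rep lin_closed[OF el] by (auto simp: quot_simps[OF U N])
    show "?e (v \<oplus>\<^bsub>quot U N\<^esub> w) = ?e v \<oplus> ?e w" if "v \<in> carrier (quot U N)" "w \<in> carrier (quot U N)" for v w
      using that U lin_add[OF el] by (auto simp: quot_simps[OF U N] quot_add[OF U N] eq)
    show "?e (r \<odot>\<^bsub>quot U N\<^esub> v) = r \<odot> ?e v" if "r \<in> K" "v \<in> carrier (quot U N)" for r v
      using that U lin_smult[OF el] by (auto simp: quot_simps[OF U N] quot_smult[OF U N] eq)
  qed
  let ?q = "cext_map K U (quot U N) (qcls U N)" and ?e' = "cext_map K (quot U N) U ?e"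
  have UC: "C.vs (cext K U)" using U by simp
  have "cext_map K U U \<rho> t \<oplus>\<^bsub>cext K U\<^esub> ?e' (?q t) = t"
  proof (rule cext_lin_eqI[OF C.lin_add_fun[OF UC cext_map_lin[OF U U \<rho>(1)] C.lin_comp[OF cext_map_lin[OF U Q q] cext_map_lin[OF Q U e]]] C.lin_id U UC _ t])
    fix v assume v: "v \<in> carrier U"
    have "?e' (?q (ctensor U v 1)) = ctensor U (?e v) 1"
      using v U Q q e lin_closed[OF q v] eq[OF v] by simp
    moreover have "\<rho> v \<oplus> ?e v = v" using v U lin_closed[OF \<rho>(1) v] by (simp add: vs_diff_simps[OF U] vs_ac[OF U])
    ultimately show "cext_map K U U \<rho> (ctensor U v 1) \<oplus>\<^bsub>cext K U\<^esub> ?e' (?q (ctensor U v 1)) = ctensor U v 1"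
      using v U \<rho>(1) lin_closed[OF \<rho>(1) v] lin_closed[OF el v] by (simp add: ctensor_add[symmetric])
  qed
  moreover have "?e' (?q t) = \<zero>\<^bsub>cext K U\<^esub>"
    unfolding zero using C.lin_zero[OF cext_map_lin[OF Q U e]] Q U by simp
  moreover have "cext_map K U U \<rho> x \<in> csub U N" if "x \<in> carrier (cext K U)" for x
    using that
  proof (induction rule: cext_induct)
    case zero
    thus ?case using C.lin_zero[OF cext_map_lin[OF U U \<rho>(1)]] U C.sub_zero[OF csub_sub[OF N]] by simp
  next
    case (pure v z)
    thus ?case using ctensor_csub[OF \<rho>(2)[OF pure], of U z] \<rho>(1) U by simp
  next
    case (add s t)
    thus ?case using C.lin_add[OF cext_map_lin[OF U U \<rho>(1)], of s t] C.sub_add[OF csub_sub[OF N]] by simp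
  qed
  ultimately show ?thesis
    using C.lin_closed[OF cext_map_lin[OF U U \<rho>(1)] t] C.vs_r_zero[OF UC] t by metis
qed

end

section \<open>Mixed Hodge structures as opposed filtrations\<close>

context real_field
begin

lemma csub_subsp:
  assumes M: "sub V M" and N: "sub V N" and NM: "N \<subseteq> M"
  shows "cincl V M ` csub (subsp V M) N = csub V N"
proof
  note V = sub_vs[OF M] and U = vs_subsp[OF M] and i = cincl_lin[OF M]
  have UN: "sub (subsp V M) N" by (rule sub_subsp[OF M N NM])
  note c = C.sub_carrier[OF csub_sub[OF UN]]
  have incl: "cincl V M (ctensor (subsp V M) v z) = ctensor V v z" if "v \<in> N" for v z
    using that NM V U subsp_incl[OF M] by (subst cext_map_pure) auto
  have im: "C.sub (cext K V) (cincl V M ` csub (subsp V M) N)"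
    by (rule C.lin_image_sub[OF i vs_cext[OF U] vs_cext[OF V] csub_sub[OF UN]])
  show "cincl V M ` csub (subsp V M) N \<subseteq> csub V N"
  proof
    fix x assume "x \<in> cincl V M ` csub (subsp V M) N"
    then obtain t where t: "t \<in> csub (subsp V M) N" "x = cincl V M t" by blast
    have "cincl V M t \<in> csub V N" using UN t(1)
    proof (induction rule: csub_induct)
      case zero
      thus ?case using C.lin_zero[OF i vs_cext[OF U] vs_cext[OF V]] C.sub_zero[OF csub_sub[OF N]] by metis
    next
      case (pure v z)
      thus ?case using ctensor_csub[OF pure] incl by metis
    next
      case (add s t)
      thus ?case using C.lin_add[OF i c c] C.sub_add[OF csub_sub[OF N]] by metis
    qed
    thus "x \<in> csub V N" using t(2) by simp
  qed
  show "csub V N \<subseteq> cincl V M ` csub (subsp V M) N"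
  proof
    fix t assume "t \<in> csub V N"
    with N show "t \<in> cincl V M ` csub (subsp V M) N"
    proof (induction rule: csub_induct)
      case (pure v z)
      thus ?case using ctensor_csub[OF pure] incl by (metis imageI)
    next
      case (add s t)
      thus ?case using C.sub_add[OF im] by blast
    qed (rule C.sub_zero[OF im])
  qed
qed

text \<open>The complexified \<open>W m\<close> maps injectively by \<iota> to V \<otimes>
  \<complex> and surjectively by \<kappa> to the complexified graded piece. The induced filtration
  is the \<kappa>-image of the \<iota>-preimage \<open>X p\<close> of \<open>F p\<close>. The kernel
  of \<kappa> is the part lying in \<open>W (m - 1)\<close>, so intersections and sums of such
  images become statements in V \<otimes> \<complex> modulo that subspace.\<close>

lemma pure_hodge_structure_Gr_iff:
  assumes V: "vs V" and fin: "fin_dim V" and W: "increasing_filtration K V W"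
    and F: "decreasing_filtration UNIV (cext K V) F"
  shows "pure_hodge_structure K m (Gr V W m) (induced_filtration K V W F m) \<longleftrightarrow>
    (\<forall>p q. p + q = m + 1 \<longrightarrow>
      (\<forall>x\<in>csub V (W m). \<exists>f\<in>F p \<inter> csub V (W m). \<exists>h\<in>cext_conj K V ` F q \<inter> csub V (W m).
        \<exists>w\<in>csub V (W (m - 1)). x = (f \<oplus>\<^bsub>cext K V\<^esub> h) \<oplus>\<^bsub>cext K V\<^esub> w) \<and>
      (\<forall>f\<in>F p \<inter> csub V (W m). \<forall>h\<in>cext_conj K V ` F q \<inter> csub V (W m).
        f \<ominus>\<^bsub>cext K V\<^esub> h \<in> csub V (W (m - 1)) \<longrightarrow> f \<in> csub V (W (m - 1))))"
    (is "_ \<longleftrightarrow> (\<forall>p q. p + q = m + 1 \<longrightarrow> ?split p q \<and> ?inter p q)")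
proof -
  define U where "U = subsp V (W m)"
  define N where "N = W (m - 1)"
  define Q where "Q = quot U N"
  define \<iota> where "\<iota> = cincl V (W m)"
  define \<kappa> where "\<kappa> = cext_map K U Q (qcls U N)"
  define UC where "UC = cext K U"
  define VC where "VC = cext K V"
  define QC where "QC = cext K Q"
  have Wm: "sub V (W m)" "sub V N" and NW: "N \<subseteq> W m"
    using W monoD[of W "m - 1" m] unfolding N_def by (auto simp: increasing_filtration_def)
  have U: "vs U" unfolding U_def by (rule vs_subsp[OF Wm(1)])
  have UN: "sub U N" unfolding U_def by (rule sub_subsp[OF Wm NW])
  have Q: "vs Q" unfolding Q_def by (rule vs_quot[OF U UN])
  have UC: "C.vs UC" and VC: "C.vs VC" and QC: "C.vs QC" unfolding UC_def VC_def QC_def using U V Q by simp_all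
  have q: "qcls U N \<in> lin U Q" unfolding Q_def by (rule qcls_lin[OF U UN])
  have i: "\<iota> \<in> C.lin UC VC" unfolding \<iota>_def UC_def VC_def U_def by (rule cincl_lin[OF Wm(1)])
  have i_inj: "inj_on \<iota> (carrier UC)" unfolding \<iota>_def UC_def U_def by (rule cincl_inj[OF Wm(1)])
  have i_im: "csub V (W m) = \<iota> ` carrier UC" unfolding \<iota>_def UC_def U_def by (rule csub_image[OF Wm(1)])
  have k: "\<kappa> \<in> C.lin UC QC" unfolding \<kappa>_def UC_def QC_def by (rule cext_map_lin[OF U Q q])
  have k_surj: "\<kappa> ` carrier UC = carrier QC"
    unfolding \<kappa>_def UC_def QC_def Q_def by (rule cquot_surj[OF U UN])
  have csub_im: "csub V N = \<iota> ` csub U N" unfolding \<iota>_def U_def by (rule csub_subsp[OF Wm NW, symmetric])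
  have UNC: "C.sub UC (csub U N)" unfolding UC_def by (rule csub_sub[OF UN])
  have k_csub: "\<kappa> t = \<zero>\<^bsub>QC\<^esub>" if "t \<in> csub U N" for t
    using UN that
  proof (induction rule: csub_induct)
    case zero
    show ?case using C.lin_zero[OF k UC QC] by (simp add: UC_def)
  next
    case (pure v z)
    have v: "v \<in> carrier U" using sub_carrier[OF UN pure] .
    hence "\<kappa> (ctensor U v z) = ctensor Q (qcls U N v) z" unfolding \<kappa>_def using U Q q by simp
    also have "qcls U N v = \<zero>\<^bsub>Q\<^esub>" using qcls_zero_iff[OF U UN v] pure by (simp add: Q_def)
    finally show ?case using ctensor_zero[OF Q] by (simp add: QC_def)
  next
    case (add s t)
    have "s \<in> carrier UC" "t \<in> carrier UC" using add.hyps C.sub_carrier[OF UNC] by auto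
    thus ?case using C.lin_add[OF k] add.IH QC by (simp add: UC_def)
  qed
  have ker: "\<kappa> x = \<zero>\<^bsub>QC\<^esub> \<longleftrightarrow> \<iota> x \<in> csub V N" if x: "x \<in> carrier UC" for x
  proof
    assume "\<kappa> x = \<zero>\<^bsub>QC\<^esub>"
    hence "x \<in> csub U N" using cquot_kernel[OF U UN] x unfolding \<kappa>_def QC_def UC_def Q_def by blast
    thus "\<iota> x \<in> csub V N" unfolding csub_im by (rule imageI)
  next
    assume "\<iota> x \<in> csub V N"
    then obtain y where "y \<in> csub U N" "\<iota> x = \<iota> y" unfolding csub_im by blast
    moreover have "x = y" using inj_onD[OF i_inj] x C.sub_carrier[OF UNC] calculation by blast
    ultimately show "\<kappa> x = \<zero>\<^bsub>QC\<^esub>" using k_csub by simp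
  qed
  note ic = C.lin_closed[OF i] and kc = C.lin_closed[OF k]
  have Fs: "C.sub VC (F p)" for p using F unfolding VC_def by (simp add: decreasing_filtration_def)
  define X where "X p = {x \<in> carrier UC. \<iota> x \<in> F p}" for p
  define Y where "Y p = {x \<in> carrier UC. \<iota> x \<in> cext_conj K V ` F p}" for p
  have Xs: "C.sub UC (X p)" for p unfolding X_def by (rule C.lin_vimage_sub[OF i UC VC Fs])
  have Ys: "C.sub UC (Y p)" for p
    unfolding Y_def using cext_conj_sub[OF V] Fs unfolding VC_def
    by (intro C.lin_vimage_sub[OF i[unfolded VC_def] UC]) (use VC in \<open>simp_all only: VC_def\<close>)
  have ind: "induced_filtration K V W F m p = \<kappa> ` X p" for p
    unfolding induced_filtration_def X_def \<kappa>_def \<iota>_def UC_def Q_def U_def N_def Gr_def Gr_proj_def ..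
  have GrQ: "Gr V W m = Q" unfolding Gr_def Q_def U_def N_def ..
  have conj_i: "\<iota> (cext_conj K U x) = cext_conj K V (\<iota> x)" if "x \<in> carrier UC" for x
    unfolding \<iota>_def U_def using cext_conj_map[OF vs_subsp[OF Wm(1)] V subsp_incl[OF Wm(1)]] that
    unfolding UC_def U_def by simp
  have conj_k: "\<kappa> (cext_conj K U x) = cext_conj K Q (\<kappa> x)" if "x \<in> carrier UC" for x
    unfolding \<kappa>_def using cext_conj_map[OF U Q q] that unfolding UC_def by simp
  have conj_U: "cext_conj K U x \<in> carrier UC" "cext_conj K U (cext_conj K U x) = x" if "x \<in> carrier UC" for x
    using cext_conj_closed[OF U] cext_conj_conj[OF U] that unfolding UC_def by blast+
  have FV: "F p \<subseteq> carrier (cext K V)" for p using C.sub_subset[OF Fs] unfolding VC_def .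
  \<comment> \<open>\<iota> and \<kappa> are extensions of \<open>K\<close>-linear maps, hence
    commute with conjugation: the conjugate of the induced filtration is induced by the conjugate
    filtration.\<close>
  have ind_conj: "cext_conj K Q ` \<kappa> ` X p = \<kappa> ` Y p" for p
  proof (intro equalityI subsetI)
    fix z assume "z \<in> cext_conj K Q ` \<kappa> ` X p"
    then obtain x where x: "x \<in> carrier UC" "\<iota> x \<in> F p" "z = cext_conj K Q (\<kappa> x)" by (auto simp: X_def)
    hence "z = \<kappa> (cext_conj K U x)" "cext_conj K U x \<in> Y p"
      using conj_k conj_i conj_U by (auto simp: Y_def)
    thus "z \<in> \<kappa> ` Y p" by blast
  next
    fix z assume "z \<in> \<kappa> ` Y p"
    then obtain x where x: "x \<in> carrier UC" "\<iota> x \<in> cext_conj K V ` F p" "z = \<kappa> x" by (auto simp: Y_def)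
    have "\<iota> x \<in> carrier (cext K V)" using ic[OF x(1)] unfolding VC_def .
    hence "\<iota> (cext_conj K U x) \<in> F p"
      using x conj_i cext_conj_image_iff[OF V FV, of "\<iota> x" p] by simp
    hence "cext_conj K U x \<in> X p" using conj_U x(1) by (simp add: X_def)
    moreover have "z = cext_conj K Q (\<kappa> (cext_conj K U x))" using conj_k conj_U x by metis
    ultimately show "z \<in> cext_conj K Q ` \<kappa> ` X p" by blast
  qed
  have decr: "decreasing_filtration UNIV QC (\<lambda>p. \<kappa> ` X p)"
  proof -
    obtain a b where ab: "F a = {\<zero>\<^bsub>VC\<^esub>}" "F b = carrier VC"
      using F unfolding decreasing_filtration_def VC_def by blast
    have "x = \<zero>\<^bsub>UC\<^esub>" if "x \<in> X a" for x
    proof -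
      have "x \<in> carrier UC" "\<iota> x = \<iota> \<zero>\<^bsub>UC\<^esub>" using that ab(1) C.lin_zero[OF i UC VC] by (auto simp: X_def)
      thus ?thesis using inj_onD[OF i_inj, of x "\<zero>\<^bsub>UC\<^esub>"] C.vs_zero[OF UC] by simp
    qed
    hence "X a = {\<zero>\<^bsub>UC\<^esub>}" using C.sub_zero[OF Xs] by blast
    hence "\<kappa> ` X a = {\<zero>\<^bsub>QC\<^esub>}" using C.lin_zero[OF k UC QC] by simp
    moreover have "X b = carrier UC" using ic by (auto simp: X_def ab(2))
    hence "\<kappa> ` X b = carrier QC" using k_surj by simp
    moreover have "antimono (\<lambda>p. \<kappa> ` X p)"
      using F by (intro antimonoI image_mono) (auto simp: decreasing_filtration_def X_def dest: antimonoD)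
    moreover have "C.sub QC (\<kappa> ` X p)" for p by (rule C.lin_image_sub[OF k UC QC Xs])
    ultimately show ?thesis unfolding decreasing_filtration_def by blast
  qed
  have finQ: "fin_dim Q"
    using fin_dim_subsp[OF Wm(1) fin] unfolding U_def[symmetric]
    by (rule fin_dim_image[OF q U Q, rotated]) (simp add: Q_def quot_simps[OF U UN])
  \<comment> \<open>Equality in the graded piece is congruence modulo \<open>W (m - 1)\<close> in V
    \<otimes> \<complex>; both halves of the equivalence rest on this.\<close>
  have diff: "\<kappa> x = \<kappa> y \<longleftrightarrow> \<iota> x \<ominus>\<^bsub>VC\<^esub> \<iota> y \<in> csub V N" if "x \<in> carrier UC" "y \<in> carrier UC" for x y
    using ker[of "x \<ominus>\<^bsub>UC\<^esub> y"] that UC C.lin_minus[OF k UC QC] C.lin_minus[OF i UC VC]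
      C.vs_diff_eq_zero[OF QC kc kc] by simp
  have A: "\<kappa> ` X p \<inter> \<kappa> ` Y r = {\<zero>\<^bsub>QC\<^esub>} \<longleftrightarrow> ?inter p r" for p r
  proof
    assume eq: "\<kappa> ` X p \<inter> \<kappa> ` Y r = {\<zero>\<^bsub>QC\<^esub>}"
    show "?inter p r"
    proof (intro ballI impI)
      fix f h assume f: "f \<in> F p \<inter> csub V (W m)" and h: "h \<in> cext_conj K V ` F r \<inter> csub V (W m)"
        and d: "f \<ominus>\<^bsub>cext K V\<^esub> h \<in> csub V (W (m - 1))"
      obtain x where x: "x \<in> carrier UC" "f = \<iota> x" using f unfolding i_im by blast
      obtain y where y: "y \<in> carrier UC" "h = \<iota> y" using h unfolding i_im by blast
      have "\<kappa> x = \<kappa> y" using diff[OF x(1) y(1)] d x y unfolding N_def VC_def by simp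
      moreover have "x \<in> X p" "y \<in> Y r" using f h x y by (auto simp: X_def Y_def)
      ultimately have "\<kappa> x \<in> \<kappa> ` X p \<inter> \<kappa> ` Y r" by blast
      thus "f \<in> csub V (W (m - 1))" using ker[OF x(1)] x(2) eq unfolding N_def by simp
    qed
  next
    assume inter: "?inter p r"
    have "z = \<zero>\<^bsub>QC\<^esub>" if z: "z \<in> \<kappa> ` X p" "z \<in> \<kappa> ` Y r" for z
    proof -
      obtain x y where xy: "x \<in> X p" "z = \<kappa> x" "y \<in> Y r" "z = \<kappa> y" using z by blast
      hence c: "x \<in> carrier UC" "y \<in> carrier UC" by (auto simp: X_def Y_def)
      have "\<iota> x \<ominus>\<^bsub>cext K V\<^esub> \<iota> y \<in> csub V (W (m - 1))" using diff[OF c] xy unfolding N_def VC_def by simp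
      moreover have "\<iota> x \<in> F p \<inter> csub V (W m)" "\<iota> y \<in> cext_conj K V ` F r \<inter> csub V (W m)"
        using xy c i_im by (auto simp: X_def Y_def)
      ultimately have "\<iota> x \<in> csub V N" using inter unfolding N_def by blast
      thus ?thesis using ker[OF c(1)] xy(2) by simp
    qed
    moreover have "\<zero>\<^bsub>QC\<^esub> \<in> \<kappa> ` X p \<inter> \<kappa> ` Y r"
      using C.sub_zero[OF C.lin_image_sub[OF k UC QC Xs]] C.sub_zero[OF C.lin_image_sub[OF k UC QC Ys]] by blast
    ultimately show "\<kappa> ` X p \<inter> \<kappa> ` Y r = {\<zero>\<^bsub>QC\<^esub>}" by blast
  qed
  have B: "\<kappa> ` X p <+>\<^bsub>QC\<^esub> \<kappa> ` Y r = carrier QC \<longleftrightarrow> ?split p r" for p r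
  proof
    assume eq: "\<kappa> ` X p <+>\<^bsub>QC\<^esub> \<kappa> ` Y r = carrier QC"
    show "?split p r"
    proof
      fix x assume "x \<in> csub V (W m)"
      then obtain u where u: "u \<in> carrier UC" "x = \<iota> u" unfolding i_im by blast
      have "\<kappa> u \<in> \<kappa> ` X p <+>\<^bsub>QC\<^esub> \<kappa> ` Y r" unfolding eq using kc[OF u(1)] .
      then obtain a b where ab: "a \<in> X p" "b \<in> Y r" "\<kappa> u = \<kappa> a \<oplus>\<^bsub>QC\<^esub> \<kappa> b" by (auto simp: C.set_add_iff)
      have c: "a \<in> carrier UC" "b \<in> carrier UC" using ab by (auto simp: X_def Y_def)
      let ?w = "\<iota> u \<ominus>\<^bsub>VC\<^esub> (\<iota> a \<oplus>\<^bsub>VC\<^esub> \<iota> b)"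
      have "\<kappa> u = \<kappa> (a \<oplus>\<^bsub>UC\<^esub> b)" using ab(3) C.lin_add[OF k c] by simp
      hence "?w \<in> csub V N" using diff[of u "a \<oplus>\<^bsub>UC\<^esub> b"] u c UC C.lin_add[OF i c] by simp
      moreover have "x = (\<iota> a \<oplus>\<^bsub>VC\<^esub> \<iota> b) \<oplus>\<^bsub>VC\<^esub> ?w"
        unfolding u(2) using ic[OF u(1)] ic[OF c(1)] ic[OF c(2)] VC
        by (simp add: C.vs_diff_simps[OF VC] C.vs_ac[OF VC])
      moreover have "\<iota> a \<in> F p \<inter> csub V (W m)" "\<iota> b \<in> cext_conj K V ` F r \<inter> csub V (W m)"
        using ab c i_im by (auto simp: X_def Y_def)
      ultimately show "\<exists>f\<in>F p \<inter> csub V (W m). \<exists>h\<in>cext_conj K V ` F r \<inter> csub V (W m).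
          \<exists>w\<in>csub V (W (m - 1)). x = (f \<oplus>\<^bsub>cext K V\<^esub> h) \<oplus>\<^bsub>cext K V\<^esub> w"
        unfolding N_def VC_def by blast
    qed
  next
    assume split: "?split p r"
    have "z \<in> \<kappa> ` X p <+>\<^bsub>QC\<^esub> \<kappa> ` Y r" if z: "z \<in> carrier QC" for z
    proof -
      obtain u where u: "u \<in> carrier UC" "z = \<kappa> u" using z unfolding k_surj[symmetric] by (elim imageE) (rule that)
      have "\<iota> u \<in> csub V (W m)" using u(1) i_im by blast
      from bspec[OF split this] obtain f h w where fhw: "f \<in> F p \<inter> csub V (W m)"
          "h \<in> cext_conj K V ` F r \<inter> csub V (W m)" "w \<in> csub V N" "\<iota> u = (f \<oplus>\<^bsub>VC\<^esub> h) \<oplus>\<^bsub>VC\<^esub> w"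
        by (elim bexE) (rule that[unfolded N_def VC_def])
      obtain a where a: "a \<in> carrier UC" "f = \<iota> a" using fhw(1) unfolding i_im by blast
      obtain b where b: "b \<in> carrier UC" "h = \<iota> b" using fhw(2) unfolding i_im by blast
      have w: "w \<in> carrier VC" using C.sub_carrier[OF csub_sub[OF Wm(2)] fhw(3)] unfolding VC_def .
      have "\<iota> u \<ominus>\<^bsub>VC\<^esub> \<iota> (a \<oplus>\<^bsub>UC\<^esub> b) = w"
        using fhw(4) a b w ic[OF a(1)] ic[OF b(1)] VC C.lin_add[OF i a(1) b(1)]
        by (simp add: C.vs_diff_simps[OF VC] C.vs_ac[OF VC])
      hence "\<kappa> u = \<kappa> (a \<oplus>\<^bsub>UC\<^esub> b)" using diff[of u "a \<oplus>\<^bsub>UC\<^esub> b"] u a b UC fhw(3) by simp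
      hence "z = \<kappa> a \<oplus>\<^bsub>QC\<^esub> \<kappa> b" using u(2) C.lin_add[OF k a(1) b(1)] by simp
      moreover have "a \<in> X p" "b \<in> Y r" using fhw a b by (auto simp: X_def Y_def)
      ultimately show ?thesis by (auto simp: C.set_add_iff)
    qed
    moreover have "\<kappa> ` X p <+>\<^bsub>QC\<^esub> \<kappa> ` Y r \<subseteq> carrier QC"
      by (rule C.sub_subset[OF C.sub_set_add[OF C.lin_image_sub[OF k UC QC Xs] C.lin_image_sub[OF k UC QC Ys]]])
    ultimately show "\<kappa> ` X p <+>\<^bsub>QC\<^esub> \<kappa> ` Y r = carrier QC" by blast
  qed
  show ?thesis
    unfolding pure_hodge_structure_def GrQ ind ind_conj QC_def[symmetric] A B using Q finQ decr by blast
qed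

lemma is_mhs_iff:
  "is_mhs K A \<longleftrightarrow> vs (hspace A) \<and> fin_dim (hspace A) \<and> increasing_filtration K (hspace A) (wfil A) \<and>
     opposed_filtrations UNIV (cext K (hspace A)) (\<lambda>m. csub (hspace A) (wfil A m)) (hfil A)
       (\<lambda>p. cext_conj K (hspace A) ` hfil A p)" (is "_ \<longleftrightarrow> ?R")
proof
  assume A: "is_mhs K A"
  hence 1: "vs (hspace A)" "fin_dim (hspace A)" "increasing_filtration K (hspace A) (wfil A)"
    "decreasing_filtration UNIV (cext K (hspace A)) (hfil A)" by (simp_all add: is_mhs_def)
  have "\<forall>m. pure_hodge_structure K m (Gr (hspace A) (wfil A) m) (induced_filtration K (hspace A) (wfil A) (hfil A) m)"
    using A by (simp add: is_mhs_def)
  hence "C.opposed (cext K (hspace A)) (\<lambda>m. csub (hspace A) (wfil A m)) (hfil A)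
       (\<lambda>p. cext_conj K (hspace A) ` hfil A p)"
    unfolding pure_hodge_structure_Gr_iff[OF 1] C.opposed_def by blast
  thus ?R using 1 vs_cext[OF 1(1)] csub_increasing[OF 1(1,3)] cext_conj_decreasing[OF 1(1,4)]
    by (simp add: opposed_filtrations_def opposed_filtrations_axioms_def C.base_field_axioms)
next
  assume A: ?R
  then interpret O: opposed_filtrations UNIV "cext K (hspace A)" "\<lambda>m. csub (hspace A) (wfil A m)" "hfil A"
    "\<lambda>p. cext_conj K (hspace A) ` hfil A p" by blast
  have 1: "vs (hspace A)" "fin_dim (hspace A)" "increasing_filtration K (hspace A) (wfil A)" using A by blast+
  have "pure_hodge_structure K m (Gr (hspace A) (wfil A) m) (induced_filtration K (hspace A) (wfil A) (hfil A) m)" for m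
    unfolding pure_hodge_structure_Gr_iff[OF 1 O.F_fil] using O.opposed unfolding C.opposed_def by blast
  thus "is_mhs K A" unfolding is_mhs_def using 1 O.F_fil by blast
qed

section \<open>Extension of scalars and tensor products\<close>

text \<open>A lift uses only the zero and the addition of its target, where the two spaces
  coincide.\<close>

lemma tlift_cext: "tlift (cext K V) = tlift (tensor K V CC)"
  by (intro ext) (simp add: tlift_fsum fsum_def)

lemma lin_cext: "\<lbrakk>f \<in> lin U (tensor K V CC); vs V\<rbrakk> \<Longrightarrow> f \<in> lin U (cext K V)"
  by (rule linI) (simp_all add: lin_closed lin_add lin_smult cext_smult_real)

lemma Scal_mult_lin: "(\<lambda>x. Scal (z * scal x)) \<in> lin CC CC" "(\<lambda>x. Scal (scal x * z)) \<in> lin CC CC"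
  by (rule linI; auto simp: algebra_simps)+

context
  fixes V V' :: "'a vs"
  assumes V: "vs V" and V': "vs V'"
begin

private abbreviation "VV \<equiv> tensor K V V'"
private abbreviation "X \<equiv> tensor K VV CC"
private abbreviation "XC \<equiv> cext K VV"
private abbreviation "T \<equiv> tensor UNIV (cext K V) (cext K V')"
private abbreviation "tt \<equiv> pure_tensor UNIV (cext K V) (cext K V')"

text \<open>The nested lifts of \<open>cext_tensor\<close> are named from the inside:
  \<open>\<gamma>\<close> is lifted in the second argument to \<open>\<beta>2\<close> and in the
  first one to \<open>\<beta>1\<close>, so that bilinearity can be shown one layer at a
  time.\<close>

private definition \<gamma> :: "'a pt \<Rightarrow> complex \<Rightarrow> 'a pt \<Rightarrow> 'a pt \<Rightarrow> 'a pt" where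
  "\<gamma> v z v' z' = ctensor VV (pure_tensor K V V' v v') (z * scal z')"

private lemma spaces: "vs VV" "vs X" "C.vs XC" "C.vs (cext K V)" "C.vs (cext K V')" "C.vs T"
  "vs (tensor K V CC)" "vs (tensor K V' CC)"
  using V V' by simp_all

private lemma bilin_\<gamma>: "v \<in> carrier V \<Longrightarrow> bilin V' CC X (\<gamma> v z)"
  unfolding \<gamma>_def
  using bilin_comp[OF bilin_pure[OF spaces(1) vs_CC] pure_lin_right[OF V V'] Scal_mult_lin(1)] by blast

private lemma \<gamma>_lin: "\<lbrakk>v' \<in> carrier V'; z' \<in> carrier CC\<rbrakk> \<Longrightarrow> (\<lambda>v. \<gamma> v z v' z') \<in> lin V X"
  "\<lbrakk>v \<in> carrier V; v' \<in> carrier V'; z' \<in> carrier CC\<rbrakk> \<Longrightarrow> (\<lambda>z. \<gamma> v (scal z) v' z') \<in> lin CC X"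
proof -
  assume v': "v' \<in> carrier V'" "z' \<in> carrier CC"
  thus "(\<lambda>v. \<gamma> v z v' z') \<in> lin V X"
    unfolding \<gamma>_def using spaces V V' by (intro lin_comp[OF pure_lin_left pure_lin_left]) auto
  assume v: "v \<in> carrier V"
  show "(\<lambda>z. \<gamma> v (scal z) v' z') \<in> lin CC X"
    unfolding \<gamma>_def using v v' spaces by (intro lin_comp[OF Scal_mult_lin(2) pure_lin_right]) auto
qed

private definition \<beta>2 :: "'a pt \<Rightarrow> complex \<Rightarrow> 'a pt \<Rightarrow> 'a pt" where
  "\<beta>2 v z s' = tlift X (\<gamma> v z) s'"

private lemma \<beta>2_lin: "v \<in> carrier V \<Longrightarrow> \<beta>2 v z \<in> lin (tensor K V' CC) X"
  unfolding \<beta>2_def using tlift_lin[OF V' vs_CC spaces(2) bilin_\<gamma>] .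

private lemma \<beta>2_bilin: "s' \<in> carrier (tensor K V' CC) \<Longrightarrow> bilin V CC X (\<lambda>v z. \<beta>2 v (scal z) s')"
proof (rule bilinI)
  assume s': "s' \<in> carrier (tensor K V' CC)"
  fix z assume "z \<in> carrier (CC :: 'a vs)"
  have "bilin (tensor K V' CC) V X (\<lambda>s w. tlift X (\<gamma> w (scal z)) s)"
    by (rule bilin_tlift[OF V' vs_CC V spaces(2) bilin_\<gamma> \<gamma>_lin(1)])
  from bilin_right[OF this s'] show "(\<lambda>v. \<beta>2 v (scal z) s') \<in> lin V X" unfolding \<beta>2_def .
next
  assume s': "s' \<in> carrier (tensor K V' CC)"
  fix v assume v: "v \<in> carrier V"
  have "bilin (tensor K V' CC) CC X (\<lambda>s w. tlift X (\<gamma> v (scal w)) s)"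
    by (rule bilin_tlift[OF V' vs_CC vs_CC spaces(2) bilin_\<gamma>[OF v] \<gamma>_lin(2)[OF v]])
  from bilin_right[OF this s'] show "(\<lambda>z. \<beta>2 v (scal z) s') \<in> lin CC X" unfolding \<beta>2_def .
qed

private definition \<beta>1 :: "'a pt \<Rightarrow> 'a pt \<Rightarrow> 'a pt" where
  "\<beta>1 s s' = tlift X (\<lambda>v z. \<beta>2 v (scal z) s') s"

private lemma \<beta>1_pure: "\<lbrakk>v \<in> carrier V; s' \<in> carrier (tensor K V' CC)\<rbrakk> \<Longrightarrow> \<beta>1 (ctensor V v z) s' = \<beta>2 v z s'"
  unfolding \<beta>1_def by (subst tlift_pure[OF V vs_CC spaces(2) \<beta>2_bilin]) auto

private lemma \<beta>2_pure: "\<lbrakk>v \<in> carrier V; v' \<in> carrier V'\<rbrakk>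
    \<Longrightarrow> \<beta>2 v z (ctensor V' v' z') = ctensor VV (pure_tensor K V V' v v') (z * z')"
  unfolding \<beta>2_def by (subst tlift_pure[OF V' vs_CC spaces(2) bilin_\<gamma>]) (auto simp: \<gamma>_def)

private lemma \<beta>1_bilin: "bilin (tensor K V CC) (tensor K V' CC) X \<beta>1"
  unfolding \<beta>1_def using bilin_tlift[OF V vs_CC spaces(8,2) \<beta>2_bilin \<beta>2_lin] by simp

text \<open>By construction \<open>\<beta>1\<close> is bilinear over \<open>K\<close> only.
  Compatibility with complex scalars in either argument is checked on pure tensors, where all
  scalars are collected in one product.\<close>

private lemma \<beta>1_C_bilin: "C.bilin (cext K V) (cext K V') XC \<beta>1"
proof (rule C.bilinI)
  fix s' assume s': "s' \<in> carrier (cext K V')"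
  hence s'': "s' \<in> carrier (tensor K V' CC)" by simp
  show "(\<lambda>s. \<beta>1 s s') \<in> C.lin (cext K V) XC"
  proof (rule cext_linI[OF V spaces(3)])
    show "(\<lambda>s. \<beta>1 s s') \<in> lin (tensor K V CC) XC"
      by (rule lin_cext[OF bilin_left[OF \<beta>1_bilin s''] spaces(1)])
    fix c z v assume v: "v \<in> carrier V"
    have "\<beta>2 v (c * z) s' = c \<odot>\<^bsub>XC\<^esub> \<beta>2 v z s'"
      using s'
    proof (induction rule: cext_induct)
      case zero
      show ?case using lin_zero[OF \<beta>2_lin[OF v] spaces(8,2)] C.vs_smult_zero[OF spaces(3), of c] by simp
    next
      case (pure v' z')
      thus ?case using v spaces(1) by (simp add: \<beta>2_pure mult.assoc)
    next
      case (add s t)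
      thus ?case using C.vs_distr[OF spaces(3), of c] lin_closed[OF \<beta>2_lin[OF v]] by (simp add: lin_add[OF \<beta>2_lin[OF v]])
    qed
    thus "\<beta>1 (ctensor V v (c * z)) s' = c \<odot>\<^bsub>XC\<^esub> \<beta>1 (ctensor V v z) s'" using v s'' by (simp add: \<beta>1_pure)
  qed
next
  fix s assume s: "s \<in> carrier (cext K V)"
  hence s'': "s \<in> carrier (tensor K V CC)" by simp
  show "\<beta>1 s \<in> C.lin (cext K V') XC"
  proof (rule cext_linI[OF V' spaces(3)])
    show "\<beta>1 s \<in> lin (tensor K V' CC) XC"
      by (rule lin_cext[OF bilin_right[OF \<beta>1_bilin s''] spaces(1)])
    fix c z v' assume v': "v' \<in> carrier V'"
    hence t: "ctensor V' v' (c * z) \<in> carrier (tensor K V' CC)" "ctensor V' v' z \<in> carrier (tensor K V' CC)" by simp_all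
    note l = bilin_left[OF \<beta>1_bilin t(1)] bilin_left[OF \<beta>1_bilin t(2)]
    show "\<beta>1 s (ctensor V' v' (c * z)) = c \<odot>\<^bsub>XC\<^esub> \<beta>1 s (ctensor V' v' z)"
      using s
    proof (induction rule: cext_induct)
      case zero
      show ?case using lin_zero[OF l(1) spaces(7,2)] lin_zero[OF l(2) spaces(7,2)] C.vs_smult_zero[OF spaces(3), of c] by simp
    next
      case (pure v z)
      thus ?case using v' t spaces(1) by (simp add: \<beta>1_pure \<beta>2_pure mult.left_commute)
    next
      case (add s t)
      thus ?case using C.vs_distr[OF spaces(3), of c] lin_closed[OF l(2)] lin_add[OF l(1), of s t] lin_add[OF l(2), of s t] by simp
    qed
  qed
qed

private lemma cext_tensor_eq: "cext_tensor K V V' = (\<lambda>t\<in>carrier T. tlift XC \<beta>1 t)"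
  unfolding cext_tensor_def Let_def tlift_cext \<beta>1_def \<beta>2_def \<gamma>_def ..

lemma cext_tensor_linear: "cext_tensor K V V' \<in> linear_maps UNIV T XC"
  unfolding cext_tensor_eq using spaces \<beta>1_C_bilin by (intro C.linear_maps_restrict C.tlift_lin)

lemma cext_tensor_pure:
  assumes "v \<in> carrier V" "v' \<in> carrier V'"
  shows "cext_tensor K V V' (tt (ctensor V v z) (ctensor V' v' z')) = ctensor VV (pure_tensor K V V' v v') (z * z')"
  using assms spaces unfolding cext_tensor_eq
  by (simp add: C.tlift_pure[OF spaces(4,5,3) \<beta>1_C_bilin] \<beta>1_pure \<beta>2_pure)

lemma cext_tensor_lin_eqI:
  assumes f: "f \<in> C.lin T Y" and g: "g \<in> C.lin T Y" and Y: "C.vs Y" and t: "t \<in> carrier T"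
    and eq: "\<And>v v'. \<lbrakk>v \<in> carrier V; v' \<in> carrier V'\<rbrakk>
      \<Longrightarrow> f (tt (ctensor V v 1) (ctensor V' v' 1)) = g (tt (ctensor V v 1) (ctensor V' v' 1))"
  shows "f t = g t"
proof (rule C.tensor_lin_eqI[OF f g spaces(4,5) Y _ t])
  have right: "f (tt (ctensor V v 1) s') = g (tt (ctensor V v 1) s')"
    if v: "v \<in> carrier V" and s': "s' \<in> carrier (cext K V')" for v s'
  proof (rule cext_lin_eqI[OF C.lin_comp[OF C.pure_lin_right[OF spaces(4,5)] f] C.lin_comp[OF C.pure_lin_right[OF spaces(4,5)] g] V' Y _ s'])
    show "ctensor V v 1 \<in> carrier (cext K V)" "ctensor V v 1 \<in> carrier (cext K V)" using v by simp_all
    show "f (tt (ctensor V v 1) (ctensor V' v' 1)) = g (tt (ctensor V v 1) (ctensor V' v' 1))" if "v' \<in> carrier V'" for v'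
      using eq[OF v that] .
  qed
  show "f (tt s s') = g (tt s s')" if s: "s \<in> carrier (cext K V)" and s': "s' \<in> carrier (cext K V')" for s s'
    by (rule cext_lin_eqI[OF C.lin_comp[OF C.pure_lin_left[OF spaces(4,5) s'] f] C.lin_comp[OF C.pure_lin_left[OF spaces(4,5) s'] g] V Y right[OF _ s'] s])
qed

text \<open>The inverse sends (v \<otimes> v') \<otimes> z to z times (v \<otimes> 1) \<otimes> (v'
  \<otimes> 1). It is built in two lifts: \<chi> over \<open>K\<close> on V \<otimes> V', and from
  it the complex linear \<psi>.\<close>

lemma cext_tensor_bij: "bij_betw (cext_tensor K V V') (carrier T) (carrier XC)"
proof -
  let ?\<phi> = "cext_tensor K V V'"
  have \<phi>: "?\<phi> \<in> C.lin T XC" using cext_tensor_linear by (rule C.linear_maps_lin)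
  have one: "(\<lambda>v. ctensor U v 1) \<in> lin U (cext K U)" if "vs U" for U :: "'a vs"
    using that by (intro lin_cext pure_lin_left) auto
  let ?c = "\<lambda>v v'. tt (ctensor V v 1) (ctensor V' v' 1)"
  have T: "vs T" by (rule restrict_vs[OF spaces(6)])
  have cb: "bilin V V' T ?c"
  proof (rule bilinI)
    show "(\<lambda>v. ?c v v') \<in> lin V T" if "v' \<in> carrier V'" for v'
      using that by (intro lin_comp[OF one[OF V] restrict_lin[OF C.pure_lin_left[OF spaces(4,5)]]]) simp
    show "?c v \<in> lin V' T" if "v \<in> carrier V" for v
      using that by (intro lin_comp[OF one[OF V'] restrict_lin[OF C.pure_lin_right[OF spaces(4,5)]]]) simp
  qed
  define \<chi> where "\<chi> = tlift T ?c"
  have \<chi>: "\<chi> \<in> lin VV T" unfolding \<chi>_def by (rule tlift_lin[OF V V' T cb])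
  have \<chi>_pure: "\<chi> (pure_tensor K V V' v v') = ?c v v'" if "v \<in> carrier V" "v' \<in> carrier V'" for v v'
    unfolding \<chi>_def using that by (rule tlift_pure[OF V V' T cb])
  have mb: "bilin VV CC T (\<lambda>u z. scal z \<odot>\<^bsub>T\<^esub> \<chi> u)"
  proof (rule bilinI)
    show "(\<lambda>u. scal z \<odot>\<^bsub>T\<^esub> \<chi> u) \<in> lin VV T" for z
      using spaces(6) lin_closed[OF \<chi>]
      by (intro linI) (simp_all add: lin_add[OF \<chi>] lin_smult[OF \<chi>] C.vs_distr C.vs_smult_smult mult.commute)
    show "(\<lambda>z. scal z \<odot>\<^bsub>T\<^esub> \<chi> u) \<in> lin CC T" if "u \<in> carrier VV" for u
      using spaces(6) lin_closed[OF \<chi> that]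
      by (intro linI) (auto simp add: C.vs_distl C.vs_smult_smult)
  qed
  define \<psi> where "\<psi> = tlift T (\<lambda>u z. scal z \<odot>\<^bsub>T\<^esub> \<chi> u)"
  have \<psi>_pure: "\<psi> (ctensor VV u z) = z \<odot>\<^bsub>T\<^esub> \<chi> u" if "u \<in> carrier VV" for u z
    unfolding \<psi>_def using that by (subst tlift_pure[OF spaces(1) vs_CC T mb]) auto
  have \<psi>: "\<psi> \<in> C.lin XC T"
  proof (rule cext_linI[OF spaces(1,6)])
    show "\<psi> \<in> lin (tensor K VV CC) T" unfolding \<psi>_def by (rule tlift_lin[OF spaces(1) vs_CC T mb])
    show "\<psi> (ctensor VV u (c * z)) = c \<odot>\<^bsub>T\<^esub> \<psi> (ctensor VV u z)" if "u \<in> carrier VV" for c u z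
      using that spaces(6) lin_closed[OF \<chi> that] by (simp add: \<psi>_pure C.vs_smult_smult)
  qed
  have 1: "?\<phi> (\<psi> x) = x" if "x \<in> carrier XC" for x
  proof (rule cext_lin_eqI[OF C.lin_comp[OF \<psi> \<phi>] C.lin_id spaces(1,3) _ that])
    fix u assume u: "u \<in> carrier VV"
    have "?\<phi> (\<chi> u) = ctensor VV u 1"
    proof (rule tensor_lin_eqI[OF lin_comp[OF \<chi> restrict_lin[OF \<phi>]] one[OF spaces(1)] V V' restrict_vs[OF spaces(3)] _ u])
      show "?\<phi> (\<chi> (pure_tensor K V V' v v')) = ctensor VV (pure_tensor K V V' v v') 1"
        if "v \<in> carrier V" "v' \<in> carrier V'" for v v'
        using that by (simp add: \<chi>_pure cext_tensor_pure)
    qed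
    thus "?\<phi> (\<psi> (ctensor VV u 1)) = ctensor VV u 1"
      using u spaces(6) lin_closed[OF \<chi> u] by (simp add: \<psi>_pure)
  qed
  have 2: "\<psi> (?\<phi> t) = t" if t: "t \<in> carrier T" for t
  proof (rule cext_tensor_lin_eqI[OF C.lin_comp[OF \<phi> \<psi>] C.lin_id spaces(6) t])
    show "\<psi> (?\<phi> (?c v v')) = ?c v v'" if "v \<in> carrier V" "v' \<in> carrier V'" for v v'
      using that spaces(4,5,6) by (simp add: cext_tensor_pure \<psi>_pure \<chi>_pure)
  qed
  show ?thesis
    by (rule bij_betw_byWitness[where f' = \<psi>]) (use 1 2 C.lin_closed[OF \<phi>] C.lin_closed[OF \<psi>] in auto)
qed

text \<open>Both sides are conjugate-linear, so the comparison of complex linear maps is replaced by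
  an induction in each argument, using additivity.\<close>

lemma cext_tensor_conj:
  assumes s: "s \<in> carrier (cext K V)" and s': "s' \<in> carrier (cext K V')"
  shows "cext_conj K VV (cext_tensor K V V' (tt s s')) = cext_tensor K V V' (tt (cext_conj K V s) (cext_conj K V' s'))"
proof -
  let ?\<phi> = "cext_tensor K V V'"
  have \<phi>: "?\<phi> \<in> C.lin T XC" using cext_tensor_linear by (rule C.linear_maps_lin)
  have left: "(\<lambda>s. ?\<phi> (tt s s')) \<in> C.lin (cext K V) XC" if "s' \<in> carrier (cext K V')" for s'
    by (rule C.lin_comp[OF C.pure_lin_left[OF spaces(4,5) that] \<phi>])
  have right: "(\<lambda>s'. ?\<phi> (tt s s')) \<in> C.lin (cext K V') XC" if "s \<in> carrier (cext K V)" for s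
    by (rule C.lin_comp[OF C.pure_lin_right[OF spaces(4,5) that] \<phi>])
  note cc = cext_conj_closed[OF V] cext_conj_closed[OF V']
  show ?thesis using s
  proof (induction rule: cext_induct)
    case zero
    show ?case using C.lin_zero[OF left[OF s'] spaces(4,3)] C.lin_zero[OF left[OF cc(2)[OF s']] spaces(4,3)]
      cext_conj_zero[OF spaces(1)] cext_conj_zero[OF V] by metis
  next
    case (add s t)
    thus ?case using C.lin_add[OF left[OF s'], of s t] C.lin_add[OF left[OF cc(2)[OF s']] cc(1) cc(1), of s t]
      cext_conj_add[OF spaces(1) C.lin_closed[OF left[OF s']] C.lin_closed[OF left[OF s']], of s t] cext_conj_add[OF V, of s t] by metis
  next
    case (pure v z)
    hence v: "ctensor V v z \<in> carrier (cext K V)" "ctensor V v (cnj z) \<in> carrier (cext K V)" by simp_all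
    have "cext_conj K VV (?\<phi> (tt (ctensor V v z) s')) = ?\<phi> (tt (ctensor V v (cnj z)) (cext_conj K V' s'))" using s'
    proof (induction rule: cext_induct)
      case zero
      show ?case using C.lin_zero[OF right[OF v(1)] spaces(5,3)] C.lin_zero[OF right[OF v(2)] spaces(5,3)]
        cext_conj_zero[OF spaces(1)] cext_conj_zero[OF V'] by metis
    next
      case (add s t)
      thus ?case using C.lin_add[OF right[OF v(1)], of s t] C.lin_add[OF right[OF v(2)] cc(2) cc(2), of s t]
        cext_conj_add[OF spaces(1) C.lin_closed[OF right[OF v(1)]] C.lin_closed[OF right[OF v(1)]], of s t] cext_conj_add[OF V', of s t] by metis
    next
      case (pure v' z')
      thus ?case using \<open>v \<in> carrier V\<close> V' spaces(1) by (simp add: cext_tensor_pure)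
    qed
    thus ?case using pure V by simp
  qed
qed

lemma cext_tensor_csub:
  assumes W: "\<And>m. sub V (W m)" and W': "\<And>m. sub V' (W' m)"
  shows "cext_tensor K V V' ` tensor_family UNIV (cext K V) (cext K V') (\<lambda>m. csub V (W m)) (\<lambda>m. csub V' (W' m)) n
    = csub VV (tensor_family K V V' W W' n)"
proof
  let ?\<phi> = "cext_tensor K V V'" and ?tf = "tensor_family UNIV (cext K V) (cext K V') (\<lambda>m. csub V (W m)) (\<lambda>m. csub V' (W' m)) n"
  have \<phi>: "?\<phi> \<in> C.lin T XC" using cext_tensor_linear by (rule C.linear_maps_lin)
  have fam: "family V W" "family V' W'" using W W' by auto
  have cfam: "C.family (cext K V) (\<lambda>m. csub V (W m))" "C.family (cext K V') (\<lambda>m. csub V' (W' m))"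
    using csub_sub[OF W] csub_sub[OF W'] by auto
  have tf: "sub VV (tensor_family K V V' W W' n)" by (rule tensor_family_sub[OF V V' fam])
  note M = csub_sub[OF tf]
  have tfc: "C.sub T ?tf" by (rule C.tensor_family_sub[OF spaces(4,5) cfam])
  note im = C.lin_image_sub[OF \<phi> spaces(6,3) tfc]
  show "?\<phi> ` ?tf \<subseteq> csub VV (tensor_family K V V' W W' n)"
  proof (rule C.tensor_family_image[OF spaces(4,5) cfam \<phi> spaces(3) M])
    fix i j s s' assume ij: "i + j = n" and s: "s \<in> csub V (W i)" and s': "s' \<in> csub V' (W' j)"
    have c': "s' \<in> carrier (cext K V')" if "s' \<in> csub V' (W' j)" for s' using C.sub_carrier[OF csub_sub[OF W'] that] .
    have c: "s \<in> carrier (cext K V)" if "s \<in> csub V (W i)" for s using C.sub_carrier[OF csub_sub[OF W] that] .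
    note left = C.lin_comp[OF C.pure_lin_left[OF spaces(4,5) c'[OF s']] \<phi>]
    show "?\<phi> (tt s s') \<in> csub VV (tensor_family K V V' W W' n)"
      using W s
    proof (induction rule: csub_induct)
      case zero
      show ?case using C.lin_zero[OF left spaces(4,3)] C.sub_zero[OF M] by metis
    next
      case (add s t)
      thus ?case using C.lin_add[OF left c c, of s t] C.sub_add[OF M] by metis
    next
      case (pure v z)
      have vc: "v \<in> carrier V" using sub_carrier[OF W pure] .
      hence "ctensor V v z \<in> carrier (cext K V)" by simp
      note right = C.lin_comp[OF C.pure_lin_right[OF spaces(4,5) this] \<phi>]
      show ?case using W' s'
      proof (induction rule: csub_induct)
        case zero
        show ?case using C.lin_zero[OF right spaces(5,3)] C.sub_zero[OF M] by metis
      next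
        case (add s t)
        thus ?case using C.lin_add[OF right c' c', of s t] C.sub_add[OF M] by metis
      next
        case (pure v' z')
        have v'c: "v' \<in> carrier V'" using sub_carrier[OF W' pure] .
        have "pure_tensor K V V' v v' \<in> tensor_family K V V' W W' n"
          by (rule pure_in_tensor_family[OF V V' fam \<open>v \<in> W i\<close> pure ij])
        from ctensor_csub[OF this] show ?case unfolding cext_tensor_pure[OF vc v'c] .
      qed
    qed
  qed
  show "csub VV (tensor_family K V V' W W' n) \<subseteq> ?\<phi> ` ?tf"
  proof
    fix x assume "x \<in> csub VV (tensor_family K V V' W W' n)"
    with tf show "x \<in> ?\<phi> ` ?tf"
    proof (induction rule: csub_induct)
      case zero
      show ?case by (rule C.sub_zero[OF im])
    next
      case (add s t)
      thus ?case using C.sub_add[OF im] by blast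
    next
      case (pure u z)
      thus ?case
      proof (induction rule: tensor_family_induct[OF V V' fam, consumes 1, case_names zero pure add])
        case zero
        show ?case using C.sub_zero[OF im] ctensor_zero[OF spaces(1)] by simp
      next
        case (add s t)
        thus ?case using C.sub_add[OF im, of "ctensor VV s z" "ctensor VV t z"] spaces(1) by (simp add: ctensor_add)
      next
        case (pure i j v v')
        have vc: "v \<in> carrier V" "v' \<in> carrier V'" using sub_carrier[OF W] sub_carrier[OF W'] pure by auto
        \<comment> \<open>The scalar z is put on the first factor; on which factor it sits is
          irrelevant after \<open>cext_tensor\<close>.\<close>
        have "tt (ctensor V v z) (ctensor V' v' 1) \<in> ?tf"
          using pure by (intro C.pure_in_tensor_family[OF spaces(4,5) cfam ctensor_csub ctensor_csub])
        from imageI[OF this, of ?\<phi>] show ?case using cext_tensor_pure[OF vc, of z 1] by simp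
      qed
    qed
  qed
qed

text \<open>One inclusion is checked on generators. The other is the same inclusion for the
  conjugated filtrations, conjugated once more, as conjugation is an involution.\<close>

lemma cext_tensor_conj_family:
  assumes F: "\<And>p. C.sub (cext K V) (F p)" and F': "\<And>p. C.sub (cext K V') (F' p)"
  shows "cext_conj K VV ` cext_tensor K V V' ` tensor_family UNIV (cext K V) (cext K V') F F' n
    = cext_tensor K V V' ` tensor_family UNIV (cext K V) (cext K V')
        (\<lambda>p. cext_conj K V ` F p) (\<lambda>p. cext_conj K V' ` F' p) n"
proof -
  let ?\<phi> = "cext_tensor K V V'" and ?tf = "\<lambda>F F'. tensor_family UNIV (cext K V) (cext K V') F F' n"
  let ?c = "\<lambda>F p. cext_conj K V ` F p" and ?c' = "\<lambda>F' p. cext_conj K V' ` F' p"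
  have \<phi>: "?\<phi> \<in> C.lin T XC" using cext_tensor_linear by (rule C.linear_maps_lin)
  have incl: "cext_conj K VV ` ?\<phi> ` ?tf F F' \<subseteq> ?\<phi> ` ?tf (?c F) (?c' F')"
    if F: "\<And>p. C.sub (cext K V) (F p)" and F': "\<And>p. C.sub (cext K V') (F' p)" for F F'
  proof -
    have fam: "C.family (cext K V) F" "C.family (cext K V') F'" using F F' by auto
    have cfam: "C.family (cext K V) (?c F)" "C.family (cext K V') (?c' F')"
      using cext_conj_sub[OF V F] cext_conj_sub[OF V' F'] by auto
    note im = C.lin_image_sub[OF \<phi> spaces(6,3) C.tensor_family_sub[OF spaces(4,5) cfam]]
    have "cext_conj K VV (?\<phi> t) \<in> ?\<phi> ` ?tf (?c F) (?c' F')" if "t \<in> ?tf F F'" for t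
      using that
    proof (induction rule: C.tensor_family_induct[OF spaces(4,5) fam, consumes 1, case_names zero pure add])
      case zero
      show ?case using C.lin_zero[OF \<phi> spaces(6,3)] cext_conj_zero[OF spaces(1)] C.sub_zero[OF im] by metis
    next
      case (pure i j s s')
      have c: "s \<in> carrier (cext K V)" "s' \<in> carrier (cext K V')"
        using pure C.sub_carrier[OF F] C.sub_carrier[OF F'] by blast+
      have "tt (cext_conj K V s) (cext_conj K V' s') \<in> ?tf (?c F) (?c' F')"
        using pure by (intro C.pure_in_tensor_family[OF spaces(4,5) cfam imageI imageI])
      thus ?case unfolding cext_tensor_conj[OF c] by (rule imageI)
    next
      case (add s t)
      have "cext_conj K VV (?\<phi> (s \<oplus>\<^bsub>T\<^esub> t)) = cext_conj K VV (?\<phi> s) \<oplus>\<^bsub>XC\<^esub> cext_conj K VV (?\<phi> t)"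
        unfolding C.lin_add[OF \<phi> add.hyps]
        by (rule cext_conj_add[OF spaces(1) C.lin_closed[OF \<phi> add.hyps(1)] C.lin_closed[OF \<phi> add.hyps(2)]])
      thus ?case using C.sub_add[OF im add.IH] by simp
    qed
    thus ?thesis by blast
  qed
  have cc: "?c (?c F) = F" "?c' (?c' F') = F'"
  proof -
    show "?c (?c F) = F" using cext_conj_conj[OF V] C.sub_carrier[OF F] by (intro ext) (force simp: image_image)
    show "?c' (?c' F') = F'" using cext_conj_conj[OF V'] C.sub_carrier[OF F'] by (intro ext) (force simp: image_image)
  qed
  have "cext_conj K VV ` ?\<phi> ` ?tf (?c F) (?c' F') \<subseteq> ?\<phi> ` ?tf F F'"
    using incl[of "?c F" "?c' F'", OF cext_conj_sub[OF V F] cext_conj_sub[OF V' F']] unfolding cc .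
  hence "cext_conj K VV ` cext_conj K VV ` ?\<phi> ` ?tf (?c F) (?c' F') \<subseteq> cext_conj K VV ` ?\<phi> ` ?tf F F'"
    by (rule image_mono)
  moreover have "x \<in> cext_conj K VV ` cext_conj K VV ` ?\<phi> ` ?tf (?c F) (?c' F')" if x: "x \<in> ?\<phi> ` ?tf (?c F) (?c' F')" for x
  proof -
    have "C.family (cext K V) (?c F)" "C.family (cext K V') (?c' F')"
      by (rule allI, rule cext_conj_sub[OF V F], rule allI, rule cext_conj_sub[OF V' F'])
    note C.tensor_family_sub[OF spaces(4,5) this]
    from C.sub_carrier[OF C.lin_image_sub[OF \<phi> spaces(6,3) this] x]
    have "cext_conj K VV (cext_conj K VV x) = x" by (rule cext_conj_conj[OF spaces(1)])
    with imageI[OF imageI[OF x, of "cext_conj K VV"], of "cext_conj K VV"] show ?thesis by (simp only:)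
  qed
  ultimately show ?thesis using incl[of F F', OF F F'] by (meson equalityI subsetI subset_trans)
qed

end

end

section \<open>Extension of scalars and the structure maps of the tensor product\<close>

context real_field
begin

abbreviation KC :: "'a vs" where "KC \<equiv> cext K (scalars K)"
abbreviation cspace :: "'a mhs \<Rightarrow> 'a vs" where "cspace A \<equiv> cext K (hspace A)"
abbreviation hspace2 where "hspace2 A B \<equiv> tensor K (hspace A) (hspace B)"
abbreviation cmap where "cmap A B \<equiv> cext_map K (hspace A) (hspace B)"
abbreviation cten where "cten A B \<equiv> cext_tensor K (hspace A) (hspace B)"
abbreviation wfil2 where "wfil2 A B \<equiv> tensor_family K (hspace A) (hspace B) (wfil A) (wfil B)"
abbreviation hfil2 where "hfil2 A B \<equiv> tensor_family UNIV (cspace A) (cspace B) (hfil A) (hfil B)"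
abbreviation hbar where "hbar A p \<equiv> cext_conj K (hspace A) ` hfil A p"
abbreviation cwfil where "cwfil A m \<equiv> csub (hspace A) (wfil A m)"

lemma cext_tensor_lin: "\<lbrakk>vs V; vs V'\<rbrakk>
    \<Longrightarrow> cext_tensor K V V' \<in> C.lin (tensor UNIV (cext K V) (cext K V')) (cext K (tensor K V V'))"
  by (rule C.linear_maps_lin[OF cext_tensor_linear])

lemma cext_tensor_triple_eqI:
  assumes vs: "vs U" "vs V" "vs W" and Y: "C.vs Y"
    and f: "f \<in> C.lin (tensor UNIV (tensor UNIV (cext K U) (cext K V)) (cext K W)) Y"
    and g: "g \<in> C.lin (tensor UNIV (tensor UNIV (cext K U) (cext K V)) (cext K W)) Y"
    and t: "t \<in> carrier (tensor UNIV (tensor UNIV (cext K U) (cext K V)) (cext K W))"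
    and eq: "\<And>u v w. \<lbrakk>u \<in> carrier U; v \<in> carrier V; w \<in> carrier W\<rbrakk>
      \<Longrightarrow> f (pure_tensor UNIV (tensor UNIV (cext K U) (cext K V)) (cext K W)
            (pure_tensor UNIV (cext K U) (cext K V) (ctensor U u 1) (ctensor V v 1)) (ctensor W w 1))
        = g (pure_tensor UNIV (tensor UNIV (cext K U) (cext K V)) (cext K W)
            (pure_tensor UNIV (cext K U) (cext K V) (ctensor U u 1) (ctensor V v 1)) (ctensor W w 1))"
  shows "f t = g t"
proof -
  let ?UV = "tensor UNIV (cext K U) (cext K V)"
  have UV: "C.vs ?UV" and WC: "C.vs (cext K W)" using vs by simp_all
  let ?p = "pure_tensor UNIV ?UV (cext K W)"
  have 1: "f (?p s (ctensor W w 1)) = g (?p s (ctensor W w 1))" if s: "s \<in> carrier ?UV" and w: "w \<in> carrier W" for s w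
  proof -
    have c: "ctensor W w 1 \<in> carrier (cext K W)" using w by simp
    show ?thesis
      by (rule cext_tensor_lin_eqI[OF vs(1,2) C.lin_comp[OF C.pure_lin_left[OF UV WC c] f]
            C.lin_comp[OF C.pure_lin_left[OF UV WC c] g] Y s eq[OF _ _ w]])
  qed
  have 2: "f (?p s x) = g (?p s x)" if s: "s \<in> carrier ?UV" and x: "x \<in> carrier (cext K W)" for s x
    by (rule cext_lin_eqI[OF C.lin_comp[OF C.pure_lin_right[OF UV WC s] f]
          C.lin_comp[OF C.pure_lin_right[OF UV WC s] g] vs(3) Y 1[OF s] x])
  show ?thesis by (rule C.tensor_lin_eqI[OF f g UV WC Y 2 t])
qed

text \<open>This lemma and those for associativity and swap below serve twice: they reduce
  preservation of the Hodge filtrations, which on tensor products are images under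
  \<open>cext_tensor\<close>, to statements over \<complex>, and they are the coherence laws of
  \<open>G\<close>.\<close>

lemma cext_tensor_natural:
  assumes vs: "vs V" "vs V'" "vs U" "vs U'" and f: "f \<in> lin V U" and g: "g \<in> lin V' U'"
    and t: "t \<in> carrier (tensor UNIV (cext K V) (cext K V'))"
  shows "cext_map K (tensor K V V') (tensor K U U') (tensor_map K V V' U U' f g) (cext_tensor K V V' t)
    = cext_tensor K U U' (tensor_map UNIV (cext K V) (cext K V') (cext K U) (cext K U')
        (cext_map K V U f) (cext_map K V' U' g) t)"
proof -
  note fg = tensor_map_linear[OF vs f g, THEN linear_maps_lin]
  note F = cext_map_lin[OF vs(1,3) f] and G = cext_map_lin[OF vs(2,4) g]
  note FG = C.tensor_map_linear[OF _ _ _ _ F G, THEN C.linear_maps_lin]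
  show ?thesis
  proof (rule cext_tensor_lin_eqI[OF vs(1,2)
        C.lin_comp[OF cext_tensor_lin[OF vs(1,2)] cext_map_lin[OF _ _ fg]]
        C.lin_comp[OF FG cext_tensor_lin[OF vs(3,4)]] _ t])
    fix v v' assume v: "v \<in> carrier V" "v' \<in> carrier V'"
    thus "cext_map K (tensor K V V') (tensor K U U') (tensor_map K V V' U U' f g)
          (cext_tensor K V V' (pure_tensor UNIV (cext K V) (cext K V') (ctensor V v 1) (ctensor V' v' 1)))
        = cext_tensor K U U' (tensor_map UNIV (cext K V) (cext K V') (cext K U) (cext K U')
            (cext_map K V U f) (cext_map K V' U' g)
            (pure_tensor UNIV (cext K V) (cext K V') (ctensor V v 1) (ctensor V' v' 1)))"
      using vs f g fg F G lin_closed[OF f v(1)] lin_closed[OF g v(2)]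
      by (simp add: cext_tensor_pure tensor_map_pure C.tensor_map_pure)
  qed (use vs in simp_all)
qed

lemma cext_tensor_assoc:
  assumes vs: "vs U" "vs V" "vs W"
    and t: "t \<in> carrier (tensor UNIV (tensor UNIV (cext K U) (cext K V)) (cext K W))"
  shows "cext_map K (tensor K (tensor K U V) W) (tensor K U (tensor K V W)) (tensor_assoc K U V W)
      (cext_tensor K (tensor K U V) W (tensor_map UNIV (tensor UNIV (cext K U) (cext K V)) (cext K W)
        (cext K (tensor K U V)) (cext K W) (cext_tensor K U V) (\<lambda>x\<in>carrier (cext K W). x) t))
    = cext_tensor K U (tensor K V W) (tensor_map UNIV (cext K U) (tensor UNIV (cext K V) (cext K W))
        (cext K U) (cext K (tensor K V W)) (\<lambda>x\<in>carrier (cext K U). x) (cext_tensor K V W)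
        (tensor_assoc UNIV (cext K U) (cext K V) (cext K W) t))"
proof -
  have id: "(\<lambda>x\<in>carrier (cext K W). x) \<in> C.lin (cext K W) (cext K W)" if "vs W" for W :: "'a vs"
    using that by (intro C.lin_restrict C.lin_id) simp
  have s: "vs (tensor K U V)" "vs (tensor K V W)" "C.vs (cext K U)" "C.vs (cext K V)" "C.vs (cext K W)"
    "C.vs (cext K (tensor K U V))" "C.vs (cext K (tensor K V W))"
    "C.vs (tensor UNIV (cext K U) (cext K V))" "C.vs (tensor UNIV (cext K V) (cext K W))"
    "vs (tensor K (tensor K U V) W)" "vs (tensor K U (tensor K V W))"
    "C.vs (cext K (tensor K U (tensor K V W)))"
    using vs by simp_all
  note a = tensor_assoc_linear[OF vs, THEN linear_maps_lin]
  note A = C.tensor_assoc_linear[OF s(3,4,5), THEN C.linear_maps_lin]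
  note p1 = cext_tensor_lin[OF vs(1,2)] and p2 = cext_tensor_lin[OF vs(2,3)]
  note m1 = C.tensor_map_linear[OF s(8,5,6,5) p1 id[OF vs(3)], THEN C.linear_maps_lin]
  note m2 = C.tensor_map_linear[OF s(3,9,3,7) id[OF vs(1)] p2, THEN C.linear_maps_lin]
  note lhs = C.lin_comp[OF C.lin_comp[OF m1 cext_tensor_lin[OF s(1) vs(3)]] cext_map_lin[OF s(10,11) a]]
  note rhs = C.lin_comp[OF C.lin_comp[OF A m2] cext_tensor_lin[OF vs(1) s(2)]]
  show ?thesis
  proof (rule cext_tensor_triple_eqI[OF vs s(12) lhs rhs t], goal_cases)
    case (1 u v w)
    hence c: "ctensor U u 1 \<in> carrier (cext K U)" "ctensor V v 1 \<in> carrier (cext K V)"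
      "ctensor W w 1 \<in> carrier (cext K W)" by simp_all
    have 2: "pure_tensor UNIV (cext K U) (cext K V) (ctensor U u 1) (ctensor V v 1)
        \<in> carrier (tensor UNIV (cext K U) (cext K V))"
      "pure_tensor UNIV (cext K V) (cext K W) (ctensor V v 1) (ctensor W w 1)
        \<in> carrier (tensor UNIV (cext K V) (cext K W))"
      using c by (simp_all del: cext_simps)
    have uv: "pure_tensor K U V u v \<in> carrier (tensor K U V)" "pure_tensor K V W v w \<in> carrier (tensor K V W)"
      using 1 by simp_all
    show ?case
      unfolding C.tensor_map_pure[OF s(8,5,6,5) p1 id[OF vs(3)] 2(1) c(3)]
        C.tensor_assoc_pure[OF s(3,4,5) c] C.tensor_map_pure[OF s(3,9,3,7) id[OF vs(1)] p2 c(1) 2(2)]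
        restrict_apply'[OF c(1)] restrict_apply'[OF c(3)]
        cext_tensor_pure[OF vs(1,2) 1(1,2)] cext_tensor_pure[OF vs(2,3) 1(2,3)]
        cext_tensor_pure[OF s(1) vs(3) uv(1) 1(3)] cext_tensor_pure[OF vs(1) s(2) 1(1) uv(2)] mult_1
      using 1 vs s a uv by (simp add: tensor_assoc_pure)
  qed
qed

lemma cext_tensor_swap:
  assumes vs: "vs V" "vs V'" and t: "t \<in> carrier (tensor UNIV (cext K V) (cext K V'))"
  shows "cext_map K (tensor K V V') (tensor K V' V) (tensor_swap K V V') (cext_tensor K V V' t)
    = cext_tensor K V' V (tensor_swap UNIV (cext K V) (cext K V') t)"
proof -
  note sw = tensor_swap_linear[OF vs, THEN linear_maps_lin]
  have vsC: "C.vs (cext K V)" "C.vs (cext K V')" using vs by simp_all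
  note SW = C.tensor_swap_linear[OF vsC, THEN C.linear_maps_lin]
  show ?thesis
  proof (rule cext_tensor_lin_eqI[OF vs C.lin_comp[OF cext_tensor_lin[OF vs] cext_map_lin[OF _ _ sw]]
        C.lin_comp[OF SW cext_tensor_lin[OF vs(2,1)]] _ t])
    fix v v' assume v: "v \<in> carrier V" "v' \<in> carrier V'"
    thus "cext_map K (tensor K V V') (tensor K V' V) (tensor_swap K V V')
          (cext_tensor K V V' (pure_tensor UNIV (cext K V) (cext K V') (ctensor V v 1) (ctensor V' v' 1)))
        = cext_tensor K V' V (tensor_swap UNIV (cext K V) (cext K V')
            (pure_tensor UNIV (cext K V) (cext K V') (ctensor V v 1) (ctensor V' v' 1)))"
      using vs sw vsC by (simp add: cext_tensor_pure tensor_swap_pure C.tensor_swap_pure)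
  qed (use vs in simp_all)
qed

abbreviation cunit :: "'a pt \<Rightarrow> 'a pt" where
  "cunit \<equiv> (\<lambda>z\<in>carrier CC. pure_tensor K (scalars K) CC (Scal 1) z)"

lemma cunit_apply: "cunit (Scal c) = ctensor (scalars K) (Scal 1) c"
  by simp

lemma cunit_linear: "(cunit :: 'a pt \<Rightarrow> 'a pt) \<in> linear_maps UNIV CC KC"
proof (rule C.linear_maps_restrict)
  show "pure_tensor K (scalars K) CC (Scal 1) \<in> C.lin CC (KC :: 'a vs)"
  proof (rule C.linI)
    fix v :: "'a pt" assume v: "v \<in> carrier CC"
    thus "pure_tensor K (scalars K) CC (Scal 1) v \<in> carrier KC" by auto
    fix w :: "'a pt" assume w: "w \<in> carrier CC"
    show "pure_tensor K (scalars K) CC (Scal 1) (v \<oplus>\<^bsub>CC\<^esub> w)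
        = pure_tensor K (scalars K) CC (Scal 1) v \<oplus>\<^bsub>KC\<^esub> pure_tensor K (scalars K) CC (Scal 1) w"
      using pure_add_right[of "scalars K" CC "Scal 1" v w] v w by auto
  next
    fix r and v :: "'a pt" assume "v \<in> carrier CC"
    thus "pure_tensor K (scalars K) CC (Scal 1) (r \<odot>\<^bsub>CC\<^esub> v)
        = r \<odot>\<^bsub>KC\<^esub> pure_tensor K (scalars K) CC (Scal 1) v" by auto
  qed
qed simp

lemmas cunit_lin = cunit_linear[THEN C.linear_maps_lin]

text \<open>The inverse sends k \<otimes> z to k z. Surjectivity holds because k \<otimes> z = 1
  \<otimes> k z for k in \<open>K\<close>.\<close>

lemma cunit_bij: "bij_betw cunit (carrier CC) (carrier KC)"
proof -
  let ?\<beta> = "\<lambda>k z. Scal (scal k * scal z) :: 'a pt"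
  have \<beta>: "bilin (scalars K) CC CC ?\<beta>"
    by (intro bilinI linI) (auto simp: algebra_simps)
  have inv: "tlift CC ?\<beta> (cunit z) = z" if "z \<in> carrier CC" for z :: "'a pt"
    using that tlift_pure[OF vs_scalars vs_CC vs_CC \<beta>, of "Scal 1" z] by auto
  have surj: "t \<in> cunit ` carrier CC" if "t \<in> carrier KC" for t :: "'a pt"
    using that
  proof (induction rule: cext_induct)
    case zero
    show ?case
      by (rule image_eqI[where f = cunit, OF C.lin_zero[OF cunit_lin C.vs_CC vs_cext[OF vs_scalars], symmetric] C.vs_zero[OF C.vs_CC]])
  next
    case (pure v z)
    then obtain k where k: "v = Scal k" "k \<in> K" by auto
    have "ctensor (scalars K) v z = cunit (Scal (k * z))"
      using pure_smult_left[of "scalars K :: 'a vs" CC k "Scal 1" "Scal z"]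
        pure_smult_right[of "scalars K :: 'a vs" CC k "Scal 1" "Scal z"] k
      by simp
    thus ?case by (intro image_eqI[of _ _ "Scal (k * z)"]) simp_all
  next
    case (add s t)
    have "C.sub KC (cunit ` carrier CC)"
      by (rule C.lin_image_sub[OF cunit_lin C.vs_CC vs_cext[OF vs_scalars] C.sub_self[OF C.vs_CC]])
    thus ?case using add.IH by (rule C.sub_add)
  qed
  have "inj_on cunit (carrier (CC :: 'a vs))" by (rule inj_on_inverseI) (rule inv)
  moreover have "cunit ` carrier CC = carrier (KC :: 'a vs)"
    using surj C.lin_closed[OF cunit_lin] by blast
  ultimately show ?thesis by (simp add: bij_betw_def)
qed

text \<open>Needed both for the Hodge filtration under the left unit map and for the left unit law
  of \<open>G\<close>.\<close>

lemma cext_tensor_lunit_pure: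
  assumes V: "vs V" and x: "x \<in> carrier (cext K V)"
  shows "cext_map K (tensor K (scalars K) V) V (tensor_lunit K V)
      (cext_tensor K (scalars K) V (pure_tensor UNIV KC (cext K V) (cunit (Scal c)) x))
    = c \<odot>\<^bsub>cext K V\<^esub> x"
proof -
  let ?l = "cext_map K (tensor K (scalars K) V) V (tensor_lunit K V)" and ?t = "cext_tensor K (scalars K) V"
    and ?p = "pure_tensor UNIV KC (cext K V)"
  have vsC: "C.vs (cext K V)" "C.vs (KC :: 'a vs)" using V by simp_all
  note l = tensor_lunit_linear[OF V, THEN linear_maps_lin]
  have cu: "cunit (Scal c) \<in> carrier KC" by (rule C.lin_closed[OF cunit_lin]) simp
  have KV: "vs (tensor K (scalars K) V)" using V by simp
  show ?thesis
  proof (rule cext_lin_eqI[OF C.lin_comp[OF C.lin_comp[OF C.pure_lin_right[OF vsC(2,1) cu]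
            cext_tensor_lin[OF vs_scalars V]] cext_map_lin[OF KV V l]] _ V vsC(1) _ x])
    show "(\<lambda>x. c \<odot>\<^bsub>cext K V\<^esub> x) \<in> C.lin (cext K V) (cext K V)"
      using vsC by (intro C.linI) (simp_all add: C.vs_distr C.vs_smult_smult mult.commute del: cext_simps)
    fix v assume v: "v \<in> carrier V"
    have p: "?t (?p (cunit (Scal c)) (ctensor V v 1))
        = ctensor (tensor K (scalars K) V) (pure_tensor K (scalars K) V (Scal 1) v) c"
      unfolding cunit_apply using cext_tensor_pure[OF vs_scalars V, of "Scal 1" v c 1] v by simp
    show "?l
        (?t (?p (cunit (Scal c)) (ctensor V v 1)))
      = c \<odot>\<^bsub>cext K V\<^esub> ctensor V v 1"
      unfolding p using v V KV l by (simp add: tensor_lunit_pure)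
  qed
qed

lemma cext_tensor_runit_pure:
  assumes V: "vs V" and x: "x \<in> carrier (cext K V)"
  shows "cext_map K (tensor K V (scalars K)) V (tensor_runit K V)
      (cext_tensor K V (scalars K) (pure_tensor UNIV (cext K V) KC x (cunit (Scal c))))
    = c \<odot>\<^bsub>cext K V\<^esub> x"
proof -
  let ?r = "cext_map K (tensor K V (scalars K)) V (tensor_runit K V)" and ?t = "cext_tensor K V (scalars K)"
    and ?p = "pure_tensor UNIV (cext K V) KC"
  have vsC: "C.vs (cext K V)" "C.vs (KC :: 'a vs)" using V by simp_all
  note l = tensor_runit_linear[OF V, THEN linear_maps_lin]
  have cu: "cunit (Scal c) \<in> carrier KC" by (rule C.lin_closed[OF cunit_lin]) simp
  have KV: "vs (tensor K V (scalars K))" using V by simp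
  show ?thesis
  proof (rule cext_lin_eqI[OF C.lin_comp[OF C.lin_comp[OF C.pure_lin_left[OF vsC(1,2) cu]
            cext_tensor_lin[OF V vs_scalars]] cext_map_lin[OF KV V l]] _ V vsC(1) _ x])
    show "(\<lambda>x. c \<odot>\<^bsub>cext K V\<^esub> x) \<in> C.lin (cext K V) (cext K V)"
      using vsC by (intro C.linI) (simp_all add: C.vs_distr C.vs_smult_smult mult.commute del: cext_simps)
    fix v assume v: "v \<in> carrier V"
    have p: "?t (?p (ctensor V v 1) (cunit (Scal c)))
        = ctensor (tensor K V (scalars K)) (pure_tensor K V (scalars K) v (Scal 1)) c"
      unfolding cunit_apply using cext_tensor_pure[OF V vs_scalars, of v "Scal 1" 1 c] v by simp
    show "?r
        (?t (?p (ctensor V v 1) (cunit (Scal c))))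
      = c \<odot>\<^bsub>cext K V\<^esub> ctensor V v 1"
      unfolding p using v V KV l by (simp add: tensor_runit_pure)
  qed
qed

lemma cext_lunit_inv:
  assumes V: "vs V" and x: "x \<in> carrier (cext K V)"
  shows "cext_map K V (tensor K (scalars K) V) (tensor_lunit_inv V) x
    = cext_tensor K (scalars K) V (pure_tensor UNIV KC (cext K V) (cunit (Scal 1)) x)"
proof -
  have vsC: "C.vs (cext K V)" "C.vs (KC :: 'a vs)" "C.vs (cext K (tensor K (scalars K) V))" using V by simp_all
  note l = tensor_lunit_inv_linear[OF V, THEN linear_maps_lin]
  have cu: "cunit (Scal 1) \<in> carrier KC" by (rule C.lin_closed[OF cunit_lin]) simp
  have KV: "vs (tensor K (scalars K) V)" using V by simp
  show ?thesis
  proof (rule cext_lin_eqI[OF cext_map_lin[OF V KV l] C.lin_comp[OF C.pure_lin_right[OF vsC(2,1) cu]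
            cext_tensor_lin[OF vs_scalars V]] V vsC(3) _ x])
    fix v assume v: "v \<in> carrier V"
    have "cext_tensor K (scalars K) V (pure_tensor UNIV KC (cext K V) (cunit (Scal 1)) (ctensor V v 1))
        = ctensor (tensor K (scalars K) V) (pure_tensor K (scalars K) V (Scal 1) v) 1"
      unfolding cunit_apply using cext_tensor_pure[OF vs_scalars V, of "Scal 1" v 1 1] v by simp
    thus "cext_map K V (tensor K (scalars K) V) (tensor_lunit_inv V) (ctensor V v 1)
      = cext_tensor K (scalars K) V (pure_tensor UNIV KC (cext K V) (cunit (Scal 1)) (ctensor V v 1))"
      using v V KV l by (simp add: tensor_lunit_inv_def)
  qed
qed

section \<open>The symmetric monoidal category of mixed Hodge structures\<close>

lemma mhsD:
  assumes "is_mhs K A"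
  shows "vs (hspace A)" "fin_dim (hspace A)" "increasing_filtration K (hspace A) (wfil A)"
    "opposed_filtrations UNIV (cspace A) (\<lambda>m. cwfil A m) (hfil A)
       (\<lambda>p. hbar A p)"
    "sub (hspace A) (wfil A m)" "C.sub (cspace A) (hfil A p)"
    "decreasing_filtration UNIV (cspace A) (hfil A)"
proof -
  note a = assms[unfolded is_mhs_iff] and a' = assms[unfolded is_mhs_def]
  show "vs (hspace A)" "fin_dim (hspace A)" and W: "increasing_filtration K (hspace A) (wfil A)"
    "opposed_filtrations UNIV (cspace A) (\<lambda>m. cwfil A m) (hfil A)
       (\<lambda>p. hbar A p)" using a by blast+
  show F: "decreasing_filtration UNIV (cspace A) (hfil A)" using a' by blast
  show "sub (hspace A) (wfil A m)" "C.sub (cspace A) (hfil A p)"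
    using W F unfolding increasing_filtration_def decreasing_filtration_def by blast+
qed

lemma mhs_tensor_simps [simp]:
  "hspace (mhs_tensor K A B) = hspace2 A B"
  "wfil (mhs_tensor K A B) = wfil2 A B"
  "hfil (mhs_tensor K A B) = (\<lambda>p. cten A B `
      hfil2 A B p)"
  by (simp_all add: mhs_tensor_def)

lemma mhs_unit_simps [simp]:
  "hspace (mhs_unit K) = scalars K"
  "wfil (mhs_unit K) = (\<lambda>m. if 0 \<le> m then carrier (scalars K) else {\<zero>\<^bsub>scalars K\<^esub>})"
  "hfil (mhs_unit K) = (\<lambda>p. if p \<le> 0 then carrier KC else {\<zero>\<^bsub>KC\<^esub>})"
  by (simp_all add: mhs_unit_def)

text \<open>The complexifications carry opposed filtrations, hence so does their tensor product, and
  \<open>cext_tensor\<close> transports them. Its Hodge filtration is this image by definition;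
  \<open>cext_tensor_csub\<close> and \<open>cext_tensor_conj_family\<close> identify the images of
  the two other filtrations.\<close>

lemma is_mhs_tensor:
  assumes A: "is_mhs K A" and B: "is_mhs K B"
  shows "is_mhs K (mhs_tensor K A B)"
proof -
  note a = mhsD[OF A] and b = mhsD[OF B]
  have "opposed_filtrations UNIV (cext K (hspace2 A B))
      (\<lambda>m. csub (hspace2 A B) (wfil2 A B m))
      (\<lambda>p. cten A B `
        hfil2 A B p)
      (\<lambda>p. cext_conj K (hspace2 A B) ` cten A B `
        hfil2 A B p)"
    by (rule C.opposed_filtrations_image[OF C.opposed_filtrations_tensor[OF a(4) b(4)] cext_tensor_lin[OF a(1) b(1)]
          _ cext_tensor_bij[OF a(1) b(1)] cext_tensor_csub[OF a(1) b(1) a(5) b(5), symmetric] HOL.refl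
          cext_tensor_conj_family[OF a(1) b(1) a(6) b(6)]])
       (use a(1) b(1) in simp)
  thus ?thesis
    unfolding is_mhs_iff mhs_tensor_simps
    using a(1-3) b(1-3) by (simp add: fin_dim_tensor increasing_filtration_tensor)
qed

text \<open>Everything is of type (0, 0). Only weight 0 matters, where p + q = 1: exactly one of p
  and q is at most 0, so one of the two steps is the whole space and the other is zero.\<close>

lemma trivial_opposed_filtrations:
  fixes X (structure)
  assumes X: "C.vs X" and W: "\<And>m. W m = (if 0 \<le> m then carrier X else {\<zero>})"
    and F: "\<And>p. F p = (if p \<le> 0 then carrier X else {\<zero>})"
    and H: "\<And>p. H p = (if p \<le> 0 then carrier X else {\<zero>})"
  shows "opposed_filtrations UNIV X W F H"
proof (intro opposed_filtrations.intro C.base_field_axioms opposed_filtrations_axioms.intro X)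
  have sub: "C.sub X (if b then carrier X else {\<zero>})" for b
    using C.sub_self[OF X] C.sub_zero_space[OF X] by simp
  have "W (- 1) = {\<zero>}" "W 0 = carrier X" "mono W" using X by (auto simp: W mono_def)
  thus "increasing_filtration UNIV X W" using sub unfolding increasing_filtration_def W by blast
  have "antimono (\<lambda>p :: int. if p \<le> 0 then carrier X else {\<zero>})" using X by (auto simp: monotone_def)
  hence d: "decreasing_filtration UNIV X (\<lambda>p. if p \<le> 0 then carrier X else {\<zero>})"
    unfolding decreasing_filtration_def using sub
    by (intro conjI exI[of _ 1] exI[of _ 0]) auto
  have "F = (\<lambda>p. if p \<le> 0 then carrier X else {\<zero>})" "H = (\<lambda>p. if p \<le> 0 then carrier X else {\<zero>})"
    using F H by auto
  thus "decreasing_filtration UNIV X F" "decreasing_filtration UNIV X H" using d by simp_all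
  show "C.opposed X W F H"
    unfolding C.opposed_def
  proof (intro allI impI conjI ballI)
    fix m p q :: int and x assume pq: "p + q = m + 1" and x: "x \<in> W m"
    have xc: "x \<in> carrier X" using x X by (auto simp: W split: if_splits)
    consider "m < 0" | "p \<le> 0" "0 \<le> m" | "q \<le> 0" "0 \<le> m" | "0 < m" using pq by linarith
    thus "\<exists>f\<in>F p \<inter> W m. \<exists>h\<in>H q \<inter> W m. \<exists>w\<in>W (m - 1). x = (f \<oplus> h) \<oplus> w"
    proof cases
      case 1
      thus ?thesis using x X by (intro bexI[of _ "\<zero>"]) (auto simp: W F H)
    next
      case 2
      thus ?thesis using xc X by (intro bexI[of _ x] bexI[of _ "\<zero>"]) (auto simp: W F H)
    next
      case 3
      thus ?thesis using xc X by (intro bexI[of _ "\<zero>"] bexI[of _ x]) (auto simp: W F H)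
    next
      case 4
      thus ?thesis using xc X by (intro bexI[of _ "\<zero>"] bexI[of _ x]) (auto simp: W F H)
    qed
  next
    fix m p q :: int and f h assume pq: "p + q = m + 1" and f: "f \<in> F p \<inter> W m" and h: "h \<in> H q \<inter> W m"
      and d: "f \<ominus> h \<in> W (m - 1)"
    have c: "f \<in> carrier X" "h \<in> carrier X" using f h X by (auto simp: W split: if_splits)
    consider "m < 0" | "0 < m" | "m = 0" "0 < p" | "m = 0" "0 < q" using pq by linarith
    thus "f \<in> W (m - 1)"
    proof cases
      case 4
      hence "h = \<zero>" using h by (simp add: H)
      thus ?thesis using d c X by simp
    qed (use f c X in \<open>auto simp: W F\<close>)
  qed
qed

lemma is_mhs_unit: "is_mhs K (mhs_unit K)"
proof -
  let ?K = "scalars K :: 'a vs"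
  have V: "vs ?K" by simp
  have sub: "sub ?K (if b then carrier ?K else {\<zero>\<^bsub>?K\<^esub>})" for b
    using sub_self[OF V] sub_zero_space[OF V] by simp
  have W: "csub ?K (if b then carrier ?K else {\<zero>\<^bsub>?K\<^esub>}) = (if b then carrier (cext K ?K) else {\<zero>\<^bsub>cext K ?K\<^esub>})" for b
    using csub_carrier[of ?K] csub_zero[OF V] by (cases b) (simp_all only: if_True if_False)
  have "cext_conj K ?K ` carrier (cext K ?K) = carrier (cext K ?K)"
  proof (intro equalityI subsetI)
    fix x assume x: "x \<in> carrier (cext K ?K)"
    show "x \<in> cext_conj K ?K ` carrier (cext K ?K)"
      using cext_conj_conj[OF V x] cext_conj_closed[OF V x] by (intro image_eqI[of _ _ "cext_conj K ?K x"]) simp_all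
  qed (use cext_conj_closed[OF V] in blast)
  hence H: "cext_conj K ?K ` (if b then carrier (cext K ?K) else {\<zero>\<^bsub>cext K ?K\<^esub>})
      = (if b then carrier (cext K ?K) else {\<zero>\<^bsub>cext K ?K\<^esub>})" for b
    using cext_conj_zero[OF V] by (cases b) (simp_all only: if_True if_False image_insert image_empty)
  have "mono (\<lambda>m :: int. if 0 \<le> m then carrier ?K else {\<zero>\<^bsub>?K\<^esub>})" by (auto simp: mono_def)
  hence incr: "increasing_filtration K ?K (\<lambda>m. if 0 \<le> m then carrier ?K else {\<zero>\<^bsub>?K\<^esub>})"
    unfolding increasing_filtration_def using sub by (intro conjI exI[of _ "- 1"] exI[of _ 0]) auto
  have one: "{Scal 1} \<subseteq> carrier ?K" using S_closed by auto
  have "carrier ?K \<subseteq> span ?K {Scal 1}"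
  proof
    fix x assume "x \<in> carrier ?K"
    then obtain k where k: "x = Scal k" "k \<in> K" by auto
    have "k \<odot>\<^bsub>?K\<^esub> Scal 1 \<in> span ?K {Scal 1}"
      by (rule sub_smult[OF span_sub[OF V one] k(2) subsetD[OF span_superset[OF V one]]]) simp
    thus "x \<in> span ?K {Scal 1}" using k by simp
  qed
  moreover have "span ?K {Scal 1} \<subseteq> carrier ?K" by (rule sub_subset[OF span_sub[OF V one]])
  ultimately have fin: "fin_dim ?K" unfolding fin_dim_iff[OF V] by (intro exI[of _ "{Scal 1}"]) auto
  show ?thesis
    unfolding is_mhs_iff mhs_unit_simps
    by (intro conjI V fin incr trivial_opposed_filtrations vs_cext W H HOL.refl)
qed

lemma mhs_homsD:
  assumes "f \<in> mhs_homs K A B"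
  shows "f \<in> linear_maps K (hspace A) (hspace B)" "f \<in> lin (hspace A) (hspace B)"
    "f ` wfil A m \<subseteq> wfil B m" "cmap A B f ` hfil A p \<subseteq> hfil B p"
  using assms by (auto simp: mhs_homs_def linear_maps_lin)

lemma mhs_homsI:
  "\<lbrakk>f \<in> linear_maps K (hspace A) (hspace B); \<And>m. f ` wfil A m \<subseteq> wfil B m;
    \<And>p x. x \<in> hfil A p \<Longrightarrow> cmap A B f x \<in> hfil B p\<rbrakk> \<Longrightarrow> f \<in> mhs_homs K A B"
  by (auto simp: mhs_homs_def)

text \<open>The weight filtrations are handled by the lemmas on tensor families over
  \<open>K\<close>. For the Hodge filtrations each structure map is moved through
  \<open>cext_tensor\<close>, where it becomes the structure map over \<complex> and the same lemmas
  apply there.\<close>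

lemma MHS_vs_monoidal:
  "vs_monoidal K {A. is_mhs K A} hspace (mhs_homs K) (mhs_tensor K) (mhs_unit K :: 'a mhs)"
proof (intro vs_monoidal.intro base_field_axioms vs_monoidal_axioms.intro; (unfold mem_Collect_eq)?)
  fix A :: "'a mhs" assume A: "is_mhs K A"
  note a = mhsD[OF A]
  have hc: "x \<in> carrier (cspace A)" if "x \<in> hfil A p" for x p using C.sub_carrier[OF a(6) that] .
  show "vs (hspace A)" by (rule a)
  show "(\<lambda>v\<in>carrier (hspace A). v) \<in> mhs_homs K A A"
  proof (rule mhs_homsI)
    show "(\<lambda>v\<in>carrier (hspace A). v) ` wfil A m \<subseteq> wfil A m" for m using sub_carrier[OF a(5)] by auto
    fix p x assume x: "x \<in> hfil A p"
    have "cmap A A (\<lambda>v\<in>carrier (hspace A). v) x = x"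
      using cext_map_cong[OF a(1,1) lin_id _ hc[OF x], of "\<lambda>v\<in>carrier (hspace A). v"] cext_map_id[OF a(1) hc[OF x]] by simp
    thus "cmap A A (\<lambda>v\<in>carrier (hspace A). v) x \<in> hfil A p" using x by simp
  qed (simp add: a(1))
  have E: "Scal c \<in> wfil (mhs_unit K) i \<Longrightarrow> v \<in> wfil A j \<Longrightarrow> c \<odot>\<^bsub>hspace A\<^esub> v \<in> wfil A (i + j)" for c i v j
  proof (cases "0 \<le> i")
    case True
    assume "Scal c \<in> wfil (mhs_unit K) i" "v \<in> wfil A j"
    hence "c \<in> K" "v \<in> wfil A (i + j)"
      using True a(3) monoD[of "wfil A" j "i + j"] by (auto simp: increasing_filtration_def)
    thus ?thesis by (rule sub_smult[OF a(5)])
  next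
    case False
    assume "Scal c \<in> wfil (mhs_unit K) i" "v \<in> wfil A j"
    thus ?thesis using False a(1) sub_carrier[OF a(5)] sub_zero[OF a(5)] by simp
  qed
  have Efam: "family (scalars K :: 'a vs) (wfil (mhs_unit K))"
    using mhsD(5)[OF is_mhs_unit] unfolding mhs_unit_simps(1) by blast
  have Afam: "family (hspace A) (wfil A)" using a(5) by simp
  have unit_fam: "C.family (KC :: 'a vs) (hfil (mhs_unit K))"
    using mhsD(6)[OF is_mhs_unit] unfolding mhs_unit_simps(1) by blast
  have Ffam: "C.family (cspace A) (hfil A)" using a(6) by simp
  have KA: "vs (tensor K (scalars K) (hspace A))" using a(1) by simp
  have vsC: "C.vs (KC :: 'a vs)" "C.vs (cspace A)" using a(1) by simp_all
  let ?l = "cext_map K (tensor K (scalars K) (hspace A)) (hspace A) (tensor_lunit K (hspace A))"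
    and ?i = "cext_map K (hspace A) (tensor K (scalars K) (hspace A)) (tensor_lunit_inv (hspace A))"
    and ?t = "cext_tensor K (scalars K) (hspace A)" and ?p = "pure_tensor UNIV KC (cspace A)"
    and ?F = "tensor_family UNIV KC (cspace A) (hfil (mhs_unit K)) (hfil A)"
  show "tensor_lunit K (hspace A) \<in> mhs_homs K (mhs_tensor K (mhs_unit K) A) A"
  proof (rule mhs_homsI; (unfold mhs_tensor_simps mhs_unit_simps(1))?)
    show "tensor_lunit K (hspace A) \<in> linear_maps K (tensor K (scalars K) (hspace A)) (hspace A)"
      by (rule tensor_lunit_linear[OF a(1)])
    show "tensor_lunit K (hspace A) ` tensor_family K (scalars K) (hspace A) (wfil (mhs_unit K)) (wfil A) m \<subseteq> wfil A m" for m
      by (rule tensor_family_lunit[OF a(1) Efam Afam E])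
    fix p x assume x: "x \<in> ?t `
        ?F p"
    have "(\<lambda>t. ?l
          (?t t)) `
        ?F p \<subseteq> hfil A p"
    proof (rule C.tensor_family_image[OF vsC unit_fam Ffam
          C.lin_comp[OF cext_tensor_lin[OF vs_scalars a(1)] cext_map_lin[OF KA a(1) tensor_lunit_linear[OF a(1), THEN linear_maps_lin]]]
          vsC(2) a(6)])
      fix i j z and y :: "'a pt" assume ij: "i + j = p" and y: "y \<in> hfil (mhs_unit K) i" and z: "z \<in> hfil A j"
      \<comment> \<open>Each step of the unit's Hodge filtration lies in a space that
        \<open>cunit\<close> identifies with \<complex>, so y amounts to a scalar c and the map
        becomes multiplication by c.\<close>
      have "y \<in> carrier KC" using y C.vs_zero[OF vsC(1)] by (auto split: if_splits)
      hence "y \<in> cunit ` carrier CC" unfolding bij_betw_imp_surj_on[OF cunit_bij] .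
      then obtain c where c: "y = cunit (Scal c)" by auto
      have eq: "?l
          (?t (?p y z))
          = c \<odot>\<^bsub>cspace A\<^esub> z"
        unfolding c by (rule cext_tensor_lunit_pure[OF a(1) hc[OF z]])
      show "?l
          (?t (?p y z)) \<in> hfil A p"
      proof (cases "i \<le> 0")
        case True
        hence "z \<in> hfil A p" using z ij a(7) antimonoD[of "hfil A" p j] by (auto simp: decreasing_filtration_def)
        thus ?thesis unfolding eq by (intro C.sub_smult[OF a(6)]) simp
      next
        case False
        hence "y = \<zero>\<^bsub>KC\<^esub>" using y by simp
        hence "?p y z
            = \<zero>\<^bsub>tensor UNIV KC (cspace A)\<^esub>"
          using C.pure_zero_left[OF vsC hc[OF z]] by simp
        thus ?thesis
          using C.lin_zero[OF C.lin_comp[OF cext_tensor_lin[OF vs_scalars a(1)]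
                cext_map_lin[OF KA a(1) tensor_lunit_linear[OF a(1), THEN linear_maps_lin]]] C.vs_tensor[OF vsC] vsC(2)]
            C.sub_zero[OF a(6)] by simp
      qed
    qed
    thus "?l x \<in> hfil A p"
      using x by blast
  qed
  show "tensor_lunit_inv (hspace A) \<in> mhs_homs K A (mhs_tensor K (mhs_unit K) A)"
  proof (rule mhs_homsI; (unfold mhs_tensor_simps mhs_unit_simps(1))?)
    show "tensor_lunit_inv (hspace A) \<in> linear_maps K (hspace A) (tensor K (scalars K) (hspace A))"
      by (rule tensor_lunit_inv_linear[OF a(1)])
    show "tensor_lunit_inv (hspace A) ` wfil A m \<subseteq> tensor_family K (scalars K) (hspace A) (wfil (mhs_unit K)) (wfil A) m" for m
      by (rule tensor_family_lunit_inv[OF a(1) Efam Afam]) simp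
    fix p x assume x: "x \<in> hfil A p"
    have "cunit (Scal 1) \<in> hfil (mhs_unit K) 0" using C.lin_closed[OF cunit_lin, of "Scal 1"] by simp
    hence "?p (cunit (Scal 1)) x
        \<in> ?F p"
      using x by (rule C.pure_in_tensor_family[OF vsC unit_fam Ffam]) simp
    thus "?i x
        \<in> ?t `
          ?F p"
      unfolding cext_lunit_inv[OF a(1) hc[OF x]] by (rule imageI)
  qed
next
  fix A B D :: "'a mhs" and f g
  assume A: "is_mhs K A" and B: "is_mhs K B" and D: "is_mhs K D" and f: "f \<in> mhs_homs K A B" and g: "g \<in> mhs_homs K B D"
  note a = mhsD[OF A] and b = mhsD[OF B] and d = mhsD[OF D] and f = mhs_homsD[OF f] and g = mhs_homsD[OF g]
  show "compose (carrier (hspace A)) g f \<in> mhs_homs K A D"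
  proof (rule mhs_homsI)
    show "compose (carrier (hspace A)) g f \<in> linear_maps K (hspace A) (hspace D)"
      by (rule linear_maps_compose[OF f(1) g(1) a(1)])
    show "compose (carrier (hspace A)) g f ` wfil A m \<subseteq> wfil D m" for m
    proof
      fix x assume "x \<in> compose (carrier (hspace A)) g f ` wfil A m"
      then obtain v where v: "v \<in> wfil A m" "x = compose (carrier (hspace A)) g f v" by blast
      hence "x = g (f v)" using sub_carrier[OF a(5)] by (simp add: compose_eq)
      moreover have "g (f v) \<in> wfil D m" using v(1) f(3) g(3) by blast
      ultimately show "x \<in> wfil D m" by simp
    qed
    fix p x assume x: "x \<in> hfil A p"
    have xc: "x \<in> carrier (cspace A)" using C.sub_carrier[OF a(6) x] .
    have "cmap A D (compose (carrier (hspace A)) g f) x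
        = cmap A D (\<lambda>v. g (f v)) x"
      by (rule cext_map_cong[OF a(1) d(1) lin_comp[OF f(2) g(2)] _ xc]) (simp add: compose_eq)
    also have "\<dots> = cmap B D g (cmap A B f x)"
      by (rule cext_map_comp[OF a(1) b(1) d(1) f(2) g(2) xc, symmetric])
    also have "\<dots> \<in> hfil D p" using x f(4) g(4) by blast
    finally show "cmap A D (compose (carrier (hspace A)) g f) x \<in> hfil D p" .
  qed
next
  fix A B A' B' :: "'a mhs" and f g
  assume A: "is_mhs K A" and B: "is_mhs K B" and A': "is_mhs K A'" and B': "is_mhs K B'"
    and f: "f \<in> mhs_homs K A A'" and g: "g \<in> mhs_homs K B B'"
  note a = mhsD[OF A] and b = mhsD[OF B] and a' = mhsD[OF A'] and b' = mhsD[OF B'] and f = mhs_homsD[OF f] and g = mhs_homsD[OF g]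
  let ?m = "tensor_map K (hspace A) (hspace B) (hspace A') (hspace B') f g"
  show "?m \<in> mhs_homs K (mhs_tensor K A B) (mhs_tensor K A' B')"
  proof (rule mhs_homsI; (unfold mhs_tensor_simps)?)
    show "?m
        \<in> linear_maps K (hspace2 A B) (hspace2 A' B')"
      by (rule tensor_map_linear[OF a(1) b(1) a'(1) b'(1) f(2) g(2)])
    show "?m `
        wfil2 A B m \<subseteq> wfil2 A' B' m" for m
      using a(5) b(5) a'(5) b'(5) by (intro tensor_family_map[OF a(1) b(1) a'(1) b'(1) _ _ _ _ f(2,3) g(2,3)]) blast+
    fix p x assume "x \<in> cten A B `
        hfil2 A B p"
    then obtain t where t: "t \<in> hfil2 A B p"
      and x: "x = cten A B t" by blast
    have vsC: "C.vs (cspace A)" "C.vs (cspace B)" "C.vs (cspace A')" "C.vs (cspace B')"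
      using a(1) b(1) a'(1) b'(1) by simp_all
    have fam: "C.family (cspace A) (hfil A)" "C.family (cspace B) (hfil B)"
      "C.family (cspace A') (hfil A')" "C.family (cspace B') (hfil B')"
      using a(6) b(6) a'(6) b'(6) by blast+
    have tc: "t \<in> carrier (tensor UNIV (cspace A) (cspace B))"
      by (rule C.sub_carrier[OF C.tensor_family_sub[OF vsC(1,2) fam(1,2)] t])
    have "tensor_map UNIV (cspace A) (cspace B) (cspace A') (cspace B')
        (cmap A A' f) (cmap B B' g) t
        \<in> hfil2 A' B' p"
      using C.tensor_family_map[OF vsC fam cext_map_lin[OF a(1) a'(1) f(2)] f(4) cext_map_lin[OF b(1) b'(1) g(2)] g(4)] t by blast
    thus "cext_map K (hspace2 A B) (hspace2 A' B')
        (?m) x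
      \<in> cten A' B' ` hfil2 A' B' p"
      unfolding x cext_tensor_natural[OF a(1) b(1) a'(1) b'(1) f(2) g(2) tc] by (rule imageI)
  qed
next
  fix A B D :: "'a mhs" assume A: "is_mhs K A" and B: "is_mhs K B" and D: "is_mhs K D"
  note a = mhsD[OF A] and b = mhsD[OF B] and d = mhsD[OF D]
  let ?A = "hspace A" and ?B = "hspace B" and ?D = "hspace D"
  let ?AC = "cext K ?A" and ?BC = "cext K ?B" and ?DC = "cext K ?D"
  let ?AB = "tensor K ?A ?B" and ?BD = "tensor K ?B ?D"
  show "tensor_assoc K ?A ?B ?D \<in> mhs_homs K (mhs_tensor K (mhs_tensor K A B) D) (mhs_tensor K A (mhs_tensor K B D))"
  proof (rule mhs_homsI; (unfold mhs_tensor_simps)?)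
    show "tensor_assoc K ?A ?B ?D \<in> linear_maps K (tensor K ?AB ?D) (tensor K ?A ?BD)"
      by (rule tensor_assoc_linear[OF a(1) b(1) d(1)])
    show "tensor_assoc K ?A ?B ?D ` tensor_family K ?AB ?D (tensor_family K ?A ?B (wfil A) (wfil B)) (wfil D) m
        \<subseteq> tensor_family K ?A ?BD (wfil A) (tensor_family K ?B ?D (wfil B) (wfil D)) m" for m
      using a(5) b(5) d(5) by (intro tensor_family_assoc[OF a(1) b(1) d(1)]) blast+
    have vsC: "C.vs ?AC" "C.vs ?BC" "C.vs ?DC" "C.vs (cext K ?AB)" "C.vs (cext K ?BD)" "C.vs (cext K (tensor K ?A ?BD))"
      "C.vs (tensor UNIV ?AC ?BC)" "C.vs (tensor UNIV ?BC ?DC)"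
      and vsK: "vs ?AB" "vs ?BD" "vs (tensor K ?AB ?D)" "vs (tensor K ?A ?BD)"
      using a(1) b(1) d(1) by simp_all
    have fam: "C.family ?AC (hfil A)" "C.family ?BC (hfil B)" "C.family ?DC (hfil D)" using a(6) b(6) d(6) by blast+
    have fam2: "C.family (tensor UNIV ?AC ?BC) (hfil2 A B)" "C.family (tensor UNIV ?BC ?DC) (hfil2 B D)"
      using C.tensor_family_sub[OF vsC(1,2) fam(1,2)] C.tensor_family_sub[OF vsC(2,3) fam(2,3)] by blast+
    have famBD: "C.family (cext K ?BD) (\<lambda>p. cten B D ` hfil2 B D p)"
      using mhsD(6)[OF is_mhs_tensor[OF B D]] unfolding mhs_tensor_simps by blast
    have id: "(\<lambda>x\<in>carrier X. x) \<in> C.lin X X" "(\<lambda>x\<in>carrier X. x) ` N \<subseteq> N"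
      if "C.vs X" "C.sub X N" for X :: "'a vs" and N
      using C.lin_restrict[OF C.lin_id that(1)] C.sub_carrier[OF that(2)] by auto
    let ?\<phi> = "tensor_map UNIV (tensor UNIV ?AC ?BC) ?DC (cext K ?AB) ?DC (cten A B) (\<lambda>x\<in>carrier ?DC. x)"
      and ?\<psi> = "tensor_map UNIV ?AC (tensor UNIV ?BC ?DC) ?AC (cext K ?BD) (\<lambda>x\<in>carrier ?AC. x) (cten B D)"
    fix p x assume "x \<in> cext_tensor K ?AB ?D ` tensor_family UNIV (cext K ?AB) ?DC (\<lambda>p. cten A B ` hfil2 A B p) (hfil D) p"
    \<comment> \<open>The filtration of the left factor is an image under \<open>cten A B\<close>,
      so the tensor family is covered by one on the threefold product of the complexifications;
      there associativity can be applied to t.\<close>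
    then obtain t where t: "t \<in> tensor_family UNIV (tensor UNIV ?AC ?BC) ?DC (hfil2 A B) (hfil D) p"
      and x: "x = cext_tensor K ?AB ?D (?\<phi> t)"
      using C.tensor_family_image_left[OF vsC(7,3,4) fam2(1) fam(3) cext_tensor_lin[OF a(1) b(1)]] by blast
    have tc: "t \<in> carrier (tensor UNIV (tensor UNIV ?AC ?BC) ?DC)"
      by (rule C.sub_carrier[OF C.tensor_family_sub[OF vsC(7,3) fam2(1) fam(3)] t])
    have "tensor_assoc UNIV ?AC ?BC ?DC t \<in> tensor_family UNIV ?AC (tensor UNIV ?BC ?DC) (hfil A) (hfil2 B D) p"
      using C.tensor_family_assoc[OF vsC(1,2,3) fam] t by blast
    hence "?\<psi> (tensor_assoc UNIV ?AC ?BC ?DC t)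
        \<in> tensor_family UNIV ?AC (cext K ?BD) (hfil A) (\<lambda>p. cten B D ` hfil2 B D p) p"
      using C.tensor_family_map[OF vsC(1,8,1,5) fam(1) fam2(2) fam(1) famBD id[OF vsC(1) a(6)]
          cext_tensor_lin[OF b(1) d(1)] subset_refl] by blast
    thus "cext_map K (tensor K ?AB ?D) (tensor K ?A ?BD) (tensor_assoc K ?A ?B ?D) x
        \<in> cext_tensor K ?A ?BD ` tensor_family UNIV ?AC (cext K ?BD) (hfil A) (\<lambda>p. cten B D ` hfil2 B D p) p"
      unfolding x cext_tensor_assoc[OF a(1) b(1) d(1) tc] by (rule imageI)
  qed
next
  fix A B :: "'a mhs" assume A: "is_mhs K A" and B: "is_mhs K B"
  note a = mhsD[OF A] and b = mhsD[OF B]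
  show "tensor_swap K (hspace A) (hspace B) \<in> mhs_homs K (mhs_tensor K A B) (mhs_tensor K B A)"
  proof (rule mhs_homsI; (unfold mhs_tensor_simps)?)
    show "tensor_swap K (hspace A) (hspace B) \<in> linear_maps K (hspace2 A B) (hspace2 B A)"
      by (rule tensor_swap_linear[OF a(1) b(1)])
    show "tensor_swap K (hspace A) (hspace B) ` wfil2 A B m
        \<subseteq> wfil2 B A m" for m
      using a(5) b(5) by (intro tensor_family_swap[OF a(1) b(1)]) blast+
    have vsC: "C.vs (cspace A)" "C.vs (cspace B)" using a(1) b(1) by simp_all
    have fam: "C.family (cspace A) (hfil A)" "C.family (cspace B) (hfil B)" using a(6) b(6) by blast+
    fix p x assume "x \<in> cten A B `
        hfil2 A B p"
    then obtain t where t: "t \<in> hfil2 A B p"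
      and x: "x = cten A B t" by blast
    have tc: "t \<in> carrier (tensor UNIV (cspace A) (cspace B))"
      by (rule C.sub_carrier[OF C.tensor_family_sub[OF vsC fam] t])
    have "tensor_swap UNIV (cspace A) (cspace B) t
        \<in> hfil2 B A p"
      using C.tensor_family_swap[OF vsC fam] t by blast
    thus "cext_map K (hspace2 A B) (hspace2 B A) (tensor_swap K (hspace A) (hspace B)) x
        \<in> cten B A ` hfil2 B A p"
      unfolding x cext_tensor_swap[OF a(1) b(1) tc] by (rule imageI)
  qed
next
  show "is_mhs K (mhs_tensor K A B)" if "is_mhs K A" "is_mhs K B" for A B :: "'a mhs"
    using that by (rule is_mhs_tensor)
  show "is_mhs K (mhs_unit K :: 'a mhs)" by (rule is_mhs_unit)
qed (auto simp: mhs_homs_def)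

lemma MHS_symmetric_monoidal: "symmetric_monoidal_category (MHS K :: ('a mhs, _) monoidal_data)"
  unfolding MHS_def by (rule vs_monoidal.symmetric_monoidal[OF MHS_vs_monoidal])

end

section \<open>The functor from graded to filtered vector spaces\<close>

text \<open>The property chosen here determines the maps on the carrier, since a graded space is the
  sum of its pieces. The definition thus depends on no system of projections.\<close>

definition component :: "'a gr_vs \<Rightarrow> int \<Rightarrow> 'a pt \<Rightarrow> 'a pt" where
  "component A = (SOME c. \<forall>n. c n \<in> C.lin (gspace A) (gspace A) \<and>
     (\<forall>m. \<forall>v\<in>piece A m. c n v = (if n = m then v else \<zero>\<^bsub>gspace A\<^esub>)))"

context
  fixes A :: "'a gr_vs"
  assumes A: "is_gr_vs A"
begin

lemma gr_vs: "C.vs (gspace A)" and piece_sub: "C.sub (gspace A) (piece A n)"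
  and finite_pieces: "finite (degrees A)"
  using A unfolding is_gr_vs_def by blast+

lemma piece_carrier: "v \<in> piece A n \<Longrightarrow> v \<in> carrier (gspace A)"
  by (rule C.sub_carrier[OF piece_sub])

text \<open>Existence comes from the projections onto the nonzero pieces, extended by zero maps in
  the other degrees.\<close>

lemma component: "component A n \<in> C.lin (gspace A) (gspace A)"
    "v \<in> piece A m \<Longrightarrow> component A n v = (if n = m then v else \<zero>\<^bsub>gspace A\<^esub>)"
proof -
  let ?V = "gspace A" and ?J = "(degrees A)"
  obtain \<pi> where \<pi>: "C.proj_system ?V ?J \<pi>" and P: "\<And>n. piece A n = C.supported ?V ?J \<pi> (\<lambda>i. i = n)"
    by (rule is_gr_vs_proj_system[OF A]) (rule that)
  note D = C.proj_systemD[OF \<pi>]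
  let ?c = "\<lambda>n v. if n \<in> ?J then \<pi> n v else \<zero>\<^bsub>?V\<^esub>"
  have "?c n \<in> C.lin ?V ?V" for n
    using D(3)[of n] C.lin_zero_fun[OF gr_vs, of ?V] by (cases "n \<in> ?J") auto
  moreover have "?c n v = (if n = m then v else \<zero>\<^bsub>?V\<^esub>)" if v: "v \<in> piece A m" for n m v
  proof (cases "n \<in> ?J")
    case True
    have vc: "v \<in> carrier ?V" by (rule piece_carrier[OF v])
    have z: "\<pi> i v = \<zero>\<^bsub>?V\<^esub>" if "i \<in> ?J" "i \<noteq> m" for i using v that unfolding P[of m] C.supported_def by blast
    have "\<pi> n v = v" if "n = m"
    proof (rule C.proj_eqI[OF \<pi> D(6)[OF True vc] vc])
      show "\<pi> i (\<pi> n v) = \<pi> i v" if "i \<in> ?J" for i using D(4)[OF that True vc] z[OF that] \<open>n = m\<close> by auto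
    qed
    thus ?thesis using True z[of n] by simp
  qed (use v in auto)
  ultimately have "\<forall>n. ?c n \<in> C.lin ?V ?V \<and> (\<forall>m. \<forall>v\<in>piece A m. ?c n v = (if n = m then v else \<zero>\<^bsub>?V\<^esub>))"
    by blast
  hence ex: "\<exists>c. \<forall>n. c n \<in> C.lin ?V ?V \<and> (\<forall>m. \<forall>v\<in>piece A m. c n v = (if n = m then v else \<zero>\<^bsub>?V\<^esub>))"
    by (rule exI[of _ ?c])
  have "\<forall>n. component A n \<in> C.lin ?V ?V \<and>
      (\<forall>m. \<forall>v\<in>piece A m. component A n v = (if n = m then v else \<zero>\<^bsub>?V\<^esub>))"
    unfolding component_def by (rule someI_ex[OF ex])
  thus "component A n \<in> C.lin ?V ?V"
    "v \<in> piece A m \<Longrightarrow> component A n v = (if n = m then v else \<zero>\<^bsub>?V\<^esub>)" by blast+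
qed

lemma component_finsum:
  assumes f: "\<And>n. f n \<in> piece A n"
  shows "component A n (finsum (gspace A) f (degrees A)) = f n"
proof -
  let ?V = "gspace A" and ?J = "(degrees A)"
  have c: "f n \<in> carrier ?V" for n by (rule piece_carrier[OF f])
  have "component A n (finsum ?V f ?J) = finsum ?V (\<lambda>i. component A n (f i)) ?J"
    by (rule C.lin_finsum[OF component(1) gr_vs gr_vs finite_pieces c])
  also have "\<dots> = finsum ?V (\<lambda>i. if i = n then f i else \<zero>\<^bsub>?V\<^esub>) ?J"
    using c gr_vs f by (intro C.finsum_vs_cong[OF gr_vs]) (auto simp: component(2)[OF f])
  also have "\<dots> = f n"
    using C.finsum_delta[OF gr_vs finite_pieces, of f n] c[of n] f[of n] by auto
  finally show ?thesis .
qed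

lemma component_sum:
  assumes v: "v \<in> carrier (gspace A)"
  shows "finsum (gspace A) (\<lambda>n. component A n v) (degrees A) = v"
    and component_piece: "component A n v \<in> piece A n"
proof -
  have "\<exists>!f. (\<forall>n. f n \<in> piece A n) \<and> v = finsum (gspace A) f (degrees A)"
    using A v unfolding is_gr_vs_def by (elim conjE) (rule bspec)
  then obtain f where "(\<forall>n. f n \<in> piece A n) \<and> v = finsum (gspace A) f (degrees A)"
    by (elim ex1E) (rule that)
  hence f: "\<And>n. f n \<in> piece A n" and eq: "v = finsum (gspace A) f (degrees A)"
    by (rule conjunct1[THEN spec], rule conjunct2)
  have fe: "f = (\<lambda>n. component A n v)" unfolding eq by (rule ext) (rule component_finsum[OF f, symmetric])
  show "finsum (gspace A) (\<lambda>n. component A n v) (degrees A) = v"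
    using eq[symmetric] unfolding fe .
  show "component A n v \<in> piece A n" using f[of n] unfolding fe .
qed

lemma component_closed: "v \<in> carrier (gspace A) \<Longrightarrow> component A n v \<in> carrier (gspace A)"
  by (rule C.lin_closed[OF component(1)])

lemma sub_of_components:
  assumes N: "C.sub (gspace A) N" and v: "v \<in> carrier (gspace A)" and c: "\<And>n. component A n v \<in> N"
  shows "v \<in> N"
proof -
  have "finsum (gspace A) (\<lambda>n. component A n v) (degrees A) \<in> N"
    by (rule C.finsum_in_sub[OF N finite_pieces c])
  thus ?thesis unfolding component_sum[OF v] .
qed

lemma component_eq_zero: "\<lbrakk>v \<in> carrier (gspace A); \<And>n. component A n v = \<zero>\<^bsub>gspace A\<^esub>\<rbrakk> \<Longrightarrow> v = \<zero>\<^bsub>gspace A\<^esub>"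
  using sub_of_components[OF C.sub_zero_space[OF gr_vs]] by blast

lemma component_surj:
  assumes f: "\<And>n. f n \<in> piece A n"
  obtains v where "v \<in> carrier (gspace A)" "\<And>n. component A n v = f n"
  by (rule that[OF C.finsum_vs_closed[OF gr_vs piece_carrier[OF f]] component_finsum[OF f]])

lemma piece_iff: "v \<in> piece A n \<longleftrightarrow> v \<in> carrier (gspace A) \<and> (\<forall>m. m \<noteq> n \<longrightarrow> component A m v = \<zero>\<^bsub>gspace A\<^esub>)"
proof (intro iffI)
  assume v: "v \<in> carrier (gspace A) \<and> (\<forall>m. m \<noteq> n \<longrightarrow> component A m v = \<zero>\<^bsub>gspace A\<^esub>)"
  show "v \<in> piece A n"
  proof (rule sub_of_components[OF piece_sub])
    show "component A m v \<in> piece A n" for m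
      using v component_piece[of v n] C.sub_zero[OF piece_sub] by (cases "m = n") auto
  qed (use v in simp)
qed (auto simp: component(2) piece_carrier)

lemma fil_Ufil_generators: "(\<Union>n\<in>{..m}. piece A n) \<subseteq> carrier (gspace A)"
  using piece_carrier by blast

lemma fil_Ufil_iff: "v \<in> fil (Ufil_Ob A) m
    \<longleftrightarrow> v \<in> carrier (gspace A) \<and> (\<forall>n>m. component A n v = \<zero>\<^bsub>gspace A\<^esub>)"
proof -
  let ?V = "gspace A"
  let ?N = "{v \<in> carrier ?V. \<forall>n>m. component A n v = \<zero>\<^bsub>?V\<^esub>}"
  have N: "C.sub ?V ?N"
    using gr_vs C.sub_zero_space[OF gr_vs]
    by (intro C.subI) (auto simp: C.lin_zero[OF component(1)] C.lin_add[OF component(1)] C.lin_smult[OF component(1)])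
  have "fil (Ufil_Ob A) m \<subseteq> ?N"
    unfolding Ufil_Ob_def using piece_carrier by (simp, intro C.span_least[OF N]) (auto simp: component(2))
  moreover have "v \<in> fil (Ufil_Ob A) m" if v: "v \<in> ?N" for v
    unfolding Ufil_Ob_def fil_vs.simps
  proof (rule sub_of_components[OF C.span_sub[OF gr_vs fil_Ufil_generators]])
    show "component A n v \<in> C.span ?V (\<Union>n\<in>{..m}. piece A n)" for n
    proof (cases "n \<le> m")
      case True
      thus ?thesis
        using component_piece[of v n] v by (intro subsetD[OF C.span_superset[OF gr_vs fil_Ufil_generators]]) auto
    next
      case False
      hence "component A n v = \<zero>\<^bsub>?V\<^esub>" using v by auto
      thus ?thesis using C.sub_zero[OF C.span_sub[OF gr_vs fil_Ufil_generators]] by simp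
    qed
  qed (use v in simp)
  ultimately show ?thesis by blast
qed

lemma is_fil_vs_Ufil: "is_fil_vs (Ufil_Ob A)"
proof -
  let ?V = "gspace A" and ?J = "(degrees A)"
  have fsp: "fspace (Ufil_Ob A) = ?V" by (simp add: Ufil_Ob_def)
  have sub: "C.sub ?V (fil (Ufil_Ob A) m)" for m
    unfolding Ufil_Ob_def using C.span_sub[OF gr_vs fil_Ufil_generators] by simp
  \<comment> \<open>Inserting 0 keeps the minimum and the maximum meaningful when every piece is
    zero; subtracting 1 puts a strictly below all degrees.\<close>
  define a b where "a = Min (insert 0 ?J) - 1" and "b = Max (insert 0 ?J)"
  have fin: "finite (insert 0 ?J)" using finite_pieces by simp
  have a: "a < n" and b: "n \<le> b" if "n \<in> ?J" for n
    using Min_le[OF fin, of n] Max_ge[OF fin, of n] that unfolding \<open>a = Min (insert 0 ?J) - 1\<close> \<open>b = Max (insert 0 ?J)\<close> by auto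
  have z: "component A n v = \<zero>\<^bsub>?V\<^esub>" if "n \<notin> ?J" "v \<in> carrier ?V" for n v
    using component_piece[OF that(2), of n] that(1) by auto
  have "fil (Ufil_Ob A) a = {\<zero>\<^bsub>?V\<^esub>}"
  proof -
    have "v = \<zero>\<^bsub>?V\<^esub>" if v: "v \<in> fil (Ufil_Ob A) a" for v
    proof (rule component_eq_zero)
      show vc: "v \<in> carrier ?V" using v unfolding fil_Ufil_iff by blast
      show "component A n v = \<zero>\<^bsub>?V\<^esub>" for n
        using v a[of n] z[OF _ vc, of n] unfolding fil_Ufil_iff by blast
    qed
    thus ?thesis using C.sub_zero[OF sub] by blast
  qed
  moreover have "fil (Ufil_Ob A) b = carrier ?V"
  proof (intro equalityI subsetI)
    fix v assume v: "v \<in> carrier ?V"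
    have "component A n v = \<zero>\<^bsub>?V\<^esub>" if "b < n" for n using z[OF _ v, of n] b[of n] that by linarith
    thus "v \<in> fil (Ufil_Ob A) b" using v unfolding fil_Ufil_iff by blast
  qed (use C.sub_carrier[OF sub] in blast)
  moreover have "mono (fil (Ufil_Ob A))" by (rule monoI) (auto simp: fil_Ufil_iff)
  ultimately show ?thesis unfolding is_fil_vs_def increasing_filtration_def fsp using gr_vs sub by blast
qed

end

lemma gr_homsD:
  assumes "f \<in> gr_homs A B"
  shows "f \<in> linear_maps UNIV (gspace A) (gspace B)" "f \<in> C.lin (gspace A) (gspace B)" "v \<in> piece A n \<Longrightarrow> f v \<in> piece B n"
  using assms by (auto simp: gr_homs_def C.linear_maps_lin)

text \<open>By additivity it suffices to look at each component of v, whose image lies in the piece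
  of the same degree.\<close>

lemma gr_homs_component:
  assumes A: "is_gr_vs A" and B: "is_gr_vs B" and f: "f \<in> gr_homs A B" and v: "v \<in> carrier (gspace A)"
  shows "component B n (f v) = f (component A n v)"
proof -
  note fD = gr_homsD[OF f] and vs = gr_vs[OF A] gr_vs[OF B]
  let ?J = "(degrees A)" and ?c = "\<lambda>m. component A m v"
  have c: "?c m \<in> piece A m" "?c m \<in> carrier (gspace A)" for m
    using component_piece[OF A v] component_closed[OF A v] by blast+
  have "component B n (f (finsum (gspace A) ?c ?J)) = finsum (gspace B) (\<lambda>m. component B n (f (?c m))) ?J"
    by (rule C.lin_finsum[OF C.lin_comp[OF fD(2) component(1)[OF B]] vs finite_pieces[OF A] c(2)])
  also have "\<dots> = finsum (gspace B) (\<lambda>m. f (component A n (?c m))) ?J"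
    using component(2)[OF A c(1)] component(2)[OF B fD(3)[OF c(1)]] C.lin_zero[OF fD(2) vs] C.lin_closed[OF fD(2)] c(2) vs
    by (intro C.finsum_vs_cong[OF vs(2)]) auto
  also have "\<dots> = f (component A n (finsum (gspace A) ?c ?J))"
    by (rule C.lin_finsum[OF C.lin_comp[OF component(1)[OF A] fD(2)] vs finite_pieces[OF A] c(2), symmetric])
  finally show ?thesis unfolding component_sum[OF A v] .
qed

text \<open>For filtered spaces a bijective morphism may have an inverse that is not filtered. Here
  f commutes with components: a component of the preimage in a wrong degree is mapped to a component
  of w that vanishes, so it is zero by injectivity.\<close>

lemma gr_iso_inI:
  assumes A: "is_gr_vs A" and B: "is_gr_vs B" and f: "f \<in> gr_homs A B"
    and b: "bij_betw f (carrier (gspace A)) (carrier (gspace B))"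
  shows "iso_in grVect (arr A f B) A B"
proof -
  let ?g = "\<lambda>w\<in>carrier (gspace B). inv_into (carrier (gspace A)) f w"
  note fD = gr_homsD[OF f] and vs = gr_vs[OF A] gr_vs[OF B]
  have g: "?g w \<in> carrier (gspace A)" "f (?g w) = w" if "w \<in> carrier (gspace B)" for w
    using b that by (auto simp: bij_betw_def inv_into_into f_inv_into_f)
  have gf: "?g (f v) = v" if "v \<in> carrier (gspace A)" for v
    using b that C.lin_closed[OF fD(2) that] by (simp add: bij_betw_def)
  have "?g \<in> gr_homs B A"
  proof -
    have "?g w \<in> piece A n" if w: "w \<in> piece B n" for w n
    proof -
      have wc: "w \<in> carrier (gspace B)" by (rule piece_carrier[OF B w])
      have "component A m (?g w) = \<zero>\<^bsub>gspace A\<^esub>" if "m \<noteq> n" for m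
      proof -
        have "f (component A m (?g w)) = f \<zero>\<^bsub>gspace A\<^esub>"
          using gr_homs_component[OF A B f g(1)[OF wc], of m] component(2)[OF B w, of m] g(2)[OF wc] that C.lin_zero[OF fD(2) vs]
          by simp
        thus ?thesis
          by (rule inj_onD[OF bij_betw_imp_inj_on[OF b] _ component_closed[OF A g(1)[OF wc]] C.vs_zero[OF vs(1)]])
      qed
      thus ?thesis using piece_iff[OF A] g(1)[OF wc] by blast
    qed
    moreover have "?g \<in> linear_maps UNIV (gspace B) (gspace A)"
      using C.lin_inv_into[OF fD(2) vs b] vs by (intro C.linear_maps_restrict)
    ultimately show ?thesis unfolding gr_homs_def by blast
  qed
  thus ?thesis unfolding grVect_def using A B f g(2) gf by (intro grVect.iso_inI[of A f B ?g]) simp_all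
qed

text \<open>Equality of objects, not just an isomorphism: on the same tensor product both
  filtrations are supported on the bidegrees with i + j \<le> m. The structure maps of
  \<open>Ufil\<close> are therefore identities.\<close>

lemma Ufil_tensor:
  assumes A: "is_gr_vs A" and B: "is_gr_vs B"
  shows "fil_tensor (Ufil_Ob A) (Ufil_Ob B) = Ufil_Ob (gr_tensor A B)"
proof -
  let ?T = "tensor UNIV (gspace A) (gspace B)"
  obtain \<pi> where \<pi>: "C.proj_system (gspace A) (degrees A) \<pi>"
    and P: "\<And>n. piece A n = C.supported (gspace A) (degrees A) \<pi> (\<lambda>i. i = n)"
    by (rule is_gr_vs_proj_system[OF A]) (rule that)
  obtain \<pi>' where \<pi>': "C.proj_system (gspace B) (degrees B) \<pi>'"
    and P': "\<And>n. piece B n = C.supported (gspace B) (degrees B) \<pi>' (\<lambda>i. i = n)"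
    by (rule is_gr_vs_proj_system[OF B]) (rule that)
  have fil: "fil (Ufil_Ob X) m = C.supported (gspace X) J p (\<lambda>i. i \<le> m)"
    if p: "C.proj_system (gspace X) J p" and P: "\<And>n. piece X n = C.supported (gspace X) J p (\<lambda>i. i = n)"
    for X :: "'a gr_vs" and J p m
    unfolding Ufil_Ob_def fil_vs.simps
  proof (rule C.span_supported[OF p])
    show "(\<Union>n\<in>{..m}. piece X n) \<subseteq> C.supported (gspace X) J p (\<lambda>i. i \<le> m)"
      unfolding P by (auto simp: C.supported_def)
    show "p i v \<in> (\<Union>n\<in>{..m}. piece X n)" if "i \<in> J" "i \<le> m" "v \<in> carrier (gspace X)" for i v
      unfolding P using that C.proj_supported[OF p, of i "\<lambda>j. j = i"] by auto
  qed
  let ?J = "(degrees A) \<times> (degrees B)"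
  let ?m = "\<lambda>(i, j). tensor_map UNIV (gspace A) (gspace B) (gspace A) (gspace B) (\<pi> i) (\<pi>' j)"
  note T = C.proj_system_tensor[OF \<pi> \<pi>']
  have "tensor_family UNIV (gspace A) (gspace B) (fil (Ufil_Ob A)) (fil (Ufil_Ob B)) m
      = C.supported ?T ?J ?m (\<lambda>(i, j). i + j \<le> m)" for m :: int
  proof -
    have "(\<exists>a b. a + b = m \<and> i \<le> a \<and> j \<le> b) \<longleftrightarrow> i + j \<le> m" for i j :: int by presburger
    thus ?thesis using C.tensor_family_supported[OF \<pi> \<pi>' fil[OF \<pi> P] fil[OF \<pi>' P'], where p = m] by simp
  qed
  moreover have "C.span ?T (\<Union>n\<in>{..m}. tensor_family UNIV (gspace A) (gspace B) (piece A) (piece B) n)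
      = C.supported ?T ?J ?m (\<lambda>(i, j). i + j \<le> m)" for m
  proof -
    have piece: "tensor_family UNIV (gspace A) (gspace B) (piece A) (piece B) n = C.supported ?T ?J ?m (\<lambda>(i, j). i + j = n)" for n
      using C.tensor_family_supported[OF \<pi> \<pi>' P P', where p = n] by (simp add: case_prod_unfold)
    show ?thesis unfolding piece
    proof (rule C.span_supported[OF T])
      show "(\<Union>n\<in>{..m}. C.supported ?T ?J ?m (\<lambda>(i, j). i + j = n)) \<subseteq> C.supported ?T ?J ?m (\<lambda>(i, j). i + j \<le> m)"
        by (auto simp: C.supported_def)
      show "?m x v \<in> (\<Union>n\<in>{..m}. C.supported ?T ?J ?m (\<lambda>(i, j). i + j = n))"
        if "x \<in> ?J" "case x of (i, j) \<Rightarrow> i + j \<le> m" "v \<in> carrier ?T" for x v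
        using that C.proj_supported[OF T that(1), of "\<lambda>(i, j). i + j = fst x + snd x"]
        by (intro UN_I[of "fst x + snd x"]) (auto simp: case_prod_unfold)
    qed
  qed
  ultimately show ?thesis by (simp add: fil_tensor_def gr_tensor_def Ufil_Ob_def[of "\<lparr>gspace = _, piece = _\<rparr>"] fun_eq_iff)
     (simp add: Ufil_Ob_def)
qed

lemma is_gr_vs_unit: "is_gr_vs gr_unit"
  using grVect.unt_obs by simp

lemma Ufil_unit: "Ufil_Ob gr_unit = fil_unit"
proof -
  have "fil (Ufil_Ob gr_unit) m = (fil fil_unit m :: 'a pt set)" for m
  proof (rule Set.set_eqI)
    fix v :: "'a pt"
    have "component gr_unit n v = (if n = 0 then v else \<zero>\<^bsub>CC\<^esub>)" if "v \<in> carrier CC" for n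
      using component(2)[OF is_gr_vs_unit, of v 0 n] that unfolding gr_unit_def by simp
    hence "v \<in> fil (Ufil_Ob gr_unit) m \<longleftrightarrow> v \<in> carrier CC \<and> (m < 0 \<longrightarrow> v = \<zero>\<^bsub>CC\<^esub>)"
      unfolding fil_Ufil_iff[OF is_gr_vs_unit] by (auto simp: gr_unit_def)
    thus "v \<in> fil (Ufil_Ob gr_unit) m \<longleftrightarrow> v \<in> fil fil_unit m"
      by (auto simp: fil_unit_def)
  qed
  thus ?thesis by (simp add: Ufil_Ob_def gr_unit_def fil_unit_def fun_eq_iff)
qed

lemma gr_homs_Ufil:
  assumes A: "is_gr_vs A" and B: "is_gr_vs B" and f: "f \<in> gr_homs A B"
  shows "f \<in> fil_homs (Ufil_Ob A) (Ufil_Ob B)"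
proof -
  note fD = gr_homsD[OF f]
  have "f v \<in> fil (Ufil_Ob B) m" if v: "v \<in> fil (Ufil_Ob A) m" for m v
    using v C.lin_closed[OF fD(2)] C.lin_zero[OF fD(2) gr_vs[OF A] gr_vs[OF B]] gr_homs_component[OF A B f]
    unfolding fil_Ufil_iff[OF A] fil_Ufil_iff[OF B] by metis
  thus ?thesis using fD(1) by (auto simp: fil_homs_def Ufil_Ob_def)
qed

lemmas FVect_simps = FVect.vs_category_simps[folded FVect_def] FVect.arrow_in_arr[folded FVect_def]
lemmas grVect_simps = grVect.vs_category_simps[folded grVect_def] grVect.arrow_in_arr[folded grVect_def]
lemmas grVect_arrow_inE = grVect.arrow_inE[folded grVect_def]
lemmas FVect_arrow_inE = FVect.arrow_inE[folded FVect_def]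

lemma Ufil_simps:
  "FOb Ufil = Ufil_Ob" "FAr Ufil (arr A f B) = arr (Ufil_Ob A) f (Ufil_Ob B)"
  "\<lbrakk>is_gr_vs A; is_gr_vs B\<rbrakk> \<Longrightarrow> FTen Ufil A B = Idn FVect (Ten FVect (Ufil_Ob A) (Ufil_Ob B))"
  "FUnt Ufil = Idn FVect (Unt FVect)"
  by (simp_all add: Ufil_def FVect_simps Ufil_tensor Ufil_unit) (simp_all add: Ufil_Ob_def fil_unit_def gr_tensor_def)

text \<open>\<open>Ufil\<close> is strict: as its structure maps are identities, each coherence law
  says that the corresponding structure map of graded spaces is, as a linear map, the one of
  filtered spaces.\<close>

lemma Ufil_monoidal: "strong_symmetric_monoidal_functor grVect FVect Ufil"
proof -
  interpret G: symmetric_monoidal_category grVect by (rule grVect_symmetric_monoidal)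
  interpret D: symmetric_monoidal_category FVect by (rule FVect_symmetric_monoidal)
  have ob: "X \<in> Ob grVect \<longleftrightarrow> is_gr_vs X" for X :: "'a gr_vs" by (simp add: grVect_simps)
  have sp: "fspace (Ufil_Ob X) = gspace X" for X :: "'a gr_vs" by (simp add: Ufil_Ob_def)
  have FOb: "Ufil_Ob X \<in> Ob FVect" if "X \<in> Ob grVect" for X :: "'a gr_vs"
    using that by (simp add: grVect_simps FVect_simps is_fil_vs_Ufil)
  have FAr: "arrow_in FVect (FAr Ufil f) (Ufil_Ob A) (Ufil_Ob B)" if "arrow_in grVect f A B" for f and A B :: "'a gr_vs"
    using that by (auto elim!: grVect_arrow_inE simp: Ufil_simps FVect_simps is_fil_vs_Ufil gr_homs_Ufil)
  have Ten: "Ten FVect (Ufil_Ob A) (Ufil_Ob B) = Ufil_Ob (Ten grVect A B)" if "A \<in> Ob grVect" "B \<in> Ob grVect" for A B :: "'a gr_vs"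
    using that by (simp add: grVect_simps FVect_simps Ufil_tensor)
  have Unt: "Unt FVect = Ufil_Ob (Unt grVect)" by (simp add: grVect_simps FVect_simps Ufil_unit)
  have FTen: "FTen Ufil A B = Idn FVect (Ufil_Ob (Ten grVect A B))" if "A \<in> Ob grVect" "B \<in> Ob grVect" for A B :: "'a gr_vs"
    using that by (simp add: Ufil_simps Ten ob)
  have TenA: "FAr Ufil (TenA grVect f g) = TenA FVect (FAr Ufil f) (FAr Ufil g)"
    if "arrow_in grVect f A B" "arrow_in grVect g A' B'" for f g and A B A' B' :: "'a gr_vs"
    using that by (auto elim!: grVect_arrow_inE simp: Ufil_simps FVect_simps grVect_simps Ufil_tensor sp)
  have Idn: "FAr Ufil (Idn grVect X) = Idn FVect (Ufil_Ob X)" for X :: "'a gr_vs"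
    by (simp add: Ufil_simps FVect_simps grVect_simps sp)
  have iso: "iso_in FVect (Idn FVect X) X X" if "X \<in> Ob FVect" for X :: "'a fil_vs"
    unfolding iso_in_def using D.Idn_arrow[OF that] D.Cmp_Idn_left[OF D.Idn_arrow[OF that]] by blast
  have coh: "FAr Ufil (Asc grVect X Y Z) = Asc FVect (Ufil_Ob X) (Ufil_Ob Y) (Ufil_Ob Z)"
    "FAr Ufil (LUn grVect X) = LUn FVect (Ufil_Ob X)" "FAr Ufil (RUn grVect X) = RUn FVect (Ufil_Ob X)"
    "FAr Ufil (Brd grVect X Y) = Brd FVect (Ufil_Ob X) (Ufil_Ob Y)"
    if "X \<in> Ob grVect" "Y \<in> Ob grVect" "Z \<in> Ob grVect" for X Y Z :: "'a gr_vs"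
    using that
    by (simp_all add: is_gr_vs_tensor is_gr_vs_unit Ufil_simps FVect_simps grVect_simps Ufil_tensor Ufil_unit[symmetric] sp)
  show ?thesis
  proof (unfold_locales, goal_cases obj arrow identity compose tensor unit natural assoc lunit runit braid)
    case (obj A)
    thus ?case by (simp add: Ufil_simps FOb)
  next
    case (arrow f A B)
    thus ?case by (simp add: Ufil_simps FAr)
  next
    case (identity A)
    show ?case by (simp add: Ufil_simps(1) Idn)
  next
    case (compose f X Y g Z)
    thus ?case by (auto elim!: grVect_arrow_inE simp: Ufil_simps FVect_simps grVect_simps sp)
  next
    case (tensor A B)
    thus ?case by (simp add: FTen Ufil_simps(1) Ten iso FOb G.Ten_Ob)
  next
    case unit
    show ?case by (simp only: Ufil_simps(1,4) Unt[symmetric] iso D.Unt_Ob)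
  next
    case (natural f A B g A' B')
    hence "B \<in> Ob grVect" "B' \<in> Ob grVect" "A \<in> Ob grVect" "A' \<in> Ob grVect"
      using G.Tgt_Ob G.Src_Ob by (auto simp: arrow_in_def)
    thus ?case
      using FAr[OF G.TenA_arrow[OF natural]] TenA[OF natural] by (simp add: FTen D.Cmp_Idn_left D.Cmp_Idn_right)
  next
    case (assoc X Y Z)
    have a: "arrow_in FVect (FAr Ufil (Asc grVect X Y Z)) (Ufil_Ob (Ten grVect (Ten grVect X Y) Z)) (Ufil_Ob (Ten grVect X (Ten grVect Y Z)))"
      using FAr G.Asc_iso[OF assoc] by (auto simp: iso_in_def)
    show ?case
      using a assoc
      by (simp add: G.Ten_Ob FOb FTen Ufil_simps(1) D.TenA_Idn Ten D.Cmp_Idn_left[OF D.Idn_arrow] D.Cmp_Idn_left[OF a] D.Cmp_Idn_right[OF a] coh[symmetric])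
  next
    case (lunit X)
    have a: "arrow_in FVect (FAr Ufil (LUn grVect X)) (Ufil_Ob (Ten grVect (Unt grVect) X)) (Ufil_Ob X)"
      using FAr G.LUn_iso[OF lunit] by (auto simp: iso_in_def)
    show ?case
      using a lunit
      by (simp add: G.Ten_Ob G.Unt_Ob FOb FTen Ufil_simps(1,4) Unt D.TenA_Idn Ten D.Cmp_Idn_left[OF D.Idn_arrow] D.Cmp_Idn_right[OF a] coh[symmetric])
  next
    case (runit X)
    have a: "arrow_in FVect (FAr Ufil (RUn grVect X)) (Ufil_Ob (Ten grVect X (Unt grVect))) (Ufil_Ob X)"
      using FAr G.RUn_iso[OF runit] by (auto simp: iso_in_def)
    show ?case
      using a runit
      by (simp add: G.Ten_Ob G.Unt_Ob FOb FTen Ufil_simps(1,4) Unt D.TenA_Idn Ten D.Cmp_Idn_left[OF D.Idn_arrow] D.Cmp_Idn_right[OF a] coh[symmetric])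
  next
    case (braid X Y)
    have a: "arrow_in FVect (FAr Ufil (Brd grVect X Y)) (Ufil_Ob (Ten grVect X Y)) (Ufil_Ob (Ten grVect Y X))"
      using FAr G.Brd_iso[OF braid] by (auto simp: iso_in_def)
    show ?case
      using a braid by (simp add: FTen Ufil_simps(1) D.Cmp_Idn_left[OF a] D.Cmp_Idn_right[OF a] coh[symmetric])
  qed
qed

section \<open>The functor from filtered to graded vector spaces\<close>

lemma dsum_simps:
  "\<zero>\<^bsub>dsum M\<^esub> = Fam (\<lambda>p. \<zero>\<^bsub>M p\<^esub>)" "x \<oplus>\<^bsub>dsum M\<^esub> y = Fam (\<lambda>p. comps x p \<oplus>\<^bsub>M p\<^esub> comps y p)"
  "r \<odot>\<^bsub>dsum M\<^esub> x = Fam (\<lambda>p. r \<odot>\<^bsub>M p\<^esub> comps x p)"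
  "Fam f \<in> carrier (dsum M) \<longleftrightarrow> (\<forall>p. f p \<in> carrier (M p)) \<and> finite {p. f p \<noteq> \<zero>\<^bsub>M p\<^esub>}"
  by (auto simp: dsum_def)

lemma dsumE:
  assumes "x \<in> carrier (dsum M)"
  obtains f where "x = Fam f" "\<And>p. f p \<in> carrier (M p)" "finite {p. f p \<noteq> \<zero>\<^bsub>M p\<^esub>}"
  using assms by (auto simp: dsum_def)

lemma comps_closed: "x \<in> carrier (dsum M) \<Longrightarrow> comps x p \<in> carrier (M p)"
  by (elim dsumE) simp

lemma dsum_eqI: "\<lbrakk>x \<in> carrier (dsum M); y \<in> carrier (dsum M); \<And>p. comps x p = comps y p\<rbrakk> \<Longrightarrow> x = y"
  by (elim dsumE) (auto simp: fun_eq_iff)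

context
  fixes M :: "int \<Rightarrow> 'a vs"
  assumes M: "\<And>p. C.vs (M p)"
begin

lemma vs_dsum: "C.vs (dsum M)"
proof (rule C.vsI)
  show "\<zero>\<^bsub>dsum M\<^esub> \<in> carrier (dsum M)" using M by (simp add: dsum_simps)
  show "x \<oplus>\<^bsub>dsum M\<^esub> y \<in> carrier (dsum M)" if x: "x \<in> carrier (dsum M)" and y: "y \<in> carrier (dsum M)" for x y
  proof -
    obtain f where f: "x = Fam f" "\<And>p. f p \<in> carrier (M p)" "finite {p. f p \<noteq> \<zero>\<^bsub>M p\<^esub>}" by (rule dsumE[OF x]) (rule that)
    obtain g where g: "y = Fam g" "\<And>p. g p \<in> carrier (M p)" "finite {p. g p \<noteq> \<zero>\<^bsub>M p\<^esub>}" by (rule dsumE[OF y]) (rule that)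
    have "{p. f p \<oplus>\<^bsub>M p\<^esub> g p \<noteq> \<zero>\<^bsub>M p\<^esub>} \<subseteq> {p. f p \<noteq> \<zero>\<^bsub>M p\<^esub>} \<union> {p. g p \<noteq> \<zero>\<^bsub>M p\<^esub>}"
      using C.vs_l_zero[OF M C.vs_zero[OF M]] by auto
    hence "finite {p. f p \<oplus>\<^bsub>M p\<^esub> g p \<noteq> \<zero>\<^bsub>M p\<^esub>}" using f(3) g(3) finite_subset by blast
    thus ?thesis using f g M by (simp add: dsum_simps)
  qed
  show "r \<odot>\<^bsub>dsum M\<^esub> x \<in> carrier (dsum M)" if x: "x \<in> carrier (dsum M)" for r x
  proof -
    obtain f where f: "x = Fam f" "\<And>p. f p \<in> carrier (M p)" "finite {p. f p \<noteq> \<zero>\<^bsub>M p\<^esub>}" by (rule dsumE[OF x]) (rule that)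
    have sm: "(\<lambda>x. r \<odot>\<^bsub>M p\<^esub> x) \<in> C.lin (M p) (M p)" for p
      using M by (intro C.linI) (simp_all add: C.vs_distr C.vs_smult_smult mult.commute)
    have "{p. r \<odot>\<^bsub>M p\<^esub> f p \<noteq> \<zero>\<^bsub>M p\<^esub>} \<subseteq> {p. f p \<noteq> \<zero>\<^bsub>M p\<^esub>}" using C.lin_zero[OF sm M M] by auto
    hence "finite {p. r \<odot>\<^bsub>M p\<^esub> f p \<noteq> \<zero>\<^bsub>M p\<^esub>}" using f(3) finite_subset by blast
    thus ?thesis using f M by (simp add: dsum_simps)
  qed
qed (elim dsumE; auto simp: dsum_simps M fun_eq_iff C.vs_distl C.vs_distr C.vs_smult_smult intro: C.vs_ac[OF M])+

lemma comps_lin: "(\<lambda>x. comps x p) \<in> C.lin (dsum M) (M p)"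
  by (rule C.linI) (simp_all add: dsum_simps comps_closed)

lemma dsum_lin:
  assumes N: "C.vs N" and h: "\<And>p. h p \<in> C.lin N (M p)" and fin: "\<And>v. v \<in> carrier N \<Longrightarrow> finite {p. h p v \<noteq> \<zero>\<^bsub>M p\<^esub>}"
  shows "(\<lambda>v. Fam (\<lambda>p. h p v)) \<in> C.lin N (dsum M)"
proof (rule C.linI)
  show "Fam (\<lambda>p. h p v) \<in> carrier (dsum M)" if "v \<in> carrier N" for v
    using that fin C.lin_closed[OF h that] by (simp add: dsum_simps)
qed (simp_all add: dsum_simps C.lin_add[OF h] C.lin_smult[OF h])

lemma is_gr_vs_dsum:
  assumes fin: "finite {p. carrier (M p) \<noteq> {\<zero>\<^bsub>M p\<^esub>}}"
  shows "is_gr_vs \<lparr>gspace = dsum M, piece = (\<lambda>p. {x \<in> carrier (dsum M). \<forall>q. q \<noteq> p \<longrightarrow> comps x q = \<zero>\<^bsub>M q\<^esub>})\<rparr>"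
proof -
  let ?J = "{p. carrier (M p) \<noteq> {\<zero>\<^bsub>M p\<^esub>}}"
  let ?\<pi> = "\<lambda>p x. Fam (\<lambda>q. if q = p then comps x q else \<zero>\<^bsub>M q\<^esub>)"
  have lin: "?\<pi> p \<in> C.lin (dsum M) (dsum M)" for p
  proof (rule dsum_lin[OF vs_dsum])
    show "(\<lambda>x. if q = p then comps x q else \<zero>\<^bsub>M q\<^esub>) \<in> C.lin (dsum M) (M q)" for q
      by (cases "q = p") (simp_all add: comps_lin C.lin_zero_fun[OF M])
    show "finite {q. (if q = p then comps v q else \<zero>\<^bsub>M q\<^esub>) \<noteq> \<zero>\<^bsub>M q\<^esub>}" for v
      by (rule finite_subset[of _ "{p}"]) auto
  qed
  have z: "comps x p = \<zero>\<^bsub>M p\<^esub>" if "x \<in> carrier (dsum M)" "p \<notin> ?J" for x p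
    using comps_closed[OF that(1), of p] that(2) by auto
  have "C.proj_system (dsum M) ?J ?\<pi>"
    unfolding C.proj_system_def
  proof (intro conjI ballI vs_dsum fin lin)
    show "?\<pi> i (?\<pi> j v) = (if i = j then ?\<pi> i v else \<zero>\<^bsub>dsum M\<^esub>)" for i j v
      by (auto simp: dsum_simps fun_eq_iff)
    fix v assume v: "v \<in> carrier (dsum M)"
    show "finsum (dsum M) (\<lambda>i. ?\<pi> i v) ?J = v"
    proof (rule dsum_eqI[OF C.finsum_vs_closed[OF vs_dsum C.lin_closed[OF lin v]] v])
      fix q
      have "comps (finsum (dsum M) (\<lambda>i. ?\<pi> i v) ?J) q = finsum (M q) (\<lambda>i. comps (?\<pi> i v) q) ?J"
        by (rule C.lin_finsum[OF comps_lin vs_dsum M fin C.lin_closed[OF lin v]])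
      also have "\<dots> = finsum (M q) (\<lambda>i. if i = q then comps v q else \<zero>\<^bsub>M q\<^esub>) ?J"
        using comps_closed[OF v] M by (intro C.finsum_vs_cong[OF M]) auto
      also have "\<dots> = comps v q"
        using C.finsum_delta[OF M fin, of "\<lambda>_. comps v q" q q] comps_closed[OF v] z[OF v, of q] by auto
      finally show "comps (finsum (dsum M) (\<lambda>i. ?\<pi> i v) ?J) q = comps v q" .
    qed
  qed
  thus ?thesis
  proof (rule proj_system_is_gr_vs[where d = "\<lambda>i. i"])
    show "{x \<in> carrier (dsum M). \<forall>q. q \<noteq> p \<longrightarrow> comps x q = \<zero>\<^bsub>M q\<^esub>} = C.supported (dsum M) ?J ?\<pi> (\<lambda>i. i = p)" for p
      unfolding C.supported_def using z by (auto simp: dsum_simps fun_eq_iff)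
  qed
qed

end

context
  fixes A :: "'a fil_vs"
  assumes A: "is_fil_vs A"
begin

lemma fil_vs: "C.vs (fspace A)" and fil_sub: "C.sub (fspace A) (fil A m)" and fil_mono: "mono (fil A)"
  using A unfolding is_fil_vs_def increasing_filtration_def by blast+

lemma fil_carrier: "v \<in> fil A m \<Longrightarrow> v \<in> carrier (fspace A)"
  by (rule C.sub_carrier[OF fil_sub])

lemma fil_subsp: "C.vs (subsp (fspace A) (fil A m))"
  "C.sub (subsp (fspace A) (fil A m)) (fil A (m - 1))"
  using C.vs_subsp[OF fil_sub] C.sub_subsp[OF fil_sub fil_sub monoD[OF fil_mono, of "m - 1" m]] by simp_all

lemma vs_Gr: "C.vs (Gr (fspace A) (fil A) m)"
  unfolding Gr_def by (rule C.vs_quot[OF fil_subsp])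

lemma carrier_Gr: "carrier (Gr (fspace A) (fil A) m) = Gr_proj (fspace A) (fil A) m ` fil A m"
  by (simp add: Gr_def Gr_proj_def C.quot_simps[OF fil_subsp])

lemma Gr_proj_lin: "Gr_proj (fspace A) (fil A) m \<in> C.lin (subsp (fspace A) (fil A m)) (Gr (fspace A) (fil A) m)"
  unfolding Gr_def Gr_proj_def by (rule C.qcls_lin[OF fil_subsp])

lemma Gr_proj_rep: "v \<in> fil A m \<Longrightarrow> Gr_proj (fspace A) (fil A) m v \<in> fil A m
    \<and> Gr_proj (fspace A) (fil A) m v \<ominus>\<^bsub>fspace A\<^esub> v \<in> fil A (m - 1)"
  using C.qcls_rep[OF fil_subsp, of v m] C.subsp_minus[OF fil_sub] unfolding Gr_proj_def by auto

lemma Gr_proj_eq_iff: "\<lbrakk>v \<in> fil A m; w \<in> fil A m\<rbrakk> \<Longrightarrow>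
    Gr_proj (fspace A) (fil A) m v = Gr_proj (fspace A) (fil A) m w \<longleftrightarrow> v \<ominus>\<^bsub>fspace A\<^esub> w \<in> fil A (m - 1)"
  using C.qcls_eq_iff[OF fil_subsp, of v m w] C.subsp_minus[OF fil_sub, of v m w] unfolding Gr_proj_def by simp

lemma Gr_proj_zero_iff: "v \<in> fil A m \<Longrightarrow>
    Gr_proj (fspace A) (fil A) m v = \<zero>\<^bsub>Gr (fspace A) (fil A) m\<^esub> \<longleftrightarrow> v \<in> fil A (m - 1)"
  using C.qcls_zero_iff[OF fil_subsp, of v m] unfolding Gr_proj_def Gr_def by simp

text \<open>Classes are encoded by representatives, so an element of the graded piece is a vector of
  \<open>fil A m\<close> that represents itself. This is why \<open>gr_functor\<close> can apply a
  mapping directly to the components of a family.\<close>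

lemma Gr_carrierD:
  assumes "x \<in> carrier (Gr (fspace A) (fil A) m)"
  shows "x \<in> fil A m" "Gr_proj (fspace A) (fil A) m x = x"
proof -
  obtain v where v: "v \<in> fil A m" "x = Gr_proj (fspace A) (fil A) m v" using assms unfolding carrier_Gr by blast
  note r = Gr_proj_rep[OF v(1)]
  show "x \<in> fil A m" using r v(2) by simp
  show "Gr_proj (fspace A) (fil A) m x = x" unfolding v(2) using Gr_proj_eq_iff[of _ m v] r v(1) by blast
qed

lemma gr_Ob_simps: "gspace (gr_Ob A) = dsum (Gr (fspace A) (fil A))"
  "piece (gr_Ob A) p = {x \<in> carrier (dsum (Gr (fspace A) (fil A))). \<forall>q. q \<noteq> p \<longrightarrow> comps x q = \<zero>\<^bsub>Gr (fspace A) (fil A) q\<^esub>}"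
  by (simp_all add: gr_Ob_def)

lemma is_gr_vs_gr_Ob: "is_gr_vs (gr_Ob A)"
  unfolding gr_Ob_def
proof (rule is_gr_vs_dsum[OF vs_Gr])
  obtain a b where a: "fil A a = {\<zero>\<^bsub>fspace A\<^esub>}" and b: "fil A b = carrier (fspace A)"
    using A unfolding is_fil_vs_def increasing_filtration_def by blast
  \<comment> \<open>Up to a the filtration is zero and from b on it is everything, so that outside
    of the interval two consecutive steps agree.\<close>
  have "carrier (Gr (fspace A) (fil A) p) = {\<zero>\<^bsub>Gr (fspace A) (fil A) p\<^esub>}" if p: "p \<notin> {a<..b}" for p
  proof -
    have "fil A p \<subseteq> fil A (p - 1)"
    proof (cases "p \<le> a")
      case True
      have "fil A p \<subseteq> {\<zero>\<^bsub>fspace A\<^esub>}" using monoD[OF fil_mono True] unfolding a .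
      thus ?thesis using C.sub_zero[OF fil_sub[of "p - 1"]] by auto
    next
      case False
      thus ?thesis using monoD[OF fil_mono, of b "p - 1"] p b C.sub_subset[OF fil_sub] by fastforce
    qed
    hence "x = \<zero>\<^bsub>Gr (fspace A) (fil A) p\<^esub>" if "x \<in> carrier (Gr (fspace A) (fil A) p)" for x
      using that Gr_proj_zero_iff unfolding carrier_Gr by blast
    thus ?thesis using C.vs_zero[OF vs_Gr] by blast
  qed
  hence "{p. carrier (Gr (fspace A) (fil A) p) \<noteq> {\<zero>\<^bsub>Gr (fspace A) (fil A) p\<^esub>}} \<subseteq> {a<..b}" by blast
  thus "finite {p. carrier (Gr (fspace A) (fil A) p) \<noteq> {\<zero>\<^bsub>Gr (fspace A) (fil A) p\<^esub>}}"
    using finite_subset by blast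
qed

end

lemma fil_homsD:
  assumes "f \<in> fil_homs A B"
  shows "f \<in> linear_maps UNIV (fspace A) (fspace B)" "f \<in> C.lin (fspace A) (fspace B)" "v \<in> fil A n \<Longrightarrow> f v \<in> fil B n"
  using assms by (auto simp: fil_homs_def C.linear_maps_lin)

context
  fixes A B :: "'a fil_vs" and f
  assumes A: "is_fil_vs A" and B: "is_fil_vs B" and f: "f \<in> fil_homs A B"
begin

text \<open>The map on graded pieces is independent of the chosen representative: two
  representatives differ by an element of the previous step, which f respects.\<close>

lemma Gr_proj_map: "v \<in> fil A p \<Longrightarrow> Gr_proj (fspace B) (fil B) p (f (Gr_proj (fspace A) (fil A) p v)) = Gr_proj (fspace B) (fil B) p (f v)"
proof -
  assume v: "v \<in> fil A p"
  note r = Gr_proj_rep[OF A v]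
  have "f (Gr_proj (fspace A) (fil A) p v) \<ominus>\<^bsub>fspace B\<^esub> f v = f (Gr_proj (fspace A) (fil A) p v \<ominus>\<^bsub>fspace A\<^esub> v)"
    using r v fil_carrier[OF A] by (intro C.lin_minus[OF fil_homsD(2)[OF f] fil_vs[OF A] fil_vs[OF B], symmetric]) auto
  thus ?thesis using fil_homsD(3)[OF f] r v by (simp add: Gr_proj_eq_iff[OF B])
qed

lemma Gr_map_lin: "(\<lambda>x. Gr_proj (fspace B) (fil B) p (f x)) \<in> C.lin (Gr (fspace A) (fil A) p) (Gr (fspace B) (fil B) p)"
proof (rule C.linI)
  let ?PA = "Gr_proj (fspace A) (fil A) p" and ?PB = "Gr_proj (fspace B) (fil B) p"
  note fD = fil_homsD[OF f] and lA = Gr_proj_lin[OF A, of p] and lB = Gr_proj_lin[OF B, of p]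
  have c: "f v \<in> fil B p" if "v \<in> fil A p" for v using fD(3) that .
  have e: "?PB (f (?PA v)) = ?PB (f v)" if "v \<in> fil A p" for v using Gr_proj_map that .
  fix x assume "x \<in> carrier (Gr (fspace A) (fil A) p)"
  then obtain v where v: "v \<in> fil A p" "x = ?PA v" unfolding carrier_Gr[OF A] by blast
  show "?PB (f x) \<in> carrier (Gr (fspace B) (fil B) p)"
    unfolding v(2) e[OF v(1)] carrier_Gr[OF B] using c[OF v(1)] by blast
  show "?PB (f (r \<odot>\<^bsub>Gr (fspace A) (fil A) p\<^esub> x)) = r \<odot>\<^bsub>Gr (fspace B) (fil B) p\<^esub> ?PB (f x)" for r
    using C.lin_smult[OF lA, of r v] C.lin_smult[OF lB, of r "f v"] C.lin_smult[OF fD(2), of r v] v c[OF v(1)] fil_carrier[OF A]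
      C.sub_smult[OF fil_sub[OF A], of r v p] e
    by (metis UNIV_I C.subsp_simps(1,4))
  fix y assume "y \<in> carrier (Gr (fspace A) (fil A) p)"
  then obtain w where w: "w \<in> fil A p" "y = ?PA w" unfolding carrier_Gr[OF A] by blast
  have "?PB (f (x \<oplus>\<^bsub>Gr (fspace A) (fil A) p\<^esub> y)) = ?PB (f (v \<oplus>\<^bsub>fspace A\<^esub> w))"
    using C.lin_add[OF lA, of v w] v w e[OF C.sub_add[OF fil_sub[OF A] v(1) w(1)]] by simp
  also have "\<dots> = ?PB (f x) \<oplus>\<^bsub>Gr (fspace B) (fil B) p\<^esub> ?PB (f y)"
    using C.lin_add[OF lB, of "f v" "f w"] C.lin_add[OF fD(2) fil_carrier[OF A v(1)] fil_carrier[OF A w(1)]] c v w e by simp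
  finally show "?PB (f (x \<oplus>\<^bsub>Gr (fspace A) (fil A) p\<^esub> y)) = ?PB (f x) \<oplus>\<^bsub>Gr (fspace B) (fil B) p\<^esub> ?PB (f y)" .
qed

lemma gr_map_homs: "(\<lambda>x\<in>carrier (gspace (gr_Ob A)). Fam (\<lambda>p. Gr_proj (fspace B) (fil B) p (f (comps x p))))
    \<in> gr_homs (gr_Ob A) (gr_Ob B)"
proof -
  let ?A = "Gr (fspace A) (fil A)" and ?B = "Gr (fspace B) (fil B)"
  let ?h = "\<lambda>p x. Gr_proj (fspace B) (fil B) p (f x)"
  have z: "?h p \<zero>\<^bsub>?A p\<^esub> = \<zero>\<^bsub>?B p\<^esub>" for p by (rule C.lin_zero[OF Gr_map_lin vs_Gr[OF A] vs_Gr[OF B]])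
  have "(\<lambda>x. Fam (\<lambda>p. ?h p (comps x p))) \<in> C.lin (dsum ?A) (dsum ?B)"
  proof (rule dsum_lin[OF vs_Gr[OF B] vs_dsum[OF vs_Gr[OF A]] C.lin_comp[OF comps_lin[OF vs_Gr[OF A]] Gr_map_lin]])
    fix x assume "x \<in> carrier (dsum ?A)"
    hence "finite {p. comps x p \<noteq> \<zero>\<^bsub>?A p\<^esub>}" by (elim dsumE) simp
    moreover have "{p. ?h p (comps x p) \<noteq> \<zero>\<^bsub>?B p\<^esub>} \<subseteq> {p. comps x p \<noteq> \<zero>\<^bsub>?A p\<^esub>}" using z by auto
    ultimately show "finite {p. ?h p (comps x p) \<noteq> \<zero>\<^bsub>?B p\<^esub>}" using finite_subset by blast
  qed
  note l = this
  have "Fam (\<lambda>p. ?h p (comps x p)) \<in> piece (gr_Ob B) n" if "x \<in> piece (gr_Ob A) n" for x n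
    using that z C.lin_closed[OF l, of x] unfolding gr_Ob_simps[OF A] gr_Ob_simps[OF B] by simp
  thus ?thesis
    using C.linear_maps_restrict[OF l vs_dsum[OF vs_Gr[OF A]]]
    unfolding gr_homs_def gr_Ob_simps(1)[OF A] gr_Ob_simps(1)[OF B] by (auto simp: gr_Ob_simps(2)[OF A])
qed

end

lemma gr_functor: "functor_laws FVect grVect gr_functor"
proof (intro functor_laws.intro functor_laws_axioms.intro)
  show "category_laws FVect" "category_laws grVect"
    by (rule symmetric_monoidal_category.axioms(1)[OF FVect_symmetric_monoidal],
        rule symmetric_monoidal_category.axioms(1)[OF grVect_symmetric_monoidal])
  show "FOb gr_functor A \<in> Ob grVect" if "A \<in> Ob FVect" for A :: "'a fil_vs"
    using that by (simp add: FVect_simps grVect_simps gr_functor_def is_gr_vs_gr_Ob)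
  show "arrow_in grVect (FAr gr_functor f) (FOb gr_functor A) (FOb gr_functor B)" if "arrow_in FVect f A B"
    for f and A B :: "'a fil_vs"
    using that by (auto elim!: FVect_arrow_inE simp: gr_functor_def grVect_simps is_gr_vs_gr_Ob gr_map_homs)
  show "FAr gr_functor (Idn FVect A) = Idn grVect (FOb gr_functor A)" if "A \<in> Ob FVect" for A :: "'a fil_vs"
  proof -
    have A: "is_fil_vs A" using that by (simp add: FVect_simps)
    have "Fam (\<lambda>p. Gr_proj (fspace A) (fil A) p (restrict (\<lambda>v. v) (carrier (fspace A)) (comps x p))) = x"
      if x: "x \<in> carrier (gspace (gr_Ob A))" for x
    proof -
      have c: "comps x p \<in> carrier (Gr (fspace A) (fil A) p)" for p
        using x by (simp add: gr_Ob_simps[OF A] comps_closed)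
      obtain f where "x = Fam f" using x unfolding gr_Ob_simps[OF A] by (rule dsumE)
      thus ?thesis using Gr_carrierD(2)[OF A c] fil_carrier[OF A Gr_carrierD(1)[OF A c]] by (simp add: fun_eq_iff)
    qed
    thus ?thesis by (simp add: gr_functor_def FVect_simps grVect_simps cong: restrict_cong)
  qed
  show "FAr gr_functor (Cmp FVect g f) = Cmp grVect (FAr gr_functor g) (FAr gr_functor f)"
    if "arrow_in FVect f X Y" "arrow_in FVect g Y Z" for f g and X Y Z :: "'a fil_vs"
  proof -
    obtain \<phi> \<psi> where eq: "f = arr X \<phi> Y" "g = arr Y \<psi> Z" and X: "is_fil_vs X" and Y: "is_fil_vs Y" and Z: "is_fil_vs Z"
      and \<phi>: "\<phi> \<in> fil_homs X Y" and \<psi>: "\<psi> \<in> fil_homs Y Z"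
      using \<open>arrow_in FVect f X Y\<close> \<open>arrow_in FVect g Y Z\<close> by (auto elim!: FVect_arrow_inE)
    let ?h = "\<lambda>x\<in>carrier (gspace (gr_Ob X)). Fam (\<lambda>p. Gr_proj (fspace Y) (fil Y) p (\<phi> (comps x p)))"
    have "Fam (\<lambda>p. Gr_proj (fspace Z) (fil Z) p (compose (carrier (fspace X)) \<psi> \<phi> (comps x p)))
        = restrict (\<lambda>x. Fam (\<lambda>p. Gr_proj (fspace Z) (fil Z) p (\<psi> (comps x p)))) (carrier (gspace (gr_Ob Y))) (?h x)"
      if x: "x \<in> carrier (gspace (gr_Ob X))" for x
    proof -
      have c: "comps x p \<in> fil X p" for p
        using x Gr_carrierD(1)[OF X comps_closed] by (simp add: gr_Ob_simps[OF X])
      have "?h x \<in> carrier (gspace (gr_Ob Y))" using C.lin_closed[OF gr_homsD(2)[OF gr_map_homs[OF X Y \<phi>]] x] .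
      thus ?thesis
        using x c fil_carrier[OF X c] by (simp add: compose_eq Gr_proj_map[OF Y Z \<psi>] fil_homsD(3)[OF \<phi>])
    qed
    thus ?thesis
      by (simp add: eq gr_functor_def FVect_simps grVect_simps compose_def[of "carrier (gspace (gr_Ob X))"] cong: restrict_cong)
  qed
qed

section \<open>Recovering a graded vector space from its filtration\<close>

definition gr_Ufil_map :: "'a gr_vs \<Rightarrow> 'a pt \<Rightarrow> 'a pt" where
  "gr_Ufil_map A = (\<lambda>v\<in>carrier (gspace A).
     Fam (\<lambda>p. Gr_proj (gspace A) (fil (Ufil_Ob A)) p (component A p v)))"

context
  fixes A :: "'a gr_vs"
  assumes A: "is_gr_vs A"
begin

lemma fspace_Ufil: "fspace (Ufil_Ob A) = gspace A"
  by (simp add: Ufil_Ob_def)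

lemmas U = is_fil_vs_Ufil[OF A]
lemmas Gr_U = vs_Gr[OF U, unfolded fspace_Ufil] Gr_proj_lin[OF U, unfolded fspace_Ufil]
  Gr_proj_zero_iff[OF U, unfolded fspace_Ufil] carrier_Gr[OF U, unfolded fspace_Ufil]
  Gr_proj_eq_iff[OF U, unfolded fspace_Ufil]

lemma component_in_Ufil: "v \<in> carrier (gspace A) \<Longrightarrow> component A p v \<in> fil (Ufil_Ob A) p"
  unfolding fil_Ufil_iff[OF A] using component_closed[OF A] component(2)[OF A component_piece[OF A]] by auto

lemma Gr_proj_component_lin:
  "(\<lambda>v. Gr_proj (gspace A) (fil (Ufil_Ob A)) p (component A p v)) \<in> C.lin (gspace A) (Gr (gspace A) (fil (Ufil_Ob A)) p)"
proof (rule C.lin_comp[OF _ Gr_U(2)])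
  show "component A p \<in> C.lin (gspace A) (subsp (gspace A) (fil (Ufil_Ob A) p))"
    by (rule C.linI) (simp_all add: component_in_Ufil C.lin_add[OF component(1)[OF A]] C.lin_smult[OF component(1)[OF A]])
qed

lemma Gr_proj_component_zero_iff:
  assumes v: "v \<in> carrier (gspace A)"
  shows "Gr_proj (gspace A) (fil (Ufil_Ob A)) p (component A p v) = \<zero>\<^bsub>Gr (gspace A) (fil (Ufil_Ob A)) p\<^esub>
    \<longleftrightarrow> component A p v = \<zero>\<^bsub>gspace A\<^esub>"
proof -
  have c: "component A p (component A p v) = component A p v" using component(2)[OF A component_piece[OF A v]] by simp
  have "component A p v \<in> fil (Ufil_Ob A) (p - 1) \<longleftrightarrow> component A p v = \<zero>\<^bsub>gspace A\<^esub>"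
    using c component_in_Ufil[OF v, of p] C.sub_zero[OF fil_sub[OF U]] fil_Ufil_iff[OF A, of "component A p v" "p - 1"]
    by (auto simp: fspace_Ufil)
  thus ?thesis using Gr_U(3)[OF component_in_Ufil[OF v]] by simp
qed

lemma gr_Ufil_map_homs: "gr_Ufil_map A \<in> gr_homs A (gr_Ob (Ufil_Ob A))"
proof -
  let ?G = "Gr (gspace A) (fil (Ufil_Ob A))"
  let ?h = "\<lambda>v. Fam (\<lambda>p. Gr_proj (gspace A) (fil (Ufil_Ob A)) p (component A p v))"
  have l: "?h \<in> C.lin (gspace A) (dsum ?G)"
  proof (rule dsum_lin[OF Gr_U(1) gr_vs[OF A] Gr_proj_component_lin])
    fix v assume v: "v \<in> carrier (gspace A)"
    have "{p. component A p v \<noteq> \<zero>\<^bsub>gspace A\<^esub>} \<subseteq> {n. piece A n \<noteq> {\<zero>\<^bsub>gspace A\<^esub>}}"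
      using component_piece[OF A v] by auto
    thus "finite {p. Gr_proj (gspace A) (fil (Ufil_Ob A)) p (component A p v) \<noteq> \<zero>\<^bsub>?G p\<^esub>}"
      unfolding Gr_proj_component_zero_iff[OF v] using finite_pieces[OF A] by (rule finite_subset)
  qed
  have "gr_Ufil_map A ` piece A n \<subseteq> piece (gr_Ob (Ufil_Ob A)) n" for n
  proof
    fix x assume "x \<in> gr_Ufil_map A ` piece A n"
    then obtain v where v: "v \<in> piece A n" "x = ?h v"
      using piece_carrier[OF A] unfolding gr_Ufil_map_def by auto
    have "Gr_proj (gspace A) (fil (Ufil_Ob A)) q (component A q v) = \<zero>\<^bsub>?G q\<^esub>" if "q \<noteq> n" for q
      unfolding Gr_proj_component_zero_iff[OF piece_carrier[OF A v(1)]] using component(2)[OF A v(1), of q] that by simp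
    thus "x \<in> piece (gr_Ob (Ufil_Ob A)) n"
      using C.lin_closed[OF l piece_carrier[OF A v(1)]] unfolding gr_Ob_simps[OF U] fspace_Ufil v(2) by simp
  qed
  thus ?thesis
    using C.linear_maps_restrict[OF l gr_vs[OF A]] unfolding gr_homs_def gr_Ob_simps[OF U] fspace_Ufil gr_Ufil_map_def by blast
qed

text \<open>For surjectivity, a representative w in step p is replaced by its component of degree p:
  their difference has components below p only, so the class is unchanged. These components can be
  prescribed independently in all degrees.\<close>

lemma gr_Ufil_map_bij: "bij_betw (gr_Ufil_map A) (carrier (gspace A)) (carrier (gspace (gr_Ob (Ufil_Ob A))))"
proof -
  let ?G = "Gr (gspace A) (fil (Ufil_Ob A))" and ?P = "Gr_proj (gspace A) (fil (Ufil_Ob A))"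
  have gs: "gspace (gr_Ob (Ufil_Ob A)) = dsum ?G" unfolding gr_Ob_simps[OF U] fspace_Ufil ..
  note l = gr_homsD(2)[OF gr_Ufil_map_homs]
  have "inj_on (gr_Ufil_map A) (carrier (gspace A))"
  proof (rule C.lin_inj_on[OF l gr_vs[OF A] gr_vs[OF is_gr_vs_gr_Ob[OF U]]])
    fix v assume v: "v \<in> carrier (gspace A)" and z: "gr_Ufil_map A v = \<zero>\<^bsub>gspace (gr_Ob (Ufil_Ob A))\<^esub>"
    have "?P p (component A p v) = \<zero>\<^bsub>?G p\<^esub>" for p
      using z v unfolding gs gr_Ufil_map_def dsum_simps by (simp add: fun_eq_iff)
    thus "v = \<zero>\<^bsub>gspace A\<^esub>" using Gr_proj_component_zero_iff[OF v] by (intro component_eq_zero[OF A v]) simp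
  qed
  moreover have "x \<in> gr_Ufil_map A ` carrier (gspace A)" if x: "x \<in> carrier (dsum ?G)" for x
  proof -
    have "\<exists>w. w \<in> piece A p \<and> ?P p w = comps x p" for p
    proof -
      obtain w where w: "w \<in> fil (Ufil_Ob A) p" "comps x p = ?P p w"
        using comps_closed[OF x, of p] unfolding Gr_U(4) by blast
      have wc: "w \<in> carrier (gspace A)" using w(1) unfolding fil_Ufil_iff[OF A] by blast
      have "component A n (component A p w \<ominus>\<^bsub>gspace A\<^esub> w) = \<zero>\<^bsub>gspace A\<^esub>" if "n > p - 1" for n
        using that w(1) C.lin_minus[OF component(1)[OF A] gr_vs[OF A] gr_vs[OF A] component_closed[OF A wc] wc, of n p]
          component(2)[OF A component_piece[OF A wc], of n p] component_closed[OF A wc] gr_vs[OF A]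
        unfolding fil_Ufil_iff[OF A] by (cases "n = p") auto
      hence "component A p w \<ominus>\<^bsub>gspace A\<^esub> w \<in> fil (Ufil_Ob A) (p - 1)"
        unfolding fil_Ufil_iff[OF A] using component_closed[OF A wc] wc gr_vs[OF A] by simp
      hence "?P p (component A p w) = ?P p w" using Gr_U(5)[OF component_in_Ufil[OF wc] w(1)] by simp
      thus ?thesis using w(2) component_piece[OF A wc] by metis
    qed
    then obtain g where g: "\<And>p. g p \<in> piece A p" "\<And>p. ?P p (g p) = comps x p" by metis
    obtain v where v: "v \<in> carrier (gspace A)" "\<And>p. component A p v = g p" by (rule component_surj[OF A g(1)]) (rule that)
    have "x = gr_Ufil_map A v"
    proof (rule dsum_eqI[OF x])
      show "gr_Ufil_map A v \<in> carrier (dsum ?G)" using C.lin_closed[OF l v(1)] unfolding gs .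
    qed (simp add: gr_Ufil_map_def v g)
    thus ?thesis using v(1) by blast
  qed
  ultimately show ?thesis unfolding gs bij_betw_def using C.lin_closed[OF l] unfolding gs by blast
qed

lemma gr_Ufil_iso: "iso_in grVect (arr A (gr_Ufil_map A) (gr_Ob (Ufil_Ob A))) A (gr_Ob (Ufil_Ob A))"
  by (rule gr_iso_inI[OF A is_gr_vs_gr_Ob[OF U] gr_Ufil_map_homs gr_Ufil_map_bij])

end

lemma gr_Ufil_natural:
  assumes A: "is_gr_vs A" and B: "is_gr_vs B" and f: "f \<in> gr_homs A B" and v: "v \<in> carrier (gspace A)"
  shows "mapping (FAr gr_functor (arr (Ufil_Ob A) f (Ufil_Ob B))) (gr_Ufil_map A v) = gr_Ufil_map B (f v)"
proof -
  note U = is_fil_vs_Ufil[OF A] is_fil_vs_Ufil[OF B] gr_homs_Ufil[OF A B f]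
  have "gr_Ufil_map A v \<in> carrier (gspace (gr_Ob (Ufil_Ob A)))"
    by (rule C.lin_closed[OF gr_homsD(2)[OF gr_Ufil_map_homs[OF A]] v])
  thus ?thesis
    using v C.lin_closed[OF gr_homsD(2)[OF f] v] Gr_proj_map[OF U component_in_Ufil[OF A v]] gr_homs_component[OF A B f v]
    by (simp add: gr_functor_def gr_Ufil_map_def fspace_Ufil[OF A] fspace_Ufil[OF B])
qed

section \<open>The grading of a mixed Hodge structure\<close>

context real_field
begin

abbreviation bigrading :: "'a mhs \<Rightarrow> int \<Rightarrow> int \<Rightarrow> 'a pt set" where
  "bigrading A \<equiv> C.deligne (cspace A) (\<lambda>m. cwfil A m) (hfil A) (\<lambda>p. hbar A p)"

definition G_Ob :: "'a mhs \<Rightarrow> 'a gr_vs" where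
  "G_Ob A = \<lparr>gspace = cspace A, piece = (\<lambda>n. C.span (cspace A) (\<Union>p. bigrading A p (n - p)))\<rparr>"

text \<open>All mappings are those of \<open>PiW\<close>; only the structure on source and target is
  finer. The factorization can thus be an equality of functors.\<close>

definition G :: "('a mhs, ('a mhs, 'a pt \<Rightarrow> 'a pt) arrow, 'a gr_vs, ('a gr_vs, 'a pt \<Rightarrow> 'a pt) arrow)
    monoidal_functor_data" where
  "G = \<lparr>FOb = G_Ob,
    FAr = (\<lambda>f. arr (G_Ob (source f)) (cmap (source f) (target f) (mapping f)) (G_Ob (target f))),
    FTen = (\<lambda>A B. arr (gr_tensor (G_Ob A) (G_Ob B)) (cten A B) (G_Ob (mhs_tensor K A B))),
    FUnt = arr gr_unit cunit (G_Ob (mhs_unit K))\<rparr>"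

lemma gspace_G [simp]: "gspace (G_Ob A) = cspace A"
  by (simp add: G_Ob_def)

lemma G_Ob:
  assumes A: "is_mhs K A"
  shows "is_gr_vs (G_Ob A)" "Ufil_Ob (G_Ob A) = PiW_Ob K A"
proof -
  note a = mhsD[OF A]
  let ?W = "\<lambda>m. cwfil A m" and ?H = "\<lambda>p. hbar A p"
  obtain p0 where p0: "hfil A p0 = {\<zero>\<^bsub>cspace A\<^esub>}" using a(7) unfolding decreasing_filtration_def by blast
  obtain c where "wfil A c = {\<zero>\<^bsub>hspace A\<^esub>}" using a(3) unfolding increasing_filtration_def by blast
  hence c: "?W c = {\<zero>\<^bsub>cspace A\<^esub>}" using csub_zero[OF a(1)] by simp
  \<comment> \<open>Conjugation fixes zero, so the same index bounds the Hodge filtration and its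
    conjugate.\<close>
  have q0: "?H p0 = {\<zero>\<^bsub>cspace A\<^esub>}" using cext_conj_zero[OF a(1)] by (simp add: p0)
  let ?J = "{(x, y). x < p0 \<and> y < p0 \<and> c < x + y}"
  have "?J \<subseteq> {c - p0..p0} \<times> {c - p0..p0}" by auto
  hence J: "finite ?J" using finite_subset by blast
  have b: "bij_betw (\<lambda>i. (fst i, snd i)) ?J ?J" by (simp add: bij_betw_def)
  obtain \<pi> where \<pi>: "C.proj_system (cspace A) ?J \<pi>" and W: "\<And>n. ?W n = C.supported (cspace A) ?J \<pi> (\<lambda>i. fst i + snd i \<le> n)"
    and P: "\<And>n. C.span (cspace A) (\<Union>p. bigrading A p (n - p)) = C.supported (cspace A) ?J \<pi> (\<lambda>i. fst i + snd i = n)"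
    by (rule opposed_filtrations.splitting[OF a(4) p0 q0 c J b]) (rule that)
  show "is_gr_vs (G_Ob A)" unfolding G_Ob_def by (rule proj_system_is_gr_vs[OF \<pi> P])
  have "C.span (cspace A) (\<Union>n\<in>{..m}. C.span (cspace A) (\<Union>p. bigrading A p (n - p))) = ?W m" for m
    unfolding P unfolding W
  proof (rule C.span_supported[OF \<pi>])
    show "(\<Union>n\<in>{..m}. C.supported (cspace A) ?J \<pi> (\<lambda>i. fst i + snd i = n)) \<subseteq> C.supported (cspace A) ?J \<pi> (\<lambda>i. fst i + snd i \<le> m)"
      by (auto simp: C.supported_def)
    show "\<pi> i v \<in> (\<Union>n\<in>{..m}. C.supported (cspace A) ?J \<pi> (\<lambda>i. fst i + snd i = n))"
      if "i \<in> ?J" "fst i + snd i \<le> m" "v \<in> carrier (cspace A)" for i v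
      using that C.proj_supported[OF \<pi>, of i "\<lambda>j. fst j + snd j = fst i + snd i" v] by blast
  qed
  thus "Ufil_Ob (G_Ob A) = PiW_Ob K A" by (simp add: Ufil_Ob_def G_Ob_def PiW_Ob_def)
qed

lemma bigrading_sub:
  assumes A: "is_mhs K A"
  shows "C.sub (cspace A) (bigrading A p q)"
  by (rule opposed_filtrations.I_sub[OF mhsD(4)[OF A]])

lemma bigrading_piece:
  assumes A: "is_mhs K A" and x: "x \<in> bigrading A p q"
  shows "x \<in> piece (G_Ob A) (p + q)"
proof -
  have "(\<Union>r. bigrading A r (p + q - r)) \<subseteq> carrier (cspace A)" using C.sub_carrier[OF bigrading_sub[OF A]] by blast
  moreover have "x \<in> (\<Union>r. bigrading A r (p + q - r))" using x by (intro UN_I[of p]) simp_all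
  ultimately show ?thesis using C.span_superset[OF vs_cext[OF mhsD(1)[OF A]]] unfolding G_Ob_def gr_vs.simps by blast
qed

lemma lin_piece:
  assumes A: "is_mhs K A" and f: "f \<in> C.lin (cspace A) X" and X: "C.vs X" and N: "C.sub X N"
    and b: "\<And>p q x. \<lbrakk>p + q = n; x \<in> bigrading A p q\<rbrakk> \<Longrightarrow> f x \<in> N" and x: "x \<in> piece (G_Ob A) n"
  shows "f x \<in> N"
proof -
  have "C.span (cspace A) (\<Union>p. bigrading A p (n - p)) \<subseteq> {x \<in> carrier (cspace A). f x \<in> N}"
    using C.sub_carrier[OF bigrading_sub[OF A]] b[of _ "n - _"]
    by (intro C.span_least[OF C.lin_vimage_sub[OF f vs_cext[OF mhsD(1)[OF A]] X N]]) auto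
  thus ?thesis using x unfolding G_Ob_def gr_vs.simps by blast
qed

lemma cext_map_csub:
  assumes V: "vs V" "vs W" and f: "f \<in> lin V W" and N: "sub V N" "sub W N'" and sub: "f ` N \<subseteq> N'"
  shows "cext_map K V W f ` csub V N \<subseteq> csub W N'"
proof
  note l = cext_map_lin[OF V f] and N'C = csub_sub[OF N(2)]
  fix y assume "y \<in> cext_map K V W f ` csub V N"
  then obtain t where t: "t \<in> csub V N" and y: "y = cext_map K V W f t" by blast
  have c: "s \<in> csub V N \<Longrightarrow> s \<in> carrier (cext K V)" for s by (rule C.sub_carrier[OF csub_sub[OF N(1)]])
  show "y \<in> csub W N'"
    unfolding y using N(1) t
  proof (induction rule: csub_induct)
    case zero
    thus ?case using C.lin_zero[OF l] V C.sub_zero[OF N'C] by simp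
  next
    case (pure v z)
    have "cext_map K V W f (ctensor V v z) = ctensor W (f v) z"
      using pure sub_carrier[OF N(1)] V f by (intro cext_map_pure) auto
    moreover have "f v \<in> N'" using sub pure by blast
    ultimately show ?case using ctensor_csub by simp
  next
    case (add s t)
    thus ?case using C.lin_add[OF l c c] C.sub_add[OF N'C] by simp
  qed
qed

lemma cext_map_gr_homs:
  assumes A: "is_mhs K A" and B: "is_mhs K B" and f: "f \<in> mhs_homs K A B"
  shows "cmap A B f \<in> gr_homs (G_Ob A) (G_Ob B)"
proof -
  note a = mhsD[OF A] and b = mhsD[OF B] and fD = mhs_homsD[OF f]
  let ?f = "cmap A B f"
  note l = cext_map_lin[OF a(1) b(1) fD(2)]
  have H: "?f ` hbar A p \<subseteq> hbar B p" for p
  proof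
    fix y assume "y \<in> ?f ` hbar A p"
    then obtain x where x: "x \<in> hfil A p" "y = ?f (cext_conj K (hspace A) x)" by blast
    have "y = cext_conj K (hspace B) (?f x)" unfolding x(2)
      by (rule cext_conj_map[OF a(1) b(1) fD(2) C.sub_carrier[OF a(6) x(1)], symmetric])
    thus "y \<in> hbar B p" using fD(4) x(1) by blast
  qed
  have "?f x \<in> bigrading B p q" if "x \<in> bigrading A p q" for x p q
    using C.deligne_map[OF a(4) b(4) l cext_map_csub[OF a(1) b(1) fD(2) a(5) b(5) fD(3)] fD(4) H] that by blast
  hence "?f x \<in> piece (G_Ob B) n" if "p + q = n" "x \<in> bigrading A p q" for x n p q
    using bigrading_piece[OF B] that by blast
  hence "?f x \<in> piece (G_Ob B) n" if "x \<in> piece (G_Ob A) n" for x n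
    by (rule lin_piece[OF A l vs_cext[OF b(1)] piece_sub[OF G_Ob(1)[OF B], unfolded gspace_G] _ that])
  thus ?thesis
    using cext_map_linear[OF a(1) b(1) fD(2)] unfolding gr_homs_def gspace_G by blast
qed

text \<open>A product of bidegrees (p, q) and (r, s) lies in the Deligne subspace (p + r, q + s) of
  the tensored filtrations, and \<open>cext_tensor\<close>, preserving all three filtrations,
  carries it to the one of the tensor product. Linearity in each argument extends this to the
  pieces.\<close>

lemma cext_tensor_gr_homs:
  assumes A: "is_mhs K A" and B: "is_mhs K B"
  shows "cten A B \<in> gr_homs (gr_tensor (G_Ob A) (G_Ob B)) (G_Ob (mhs_tensor K A B))"
proof -
  note a = mhsD[OF A] and b = mhsD[OF B] and AB = is_mhs_tensor[OF A B] and l = cext_tensor_lin[OF a(1) b(1)]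
  let ?\<phi> = "cten A B" and ?p = "pure_tensor UNIV (cspace A) (cspace B)"
  let ?AB = "mhs_tensor K A B"
  have vsC: "C.vs (cspace A)" "C.vs (cspace B)" "C.vs (cspace ?AB)" using a(1) b(1) mhsD(1)[OF AB] by simp_all
  have l: "?\<phi> \<in> C.lin (tensor UNIV (cspace A) (cspace B)) (cspace ?AB)" using l by simp
  have P: "C.sub (cspace ?AB) (piece (G_Ob ?AB) n)" for n using piece_sub[OF G_Ob(1)[OF AB]] unfolding gspace_G .
  have fam: "C.family (cspace A) (piece (G_Ob A))" "C.family (cspace B) (piece (G_Ob B))"
    using piece_sub[OF G_Ob(1)[OF A]] piece_sub[OF G_Ob(1)[OF B]] unfolding gspace_G by blast+
  have 1: "?\<phi> (?p x y) \<in> bigrading ?AB (p + r) (q + s)" if x: "x \<in> bigrading A p q" and y: "y \<in> bigrading B r s" for x y p q r s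
  proof (rule subsetD[OF C.deligne_map[OF C.opposed_filtrations_tensor[OF a(4) b(4)] mhsD(4)[OF AB] l] imageI
        [OF C.deligne_pure_tensor[OF a(4) b(4) x y]]])
    show "?\<phi> ` tensor_family UNIV (cspace A) (cspace B) (\<lambda>m. cwfil A m) (\<lambda>m. cwfil B m) m
        \<subseteq> cwfil ?AB m" for m
      using cext_tensor_csub[OF a(1) b(1) a(5) b(5), where n = m] by simp
    show "?\<phi> ` hfil2 A B p \<subseteq> hfil ?AB p" for p by simp
    show "?\<phi> ` tensor_family UNIV (cspace A) (cspace B) (\<lambda>p. hbar A p) (\<lambda>p. hbar B p) p
        \<subseteq> hbar ?AB p" for p
      using cext_tensor_conj_family[OF a(1) b(1) a(6) b(6), where n = p] by simp
  qed
  have "?\<phi> ` tensor_family UNIV (cspace A) (cspace B) (piece (G_Ob A)) (piece (G_Ob B)) n \<subseteq> piece (G_Ob ?AB) n" for n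
  proof (rule C.tensor_family_image[OF vsC(1,2) fam l vsC(3) P])
    fix i j x y assume ij: "i + j = n" and x: "x \<in> piece (G_Ob A) i" and y: "y \<in> piece (G_Ob B) j"
    have yc: "y \<in> carrier (cspace B)" using C.sub_carrier fam(2) y by blast
    show "?\<phi> (?p x y) \<in> piece (G_Ob ?AB) n"
    proof (rule lin_piece[OF A C.lin_comp[OF C.pure_lin_left[OF vsC(1,2) yc] l] vsC(3) P _ x])
      fix p q x assume pq: "p + q = i" and x: "x \<in> bigrading A p q"
      have xc: "x \<in> carrier (cspace A)" by (rule C.sub_carrier[OF bigrading_sub[OF A] x])
      show "?\<phi> (?p x y) \<in> piece (G_Ob ?AB) n"
      proof (rule lin_piece[OF B C.lin_comp[OF C.pure_lin_right[OF vsC(1,2) xc] l] vsC(3) P _ y])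
        fix r s y assume "r + s = j" "y \<in> bigrading B r s"
        hence "?\<phi> (?p x y) \<in> piece (G_Ob ?AB) ((p + r) + (q + s))" "(p + r) + (q + s) = n"
          using bigrading_piece[OF AB 1[OF x]] pq ij by auto
        thus "?\<phi> (?p x y) \<in> piece (G_Ob ?AB) n" by simp
      qed
    qed
  qed
  thus ?thesis using cext_tensor_linear[OF a(1) b(1)] by (simp add: gr_homs_def gr_tensor_def)
qed

lemma gspace_gr_tensor [simp]: "gspace (gr_tensor A B) = tensor UNIV (gspace A) (gspace B)"
  and gspace_gr_unit [simp]: "gspace gr_unit = CC"
  by (simp_all add: gr_tensor_def gr_unit_def)

lemma cunit_gr_homs: "cunit \<in> gr_homs gr_unit (G_Ob (mhs_unit K))"
proof -
  let ?K = "scalars K :: 'a vs" and ?U = "mhs_unit K :: 'a mhs"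
  note u = mhsD[OF is_mhs_unit]
  have hU: "cspace ?U = cext K ?K" by simp
  have P: "C.sub (cext K ?K) (piece (G_Ob ?U) n)" for n using piece_sub[OF G_Ob(1)[OF is_mhs_unit]] unfolding gspace_G mhs_unit_simps(1) .
  \<comment> \<open>The unit is of type (0, 0): x lies in \<open>F 0\<close>, in \<open>W 0\<close>
    and in the conjugate of \<open>F 0\<close>, hence in the first term of the tail.\<close>
  have "x \<in> piece (G_Ob ?U) 0" if x: "x \<in> carrier (cext K ?K)" for x
  proof -
    have F: "hfil ?U 0 = carrier (cext K ?K)" and W: "cwfil ?U 0 = carrier (cext K ?K)"
      using csub_carrier[of ?K] by simp_all
    have "x = cext_conj K (hspace ?U) (cext_conj K (hspace ?U) x)" using cext_conj_conj[OF vs_scalars x] by simp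
    moreover have "cext_conj K (hspace ?U) x \<in> hfil ?U 0" using cext_conj_closed[OF vs_scalars x] unfolding F by simp
    ultimately have H: "x \<in> hbar ?U 0" by blast
    have "x \<in> bigrading ?U 0 0"
      using opposed_filtrations.tail_base[OF u(4) H, of 0] x unfolding C.deligne_def F add_0_left W by blast
    thus ?thesis using bigrading_piece[OF is_mhs_unit] by fastforce
  qed
  note 0 = this
  have "cunit x \<in> piece (G_Ob ?U) n" if x: "x \<in> piece gr_unit n" for x n
  proof (cases "n = 0")
    case True
    hence "x \<in> carrier CC" using x by (simp add: gr_unit_def)
    thus ?thesis unfolding True by (rule 0[OF C.lin_closed[OF cunit_lin]])
  next
    case False
    hence x: "x = \<zero>\<^bsub>CC\<^esub>" using x by (simp add: gr_unit_def)
    show ?thesis using C.sub_zero[OF P] unfolding x C.lin_zero[OF cunit_lin C.vs_CC vs_cext[OF vs_scalars]] .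
  qed
  moreover have "cunit \<in> linear_maps UNIV (gspace gr_unit) (gspace (G_Ob ?U))"
    using cunit_linear by (simp only: gspace_G gspace_gr_unit mhs_unit_simps(1))
  ultimately show ?thesis unfolding gr_homs_def by blast
qed

lemmas MHS_simps = vs_monoidal.vs_category_simps[OF MHS_vs_monoidal, folded MHS_def]
  vs_monoidal.arrow_in_arr[OF MHS_vs_monoidal, folded MHS_def]
lemmas MHS_arrow_inE = vs_monoidal.arrow_inE[OF MHS_vs_monoidal, folded MHS_def]

lemma G_simps [simp]: "FOb G = G_Ob"
  "FAr G (arr A f B) = arr (G_Ob A) (cmap A B f) (G_Ob B)"
  "FTen G A B = arr (gr_tensor (G_Ob A) (G_Ob B)) (cten A B) (G_Ob (mhs_tensor K A B))"
  "FUnt G = arr gr_unit cunit (G_Ob (mhs_unit K))"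
  by (simp_all add: G_def)

lemma G_functor: "functor_laws (MHS K) grVect G"
proof (intro functor_laws.intro functor_laws_axioms.intro)
  show "category_laws (MHS K :: ('a mhs, _) monoidal_data)" "category_laws grVect"
    by (rule symmetric_monoidal_category.axioms(1)[OF MHS_symmetric_monoidal],
        rule symmetric_monoidal_category.axioms(1)[OF grVect_symmetric_monoidal])
  show "FOb G A \<in> Ob grVect" if "A \<in> Ob (MHS K)" for A :: "'a mhs"
    using that by (simp add: MHS_simps grVect_simps G_Ob)
  show "arrow_in grVect (FAr G f) (FOb G A) (FOb G B)" if "arrow_in (MHS K) f A B" for f and A B :: "'a mhs"
    using that by (auto elim!: MHS_arrow_inE simp: grVect_simps G_Ob cext_map_gr_homs)
  show "FAr G (Idn (MHS K) A) = Idn grVect (FOb G A)" if "A \<in> Ob (MHS K)" for A :: "'a mhs"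
  proof -
    have A: "vs (hspace A)" using that mhsD(1) by (simp add: MHS_simps)
    have "cmap A A (\<lambda>v\<in>carrier (hspace A). v) x = x" if x: "x \<in> carrier (cspace A)" for x
      using cext_map_cong[OF A A lin_id _ x, of "\<lambda>v\<in>carrier (hspace A). v"] cext_map_id[OF A x] by simp
    moreover have "cmap A A (\<lambda>v\<in>carrier (hspace A). v) \<in> extensional (carrier (cspace A))"
      using cext_map_linear[OF A A lin_restrict[OF lin_id A]] by (simp add: C.linear_maps_iff)
    ultimately have "cmap A A (\<lambda>v\<in>carrier (hspace A). v) = (\<lambda>x\<in>carrier (cspace A). x)"
      by (intro extensionalityI[of _ "carrier (cspace A)"]) (simp_all del: cext_simps)
    thus ?thesis by (simp add: MHS_simps grVect_simps del: cext_simps)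
  qed
  show "FAr G (Cmp (MHS K) g f) = Cmp grVect (FAr G g) (FAr G f)"
    if fg: "arrow_in (MHS K) f X Y" "arrow_in (MHS K) g Y Z" for f g and X Y Z :: "'a mhs"
  proof -
    obtain \<phi> \<psi> where eq: "f = arr X \<phi> Y" "g = arr Y \<psi> Z" and "is_mhs K X" "is_mhs K Y" "is_mhs K Z"
      and "\<phi> \<in> mhs_homs K X Y" "\<psi> \<in> mhs_homs K Y Z"
      using fg by (auto elim!: MHS_arrow_inE)
    hence vs: "vs (hspace X)" "vs (hspace Y)" "vs (hspace Z)"
      and \<phi>: "\<phi> \<in> lin (hspace X) (hspace Y)" and \<psi>: "\<psi> \<in> lin (hspace Y) (hspace Z)"
      by (simp_all add: mhsD(1) mhs_homsD(2))
    have c: "compose (carrier (hspace X)) \<psi> \<phi> \<in> lin (hspace X) (hspace Z)"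
      by (rule lin_cong[OF lin_comp[OF \<phi> \<psi>] vs(1)]) (simp add: compose_eq)
    have "cmap X Z (compose (carrier (hspace X)) \<psi> \<phi>)
        = compose (carrier (cspace X)) (cmap Y Z \<psi>) (cmap X Y \<phi>)"
    proof (rule extensionalityI[of _ "carrier (cspace X)"])
      show "cmap X Z (compose (carrier (hspace X)) \<psi> \<phi>) \<in> extensional (carrier (cspace X))"
        using cext_map_linear[OF vs(1,3) c] unfolding C.linear_maps_iff by blast
      fix x assume x: "x \<in> carrier (cspace X)"
      have "cmap X Z (compose (carrier (hspace X)) \<psi> \<phi>) x = cmap X Z (\<lambda>v. \<psi> (\<phi> v)) x"
        by (rule cext_map_cong[OF vs(1,3) lin_comp[OF \<phi> \<psi>] _ x]) (simp add: compose_eq)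
      thus "cmap X Z (compose (carrier (hspace X)) \<psi> \<phi>) x
          = compose (carrier (cspace X)) (cmap Y Z \<psi>) (cmap X Y \<phi>) x"
        unfolding compose_eq[OF x] cext_map_comp[OF vs \<phi> \<psi> x] .
    qed (rule compose_extensional)
    thus ?thesis by (simp add: eq MHS_simps grVect_simps del: cext_simps)
  qed
qed

text \<open>The coherence laws are identities of linear maps, in which the gradings do not appear.
  The gradings enter in the invertibility of the structure maps, where \<open>gr_iso_inI\<close>
  needs only bijectivity.\<close>

lemma G_monoidal: "strong_symmetric_monoidal_functor (MHS K :: ('a mhs, _) monoidal_data) grVect G"
proof -
  have restrict_eqI: "compose X f g = compose X f' g'" if "\<And>x. x \<in> X \<Longrightarrow> f (g x) = f' (g' x)"
    for X and f g f' g' :: "'a pt \<Rightarrow> 'a pt"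
    using that by (auto simp: compose_def)
  have vsC: "vs (hspace A)" "C.vs (cspace A)" if "is_mhs K A" for A :: "'a mhs" using mhsD(1)[OF that] by simp_all
  note idC = C.lin_restrict[OF C.lin_id]
  have units: "compose (carrier (tensor UNIV CC (cspace X)))
        (cext_map K (tensor K (scalars K) (hspace X)) (hspace X) (tensor_lunit K (hspace X)))
        (compose (carrier (tensor UNIV CC (cspace X))) (cext_tensor K (scalars K) (hspace X))
          (tensor_map UNIV CC (cspace X) KC (cspace X) cunit (\<lambda>x\<in>carrier (cspace X). x)))
      = tensor_lunit UNIV (cspace X)" (is "?L = _")
    "compose (carrier (tensor UNIV (cspace X) CC))
        (cext_map K (tensor K (hspace X) (scalars K)) (hspace X) (tensor_runit K (hspace X)))
        (compose (carrier (tensor UNIV (cspace X) CC)) (cext_tensor K (hspace X) (scalars K))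
          (tensor_map UNIV (cspace X) CC (cspace X) KC (\<lambda>x\<in>carrier (cspace X). x) cunit))
      = tensor_runit UNIV (cspace X)" (is "?R = _")
    if X: "is_mhs K X" for X :: "'a mhs"
  proof -
    let ?V = "hspace X" and ?K = "scalars K :: 'a vs"
    let ?VC = "cext K ?V" and ?KC = "cext K ?K" and ?id = "\<lambda>x\<in>carrier (cspace X). x"
    note V = vsC[OF X] and KC = vs_cext[OF vs_scalars]
    have KV: "vs (tensor K ?K ?V)" "vs (tensor K ?V ?K)" using V by simp_all
    note id = idC[OF V(2)]
    note lm = C.tensor_map_linear[OF C.vs_CC V(2) KC V(2) cunit_lin id] and rm = C.tensor_map_linear[OF V(2) C.vs_CC V(2) KC id cunit_lin]
    note lc = cext_tensor_linear[OF vs_scalars V(1)] and rc = cext_tensor_linear[OF V(1) vs_scalars]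
    note lu = cext_map_linear[OF KV(1) V(1) tensor_lunit_linear[OF V(1), THEN linear_maps_lin]]
      and ru = cext_map_linear[OF KV(2) V(1) tensor_runit_linear[OF V(1), THEN linear_maps_lin]]
    have TCV: "C.vs (tensor UNIV CC ?VC)" "C.vs (tensor UNIV ?VC CC)" using V(2) by (simp_all del: cext_simps)
    show "?L = tensor_lunit UNIV ?VC"
    proof (rule C.linear_maps_eqI[OF C.linear_maps_compose[OF C.linear_maps_compose[OF lm lc TCV(1)] lu TCV(1)]
          C.tensor_lunit_linear[OF V(2)] C.vs_CC V(2) V(2)])
      fix z x :: "'a pt" assume z: "z \<in> carrier CC" and x: "x \<in> carrier ?VC"
      obtain c where c: "z = Scal c" using z by auto
      have p: "pure_tensor UNIV CC ?VC z x \<in> carrier (tensor UNIV CC ?VC)" by (rule C.pure_closed[OF z x])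
      show "?L (pure_tensor UNIV CC ?VC z x) = tensor_lunit UNIV ?VC (pure_tensor UNIV CC ?VC z x)"
        unfolding compose_eq[OF p] C.tensor_map_pure[OF C.vs_CC V(2) KC V(2) cunit_lin id z x] restrict_apply'[OF x]
        using cext_tensor_lunit_pure[OF V(1) x, of c] C.tensor_lunit_pure[OF V(2), of c x] x unfolding c by simp
    qed
    show "?R = tensor_runit UNIV ?VC"
    proof (rule C.linear_maps_eqI[OF C.linear_maps_compose[OF C.linear_maps_compose[OF rm rc TCV(2)] ru TCV(2)]
          C.tensor_runit_linear[OF V(2)] V(2) C.vs_CC V(2)])
      fix x z :: "'a pt" assume z: "z \<in> carrier CC" and x: "x \<in> carrier ?VC"
      obtain c where c: "z = Scal c" using z by auto
      have p: "pure_tensor UNIV ?VC CC x z \<in> carrier (tensor UNIV ?VC CC)" by (rule C.pure_closed[OF x z])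
      show "?R (pure_tensor UNIV ?VC CC x z) = tensor_runit UNIV ?VC (pure_tensor UNIV ?VC CC x z)"
        unfolding compose_eq[OF p] C.tensor_map_pure[OF V(2) C.vs_CC V(2) KC id cunit_lin x z] restrict_apply'[OF x]
        using cext_tensor_runit_pure[OF V(1) x, of c] C.tensor_runit_pure[OF V(2), of c x] x unfolding c by simp
    qed
  qed
  show ?thesis
  proof (intro strong_symmetric_monoidal_functor.intro G_functor MHS_symmetric_monoidal grVect_symmetric_monoidal
      strong_symmetric_monoidal_functor_axioms.intro, goal_cases FTen FUnt natural Asc LUn RUn Brd)
    case (FTen A B)
    have A: "is_mhs K A" and B: "is_mhs K B" using FTen by (simp_all add: MHS_simps)
    have "iso_in grVect (arr (gr_tensor (G_Ob A) (G_Ob B)) (cten A B) (G_Ob (mhs_tensor K A B)))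
        (gr_tensor (G_Ob A) (G_Ob B)) (G_Ob (mhs_tensor K A B))"
      using cext_tensor_bij[OF vsC(1)[OF A] vsC(1)[OF B]]
      by (intro gr_iso_inI is_gr_vs_tensor G_Ob A B is_mhs_tensor cext_tensor_gr_homs) simp
    thus ?case by (simp add: MHS_simps grVect_simps)
  next
    case FUnt
    have b: "bij_betw cunit (carrier (gspace gr_unit)) (carrier (gspace (G_Ob (mhs_unit K :: 'a mhs))))"
      using cunit_bij by (simp only: gspace_G gspace_gr_unit mhs_unit_simps(1))
    have "iso_in grVect (arr gr_unit cunit (G_Ob (mhs_unit K))) gr_unit (G_Ob (mhs_unit K :: 'a mhs))"
      by (rule gr_iso_inI[OF is_gr_vs_unit G_Ob(1)[OF is_mhs_unit] cunit_gr_homs b])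
    thus ?case by (simp add: MHS_simps grVect_simps)
  next
    case (natural F A B F' A' B')
    obtain f g where eq: "F = arr A f B" "F' = arr A' g B'" and obs: "is_mhs K A" "is_mhs K B" "is_mhs K A'" "is_mhs K B'"
      and fg: "f \<in> mhs_homs K A B" "g \<in> mhs_homs K A' B'"
      using natural by (auto elim!: MHS_arrow_inE)
    show ?case
      using cext_tensor_natural[OF vsC(1)[OF obs(1)] vsC(1)[OF obs(3)] vsC(1)[OF obs(2)] vsC(1)[OF obs(4)] mhs_homsD(2)[OF fg(1)] mhs_homsD(2)[OF fg(2)]]
      by (simp add: eq MHS_simps grVect_simps) (intro restrict_eqI, simp)
  next
    case (Asc X Y Z)
    have obs: "is_mhs K X" "is_mhs K Y" "is_mhs K Z" using Asc by (simp_all add: MHS_simps)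
    show ?case
      using cext_tensor_assoc[OF vsC(1)[OF obs(1)] vsC(1)[OF obs(2)] vsC(1)[OF obs(3)]]
      by (simp add: MHS_simps grVect_simps del: cext_simps) (intro restrict_eqI, simp add: compose_eq del: cext_simps)
  next
    case (LUn X)
    thus ?case using units[of X] by (simp add: MHS_simps grVect_simps del: cext_simps scalars_simps)
  next
    case (RUn X)
    thus ?case using units[of X] by (simp add: MHS_simps grVect_simps del: cext_simps scalars_simps)
  next
    case (Brd X Y)
    have obs: "is_mhs K X" "is_mhs K Y" using Brd by (simp_all add: MHS_simps)
    show ?case
      using cext_tensor_swap[OF vsC(1)[OF obs(1)] vsC(1)[OF obs(2)]]
      by (simp add: MHS_simps grVect_simps del: cext_simps) (intro restrict_eqI, simp del: cext_simps)
  qed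
qed

text \<open>On objects this is the equality of the filtration by degree with the weight filtration,
  from \<open>G_Ob\<close>. The structure maps of the composite are those of \<open>G\<close> after
  identities.\<close>

lemma PiW_eq: "monoidal_functor_eq (MHS K :: ('a mhs, _) monoidal_data) (PiW K) (comp_monoidal_functor FVect Ufil G)"
  unfolding monoidal_functor_eq_def
proof (intro conjI ballI)
  interpret U: strong_symmetric_monoidal_functor grVect FVect Ufil by (rule Ufil_monoidal)
  interpret G: strong_symmetric_monoidal_functor "MHS K :: ('a mhs, _) monoidal_data" grVect G by (rule G_monoidal)
  show "FOb (PiW K) A = FOb (comp_monoidal_functor FVect Ufil G) A" if "A \<in> Ob (MHS K)" for A :: "'a mhs"
    using that by (simp add: PiW_def comp_monoidal_functor_def Ufil_simps G_Ob MHS_simps)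
  show "FAr (PiW K) f = FAr (comp_monoidal_functor FVect Ufil G) f" if f: "f \<in> Ar (MHS K)" for f :: "('a mhs, 'a pt \<Rightarrow> 'a pt) arrow"
  proof -
    obtain A B where "arrow_in (MHS K) f A B" using f by (simp add: arrow_in_def)
    thus ?thesis by (elim MHS_arrow_inE) (simp add: PiW_def comp_monoidal_functor_def Ufil_simps G_Ob)
  qed
  show "FTen (PiW K) A B = FTen (comp_monoidal_functor FVect Ufil G) A B" if ob: "A \<in> Ob (MHS K)" "B \<in> Ob (MHS K)" for A B :: "'a mhs"
  proof -
    have AB: "is_mhs K A" "is_mhs K B" using ob by (simp_all add: MHS_simps)
    have "arrow_in grVect (FTen G A B) (gr_tensor (G_Ob A) (G_Ob B)) (G_Ob (mhs_tensor K A B))"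
      using G.FTen_iso[OF ob] by (simp add: iso_in_def MHS_simps grVect_simps)
    note a = U.FAr_arrow[OF this]
    have "FTen Ufil (G_Ob A) (G_Ob B) = Idn FVect (FOb Ufil (gr_tensor (G_Ob A) (G_Ob B)))"
      using AB by (simp add: Ufil_simps G_Ob(1) Ufil_tensor FVect_simps)
    hence "FTen (comp_monoidal_functor FVect Ufil G) A B = FAr Ufil (FTen G A B)"
      using U.D.Cmp_Idn_right[OF a] by (simp add: comp_monoidal_functor_def)
    also have "\<dots> = FTen (PiW K) A B"
      using AB by (simp add: PiW_def Ufil_simps Ufil_tensor[symmetric] G_Ob is_mhs_tensor)
    finally show ?thesis by simp
  qed
  have "arrow_in grVect (FUnt G) gr_unit (G_Ob (mhs_unit K :: 'a mhs))"
    using G.FUnt_iso by (simp add: iso_in_def MHS_simps grVect_simps)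
  note a = U.FAr_arrow[OF this]
  have "FUnt Ufil = Idn FVect (FOb Ufil (gr_unit :: 'a gr_vs))" by (simp add: Ufil_simps Ufil_unit FVect_simps)
  hence "FUnt (comp_monoidal_functor FVect Ufil (G :: ('a mhs, _, 'a gr_vs, _) monoidal_functor_data)) = FAr Ufil (FUnt G)"
    using U.D.Cmp_Idn_right[OF a] by (simp add: comp_monoidal_functor_def)
  also have "\<dots> = FUnt (PiW K)" by (simp add: PiW_def Ufil_simps Ufil_unit G_Ob is_mhs_unit)
  finally show "FUnt (PiW K) = FUnt (comp_monoidal_functor FVect Ufil (G :: ('a mhs, _, 'a gr_vs, _) monoidal_functor_data))" by simp
qed

end

section \<open>Composition of functors and natural isomorphisms\<close>

lemma functor_laws_comp:
  assumes F: "functor_laws C D F" and G: "functor_laws D E G"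
  shows "functor_laws C E (comp_functor G F)"
proof -
  interpret F: functor_laws C D F by (rule F)
  interpret G: functor_laws D E G by (rule G)
  show ?thesis
  proof (unfold_locales, goal_cases)
    case (4 f X Y g Z)
    thus ?case using F.FAr_Cmp[OF 4] G.FAr_Cmp[OF F.FAr_arrow[OF 4(1)] F.FAr_arrow[OF 4(2)]] by (simp add: comp_functor_def)
  qed (simp_all add: comp_functor_def F.FOb_Ob G.FOb_Ob F.FAr_Idn G.FAr_Idn F.FAr_arrow G.FAr_arrow)
qed

text \<open>Provides the functor laws of \<open>PiW K\<close> from its agreement with the composite
  of \<open>G\<close> and \<open>Ufil\<close> on objects and arrows.\<close>

lemma functor_laws_cong:
  assumes F: "functor_laws C D F" and ob: "\<And>A. A \<in> Ob C \<Longrightarrow> FOb F' A = FOb F A" and ar: "\<And>f. f \<in> Ar C \<Longrightarrow> FAr F' f = FAr F f"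
  shows "functor_laws C D F'"
proof -
  interpret F: functor_laws C D F by (rule F)
  have a: "f \<in> Ar C" "A \<in> Ob C" "B \<in> Ob C" if "arrow_in C f A B" for f A B
    using that F.C.Src_Ob F.C.Tgt_Ob by (auto simp: arrow_in_def)
  show ?thesis
  proof (unfold_locales, goal_cases)
    case (1 A) thus ?case using F.FOb_Ob ob by simp
  next
    case (2 f A B) thus ?case using F.FAr_arrow a ob ar by metis
  next
    case (3 A) thus ?case using F.FAr_Idn ob ar a(1)[OF F.C.Idn_arrow] by simp
  next
    case (4 f X Y g Z) thus ?case using F.FAr_Cmp[OF 4] ar a(1) F.C.Cmp_arrow[OF 4] by simp
  qed
qed

lemma functor_iso_in:
  assumes F: "functor_laws C D F" and f: "iso_in C f A B"
  shows "iso_in D (FAr F f) (FOb F A) (FOb F B)"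
proof -
  interpret F: functor_laws C D F by (rule F)
  obtain g where g: "arrow_in C f A B" "arrow_in C g B A" "Cmp C g f = Idn C A" "Cmp C f g = Idn C B"
    using f unfolding iso_in_def by blast
  have ob: "A \<in> Ob C" "B \<in> Ob C" using g(1) F.C.Src_Ob F.C.Tgt_Ob by (auto simp: arrow_in_def)
  show ?thesis
    unfolding iso_in_def using F.FAr_arrow[OF g(1)] F.FAr_arrow[OF g(2)] F.FAr_Cmp[OF g(1,2)] F.FAr_Cmp[OF g(2,1)]
      F.FAr_Idn[OF ob(1)] F.FAr_Idn[OF ob(2)] g(3,4) by auto
qed

text \<open>The isomorphisms constructed below start at \<open>PiW K\<close>, while the theorem
  states the opposite direction. The inverses are natural: insert the composite of \<eta> and
  \<theta> next to the arrow and move \<eta> across by naturality.\<close>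

lemma naturally_isomorphic_sym:
  assumes "naturally_isomorphic C D F G"
  shows "naturally_isomorphic C D G F"
proof -
  obtain \<eta> where F: "functor_laws C D F" and G: "functor_laws C D G"
    and iso: "\<And>A. A \<in> Ob C \<Longrightarrow> iso_in D (\<eta> A) (FOb F A) (FOb G A)"
    and nat: "\<And>A B f. arrow_in C f A B \<Longrightarrow> Cmp D (\<eta> B) (FAr F f) = Cmp D (FAr G f) (\<eta> A)"
    using assms unfolding naturally_isomorphic_def by blast
  interpret F: functor_laws C D F by (rule F)
  interpret G: functor_laws C D G by (rule G)
  obtain \<theta> where \<theta>: "\<And>A. A \<in> Ob C \<Longrightarrow> arrow_in D (\<theta> A) (FOb G A) (FOb F A) \<and>
      Cmp D (\<theta> A) (\<eta> A) = Idn D (FOb F A) \<and> Cmp D (\<eta> A) (\<theta> A) = Idn D (FOb G A)"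
    using iso unfolding iso_in_def by metis
  have \<eta>: "arrow_in D (\<eta> A) (FOb F A) (FOb G A)" if "A \<in> Ob C" for A using iso[OF that] by (simp add: iso_in_def)
  have "iso_in D (\<theta> A) (FOb G A) (FOb F A)" if "A \<in> Ob C" for A
    using \<theta>[OF that] \<eta>[OF that] unfolding iso_in_def by blast
  moreover have "Cmp D (\<theta> B) (FAr G f) = Cmp D (FAr F f) (\<theta> A)" if f: "arrow_in C f A B" for A B f
  proof -
    have ob: "A \<in> Ob C" "B \<in> Ob C" using f F.C.Src_Ob F.C.Tgt_Ob by (auto simp: arrow_in_def)
    note a = \<theta>[OF ob(1)] \<eta>[OF ob(1)] and b = \<theta>[OF ob(2)] \<eta>[OF ob(2)]
    note Ff = F.FAr_arrow[OF f] and Gf = G.FAr_arrow[OF f]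
    have "Cmp D (\<theta> B) (FAr G f) = Cmp D (\<theta> B) (Cmp D (FAr G f) (Cmp D (\<eta> A) (\<theta> A)))"
      using a F.D.Cmp_Idn_right[OF Gf] by simp
    also have "\<dots> = Cmp D (\<theta> B) (Cmp D (Cmp D (\<eta> B) (FAr F f)) (\<theta> A))"
      using F.D.Cmp_assoc[OF conjunct1[OF a(1)] a(2) Gf] nat[OF f] by simp
    also have "\<dots> = Cmp D (Cmp D (Cmp D (\<theta> B) (\<eta> B)) (FAr F f)) (\<theta> A)"
      using F.D.Cmp_assoc[of "\<theta> A" _ _ "Cmp D (\<eta> B) (FAr F f)" _ "\<theta> B"] F.D.Cmp_assoc[OF Ff b(2)] F.D.Cmp_arrow[OF Ff b(2)] a b
      by metis
    finally show ?thesis using b F.D.Cmp_Idn_left[OF Ff] by simp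
  qed
  ultimately show ?thesis unfolding naturally_isomorphic_def using F G by blast
qed

theorem lemma3p3:
  fixes K :: "complex set"
  assumes "subfield K complex_ring" and "K \<subseteq> \<real>"
  shows "strong_symmetric_monoidal_functor grVect (FVect :: ('a fil_vs, _) monoidal_data) Ufil \<and>
         (\<exists>G :: ('a mhs, _, 'a gr_vs, _) monoidal_functor_data.
            strong_symmetric_monoidal_functor (MHS K) grVect G \<and>
            monoidal_functor_eq (MHS K) (PiW K) (comp_monoidal_functor FVect Ufil G)) \<and>
         functor_laws (FVect :: ('a fil_vs, _) monoidal_data) grVect gr_functor \<and>
         naturally_isomorphic (MHS K) (FVect :: ('a fil_vs, _) monoidal_data)
           (comp_functor Ufil (comp_functor gr_functor (PiW K))) (PiW K)"
proof -
  interpret real_field K using assms by (intro real_field.intro base_field.intro real_field_axioms.intro)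
  let ?M = "MHS K :: ('a mhs, _) monoidal_data" and ?P = "PiW K :: ('a mhs, _, 'a fil_vs, _) monoidal_functor_data"
  have U: "functor_laws grVect (FVect :: ('a fil_vs, _) monoidal_data) Ufil"
    by (rule strong_symmetric_monoidal_functor.axioms(1)[OF Ufil_monoidal])
  have P_Ob: "FOb ?P A = Ufil_Ob (G_Ob A)" if "A \<in> Ob ?M" for A
    using that by (simp add: PiW_def G_Ob MHS_simps)
  have P_Ar: "FAr ?P f = FAr Ufil (FAr G f)" if "f \<in> Ar ?M" for f
  proof -
    have "monoidal_functor_eq ?M ?P (comp_monoidal_functor FVect Ufil G)" by (rule PiW_eq)
    hence "FAr ?P f = FAr (comp_monoidal_functor FVect Ufil G) f" using that unfolding monoidal_functor_eq_def by blast
    thus ?thesis by (simp add: comp_monoidal_functor_def)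
  qed
  have P: "functor_laws ?M FVect ?P"
    by (rule functor_laws_cong[OF functor_laws_comp[OF G_functor U]])
       (simp_all add: P_Ob P_Ar comp_functor_def Ufil_simps)
  \<comment> \<open>The comparison of a graded space with the graded space of its filtration, taken
    at \<open>G_Ob A\<close>. Since \<open>Ufil_Ob (G_Ob A)\<close> is the value of
    \<open>PiW K\<close> at A, its target is the regraded object.\<close>
  let ?\<theta> = "\<lambda>A :: 'a mhs. arr (G_Ob A) (gr_Ufil_map (G_Ob A)) (gr_Ob (Ufil_Ob (G_Ob A)))"
  have \<theta>: "iso_in grVect (?\<theta> A) (G_Ob A) (gr_Ob (Ufil_Ob (G_Ob A)))" if "A \<in> Ob ?M" for A
    using that by (intro gr_Ufil_iso G_Ob(1)) (simp add: MHS_simps)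
  have nat: "Cmp grVect (?\<theta> B) (FAr G f) = Cmp grVect (FAr gr_functor (FAr ?P f)) (?\<theta> A)"
    if f: "arrow_in ?M f A B" for f A B
  proof -
    obtain \<phi> where eq: "f = arr A \<phi> B" and AB: "is_mhs K A" "is_mhs K B" and \<phi>: "\<phi> \<in> mhs_homs K A B"
      using f by (auto elim!: MHS_arrow_inE)
    let ?f = "cmap A B \<phi>"
    have Pf: "FAr ?P f = arr (Ufil_Ob (G_Ob A)) ?f (Ufil_Ob (G_Ob B))" using AB by (simp add: eq PiW_def G_Ob)
    define h where "h = mapping (FAr gr_functor (FAr ?P f))"
    have h: "FAr gr_functor (FAr ?P f) = arr (gr_Ob (Ufil_Ob (G_Ob A))) h (gr_Ob (Ufil_Ob (G_Ob B)))"
      unfolding h_def Pf by (simp add: gr_functor_def)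
    have "compose (carrier (cspace A)) (gr_Ufil_map (G_Ob B)) ?f = compose (carrier (cspace A)) h (gr_Ufil_map (G_Ob A))"
      using gr_Ufil_natural[OF G_Ob(1)[OF AB(1)] G_Ob(1)[OF AB(2)] cext_map_gr_homs[OF AB \<phi>]] unfolding h_def Pf
      by (auto simp: compose_def gspace_G simp del: cext_simps)
    thus ?thesis unfolding h by (simp only: eq G_simps(2) grVect_simps(7) gspace_G)
  qed
  interpret U: functor_laws grVect "FVect :: ('a fil_vs, _) monoidal_data" Ufil by (rule U)
  interpret G: functor_laws ?M grVect G by (rule G_functor)
  \<comment> \<open>Naturality already holds among graded spaces by \<open>nat\<close>;
    \<open>Ufil\<close> carries it over to filtered spaces, where the image of \<open>G\<close> is
    \<open>PiW K\<close>.\<close>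
  have "naturally_isomorphic ?M FVect ?P (comp_functor Ufil (comp_functor gr_functor ?P))"
    unfolding naturally_isomorphic_def
  proof (intro conjI exI[of _ "\<lambda>A. FAr Ufil (?\<theta> A)"] ballI allI impI)
    have gP: "functor_laws ?M grVect (comp_functor gr_functor ?P)" by (rule functor_laws_comp[OF P gr_functor])
    show "functor_laws ?M FVect (comp_functor Ufil (comp_functor gr_functor ?P))" by (rule functor_laws_comp[OF gP U])
    show "iso_in FVect (FAr Ufil (?\<theta> A)) (FOb ?P A) (FOb (comp_functor Ufil (comp_functor gr_functor ?P)) A)" if "A \<in> Ob ?M" for A
      using functor_iso_in[OF U \<theta>[OF that]] P_Ob[OF that] unfolding comp_functor_def gr_functor_def by (simp add: Ufil_simps(1))
    fix A B f assume f: "arrow_in ?M f A B"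
    have ar: "f \<in> Ar ?M" and ob: "A \<in> Ob ?M" "B \<in> Ob ?M" using f G.C.Src_Ob G.C.Tgt_Ob by (auto simp: arrow_in_def)
    have \<theta>a: "arrow_in grVect (?\<theta> A) (G_Ob A) (gr_Ob (Ufil_Ob (G_Ob A)))" "arrow_in grVect (?\<theta> B) (G_Ob B) (gr_Ob (Ufil_Ob (G_Ob B)))"
      using \<theta> ob by (simp_all add: iso_in_def)
    have Gf: "arrow_in grVect (FAr G f) (G_Ob A) (G_Ob B)" using G.FAr_arrow[OF f] by simp
    have gf: "arrow_in grVect (FAr gr_functor (FAr ?P f)) (gr_Ob (Ufil_Ob (G_Ob A))) (gr_Ob (Ufil_Ob (G_Ob B)))"
      using functor_laws.FAr_arrow[OF gP f] P_Ob ob by (simp add: comp_functor_def gr_functor_def)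
    show "Cmp FVect (FAr Ufil (?\<theta> B)) (FAr ?P f) = Cmp FVect (FAr (comp_functor Ufil (comp_functor gr_functor ?P)) f) (FAr Ufil (?\<theta> A))"
      using U.FAr_Cmp[OF Gf \<theta>a(2)] U.FAr_Cmp[OF \<theta>a(1) gf] nat[OF f] P_Ar[OF ar] by (simp add: comp_functor_def)
  qed (rule P)
  note iso = naturally_isomorphic_sym[OF this]
  show ?thesis
    by (intro conjI exI[of _ G] iso Ufil_monoidal G_monoidal PiW_eq gr_functor)
qed

end
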